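(* Let $\Omega$ be an open subset of $\mathbb{R}^n$, let $K$ be a compact subset of $\mathbb{R}^n$ with $\sigma$-finite $(p-2)$-dimensional Hausdorff measure, and let $T$ be a weakly positive current of bidimension $(p,p)$ on $(\Omega\smallsetminus K)\times\mathbb{R}^n$ with locally finite mass near $K$. Assume that either the measure $dd^{\#}T\wedge\beta^{p-1}$ is locally finite near $K$, or $T\wedge\beta^{p-1}$ is concave on $(\Omega\smallsetminus K)\times\mathbb{R}^n$. Then there exists a positive measure $S$ supported in $K$ such that $$\widetilde{dd^{\#}T\wedge\beta^{p-1}}=dd^{\#}\widetilde{T}\wedge\beta^{p-1}+S,$$ where $\widetilde{T}$ and $\widetilde{dd^{\#}T\wedge\beta^{p-1}}$ are the extensions by $0$ of $T$ and $dd^{\#}T\wedge\beta^{p-1}$ respectively across $K\times\mathbb{R}^n$.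
   Context: Superformalism. On $\mathbb{R}^n\times\mathbb{R}^n$ with coordinates $(x,\xi)$, a form of bidegree $(p,q)$ is $\sum_{|I|=p,|L|=q}\alpha_{IL}(x)\,dx_I\wedge d\xi_L$ with smooth coefficients depending only on $x$; $dx_i,d\xi_j$ all anticommute. $d=\sum_i dx_i\wedge\partial_{x_i}$, $d^{\#}=\sum_j d\xi_j\wedge\partial_{x_j}$, $\beta=\frac12dd^{\#}|x|^2=\sum_i dx_i\wedge d\xi_i$. For $\alpha=\sum_i a_i\,dx_i$ put $J(\alpha)=\sum_i a_i\,d\xi_i$. The integral of $\alpha_0(x)\,dx_1\wedge d\xi_1\wedge\dots\wedge dx_n\wedge d\xi_n$ over $A\times\mathbb{R}^n$ is $\int_A\alpha_0\,dx$ (similarly for measures); currents of bidegree $(n,n)$ of order zero are identified with measures accordingly. Currents. A current of bidegree $(p,q)$ on $U\times\mathbb{R}^n$ ($U\subset\mathbb{R}^n$ open) is $T=\sum_{|I|=p,|L|=q}T_{IL}\,dx_I\wedge d\xi_L$ with $T_{IL}$ distributions on $U$; it acts on forms of bidegree $(n-p,n-q)$ with coefficients compactly supported in $U$ by $\langle T,\alpha\rangle=\int T\wedge\alpha$. Bidimension $(p,p)$ means bidegree $(n-p,n-p)$. A current of bidegree $(k,k)$ is symmetric if its coefficients are symmetric in $(I,L)$. A form of bidegree $(k,k)$ is strongly positive if it is a finite sum $\sum_s\lambda_s\alpha_{1,s}\wedge J(\alpha_{1,s})\wedge\dots\wedge\alpha_{k,s}\wedge J(\alpha_{k,s})$, $\lambda_s\ge0$,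 $\alpha_{i,s}$ of bidegree $(1,0)$. A symmetric current of bidimension $(p,p)$ is weakly positive if it is $\ge0$ on all compactly supported strongly positive forms of bidegree $(p,p)$; its coefficients are then measures. A current $R$ is convex if $dd^{\#}R$ is weakly positive, and concave if $-R$ is convex. The mass of a current of order zero on a set is the sum of the total variations of its coefficients there. *)

theory Defs
  imports "HOL-Analysis.Analysis"
begin

type_synonym 'n space = "real^'n"

definition partial :: "'n::finite \<Rightarrow> ('n space \<Rightarrow> real) \<Rightarrow> 'n space \<Rightarrow> real" where
  "partial i f = (\<lambda>x. frechet_derivative f (at x) (axis i 1))"

definition partials :: "'n::finite list \<Rightarrow> ('n space \<Rightarrow> real) \<Rightarrow> 'n space \<Rightarrow> real" where
  "partials is f = foldr partial is f"

text \<open>For open \<open>U\<close> this is the usual class of infinitely differentiable functions: all iterated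
  partial derivatives are differentiable, hence continuous.\<close>

definition smooth_on :: "'n::finite space set \<Rightarrow> ('n space \<Rightarrow> real) \<Rightarrow> bool" where
  "smooth_on U f \<longleftrightarrow> (\<forall>is. \<forall>x\<in>U. partials is f differentiable (at x))"

definition test_functions :: "'n::finite space set \<Rightarrow> ('n space \<Rightarrow> real) set" where
  "test_functions U = {\<phi>. smooth_on UNIV \<phi> \<and>
     compact (closure {x. \<phi> x \<noteq> 0}) \<and> closure {x. \<phi> x \<noteq> 0} \<subseteq> U}"

text \<open>A distribution on \<open>U\<close> is a functional of which only the values on test functions matter.
  Continuity is the usual seminorm estimate on each compact set, with \<open>B\<close> standing for (any
  bound of) the supremum of all derivatives up to order \<open>N\<close>.\<close>

type_synonym 'n functional = "('n space \<Rightarrow> real) \<Rightarrow> real"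

definition distribution :: "'n::finite space set \<Rightarrow> 'n functional \<Rightarrow> bool" where
  "distribution U u \<longleftrightarrow>
     (\<forall>\<phi>\<in>test_functions U. \<forall>\<psi>\<in>test_functions U. \<forall>a b.
        u (\<lambda>x. a * \<phi> x + b * \<psi> x) = a * u \<phi> + b * u \<psi>) \<and>
     (\<forall>C. compact C \<and> C \<subseteq> U \<longrightarrow>
        (\<exists>N M. \<forall>\<phi>\<in>test_functions U. \<forall>B.
           closure {x. \<phi> x \<noteq> 0} \<subseteq> C \<and>
           (\<forall>is x. length is \<le> N \<longrightarrow> \<bar>partials is \<phi> x\<bar> \<le> B) \<longrightarrow> \<bar>u \<phi>\<bar> \<le> M * B))"

text \<open>Measures on the open set \<open>U\<close> are encoded as Borel measures on the whole space that vanish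
  outside \<open>U\<close>.\<close>

definition radon_measure_on :: "'n::finite space set \<Rightarrow> 'n space measure \<Rightarrow> bool" where
  "radon_measure_on U \<mu> \<longleftrightarrow> sets \<mu> = sets borel \<and> emeasure \<mu> (- U) = 0 \<and>
     (\<forall>C. compact C \<and> C \<subseteq> U \<longrightarrow> emeasure \<mu> C < \<infinity>)"

text \<open>\<open>u\<close> is given on \<open>U\<close> by the signed measure with Jordan decomposition \<open>\<mu> - \<nu>\<close>.\<close>

definition jordan_of ::
  "'n::finite space set \<Rightarrow> 'n functional \<Rightarrow> 'n space measure \<Rightarrow> 'n space measure \<Rightarrow> bool" where
  "jordan_of U u \<mu> \<nu> \<longleftrightarrow> radon_measure_on U \<mu> \<and> radon_measure_on U \<nu> \<and>
     (\<exists>A\<in>sets borel. emeasure \<mu> A = 0 \<and> emeasure \<nu> (- A) = 0) \<and>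
     (\<forall>\<phi>\<in>test_functions U. u \<phi> = integral\<^sup>L \<mu> \<phi> - integral\<^sup>L \<nu> \<phi>)"

definition order_zero :: "'n::finite space set \<Rightarrow> 'n functional \<Rightarrow> bool" where
  "order_zero U u \<longleftrightarrow> (\<exists>\<mu> \<nu>. jordan_of U u \<mu> \<nu>)"

text \<open>The decomposition is unique, so the choice operator only serves to name it. The functions
  below are meaningful only for functionals of order zero.\<close>

definition jordan :: "'n::finite space set \<Rightarrow> 'n functional \<Rightarrow> 'n space measure \<times> 'n space measure" where
  "jordan U u = (SOME m. jordan_of U u (fst m) (snd m))"

definition total_variation :: "'n::finite space set \<Rightarrow> 'n functional \<Rightarrow> 'n space set \<Rightarrow> ennreal" where
  "total_variation U u A = emeasure (fst (jordan U u)) A + emeasure (snd (jordan U u)) A"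

text \<open>Extension by \<open>0\<close> to larger open sets: the two measures of \<open>jordan U u\<close> already vanish
  outside \<open>U\<close>, so it suffices to let them act on more test functions.\<close>

definition zero_extension :: "'n::finite space set \<Rightarrow> 'n functional \<Rightarrow> 'n functional" where
  "zero_extension U u \<phi> = integral\<^sup>L (fst (jordan U u)) \<phi> - integral\<^sup>L (snd (jordan U u)) \<phi>"

text \<open>\<open>\<alpha> I L\<close> is the coefficient of \<open>dx\<^sub>I \<and> d\<xi>\<^sub>L\<close>, where the elements of \<open>I\<close> and of \<open>L\<close> are taken in
  increasing order; the linearly ordered index type \<open>'n\<close> plays the role of \<open>{1,\<dots>,n}\<close>.\<close>

type_synonym 'n superform = "'n set \<Rightarrow> 'n set \<Rightarrow> 'n space \<Rightarrow> real"

text \<open>\<open>dx\<^sub>I \<and> dx\<^sub>I\<^sub>' = shuffle_sign I I' dx\<^bsub>I \<union> I'\<^esub>\<close>.\<close>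

definition shuffle_sign :: "'n::{finite,linorder} set \<Rightarrow> 'n set \<Rightarrow> real" where
  "shuffle_sign I I' =
     (if I \<inter> I' = {} then (- 1) ^ card {(i, i'). i \<in> I \<and> i' \<in> I' \<and> i' < i} else 0)"

text \<open>\<open>(dx\<^sub>I \<and> d\<xi>\<^sub>L) \<and> (dx\<^sub>I\<^sub>' \<and> d\<xi>\<^sub>L\<^sub>') = wedge_sign I L I' L' dx\<^bsub>I \<union> I'\<^esub> \<and> d\<xi>\<^bsub>L \<union> L'\<^esub>\<close>; moving \<open>dx\<^sub>I\<^sub>'\<close> past
  \<open>d\<xi>\<^sub>L\<close> gives the first factor.\<close>

definition wedge_sign ::
  "'n::{finite,linorder} set \<Rightarrow> 'n set \<Rightarrow> 'n set \<Rightarrow> 'n set \<Rightarrow> real" where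
  "wedge_sign I L I' L' = (- 1) ^ (card L * card I') * shuffle_sign I I' * shuffle_sign L L'"

definition wedge :: "'n::{finite,linorder} superform \<Rightarrow> 'n superform \<Rightarrow> 'n superform" where
  "wedge \<alpha> \<gamma> I L = (\<lambda>x. \<Sum>I'\<in>Pow I. \<Sum>L'\<in>Pow L.
     wedge_sign I' L' (I - I') (L - L') * \<alpha> I' L' x * \<gamma> (I - I') (L - L') x)"

definition fun_form :: "('n space \<Rightarrow> real) \<Rightarrow> 'n::{finite,linorder} superform" where
  "fun_form f I L = (\<lambda>x. if I = {} \<and> L = {} then f x else 0)"

fun wedge_power :: "'n::{finite,linorder} superform \<Rightarrow> nat \<Rightarrow> 'n superform" where
  "wedge_power \<alpha> 0 = fun_form (\<lambda>x. 1)"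
| "wedge_power \<alpha> (Suc k) = wedge \<alpha> (wedge_power \<alpha> k)"

definition d_form :: "'n::{finite,linorder} superform \<Rightarrow> 'n superform" where
  "d_form \<alpha> I L = (\<lambda>x. \<Sum>i\<in>I. wedge_sign {i} {} (I - {i}) L * partial i (\<alpha> (I - {i}) L) x)"

definition dsharp_form :: "'n::{finite,linorder} superform \<Rightarrow> 'n superform" where
  "dsharp_form \<alpha> I L = (\<lambda>x. \<Sum>j\<in>L. wedge_sign {} {j} I (L - {j}) * partial j (\<alpha> I (L - {j})) x)"

definition beta :: "'n::{finite,linorder} superform" where
  "beta I L = (\<lambda>x. 1 / 2 * d_form (dsharp_form (fun_form (\<lambda>y. (norm y)\<^sup>2))) I L x)"

lemma partial_norm_sq: "partial j (\<lambda>y::'n::finite space. (norm y)\<^sup>2) = (\<lambda>x. 2 * x $ j)"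
proof
  fix x :: "'n space"
  have "((\<lambda>y::'n space. (norm y)\<^sup>2) has_derivative (\<lambda>h. 2 * (x \<bullet> h))) (at x)"
    unfolding power2_norm_eq_inner
    by (auto intro!: derivative_eq_intros simp: inner_commute)
  then have "frechet_derivative (\<lambda>y::'n space. (norm y)\<^sup>2) (at x) = (\<lambda>h. 2 * (x \<bullet> h))"
    by (metis frechet_derivative_at)
  then show "partial j (\<lambda>y::'n space. (norm y)\<^sup>2) x = 2 * x $ j"
    by (simp add: partial_def inner_axis)
qed

lemma partial_coord: "partial i (\<lambda>y::'n::finite space. 2 * y $ j) = (\<lambda>x. if i = j then 2 else 0)"
proof
  fix x :: "'n space"
  have "((\<lambda>y::'n space. 2 * y $ j) has_derivative (\<lambda>h. 2 * h $ j)) (at x)"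
    by (intro bounded_linear_imp_has_derivative bounded_linear_const_mult bounded_linear_vec_nth)
  then have "frechet_derivative (\<lambda>y::'n space. 2 * y $ j) (at x) = (\<lambda>h. 2 * h $ j)"
    by (metis frechet_derivative_at)
  then show "partial i (\<lambda>y::'n space. 2 * y $ j) x = (if i = j then 2 else 0)"
    by (simp add: partial_def axis_def)
qed

lemma partial_zero: "partial i (\<lambda>y::'n::finite space. 0) = (\<lambda>x. 0)"
  by (simp add: partial_def)

lemma shuffle_empty [simp]: "shuffle_sign {} I = 1" "shuffle_sign I {} = 1"
  by (simp_all add: shuffle_sign_def)

lemma dsharp_nsq: "dsharp_form (fun_form (\<lambda>y::'n::{finite,linorder} space. (norm y)\<^sup>2)) I L
   = (if I = {} \<and> (\<exists>j. L = {j}) then (\<lambda>x. 2 * x $ (THE j. L = {j})) else (\<lambda>x. 0))"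
proof (cases "I = {} \<and> (\<exists>j. L = {j})")
  case True
  then obtain j where "I = {}" "L = {j}" by blast
  then show ?thesis
    by (simp add: dsharp_form_def fun_form_def wedge_sign_def partial_norm_sq)
next
  case False
  have "partial j (fun_form (\<lambda>y::'n space. (norm y)\<^sup>2) I (L - {j})) = (\<lambda>x. 0)" if "j \<in> L" for j
  proof -
    have "\<not> (I = {} \<and> L - {j} = {})" using False that by blast
    then have "fun_form (\<lambda>y::'n space. (norm y)\<^sup>2) I (L - {j}) = (\<lambda>x. 0)"
      unfolding fun_form_def by (intro ext if_not_P)
    then show ?thesis by (simp add: partial_zero)
  qed
  then have "dsharp_form (fun_form (\<lambda>y::'n space. (norm y)\<^sup>2)) I L = (\<lambda>x. 0)"
    by (simp add: dsharp_form_def)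
  then show ?thesis by (simp only: if_not_P[OF False])
qed

lemma beta_eq: "beta I L x = (if \<exists>i. I = {i} \<and> L = {i} then 1 else 0)"
proof (cases "(\<exists>i. I = {i}) \<and> (\<exists>j. L = {j})")
  case True
  then obtain i j where "I = {i}" "L = {j}" by blast
  then show ?thesis
    by (simp add: beta_def d_form_def dsharp_nsq wedge_sign_def partial_coord)
next
  case False
  have "partial i (dsharp_form (fun_form (\<lambda>y. (norm y)\<^sup>2)) (I - {i}) L) x = 0" if "i \<in> I" for i
  proof -
    have "\<not> (I - {i} = {} \<and> (\<exists>j. L = {j}))" using False that by blast
    then have "dsharp_form (fun_form (\<lambda>y. (norm y)\<^sup>2)) (I - {i}) L = (\<lambda>x. 0)"
      unfolding dsharp_nsq by (rule if_not_P)
    then show ?thesis by (simp add: partial_zero)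
  qed
  then have "beta I L x = 0" by (simp add: beta_def d_form_def)
  moreover have "\<not> (\<exists>i. I = {i} \<and> L = {i})" using False by blast
  ultimately show ?thesis by simp
qed

text \<open>Only used for \<open>\<alpha>\<close> of bidegree \<open>(1,0)\<close>, where it replaces each \<open>dx\<^sub>i\<close> by \<open>d\<xi>\<^sub>i\<close>.\<close>

definition J :: "'n::{finite,linorder} superform \<Rightarrow> 'n superform" where
  "J \<alpha> I L = \<alpha> L I"

definition bidegree_form ::
  "'n space set \<Rightarrow> nat \<Rightarrow> nat \<Rightarrow> 'n::{finite,linorder} superform \<Rightarrow> bool" where
  "bidegree_form U p q \<alpha> \<longleftrightarrow> (\<forall>I L. smooth_on U (\<alpha> I L)) \<and>
     (\<forall>I L. (card I, card L) \<noteq> (p, q) \<longrightarrow> (\<forall>x\<in>U. \<alpha> I L x = 0))"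

definition test_form ::
  "'n space set \<Rightarrow> nat \<Rightarrow> nat \<Rightarrow> 'n::{finite,linorder} superform \<Rightarrow> bool" where
  "test_form U p q \<alpha> \<longleftrightarrow> bidegree_form U p q \<alpha> \<and> (\<forall>I L. \<alpha> I L \<in> test_functions U)"

fun wedge_J :: "'n::{finite,linorder} superform list \<Rightarrow> 'n superform" where
  "wedge_J [] = fun_form (\<lambda>x. 1)"
| "wedge_J (\<alpha> # \<alpha>s) = wedge (wedge \<alpha> (J \<alpha>)) (wedge_J \<alpha>s)"

text \<open>The weights \<open>c s\<close> are nonnegative smooth functions, not constants: constants would
  leave \<open>0\<close> as the only strongly positive test form of bidegree \<open>(0,0)\<close>.\<close>

definition strongly_positive ::
  "'n space set \<Rightarrow> nat \<Rightarrow> 'n::{finite,linorder} superform \<Rightarrow> bool" where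
  "strongly_positive U k \<gamma> \<longleftrightarrow> bidegree_form U k k \<gamma> \<and>
     (\<exists>(m::nat) (c :: nat \<Rightarrow> 'n space \<Rightarrow> real) (\<alpha> :: nat \<Rightarrow> nat \<Rightarrow> 'n superform).
        (\<forall>s<m. smooth_on U (c s) \<and> (\<forall>x\<in>U. 0 \<le> c s x)) \<and>
        (\<forall>s<m. \<forall>i<k. bidegree_form U 1 0 (\<alpha> s i)) \<and>
        (\<forall>I L. \<forall>x\<in>U. \<gamma> I L x = (\<Sum>s<m. c s x * wedge_J (map (\<alpha> s) [0..<k]) I L x)))"

type_synonym 'n current = "'n set \<Rightarrow> 'n set \<Rightarrow> 'n functional"

definition current_eq_on ::
  "'n space set \<Rightarrow> 'n::{finite,linorder} current \<Rightarrow> 'n current \<Rightarrow> bool" where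
  "current_eq_on U T R \<longleftrightarrow> (\<forall>I L. \<forall>\<phi>\<in>test_functions U. T I L \<phi> = R I L \<phi>)"

definition bidegree_current ::
  "'n space set \<Rightarrow> nat \<Rightarrow> nat \<Rightarrow> 'n::{finite,linorder} current \<Rightarrow> bool" where
  "bidegree_current U p q T \<longleftrightarrow> (\<forall>I L. distribution U (T I L)) \<and>
     (\<forall>I L. (card I, card L) \<noteq> (p, q) \<longrightarrow> (\<forall>\<phi>\<in>test_functions U. T I L \<phi> = 0))"

definition bidimension_current ::
  "'n space set \<Rightarrow> nat \<Rightarrow> 'n::{finite,linorder} current \<Rightarrow> bool" where
  "bidimension_current U p T \<longleftrightarrow>
     p \<le> CARD('n) \<and> bidegree_current U (CARD('n) - p) (CARD('n) - p) T"

definition symmetric_current ::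
  "'n space set \<Rightarrow> 'n::{finite,linorder} current \<Rightarrow> bool" where
  "symmetric_current U T \<longleftrightarrow> (\<forall>I L. \<forall>\<phi>\<in>test_functions U. T I L \<phi> = T L I \<phi>)"

definition add_current :: "'n::{finite,linorder} current \<Rightarrow> 'n current \<Rightarrow> 'n current" where
  "add_current T R I L = (\<lambda>\<phi>. T I L \<phi> + R I L \<phi>)"

definition neg_current :: "'n::{finite,linorder} current \<Rightarrow> 'n current" where
  "neg_current T I L = (\<lambda>\<phi>. - T I L \<phi>)"

definition wedge_current ::
  "'n::{finite,linorder} current \<Rightarrow> 'n superform \<Rightarrow> 'n current" where
  "wedge_current T \<gamma> I L = (\<lambda>\<phi>. \<Sum>I'\<in>Pow I. \<Sum>L'\<in>Pow L.
     wedge_sign I' L' (I - I') (L - L') * T I' L' (\<lambda>x. \<gamma> (I - I') (L - L') x * \<phi> x))"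

definition distr_partial :: "'n::finite \<Rightarrow> 'n functional \<Rightarrow> 'n functional" where
  "distr_partial i u \<phi> = - u (partial i \<phi>)"

definition d_current :: "'n::{finite,linorder} current \<Rightarrow> 'n current" where
  "d_current T I L = (\<lambda>\<phi>. \<Sum>i\<in>I.
     wedge_sign {i} {} (I - {i}) L * distr_partial i (T (I - {i}) L) \<phi>)"

definition dsharp_current :: "'n::{finite,linorder} current \<Rightarrow> 'n current" where
  "dsharp_current T I L = (\<lambda>\<phi>. \<Sum>j\<in>L.
     wedge_sign {} {j} I (L - {j}) * distr_partial j (T I (L - {j})) \<phi>)"

text \<open>\<open>dx\<^sub>1 \<and> d\<xi>\<^sub>1 \<and> \<dots> \<and> dx\<^sub>n \<and> d\<xi>\<^sub>n = volume_sign dx\<^sub>1 \<and> \<dots> \<and> dx\<^sub>n \<and> d\<xi>\<^sub>1 \<and> \<dots> \<and> d\<xi>\<^sub>n\<close>; the left-hand side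
  is the form of integral one, the right-hand side the one to which coefficients refer.\<close>

definition volume_sign :: "'n::{finite,linorder} itself \<Rightarrow> real" where
  "volume_sign _ = (- 1) ^ (CARD('n) * (CARD('n) - 1) div 2)"

text \<open>The integral of \<open>T \<and> \<alpha>\<close>. Since \<open>\<alpha>\<close> has compact support, \<open>T \<and> \<alpha>\<close> may be evaluated on the
  constant function \<open>1\<close>.\<close>

definition pairing :: "'n::{finite,linorder} current \<Rightarrow> 'n superform \<Rightarrow> real" where
  "pairing T \<alpha> = volume_sign TYPE('n) * wedge_current T \<alpha> UNIV UNIV (\<lambda>x. 1)"

definition weakly_positive ::
  "'n space set \<Rightarrow> nat \<Rightarrow> 'n::{finite,linorder} current \<Rightarrow> bool" where
  "weakly_positive U p T \<longleftrightarrow> bidimension_current U p T \<and> symmetric_current U T \<and>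
     (\<forall>\<alpha>. test_form U p p \<alpha> \<and> strongly_positive U p \<alpha> \<longrightarrow> 0 \<le> pairing T \<alpha>)"

text \<open>For \<open>R\<close> of bidimension \<open>(p,p)\<close>, so that the second derivative has bidimension
  \<open>(p - 1,p - 1)\<close>.\<close>

definition convex_current ::
  "'n space set \<Rightarrow> nat \<Rightarrow> 'n::{finite,linorder} current \<Rightarrow> bool" where
  "convex_current U p R \<longleftrightarrow> 1 \<le> p \<and> bidimension_current U p R \<and>
     weakly_positive U (p - 1) (d_current (dsharp_current R))"

definition concave_current ::
  "'n space set \<Rightarrow> nat \<Rightarrow> 'n::{finite,linorder} current \<Rightarrow> bool" where
  "concave_current U p R \<longleftrightarrow> convex_current U p (neg_current R)"

definition mass ::
  "'n space set \<Rightarrow> 'n::{finite,linorder} current \<Rightarrow> 'n space set \<Rightarrow> ennreal" where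
  "mass U T A = (\<Sum>I\<in>UNIV. \<Sum>L\<in>UNIV. total_variation U (T I L) A)"

text \<open>For a current on \<open>\<Omega> - K\<close>. Having order zero is part of the notion, as mass is only
  defined for currents of order zero.\<close>

definition locally_finite_mass_near ::
  "'n space set \<Rightarrow> 'n space set \<Rightarrow> 'n::{finite,linorder} current \<Rightarrow> bool" where
  "locally_finite_mass_near \<Omega> K T \<longleftrightarrow> (\<forall>I L. order_zero (\<Omega> - K) (T I L)) \<and>
     (\<forall>x\<in>\<Omega> \<inter> K. \<exists>V. open V \<and> x \<in> V \<and> V \<subseteq> \<Omega> \<and> mass (\<Omega> - K) T (V - K) < \<infinity>)"

definition zero_extension_current ::
  "'n space set \<Rightarrow> 'n::{finite,linorder} current \<Rightarrow> 'n current" where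
  "zero_extension_current U T I L = zero_extension U (T I L)"

text \<open>The measure \<open>\<mu>\<close> as the current \<open>\<mu> dx\<^sub>1 \<and> d\<xi>\<^sub>1 \<and> \<dots> \<and> dx\<^sub>n \<and> d\<xi>\<^sub>n\<close>.\<close>

definition measure_current :: "'n space measure \<Rightarrow> 'n::{finite,linorder} current" where
  "measure_current \<mu> I L = (\<lambda>\<phi>.
     if I = UNIV \<and> L = UNIV then volume_sign TYPE('n) * integral\<^sup>L \<mu> \<phi> else 0)"

text \<open>Hausdorff measure of integer dimension \<open>d\<close>, without normalising constant. The empty set is
  singled out because \<open>0 ^ 0 = 1\<close>, which is what nonempty sets of diameter \<open>0\<close> need when \<open>d = 0\<close>.\<close>

definition hausdorff_cost :: "nat \<Rightarrow> 'a::metric_space set \<Rightarrow> ennreal" where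
  "hausdorff_cost d A = (if A = {} then 0 else ennreal (diameter A ^ d))"

definition hausdorff_pre :: "real \<Rightarrow> nat \<Rightarrow> 'a::metric_space set \<Rightarrow> ennreal" where
  "hausdorff_pre \<delta> d A =
     (INF C\<in>{C :: nat \<Rightarrow> 'a set. A \<subseteq> (\<Union>i. C i) \<and> (\<forall>i. bounded (C i) \<and> diameter (C i) \<le> \<delta>)}.
        \<Sum>i. hausdorff_cost d (C i))"

definition hausdorff_measure :: "nat \<Rightarrow> 'a::metric_space set \<Rightarrow> ennreal" where
  "hausdorff_measure d A = (SUP \<delta>\<in>{0<..}. hausdorff_pre \<delta> d A)"

definition sigma_finite_hausdorff :: "nat \<Rightarrow> 'a::metric_space set \<Rightarrow> bool" where
  "sigma_finite_hausdorff d A \<longleftrightarrow>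
     (\<exists>E :: nat \<Rightarrow> 'a set. A = (\<Union>i. E i) \<and>
        (\<forall>i. E i \<in> sets borel \<and> hausdorff_measure d (E i) < \<infinity>))"

end

(*
Put q = p - 1.  Wedging with beta^q turns T into a symmetric matrix R of signed measures, and
dd# T ^ beta^q becomes D = sum d_i d_j R_ij.  Positivity of T gives <R a, a> >= 0 and, since
(t beta - z ^ J z)^p = t^(p-1) (t beta - p z ^ J z) ^ beta^(p-1), also t tr R >= p <R z, z>
whenever t >= |z|^2.  Hence the kernels f(|x - y|^2 + r^2) with f'(t) = - t^(-p/2) are
superharmonic for R.

A set of sigma-finite (p-2)-dimensional measure carries finite sums h >= 1 of such kernels of
arbitrarily small total charge: almost optimal covers at scale 2^-k have unbounded potential at
every point outside a Hausdorff null set, because the set has positive upper density there.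

With psi(u) = exp(-1/u) the cutoff psi(1/4 - h) vanishes near K and tends to psi(1/4) off K as the
charge of h tends to 0.  Testing D against psi(1/4 - h) eta^2 yields the terms of D(eta^2),
nonnegative terms, and an error which is controlled by the mass of R near K.  So D(eta^2) is at
most the value of the zero extension of dd# T ^ beta^q on eta^2; this gives local finiteness in
the concave case and shows that S is a positive functional, hence a measure.
*)

theory Submission
  imports Defs
begin

section \<open>Calculus of smooth functions\<close>

text \<open>The exponent is critical. A kernel superharmonic for R grows like r^(2-p), or log(1/r)
  if p = 2, so making its potential 1 on a ball of radius r costs a charge of about r^(p-2). Null
  sets are thus cheap, but a set of positive finite measure costs a fixed amount if each ball is
  paid for separately. The way out: one fine cover is felt by the kernel at every coarser dyadic
  scale, and all scales of positive density contribute equally; enough of them compensate any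
  scaling down of the charge.

  The cutoff must vanish identically near K, as only test functions on \<Omega> - K may be inserted,
  while grad h is uncontrolled near K. For psi(u) = exp(-1/u) and e = psi / u^4 one has psi' = u^2 e
  and psi'' = (1 - 2 u) e, so psi'^2 = psi e. Hence psi'' absorbs the cross term of grad h and grad
  \<eta> and leaves only a multiple of psi grad \<eta> \<otimes> grad \<eta>, free of h. This is
  done only in a neighbourhood of K that can be shrunk, and R does not charge K; outside it grad h
  tends to 0 with the charge.\<close>

abbreviation smooth :: "('n::finite space \<Rightarrow> real) \<Rightarrow> bool" where
  "smooth \<equiv> smooth_on UNIV"

lemma partial_eqI:
  assumes "(f has_derivative f') (at x)"
  shows "partial i f x = f' (axis i 1)"
  using frechet_derivative_at[OF assms] by (simp add: partial_def)

text \<open>All partial derivatives up to order \<open>k\<close> are differentiable, with the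
  innermost derivative peeled off. \<open>smooth_on\<close> quantifies over lists of indices;
  recursion on the order is what the product and chain rules need, since they reproduce functions of
  the same kind with one derivative less. \<open>Ck 0\<close> already asks for
  differentiability.\<close>

primrec Ck :: "nat \<Rightarrow> ('n::finite space \<Rightarrow> real) \<Rightarrow> bool" where
  "Ck 0 f = (\<forall>x. f differentiable (at x))"
| "Ck (Suc k) f = ((\<forall>x. f differentiable (at x)) \<and> (\<forall>i. Ck k (partial i f)))"

lemma Ck_iff: "Ck k f \<longleftrightarrow> (\<forall>is x. length is \<le> k \<longrightarrow> partials is f differentiable (at x))"
proof (induction k arbitrary: f)
  case 0
  then show ?case by (auto simp: partials_def)
next
  case (Suc k)
  show ?case
  proof
    assume C: "Ck (Suc k) f"
    show "\<forall>is x. length is \<le> Suc k \<longrightarrow> partials is f differentiable (at x)"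
    proof (intro allI impI)
      fix "is" :: "'a list" and x assume l: "length is \<le> Suc k"
      show "partials is f differentiable (at x)"
      \<comment> \<open>\<open>partials\<close> is a \<open>foldr\<close>, so the last index of the
        list is differentiated first.\<close>
      proof (cases "is" rule: rev_cases)
        case Nil
        then show ?thesis using C by (simp add: partials_def)
      next
        case (snoc js j)
        then have "partials js (partial j f) differentiable (at x)"
          using C Suc l by auto
        then show ?thesis using snoc by (simp add: partials_def)
      qed
    qed
  next
    assume D: "\<forall>is x. length is \<le> Suc k \<longrightarrow> partials is f differentiable (at x)"
    have "partials is (partial i f) differentiable (at x)" if "length is \<le> k" for "is" i x
      using D[rule_format, of "is @ [i]" x] that by (simp add: partials_def)
    moreover have "f differentiable (at x)" for x
      using D[rule_format, of "[]" x] by (simp add: partials_def)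
    ultimately show "Ck (Suc k) f" using Suc by auto
  qed
qed

lemma smooth_iff_Ck: "smooth f \<longleftrightarrow> (\<forall>k. Ck k f)"
  by (auto simp: smooth_on_def Ck_iff)

lemma Ck_Suc_D: "Ck (Suc k) f \<Longrightarrow> Ck k f"
  by (simp add: Ck_iff)

lemma smooth_differentiable: "smooth f \<Longrightarrow> f differentiable (at x)"
  by (metis Ck.simps(1) smooth_iff_Ck)

lemma smooth_partial: "smooth f \<Longrightarrow> smooth (partial i f)"
  by (meson Ck.simps(2) smooth_iff_Ck)

lemma smooth_continuous: "smooth f \<Longrightarrow> continuous_on A f"
  by (simp add: continuous_at_imp_continuous_on differentiable_imp_continuous_within
      smooth_differentiable)

lemma smooth_on_subset: "smooth f \<Longrightarrow> smooth_on U f"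
  by (simp add: smooth_on_def)

lemma partial_add:
  assumes "\<And>x. f differentiable (at x)" "\<And>x. g differentiable (at x)"
  shows "partial i (\<lambda>x. f x + g x) = (\<lambda>x. partial i f x + partial i g x)"
proof
  fix x
  have "(f has_derivative frechet_derivative f (at x)) (at x)"
       "(g has_derivative frechet_derivative g (at x)) (at x)"
    using assms frechet_derivative_works by blast+
  from has_derivative_add[OF this]
  show "partial i (\<lambda>x. f x + g x) x = partial i f x + partial i g x"
    by (simp add: partial_eqI partial_def[of _ f] partial_def[of _ g])
qed

lemma partial_mult:
  assumes "\<And>x. f differentiable (at x)" "\<And>x. g differentiable (at x)"
  shows "partial i (\<lambda>x. f x * g x) = (\<lambda>x. partial i f x * g x + f x * partial i g x)"
proof
  fix x
  have "(f has_derivative frechet_derivative f (at x)) (at x)"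
       "(g has_derivative frechet_derivative g (at x)) (at x)"
    using assms frechet_derivative_works by blast+
  from has_derivative_mult[OF this]
  show "partial i (\<lambda>x. f x * g x) x = partial i f x * g x + f x * partial i g x"
    by (simp add: partial_eqI partial_def[of _ f] partial_def[of _ g])
qed

lemma partial_const [simp]: "partial i (\<lambda>x. c) = (\<lambda>x. 0)"
  by (auto simp: fun_eq_iff intro!: partial_eqI[where f' = "\<lambda>x. 0", simplified])

lemma partial_cmult:
  assumes "\<And>x. f differentiable (at x)"
  shows "partial i (\<lambda>x. c * f x) = (\<lambda>x. c * partial i f x)"
  using partial_mult[of "\<lambda>x. c" f i] assms by simp

lemma partial_compose:
  assumes "(F has_real_derivative F') (at (g x))" "g differentiable (at x)"
  shows "partial i (\<lambda>x. F (g x)) x = F' * partial i g x"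
proof -
  have "(g has_derivative frechet_derivative g (at x)) (at x)"
    using assms frechet_derivative_works by blast
  from has_derivative_compose[OF this assms(1)[unfolded has_field_derivative_def]]
  show ?thesis by (simp add: partial_eqI partial_def[of _ g])
qed

lemma partial_nth: "partial i (\<lambda>x::'n::finite space. x $ j) = (\<lambda>x. if i = j then 1 else 0)"
proof
  fix x :: "'n space"
  have "((\<lambda>x::'n space. x $ j) has_derivative (\<lambda>h. h $ j)) (at x)"
    by (intro bounded_linear_imp_has_derivative bounded_linear_vec_nth)
  from partial_eqI[OF this] show "partial i (\<lambda>x. x $ j) x = (if i = j then 1 else 0)"
    by (auto simp: axis_def)
qed

lemma Ck_const: "Ck k (\<lambda>x. c)"
  by (induction k arbitrary: c) auto

lemma Ck_add: "Ck k f \<Longrightarrow> Ck k g \<Longrightarrow> Ck k (\<lambda>x. f x + g x)"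
  by (induction k arbitrary: f g) (auto simp: partial_add)

lemma Ck_mult: "Ck k f \<Longrightarrow> Ck k g \<Longrightarrow> Ck k (\<lambda>x. f x * g x)"
proof (induction k arbitrary: f g)
  case (Suc k)
  then show ?case
    using Ck_Suc_D[OF Suc.prems(1)] Ck_Suc_D[OF Suc.prems(2)]
    by (auto simp: partial_mult intro!: Ck_add Suc.IH)
qed auto

lemma smooth_const [simp]: "smooth (\<lambda>x. c)"
  by (simp add: smooth_iff_Ck Ck_const)

lemma smooth_add: "smooth f \<Longrightarrow> smooth g \<Longrightarrow> smooth (\<lambda>x. f x + g x)"
  by (simp add: smooth_iff_Ck Ck_add)

lemma smooth_mult: "smooth f \<Longrightarrow> smooth g \<Longrightarrow> smooth (\<lambda>x. f x * g x)"
  by (simp add: smooth_iff_Ck Ck_mult)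

lemma smooth_diff: "smooth f \<Longrightarrow> smooth g \<Longrightarrow> smooth (\<lambda>x. f x - g x)"
  using smooth_add[OF _ smooth_mult[OF smooth_const, of g "- 1"], of f] by simp

lemma smooth_minus: "smooth f \<Longrightarrow> smooth (\<lambda>x. - f x)"
  using smooth_diff[OF smooth_const, of f 0] by simp

lemma smooth_power: "smooth f \<Longrightarrow> smooth (\<lambda>x. f x ^ k)"
  by (induction k) (auto intro: smooth_mult)

lemma smooth_sum: "(\<And>m. m \<in> S \<Longrightarrow> smooth (f m)) \<Longrightarrow> smooth (\<lambda>x. \<Sum>m\<in>S. f m x)"
  by (induction S rule: infinite_finite_induct) (auto intro: smooth_add)

lemma smooth_nth: "smooth (\<lambda>x::'n::finite space. x $ j)"
  unfolding smooth_iff_Ck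
proof
  fix k show "Ck k (\<lambda>x::'n space. x $ j)"
    by (cases k) (auto simp: partial_nth Ck_const bounded_linear_vec_nth
        intro!: bounded_linear_imp_differentiable)
qed

text \<open>The outer function comes with the whole chain \<open>F m\<close> of its derivatives.
  Each partial derivative of F m (g x) is F (m+1) (g x) times a smooth function, so induction on the
  order works for all \<open>m\<close> at once. The set \<open>D\<close> admits powers and
  logarithms, which are differentiable only on a half-line.\<close>

lemma smooth_compose:
  assumes F: "\<And>m t. t \<in> D \<Longrightarrow> (F m has_real_derivative F (Suc m) t) (at t)"
    and D: "\<And>x. g x \<in> D" and g: "smooth g"
  shows "smooth (\<lambda>x. F m (g x))"
proof -
  have diff: "(\<lambda>x. F m (g x)) differentiable (at x)" for m x
  proof -
    have "(g has_derivative frechet_derivative g (at x)) (at x)"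
      using smooth_differentiable[OF g] frechet_derivative_works by blast
    from has_derivative_compose[OF this F[OF D, unfolded has_field_derivative_def]]
    show ?thesis unfolding differentiable_def by blast
  qed
  have part: "partial i (\<lambda>x. F m (g x)) = (\<lambda>x. F (Suc m) (g x) * partial i g x)" for i m
    using F D smooth_differentiable[OF g] by (intro ext partial_compose) auto
  have "Ck k (\<lambda>x. F m (g x))" for k
  proof (induction k arbitrary: m)
    case (Suc k)
    have "Ck k (partial i g)" for i using smooth_partial[OF g] smooth_iff_Ck by blast
    with Suc diff show ?case by (auto simp: part intro!: Ck_mult)
  qed (simp add: diff)
  then show ?thesis by (simp add: smooth_iff_Ck)
qed

lemma powr_chain:
  assumes "(t::real) > 0"
  shows "((\<lambda>t. (\<Prod>i<m. a - real i) * t powr (a - real m)) has_real_derivative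
    (\<Prod>i<Suc m. a - real i) * t powr (a - real (Suc m))) (at t)"
  using DERIV_cmult[OF has_real_derivative_powr[OF assms, of "a - real m"], of "\<Prod>i<m. a - real i"]
  by (simp add: mult.assoc diff_diff_eq add.commute)

lemma smooth_powr:
  assumes "smooth g" "\<And>x. g x > 0"
  shows "smooth (\<lambda>x. g x powr a)"
proof -
  have "smooth (\<lambda>x. (\<Prod>i<0. a - real i) * g x powr (a - real 0))"
    by (rule smooth_compose[where D = "{0<..}" and m = 0
      and F = "\<lambda>m t. (\<Prod>i<m. a - real i) * t powr (a - real m)" and g = g])
      (rule powr_chain, use assms in auto)
  then show ?thesis by simp
qed

lemma smooth_divide: "smooth f \<Longrightarrow> smooth g \<Longrightarrow> (\<And>x. g x > 0) \<Longrightarrow> smooth (\<lambda>x. f x / g x)"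
  using smooth_mult[of f "\<lambda>x. g x powr (- 1)"] smooth_powr[of g "- 1"]
  by (simp add: powr_minus_divide less_imp_le)

lemma norm_sq_sum: "(norm (x - y :: real^'n::finite))\<^sup>2 = (\<Sum>i\<in>UNIV. (x $ i - y $ i)\<^sup>2)"
  by (simp only: power2_norm_eq_inner inner_vec_def) (simp add: power2_eq_square)

lemma smooth_norm_sq: "smooth (\<lambda>x. (norm (x - y))\<^sup>2)"
  unfolding norm_sq_sum by (intro smooth_sum smooth_power smooth_diff smooth_nth smooth_const)

subsection \<open>Flat functions\<close>

text \<open>The function exp(-1/u) together with all its derivatives: the functions P(1/u)
  exp(-1/u), extended by 0, are closed under differentiation, which acts on \<open>P\<close> as
  \<open>flat_deriv\<close>.\<close>

definition flat :: "real poly \<Rightarrow> real \<Rightarrow> real" where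
  "flat P u = (if u > 0 then poly P (1 / u) * exp (- 1 / u) else 0)"

definition flat_deriv :: "real poly \<Rightarrow> real poly" where
  "flat_deriv P = [:0, 0, 1:] * (P - pderiv P)"

lemma poly_exp_tendsto: "((\<lambda>x. poly P x * exp (- x)) \<longlongrightarrow> 0) (at_top :: real filter)"
proof (induction P)
  case (pCons a P)
  have *: "((\<lambda>x. x * (poly Q x * exp (- x))) \<longlongrightarrow> 0) (at_top :: real filter)" for Q
  proof -
    have "((\<lambda>x. \<Sum>i\<le>degree Q. coeff Q i * (x ^ (Suc i) / exp x)) \<longlongrightarrow> (\<Sum>i\<le>degree Q. coeff Q i * 0)) at_top"
      by (intro tendsto_sum tendsto_mult tendsto_const tendsto_power_div_exp_0)
    moreover have "(\<lambda>x. \<Sum>i\<le>degree Q. coeff Q i * (x ^ (Suc i) / exp x)) = (\<lambda>x. x * (poly Q x * exp (- x)))"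
      by (auto simp: poly_altdef sum_distrib_left sum_distrib_right exp_minus field_simps)
    ultimately show ?thesis by simp
  qed
  have "((\<lambda>x. a * (x ^ 0 / exp x) + x * (poly P x * exp (- x))) \<longlongrightarrow> a * 0 + 0) (at_top :: real filter)"
    by (intro tendsto_add tendsto_mult tendsto_const tendsto_power_div_exp_0 *)
  then show ?case by (simp add: algebra_simps exp_minus field_simps)
qed simp

text \<open>The difference quotient at 0, the only delicate point. From the right it is Q(1/h)
  exp(-1/h) with Q = X P, hence the \<open>pCons 0 P\<close>; the exponential beats every
  polynomial.\<close>

lemma flat_quotient_tendsto: "((\<lambda>h. flat P h / h) \<longlongrightarrow> 0) (at 0)"
  unfolding filterlim_at_split
proof
  have "eventually (\<lambda>h. 0 = flat P h / h) (at_left 0)"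
    by (auto simp: flat_def eventually_at_filter)
  then show "((\<lambda>h. flat P h / h) \<longlongrightarrow> 0) (at_left 0)"
    by (rule Lim_transform_eventually[OF tendsto_const])
  have "((\<lambda>h. poly (pCons 0 P) (inverse h) * exp (- inverse h)) \<longlongrightarrow> 0) (at_right 0)"
    by (rule filterlim_compose[OF poly_exp_tendsto filterlim_inverse_at_top_right])
  moreover have "eventually (\<lambda>h. poly (pCons 0 P) (inverse h) * exp (- inverse h) = flat P h / h) (at_right 0)"
    by (auto simp: flat_def eventually_at_filter field_simps)
  ultimately show "((\<lambda>h. flat P h / h) \<longlongrightarrow> 0) (at_right 0)"
    by (rule Lim_transform_eventually)
qed

lemma flat_has_derivative: "(flat P has_real_derivative flat (flat_deriv P) t) (at t)"
proof -
  consider "t > 0" | "t = 0" | "t < 0" by linarith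
  then show ?thesis
  proof cases
    case 1
    have "((\<lambda>u. poly P (1 / u) * exp (- 1 / u)) has_real_derivative flat (flat_deriv P) t) (at t)"
      using 1 by (auto intro!: derivative_eq_intros DERIV_chain2[OF poly_DERIV]
          simp: flat_def flat_deriv_def field_simps power2_eq_square)
    then show ?thesis
    proof (rule has_field_derivative_transform_within_open)
      show "open {0::real<..}" "t \<in> {0<..}" using 1 by auto
    qed (auto simp: flat_def)
  next
    case 2
    then show ?thesis using flat_quotient_tendsto[of P]
      by (simp add: has_field_derivative_iff flat_def)
  next
    case 3
    have "((\<lambda>u. 0) has_real_derivative flat (flat_deriv P) t) (at t)"
      using 3 by (simp add: flat_def)
    then show ?thesis
    proof (rule has_field_derivative_transform_within_open)
      show "open {..<0::real}" "t \<in> {..<0}" using 3 by auto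
    qed (auto simp: flat_def)
  qed
qed

lemma smooth_flat:
  assumes "smooth g"
  shows "smooth (\<lambda>x. flat P (g x))"
proof -
  have "smooth (\<lambda>x. flat ((flat_deriv ^^ 0) P) (g x))"
    by (rule smooth_compose[where D = UNIV and F = "\<lambda>m. flat ((flat_deriv ^^ m) P)"])
      (use assms in \<open>auto simp: flat_has_derivative\<close>)
  then show ?thesis by simp
qed

lemma flat_pos: "u > 0 \<Longrightarrow> 0 < flat 1 u" and flat_nonpos: "u \<le> 0 \<Longrightarrow> flat P u = 0"
  and flat_nonneg: "0 \<le> flat 1 u"
  by (auto simp: flat_def)

definition smooth_step :: "real \<Rightarrow> real" where
  "smooth_step t = flat 1 t / (flat 1 t + flat 1 (1 - t))"

lemma smooth_step_denom: "flat 1 t + flat 1 (1 - t) > 0"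
  by (cases "t > 0") (auto simp: add_pos_nonneg add_nonneg_pos flat_pos flat_nonneg)

lemma smooth_step: "smooth g \<Longrightarrow> smooth (\<lambda>x. smooth_step (g x))"
  unfolding smooth_step_def
  by (intro smooth_divide smooth_add smooth_flat smooth_diff smooth_const smooth_step_denom)

lemma smooth_step_bounds: "0 \<le> smooth_step t" "smooth_step t \<le> 1"
  using smooth_step_denom[of t] flat_nonneg[of t] flat_nonneg[of "1 - t"]
  by (auto simp: smooth_step_def field_simps)

lemma smooth_step_eq_0: "t \<le> 0 \<Longrightarrow> smooth_step t = 0"
  and smooth_step_eq_1: "t \<ge> 1 \<Longrightarrow> smooth_step t = 1"
  using flat_pos[of t] by (auto simp: smooth_step_def flat_nonpos)

subsection \<open>Test functions\<close>

lemma test_smooth: "\<phi> \<in> test_functions U \<Longrightarrow> smooth \<phi>"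
  by (simp add: test_functions_def)

lemma test_functionsI:
  assumes "smooth \<phi>" "compact C" "C \<subseteq> U" "\<And>x. x \<notin> C \<Longrightarrow> \<phi> x = 0"
  shows "\<phi> \<in> test_functions U"
proof -
  have "closure {x. \<phi> x \<noteq> 0} \<subseteq> C"
    using assms by (intro closure_minimal) (auto simp: compact_imp_closed)
  moreover from this have "compact (closure {x. \<phi> x \<noteq> 0})"
    using assms(2) compact_Int_closed[of C "closure {x. \<phi> x \<noteq> 0}"] by (simp add: Int_absorb1)
  ultimately show ?thesis using assms by (auto simp: test_functions_def)
qed

lemma test_functionsE:
  assumes "\<phi> \<in> test_functions U"
  obtains C where "compact C" "C \<subseteq> U" "\<And>x. x \<notin> C \<Longrightarrow> \<phi> x = 0"
    "\<And>x. x \<notin> C \<Longrightarrow> partial i \<phi> x = 0" "C = closure {x. \<phi> x \<noteq> 0}"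
proof -
  define C where "C = closure {x. \<phi> x \<noteq> 0}"
  have z: "\<phi> x = 0" if "x \<notin> C" for x
    using that closure_subset[of "{x. \<phi> x \<noteq> 0}"] by (auto simp: C_def)
  have "partial i \<phi> x = 0" if "x \<notin> C" for x
  proof -
    have "open (- C)" "x \<in> - C" using that by (auto simp: C_def open_Compl)
    then have "(\<phi> has_derivative (\<lambda>h. 0)) (at x)"
      by (intro has_derivative_transform_within_open[OF has_derivative_const[of 0]]) (auto simp: z)
    from partial_eqI[OF this] show ?thesis .
  qed
  moreover have "compact C" "C \<subseteq> U" using assms by (simp_all add: C_def test_functions_def)
  ultimately show thesis using z C_def by (rule_tac that)
qed

lemma test_partial: assumes "\<phi> \<in> test_functions U" shows "partial i \<phi> \<in> test_functions U"
proof -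
  obtain C where "compact C" "C \<subseteq> U" "\<And>x. x \<notin> C \<Longrightarrow> partial i \<phi> x = 0"
    using test_functionsE[OF assms] by metis
  then show ?thesis using test_functionsI smooth_partial test_smooth[OF assms] by blast
qed

lemma test_mult: assumes "\<phi> \<in> test_functions U" "smooth g"
  shows "(\<lambda>x. g x * \<phi> x) \<in> test_functions U" "(\<lambda>x. \<phi> x * g x) \<in> test_functions U"
proof -
  obtain C where "compact C" "C \<subseteq> U" "\<And>x. x \<notin> C \<Longrightarrow> \<phi> x = 0"
    using test_functionsE[OF assms(1)] by metis
  then show "(\<lambda>x. g x * \<phi> x) \<in> test_functions U" "(\<lambda>x. \<phi> x * g x) \<in> test_functions U"
    using test_smooth[OF assms(1)] assms(2)
    by (auto intro!: test_functionsI[of _ C] smooth_mult)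
qed

lemma test_cmult: "\<phi> \<in> test_functions U \<Longrightarrow> (\<lambda>x. c * \<phi> x) \<in> test_functions U"
  by (simp add: test_mult)

lemma test_add: assumes "\<phi> \<in> test_functions U" "\<psi> \<in> test_functions U"
  shows "(\<lambda>x. \<phi> x + \<psi> x) \<in> test_functions U"
proof -
  obtain C where "compact C" "C \<subseteq> U" "\<And>x. x \<notin> C \<Longrightarrow> \<phi> x = 0"
    using test_functionsE[OF assms(1)] by metis
  moreover obtain D where "compact D" "D \<subseteq> U" "\<And>x. x \<notin> D \<Longrightarrow> \<psi> x = 0"
    using test_functionsE[OF assms(2)] by metis
  ultimately show ?thesis
    by (intro test_functionsI[of _ "C \<union> D"] smooth_add test_smooth[OF assms(1)]
        test_smooth[OF assms(2)]) auto
qed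

lemma test_zero [simp]: "(\<lambda>x. 0) \<in> test_functions U"
  by (rule test_functionsI[of _ "{}"]) auto

lemma test_diff: "\<phi> \<in> test_functions U \<Longrightarrow> \<psi> \<in> test_functions U \<Longrightarrow> (\<lambda>x. \<phi> x - \<psi> x) \<in> test_functions U"
  using test_add[of \<phi> U "\<lambda>x. - 1 * \<psi> x"] test_cmult[of \<psi> U "- 1"] by simp

lemma test_sum: "(\<And>m. m \<in> S \<Longrightarrow> f m \<in> test_functions U) \<Longrightarrow> (\<lambda>x. \<Sum>m\<in>S. f m x) \<in> test_functions U"
  by (induction S rule: infinite_finite_induct) (auto intro: test_add)

lemma test_mono: "\<phi> \<in> test_functions U \<Longrightarrow> U \<subseteq> V \<Longrightarrow> \<phi> \<in> test_functions V"
  by (auto simp: test_functions_def)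

lemma test_bounded: assumes "\<phi> \<in> test_functions U" obtains B where "B > 0" "\<And>x. \<bar>\<phi> x\<bar> \<le> B"
proof -
  obtain C where C: "compact C" "\<And>x. x \<notin> C \<Longrightarrow> \<phi> x = 0"
    using test_functionsE[OF assms] by metis
  have "compact (\<phi> ` C)"
    using C smooth_continuous[OF test_smooth[OF assms]] by (rule_tac compact_continuous_image)
  then obtain B where "B > 0" "\<forall>y\<in>\<phi> ` C. norm y \<le> B"
    using bounded_pos compact_imp_bounded by blast
  then show thesis using that[of B] C(2) by (metis abs_zero imageI less_imp_le real_norm_def)
qed

lemma smooth_urysohn:
  fixes C :: "'n::finite space set"
  assumes "compact C" "open V" "C \<subseteq> V"
  obtains \<theta> W where "\<theta> \<in> test_functions V" "\<And>x. 0 \<le> \<theta> x" "\<And>x. \<theta> x \<le> 1"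
    "open W" "C \<subseteq> W" "\<And>x. x \<in> W \<Longrightarrow> \<theta> x = 1"
proof (cases "C = {}")
  case True
  then show thesis using that[of "\<lambda>x. 0" "{}"] by simp
next
  case False
  have "\<forall>x\<in>C. \<exists>r>0. cball x r \<subseteq> V"
    using assms open_contains_cball by blast
  then obtain r where r: "\<And>x. x \<in> C \<Longrightarrow> r x > 0 \<and> cball x (r x) \<subseteq> V" by metis
  have "C \<subseteq> (\<Union>x\<in>C. ball x (r x))" using r by force
  then obtain F where F: "F \<subseteq> C" "finite F" "C \<subseteq> (\<Union>x\<in>F. ball x (r x))"
    using compactE_image[OF assms(1), of C "\<lambda>x. ball x (r x)"] by auto
  define g where "g x = (\<Sum>a\<in>F. flat 1 ((r a)\<^sup>2 - (norm (x - a))\<^sup>2))" for x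
  have sm: "smooth g" unfolding g_def
    by (intro smooth_sum smooth_flat smooth_diff smooth_const smooth_norm_sq)
  have pos: "g x > 0" if xC: "x \<in> C" for x
  proof -
    obtain a where a: "a \<in> F" "x \<in> ball a (r a)" using F(3) xC by auto
    have "(norm (x - a))\<^sup>2 < (r a)\<^sup>2"
      using a r[of a] F by (intro power_strict_mono) (auto simp: dist_norm norm_minus_commute)
    then have "flat 1 ((r a)\<^sup>2 - (norm (x - a))\<^sup>2) > 0" by (intro flat_pos) auto
    then show ?thesis unfolding g_def
      by (intro sum_pos2[OF F(2) a(1)]) (auto simp: flat_nonneg)
  qed
  obtain x0 where x0: "x0 \<in> C" "\<And>x. x \<in> C \<Longrightarrow> g x0 \<le> g x"
    using continuous_attains_inf[OF assms(1) False smooth_continuous[OF sm]] by auto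
  \<comment> \<open>Half the minimum of \<open>g\<close> on \<open>C\<close>: then g > m holds on an
    open neighbourhood of \<open>C\<close>, and \<theta> = 1 there and not merely on
    \<open>C\<close>.\<close>
  define m where "m = g x0 / 2"
  have m: "m > 0" "\<And>x. x \<in> C \<Longrightarrow> m < g x" using pos[OF x0(1)] x0 by (force simp: m_def)+
  define \<theta> where "\<theta> x = smooth_step (g x / m)" for x
  have "smooth \<theta>" unfolding \<theta>_def by (intro smooth_step smooth_divide sm) (simp_all add: m)
  moreover have "\<theta> x = 0" if "x \<notin> (\<Union>a\<in>F. cball a (r a))" for x
  proof -
    have "g x = 0" unfolding g_def
    proof (rule sum.neutral, rule ballI)
      fix a assume "a \<in> F"
      with that have "r a \<le> norm (x - a)" "0 \<le> r a"
        using r[of a] F by (auto simp: dist_norm norm_minus_commute)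
      then show "flat 1 ((r a)\<^sup>2 - (norm (x - a))\<^sup>2) = 0"
        by (intro flat_nonpos) (simp add: power_mono)
    qed
    then show ?thesis by (simp add: \<theta>_def smooth_step_eq_0)
  qed
  moreover have "(\<Union>a\<in>F. cball a (r a)) \<subseteq> V" using F r by blast
  moreover have "compact (\<Union>a\<in>F. cball a (r a))" using F by auto
  ultimately have "\<theta> \<in> test_functions V" by (intro test_functionsI) auto
  moreover have "open {x. m < g x}"
    using smooth_continuous[OF sm] by (intro open_Collect_less) auto
  ultimately show thesis
    by (rule_tac that[of \<theta> "{x. m < g x}"])
      (use m in \<open>auto simp: \<theta>_def smooth_step_bounds intro!: smooth_step_eq_1\<close>)
qed

section \<open>Radon measures and positive functionals\<close>

lemma test_compactE:
  assumes "\<phi> \<in> test_functions U"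
  obtains C where "compact C" "C \<subseteq> U" "\<And>x. x \<notin> C \<Longrightarrow> \<phi> x = 0"
  by (rule test_functionsE[OF assms]) (rule that)

lemma test_support: "\<phi> \<in> test_functions U \<Longrightarrow> \<phi> x \<noteq> 0 \<Longrightarrow> x \<in> U"
  by (erule test_compactE) blast

lemma radon_sets: "radon_measure_on U \<mu> \<Longrightarrow> sets \<mu> = sets borel"
  by (simp add: radon_measure_on_def)

lemma radon_finite: "radon_measure_on U \<mu> \<Longrightarrow> compact C \<Longrightarrow> C \<subseteq> U \<Longrightarrow> emeasure \<mu> C < \<infinity>"
  by (simp add: radon_measure_on_def)

lemma test_measurable: "sets \<mu> = sets borel \<Longrightarrow> smooth \<phi> \<Longrightarrow> \<phi> \<in> borel_measurable \<mu>"
  using borel_measurable_continuous_onI[OF smooth_continuous[of \<phi> UNIV]] measurable_cong_sets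
  by blast

lemma radon_integrable:
  assumes "radon_measure_on U \<mu>" "\<phi> \<in> test_functions U"
  shows "integrable \<mu> \<phi>"
proof -
  obtain C where C: "compact C" "C \<subseteq> U" "\<And>x. x \<notin> C \<Longrightarrow> \<phi> x = 0"
    by (rule test_compactE[OF assms(2)]) (rule that)
  obtain B where "\<And>x. \<bar>\<phi> x\<bar> \<le> B" using test_bounded[OF assms(2)] by metis
  then show ?thesis
    using C assms radon_finite[OF assms(1)] test_measurable[OF radon_sets[OF assms(1)]]
    by (intro integrableI_bounded_set[where A = C and B = B])
      (auto simp: radon_sets[OF assms(1)] test_smooth borel_compact)
qed

section \<open>Riesz representation for positive functionals on smooth test functions\<close>

locale positive_functional =
  fixes U :: "'n::finite space set" and \<Lambda> :: "'n functional"
  assumes U: "open U"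
    and lin: "\<And>\<phi> \<psi> a b. \<phi> \<in> test_functions U \<Longrightarrow> \<psi> \<in> test_functions U \<Longrightarrow>
      \<Lambda> (\<lambda>x. a * \<phi> x + b * \<psi> x) = a * \<Lambda> \<phi> + b * \<Lambda> \<psi>"
    and pos: "\<And>\<phi>. \<phi> \<in> test_functions U \<Longrightarrow> (\<And>x. 0 \<le> \<phi> x) \<Longrightarrow> 0 \<le> \<Lambda> \<phi>"
begin

lemma add: "\<phi> \<in> test_functions U \<Longrightarrow> \<psi> \<in> test_functions U \<Longrightarrow> \<Lambda> (\<lambda>x. \<phi> x + \<psi> x) = \<Lambda> \<phi> + \<Lambda> \<psi>"
  using lin[of \<phi> \<psi> 1 1] by simp

lemma diff: "\<phi> \<in> test_functions U \<Longrightarrow> \<psi> \<in> test_functions U \<Longrightarrow> \<Lambda> (\<lambda>x. \<phi> x - \<psi> x) = \<Lambda> \<phi> - \<Lambda> \<psi>"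
  using lin[of \<phi> \<psi> 1 "- 1"] by simp

lemma cmult: "\<phi> \<in> test_functions U \<Longrightarrow> \<Lambda> (\<lambda>x. a * \<phi> x) = a * \<Lambda> \<phi>"
  using lin[of \<phi> \<phi> a 0] by simp

lemma zero: "\<Lambda> (\<lambda>x. 0) = 0"
  using cmult[of "\<lambda>x. 0" 0] by simp

lemma sum: "(\<And>m. m \<in> S \<Longrightarrow> f m \<in> test_functions U) \<Longrightarrow> \<Lambda> (\<lambda>x. \<Sum>m\<in>S. f m x) = (\<Sum>m\<in>S. \<Lambda> (f m))"
  by (induction S rule: infinite_finite_induct) (auto simp: zero add test_sum)

lemma mono:
  assumes "\<phi> \<in> test_functions U" "\<psi> \<in> test_functions U" "\<And>x. \<phi> x \<le> \<psi> x"
  shows "\<Lambda> \<phi> \<le> \<Lambda> \<psi>"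
  using pos[OF test_diff[OF assms(2,1)]] assms by (simp add: diff)

text \<open>The content of an open set. Test functions see only the part inside \<open>U\<close>, so
  sets sticking out of \<open>U\<close> are allowed and the resulting measure vanishes outside
  \<open>U\<close>.\<close>

definition lam :: "'n space set \<Rightarrow> ennreal" where
  "lam O1 = (SUP \<phi>\<in>{\<phi> \<in> test_functions (U \<inter> O1). \<forall>x. 0 \<le> \<phi> x \<and> \<phi> x \<le> 1}. ennreal (\<Lambda> \<phi>))"

lemma lam_upper:
  "\<phi> \<in> test_functions (U \<inter> O1) \<Longrightarrow> (\<And>x. 0 \<le> \<phi> x) \<Longrightarrow> (\<And>x. \<phi> x \<le> 1) \<Longrightarrow> ennreal (\<Lambda> \<phi>) \<le> lam O1"
  unfolding lam_def by (rule SUP_upper) simp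

lemma lam_least:
  "(\<And>\<phi>. \<phi> \<in> test_functions (U \<inter> O1) \<Longrightarrow> (\<And>x. 0 \<le> \<phi> x) \<Longrightarrow> (\<And>x. \<phi> x \<le> 1) \<Longrightarrow> ennreal (\<Lambda> \<phi>) \<le> c)
    \<Longrightarrow> lam O1 \<le> c"
  unfolding lam_def by (rule SUP_least) simp

lemma lam_mono: "U \<inter> O1 \<subseteq> O2 \<Longrightarrow> lam O1 \<le> lam O2"
  by (rule lam_least, rule lam_upper) (auto intro: test_mono)

lemma lam_empty: "U \<inter> A = {} \<Longrightarrow> lam A = 0"
proof -
  assume "U \<inter> A = {}"
  then have "lam A \<le> 0"
  proof (intro lam_least)
    fix \<phi> :: "'n space \<Rightarrow> real" assume "\<phi> \<in> test_functions (U \<inter> A)"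
    with \<open>U \<inter> A = {}\<close> have "\<phi> = (\<lambda>x. 0)"
      using test_support by blast
    then show "ennreal (\<Lambda> \<phi>) \<le> 0" by (simp add: zero)
  qed
  then show ?thesis by simp
qed

lemma lam_Un:
  assumes "open O1" "open O2"
  shows "lam (O1 \<union> O2) \<le> lam O1 + lam O2"
proof (rule lam_least)
  fix \<phi> assume \<phi>: "\<phi> \<in> test_functions (U \<inter> (O1 \<union> O2))" "\<And>x. 0 \<le> \<phi> x" "\<And>x. \<phi> x \<le> 1"
  obtain C where C: "compact C" "C \<subseteq> U \<inter> (O1 \<union> O2)" "\<And>x. x \<notin> C \<Longrightarrow> \<phi> x = 0"
    by (rule test_compactE[OF \<phi>(1)]) (rule that)
  \<comment> \<open>\<theta> is 1 near the part of the support that \<open>O2\<close> misses. So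
    \<theta> \<phi> lives in \<open>O1\<close>, and (1 - \<theta>) \<phi> lives on the compact set
    \<open>C - W\<close>, which lies in \<open>O2\<close>.\<close>
  have "compact (C - O2)" using C assms by (auto intro: compact_diff)
  moreover have "open (U \<inter> O1)" using U assms by auto
  moreover have "C - O2 \<subseteq> U \<inter> O1" using C by auto
  ultimately obtain \<theta> W where \<theta>: "\<theta> \<in> test_functions (U \<inter> O1)" "\<And>x. 0 \<le> \<theta> x" "\<And>x. \<theta> x \<le> 1"
    "open W" "C - O2 \<subseteq> W" "\<And>x. x \<in> W \<Longrightarrow> \<theta> x = 1"
    using smooth_urysohn by metis
  have 1: "(\<lambda>x. \<theta> x * \<phi> x) \<in> test_functions (U \<inter> O1)"
    using \<theta> \<phi> by (intro test_mult) (auto simp: test_smooth)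
  have 2: "(\<lambda>x. (1 - \<theta> x) * \<phi> x) \<in> test_functions (U \<inter> O2)"
  proof (rule test_functionsI)
    show "smooth (\<lambda>x. (1 - \<theta> x) * \<phi> x)"
      using \<theta> \<phi> by (intro smooth_mult smooth_diff) (auto simp: test_smooth)
    show "compact (C - W)" using C \<theta> by (auto intro: compact_diff)
    show "C - W \<subseteq> U \<inter> O2" using C \<theta> by auto
  qed (use C \<theta> in auto)
  have "\<Lambda> \<phi> = \<Lambda> (\<lambda>x. \<theta> x * \<phi> x + (1 - \<theta> x) * \<phi> x)"
    by (simp add: algebra_simps)
  also have "\<dots> = \<Lambda> (\<lambda>x. \<theta> x * \<phi> x) + \<Lambda> (\<lambda>x. (1 - \<theta> x) * \<phi> x)"
    using 1 2 test_mono by (intro add) blast+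
  finally have "ennreal (\<Lambda> \<phi>) = ennreal (\<Lambda> (\<lambda>x. \<theta> x * \<phi> x)) + ennreal (\<Lambda> (\<lambda>x. (1 - \<theta> x) * \<phi> x))"
    using 1 2 test_mono \<theta> \<phi>
    by (metis (no_types, lifting) Int_lower1 diff_ge_0_iff_ge ennreal_plus mult_nonneg_nonneg pos)
  also have "\<dots> \<le> lam O1 + lam O2"
    using \<theta> \<phi> by (intro add_mono lam_upper 1 2) (auto intro!: mult_nonneg_nonneg mult_le_one)
  finally show "ennreal (\<Lambda> \<phi>) \<le> lam O1 + lam O2" .
qed

lemma lam_UN_finite:
  fixes n :: nat
  assumes "\<And>i. open (A i)"
  shows "lam (\<Union>i<n. A i) \<le> (\<Sum>i<n. lam (A i))"
proof (induction n)
  case (Suc n)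
  have "lam (\<Union>i<Suc n. A i) \<le> lam (\<Union>i<n. A i) + lam (A n)"
    using lam_Un[of "\<Union>i<n. A i" "A n"] assms by (auto simp: lessThan_Suc Un_commute)
  also have "\<dots> \<le> (\<Sum>i<n. lam (A i)) + lam (A n)" using Suc by (intro add_mono) auto
  finally show ?case by simp
qed (simp add: lam_empty)

lemma lam_UN:
  fixes A :: "nat \<Rightarrow> 'n space set"
  assumes A: "\<And>i. open (A i)"
  shows "lam (\<Union>i. A i) \<le> (\<Sum>i. lam (A i))"
proof (rule lam_least)
  fix \<phi> assume \<phi>: "\<phi> \<in> test_functions (U \<inter> (\<Union>i. A i))" "\<And>x. 0 \<le> \<phi> x" "\<And>x. \<phi> x \<le> 1"
  obtain C where C: "compact C" "C \<subseteq> U \<inter> (\<Union>i. A i)" "\<And>x. x \<notin> C \<Longrightarrow> \<phi> x = 0"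
    by (rule test_compactE[OF \<phi>(1)]) (rule that)
  then obtain F where F: "finite F" "C \<subseteq> (\<Union>i\<in>F. A i)"
    using compactE_image[OF C(1), of UNIV A] A by auto
  then obtain n where "F \<subseteq> {..<n}" using finite_nat_bounded by blast
  then have "C \<subseteq> U \<inter> (\<Union>i<n. A i)" using F C by blast
  then have "\<phi> \<in> test_functions (U \<inter> (\<Union>i<n. A i))"
    using C \<phi> by (intro test_functionsI[of _ C]) (auto simp: test_smooth)
  then have "ennreal (\<Lambda> \<phi>) \<le> lam (\<Union>i<n. A i)" using \<phi> by (intro lam_upper) auto
  also have "\<dots> \<le> (\<Sum>i<n. lam (A i))" by (rule lam_UN_finite[OF A])
  also have "\<dots> \<le> (\<Sum>i. lam (A i))" by (intro sum_le_suminf) auto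
  finally show "ennreal (\<Lambda> \<phi>) \<le> (\<Sum>i. lam (A i))" .
qed

definition out :: "'n space set \<Rightarrow> ennreal" where
  "out A = (INF V\<in>{V. open V \<and> A \<inter> U \<subseteq> V}. lam V)"

lemma out_le: "open V \<Longrightarrow> A \<inter> U \<subseteq> V \<Longrightarrow> out A \<le> lam V"
  unfolding out_def by (rule INF_lower) simp

lemma out_mono: "A \<inter> U \<subseteq> B \<Longrightarrow> out A \<le> out B"
  unfolding out_def by (rule INF_superset_mono) auto

lemma out_open: "open V \<Longrightarrow> out V = lam V"
  by (intro antisym out_le) (auto simp: out_def intro!: INF_greatest lam_mono)

lemma out_close: assumes "out A < c" obtains V where "open V" "A \<inter> U \<subseteq> V" "lam V < c"
  using assms by (auto simp: out_def INF_less_iff)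

lemma out_outer_measure: "outer_measure_space UNIV out"
  unfolding outer_measure_space_def
proof (intro conjI)
  show "positive UNIV out"
    using out_open[of "{}"] by (simp add: positive_def lam_empty)
  show "increasing UNIV out"
    by (auto simp: increasing_def intro!: out_mono)
  show "countably_subadditive UNIV out"
  proof (unfold countably_subadditive_def, intro allI impI)
    fix A :: "nat \<Rightarrow> 'n space set"
    show "out (\<Union>i. A i) \<le> (\<Sum>n. out (A n))"
    proof (rule ennreal_le_epsilon)
      fix e :: real assume e: "0 < e" "(\<Sum>n. out (A n)) < top"
      then have "out (A n) < out (A n) + e * (1/2)^Suc n" for n
        by (auto simp add: less_top dest!: ennreal_suminf_lessD)
      then have "\<exists>V. open V \<and> A n \<inter> U \<subseteq> V \<and> lam V < out (A n) + e * (1/2)^Suc n" for n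
        by (metis out_close)
      then obtain V where V: "\<And>n. open (V n)" "\<And>n. A n \<inter> U \<subseteq> V n"
        "\<And>n. lam (V n) < out (A n) + e * (1/2)^Suc n" by metis
      have "out (\<Union>i. A i) \<le> lam (\<Union>i. V i)" using V by (intro out_le) auto
      also have "\<dots> \<le> (\<Sum>i. lam (V i))" by (rule lam_UN[OF V(1)])
      also have "\<dots> \<le> (\<Sum>n. out (A n) + e * (1/2) ^ Suc n)"
        using V(3) by (intro suminf_le) (auto intro: less_imp_le)
      also have "... = (\<Sum>n. out (A n)) + (\<Sum>n. ennreal e * ennreal ((1/2) ^ Suc n))"
        using \<open>0 < e\<close> by (subst suminf_add[symmetric])
          (auto simp del: ennreal_suminf_cmult simp add: ennreal_mult[symmetric])
      also have "\<dots> = (\<Sum>n. out (A n)) + e"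
        unfolding ennreal_suminf_cmult
        by (subst suminf_ennreal_eq[OF zero_le_power power_half_series]) auto
      finally show "out (\<Union>i. A i) \<le> (\<Sum>n. out (A n)) + e" .
    qed
  qed
qed

text \<open>The reason why open sets are Caratheodory measurable. A competitor \<phi> for
  \<open>V \<inter> G\<close> vanishes off a compact set \<open>C\<close>, so \<open>G - C\<close>
  is open, contains \<open>G - V\<close>, and its competitors \<psi> vanish on \<open>C\<close>.
  Hence \<phi> + \<psi> \<le> 1 competes for \<open>G\<close>; it remains to take suprema, first
  over \<psi> and then over \<phi>.\<close>

lemma lam_split:
  assumes "open V" "open G"
  shows "lam (V \<inter> G) + out (G - V) \<le> lam G"
proof -
  let ?I = "{\<phi> \<in> test_functions (U \<inter> (V \<inter> G)). \<forall>x. 0 \<le> \<phi> x \<and> \<phi> x \<le> 1}"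
  have ne: "?I \<noteq> {}" using test_zero by fastforce
  have "ennreal (\<Lambda> \<phi>) + out (G - V) \<le> lam G" if \<phi>: "\<phi> \<in> ?I" for \<phi>
  proof -
    have \<phi>t: "\<phi> \<in> test_functions (U \<inter> (V \<inter> G))" using \<phi> by simp
    obtain C where C: "compact C" "C \<subseteq> U \<inter> (V \<inter> G)" "\<And>x. x \<notin> C \<Longrightarrow> \<phi> x = 0"
      by (rule test_compactE[OF \<phi>t]) (rule that)
    have "out (G - V) \<le> lam (G - C)"
      using C assms by (intro out_le) (auto intro: open_Diff compact_imp_closed)
    moreover have "ennreal (\<Lambda> \<phi>) + lam (G - C) \<le> lam G"
    proof -
      let ?J = "{\<psi> \<in> test_functions (U \<inter> (G - C)). \<forall>x. 0 \<le> \<psi> x \<and> \<psi> x \<le> 1}"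
      have "?J \<noteq> {}" using test_zero by fastforce
      moreover have "ennreal (\<Lambda> \<phi>) + ennreal (\<Lambda> \<psi>) \<le> lam G" if "\<psi> \<in> ?J" for \<psi>
      proof -
        have t: "\<phi> \<in> test_functions (U \<inter> G)" "\<psi> \<in> test_functions (U \<inter> G)"
          using that \<open>\<phi> \<in> ?I\<close> by (auto intro: test_mono)
        then have tU: "\<phi> \<in> test_functions U" "\<psi> \<in> test_functions U" by (auto intro: test_mono)
        have "\<psi> x = 0" if "x \<in> C" for x
          using that test_support[of \<psi> "U \<inter> (G - C)" x] \<open>\<psi> \<in> ?J\<close> by auto
        then have le: "\<phi> x + \<psi> x \<le> 1" for x
          using C(3)[of x] that \<open>\<phi> \<in> ?I\<close> by (cases "x \<in> C") auto
        have "ennreal (\<Lambda> \<phi>) + ennreal (\<Lambda> \<psi>) = ennreal (\<Lambda> (\<lambda>x. \<phi> x + \<psi> x))"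
          using that \<open>\<phi> \<in> ?I\<close> tU by (simp add: add pos)
        also have "\<dots> \<le> lam G"
          using that \<open>\<phi> \<in> ?I\<close> t le by (intro lam_upper test_add) auto
        finally show ?thesis .
      qed
      ultimately show ?thesis
        unfolding lam_def[of "G - C"] by (subst ennreal_SUP_add_right) (auto intro!: SUP_least)
    qed
    ultimately show ?thesis by (meson add_left_mono order_trans)
  qed
  then show ?thesis
    unfolding lam_def[of "V \<inter> G"] by (subst ennreal_SUP_add_left[symmetric, OF ne]) (auto intro!: SUP_least)
qed

lemma open_lambda_system: "open V \<Longrightarrow> V \<in> lambda_system UNIV UNIV out"
proof -
  assume V: "open V"
  have "out (V \<inter> x) + out (- V \<inter> x) = out x" for x
  proof (rule antisym)
    show "out (V \<inter> x) + out (- V \<inter> x) \<le> out x"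
      unfolding out_def[of x]
    proof (rule INF_greatest)
      fix G assume G: "G \<in> {G. open G \<and> x \<inter> U \<subseteq> G}"
      have "out (V \<inter> x) \<le> lam (V \<inter> G)" using V G by (intro out_le) auto
      moreover have "out (- V \<inter> x) \<le> out (G - V)" using V G by (intro out_mono) auto
      ultimately show "out (V \<inter> x) + out (- V \<inter> x) \<le> lam G"
        using order_trans[OF add_mono lam_split[OF V, of G]] G by auto
    qed
    have "ring_of_sets (UNIV :: 'n space set) UNIV"
      using algebra_Pow[of "UNIV :: 'n space set"] by (simp add: algebra_def)
    then have "subadditive UNIV out"
      using out_outer_measure ring_of_sets.countably_subadditive_subadditive[of UNIV UNIV out]
      by (simp add: outer_measure_space_def)
    from subadditiveD[OF this, of "V \<inter> x" "- V \<inter> x"]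
    have "out (V \<inter> x \<union> - V \<inter> x) \<le> out (V \<inter> x) + out (- V \<inter> x)" by auto
    moreover have "V \<inter> x \<union> - V \<inter> x = x" by auto
    ultimately show "out x \<le> out (V \<inter> x) + out (- V \<inter> x)" by simp
  qed
  then show ?thesis by (simp add: lambda_system_def Compl_eq_Diff_UNIV)
qed

definition rep :: "'n space measure" where
  "rep = measure_of UNIV (sets borel) out"

lemma sets_rep: "sets rep = sets borel"
  unfolding rep_def by (metis sets.sigma_sets_eq sets_measure_of space_borel top_greatest
      sets.space_closed)

lemma emeasure_rep: "A \<in> sets borel \<Longrightarrow> emeasure rep A = out A"
proof -
  assume A: "A \<in> sets borel"
  have P: "sigma_algebra (UNIV :: 'n space set) UNIV"
    using sigma_algebra_Pow[of "UNIV :: 'n space set"] by simp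
  have ms: "measure_space UNIV (lambda_system UNIV UNIV out) out"
    by (rule sigma_algebra.caratheodory_lemma[OF P out_outer_measure])
  then have "sigma_sets UNIV {S :: 'n space set. open S} \<subseteq> lambda_system UNIV UNIV out"
    by (intro sigma_algebra.sigma_sets_subset) (auto simp: measure_space_def open_lambda_system)
  then have "sets borel \<subseteq> lambda_system UNIV UNIV out"
    by (simp add: borel_def)
  then have "measure_space UNIV (sets borel) out"
    using measure_down[OF ms] sets.sigma_algebra_axioms[of borel] by simp
  then show ?thesis
    unfolding rep_def using A
    by (intro emeasure_measure_of_sigma) (auto simp: measure_space_def)
qed

lemma lam_finite: "compact C \<Longrightarrow> C \<subseteq> U \<Longrightarrow> out C < \<infinity>"
proof -
  assume C: "compact C" "C \<subseteq> U"
  obtain \<theta> W where \<theta>: "\<theta> \<in> test_functions U" "\<And>x. 0 \<le> \<theta> x" "\<And>x. \<theta> x \<le> 1"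
    "open W" "C \<subseteq> W" "\<And>x. x \<in> W \<Longrightarrow> \<theta> x = 1"
    using smooth_urysohn[OF C(1) U C(2)] by metis
  have "out C \<le> lam W" using \<theta> by (intro out_le) auto
  also have "\<dots> \<le> ennreal (\<Lambda> \<theta>)"
  proof (rule lam_least)
    fix \<phi> assume \<phi>: "\<phi> \<in> test_functions (U \<inter> W)" "\<And>x. 0 \<le> \<phi> x" "\<And>x. \<phi> x \<le> 1"
    have "\<phi> x \<le> \<theta> x" for x
      using test_support[OF \<phi>(1), of x] \<theta>(2)[of x] \<theta>(6)[of x] \<phi>(3)[of x]
      by (cases "\<phi> x = 0") auto
    then show "ennreal (\<Lambda> \<phi>) \<le> ennreal (\<Lambda> \<theta>)"
      using \<phi> \<theta> by (intro ennreal_leI mono) (auto intro: test_mono)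
  qed
  finally show ?thesis using ennreal_less_top le_less_trans infinity_ennreal_def by metis
qed

lemma radon_rep: "radon_measure_on U rep"
proof -
  have "out (- U) = 0" using out_le[of "{}" "- U"] by (simp add: lam_empty)
  then show ?thesis
    using U lam_finite by (auto simp: radon_measure_on_def sets_rep emeasure_rep borel_compact)
qed

text \<open>A smooth layer cake. With m the integer part of t, the layers below m are 1, those above
  m are 0, and only layer m is fractional.\<close>

lemma smooth_layers:
  fixes t :: real
  assumes "0 \<le> t" "t < real N"
  shows "\<bar>t - (\<Sum>k<N. smooth_step (t - real k))\<bar> \<le> 1"
proof -
  define m where "m = nat \<lfloor>t\<rfloor>"
  have m: "real m \<le> t" "t < real m + 1" "m < N"
    using assms by (auto simp: m_def) linarith+
  have "(\<Sum>k<N. smooth_step (t - real k)) = (\<Sum>k<m. smooth_step (t - real k)) + (\<Sum>k\<in>{m..<N}. smooth_step (t - real k))"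
    using m(3) by (simp add: sum.atLeastLessThan_concat lessThan_atLeast0 less_imp_le)
  also have "(\<Sum>k<m. smooth_step (t - real k)) = (\<Sum>k<m. 1)"
    using m by (intro sum.cong) (auto intro!: smooth_step_eq_1)
  also have "(\<Sum>k\<in>{m..<N}. smooth_step (t - real k)) = smooth_step (t - real m) + (\<Sum>k\<in>{Suc m..<N}. smooth_step (t - real k))"
    using m(3) by (simp add: sum.atLeast_Suc_lessThan)
  also have "(\<Sum>k\<in>{Suc m..<N}. smooth_step (t - real k)) = 0"
    using m by (intro sum.neutral) (auto intro!: smooth_step_eq_0)
  finally show ?thesis
    using m smooth_step_bounds[of "t - real m"] by simp
qed

definition layer :: "('n space \<Rightarrow> real) \<Rightarrow> real \<Rightarrow> nat \<Rightarrow> 'n space \<Rightarrow> real" where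
  "layer \<phi> e k x = smooth_step (\<phi> x / e - real k)"

lemma layer_test:
  assumes "\<phi> \<in> test_functions U" "e > 0" shows "layer \<phi> e k \<in> test_functions U"
proof -
  obtain C where C: "compact C" "C \<subseteq> U" "\<And>x. x \<notin> C \<Longrightarrow> \<phi> x = 0"
    by (rule test_compactE[OF assms(1)]) (rule that)
  have "smooth (layer \<phi> e k)" unfolding layer_def[abs_def] using assms
    by (intro smooth_step smooth_diff smooth_divide smooth_const) (auto simp: test_smooth)
  then show ?thesis
    using C by (intro test_functionsI[of _ C]) (auto simp: layer_def smooth_step_eq_0)
qed

text \<open>The pointwise error of the layer cake is at most e and occurs only where \<phi> is
  nonzero, so e \<theta> dominates it; positivity turns this into an estimate for the
  functional.\<close>

lemma layer_approx:
  assumes \<phi>: "\<phi> \<in> test_functions U" "\<And>x. 0 \<le> \<phi> x" "\<And>x. \<phi> x < real N * e" "e > 0"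
    and \<theta>: "\<theta> \<in> test_functions U" "\<And>x. 0 \<le> \<theta> x" "\<And>x. \<phi> x \<noteq> 0 \<Longrightarrow> \<theta> x = 1"
  shows "\<bar>\<Lambda> \<phi> - e * (\<Sum>k<N. \<Lambda> (layer \<phi> e k))\<bar> \<le> e * \<Lambda> \<theta>"
proof -
  let ?g = "\<lambda>x. e * (\<Sum>k<N. layer \<phi> e k x)"
  have gt: "?g \<in> test_functions U"
    by (intro test_cmult test_sum layer_test \<phi>)
  have ge: "\<Lambda> ?g = e * (\<Sum>k<N. \<Lambda> (layer \<phi> e k))"
    using layer_test[OF \<phi>(1,4)] by (simp add: cmult test_sum sum)
  have b: "\<bar>\<phi> x - ?g x\<bar> \<le> e * \<theta> x" for x
  proof (cases "\<phi> x = 0")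
    case True
    then show ?thesis using \<theta>(2)[of x] \<phi>(4) by (simp add: layer_def smooth_step_eq_0)
  next
    case False
    have "\<bar>\<phi> x / e - (\<Sum>k<N. layer \<phi> e k x)\<bar> \<le> 1"
      unfolding layer_def using \<phi> by (intro smooth_layers) (auto simp: divide_simps)
    then have "e * \<bar>\<phi> x / e - (\<Sum>k<N. layer \<phi> e k x)\<bar> \<le> e" using \<phi>(4) by simp
    then have "\<bar>e * (\<phi> x / e - (\<Sum>k<N. layer \<phi> e k x))\<bar> \<le> e" using \<phi>(4) by (simp add: abs_mult)
    then show ?thesis using \<theta>(3)[OF False] \<phi>(4) by (simp add: right_diff_distrib)
  qed
  have t: "(\<lambda>x. e * \<theta> x) \<in> test_functions U" by (rule test_cmult[OF \<theta>(1)])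
  have "\<Lambda> \<phi> \<le> \<Lambda> (\<lambda>x. ?g x + e * \<theta> x)"
  proof (rule mono[OF \<phi>(1) test_add[OF gt t]])
    show "\<phi> x \<le> ?g x + e * \<theta> x" for x using b[of x] by linarith
  qed
  moreover have "\<Lambda> ?g \<le> \<Lambda> (\<lambda>x. \<phi> x + e * \<theta> x)"
  proof (rule mono[OF gt test_add[OF \<phi>(1) t]])
    show "?g x \<le> \<phi> x + e * \<theta> x" for x using b[of x] by linarith
  qed
  ultimately have "\<Lambda> \<phi> \<le> \<Lambda> ?g + e * \<Lambda> \<theta>" "\<Lambda> ?g \<le> \<Lambda> \<phi> + e * \<Lambda> \<theta>"
    using add[OF gt t] add[OF \<phi>(1) t] by (simp_all add: cmult \<theta>)
  then show ?thesis unfolding ge[symmetric] by linarith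
qed

text \<open>The shift from \<open>k\<close> to \<open>Suc k\<close> buys compact support: the layer
  vanishes off the closed set \<phi> \<ge> (k + 1) e, which is contained in the open level set
  \<phi> > k e.\<close>

lemma layer_upper:
  assumes "\<phi> \<in> test_functions U" "e > 0"
  shows "ennreal (\<Lambda> (layer \<phi> e (Suc k))) \<le> lam {x. real k * e < \<phi> x}"
proof (rule lam_upper)
  obtain C where C: "compact C" "C \<subseteq> U" "\<And>x. x \<notin> C \<Longrightarrow> \<phi> x = 0"
    by (rule test_compactE[OF assms(1)]) (rule that)
  have "closed {x. real (Suc k) * e \<le> \<phi> x}"
    by (intro closed_Collect_le continuous_on_const smooth_continuous test_smooth[OF assms(1)])
  then have K: "compact (C \<inter> {x. real (Suc k) * e \<le> \<phi> x})" using C by (intro compact_Int_closed)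
  have "layer \<phi> e (Suc k) x = 0" if "x \<notin> C \<inter> {x. real (Suc k) * e \<le> \<phi> x}" for x
  proof -
    have "\<phi> x \<le> real (Suc k) * e" using that C(3)[of x] assms(2)
      by (metis (mono_tags, lifting) IntI linorder_le_cases mem_Collect_eq mult_nonneg_nonneg
          of_nat_0_le_iff less_imp_le)
    then show ?thesis using assms(2) by (auto simp: layer_def divide_simps intro!: smooth_step_eq_0)
  qed
  moreover have "real k * e < \<phi> x" if "real (Suc k) * e \<le> \<phi> x" for x
    using that assms(2) by (simp add: algebra_simps)
  ultimately show "layer \<phi> e (Suc k) \<in> test_functions (U \<inter> {x. real k * e < \<phi> x})"
    using K C(2) test_smooth[OF layer_test[OF assms]] by (intro test_functionsI[OF _ K]) auto
qed (auto simp: layer_def smooth_step_bounds)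

lemma layer_lower:
  assumes "\<phi> \<in> test_functions U" "e > 0"
  shows "lam {x. real (Suc k) * e < \<phi> x} \<le> ennreal (\<Lambda> (layer \<phi> e k))"
proof (rule lam_least)
  fix \<psi> assume \<psi>: "\<psi> \<in> test_functions (U \<inter> {x. real (Suc k) * e < \<phi> x})" "\<And>x. 0 \<le> \<psi> x" "\<And>x. \<psi> x \<le> 1"
  have "\<psi> x \<le> layer \<phi> e k x" for x
  proof (cases "real (Suc k) * e < \<phi> x")
    case True
    then have "layer \<phi> e k x = 1" using assms(2)
      by (auto simp: layer_def field_simps intro!: smooth_step_eq_1)
    then show ?thesis using \<psi> by simp
  next
    case False
    then have "\<psi> x = 0" using test_support[OF \<psi>(1), of x] by auto
    then show ?thesis by (simp add: layer_def smooth_step_bounds)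
  qed
  then show "ennreal (\<Lambda> \<psi>) \<le> ennreal (\<Lambda> (layer \<phi> e k))"
    using \<psi> assms by (intro ennreal_leI mono layer_test) (auto intro: test_mono)
qed

end

lemma positive_functional_integral:
  assumes "open U" "radon_measure_on U \<mu>"
  shows "positive_functional U (\<lambda>\<phi>. integral\<^sup>L \<mu> \<phi>)"
proof
  fix \<phi> \<psi> :: "'a space \<Rightarrow> real" and a b
  assume "\<phi> \<in> test_functions U" "\<psi> \<in> test_functions U"
  then show "integral\<^sup>L \<mu> (\<lambda>x. a * \<phi> x + b * \<psi> x) = a * integral\<^sup>L \<mu> \<phi> + b * integral\<^sup>L \<mu> \<psi>"
    using radon_integrable[OF assms(2)] by simp
qed (use assms in \<open>auto intro: integral_nonneg_AE\<close>)

lemma emeasure_le_integral: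
  assumes "integrable \<mu> f" "\<And>x. 0 \<le> f x" "\<And>x. x \<in> A \<Longrightarrow> 1 \<le> f x" "A \<in> sets \<mu>"
  shows "emeasure \<mu> A \<le> ennreal (integral\<^sup>L \<mu> f)"
proof -
  have "emeasure \<mu> A = (\<integral>\<^sup>+ x. indicator A x \<partial>\<mu>)" using assms by simp
  also have "\<dots> \<le> (\<integral>\<^sup>+ x. ennreal (f x) \<partial>\<mu>)"
    using assms by (intro nn_integral_mono) (auto simp: indicator_def)
  also have "\<dots> = ennreal (integral\<^sup>L \<mu> f)" using assms by (intro nn_integral_eq_integral) auto
  finally show ?thesis .
qed

lemma integral_le_emeasure:
  assumes "integrable \<mu> f" "\<And>x. 0 \<le> f x" "\<And>x. f x \<le> 1" "\<And>x. x \<notin> A \<Longrightarrow> f x = 0" "A \<in> sets \<mu>"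
  shows "ennreal (integral\<^sup>L \<mu> f) \<le> emeasure \<mu> A"
proof -
  have "ennreal (integral\<^sup>L \<mu> f) = (\<integral>\<^sup>+ x. ennreal (f x) \<partial>\<mu>)"
    using assms by (intro nn_integral_eq_integral[symmetric]) auto
  also have "\<dots> \<le> (\<integral>\<^sup>+ x. indicator A x \<partial>\<mu>)"
    using assms by (intro nn_integral_mono) (auto simp: indicator_def)
  finally show ?thesis using assms by simp
qed

context positive_functional
begin

lemma rep_nonneg:
  assumes \<phi>: "\<phi> \<in> test_functions U" "\<And>x. 0 \<le> \<phi> x"
  shows "\<Lambda> \<phi> = integral\<^sup>L rep \<phi>"
proof -
  interpret I: positive_functional U "\<lambda>\<phi>. integral\<^sup>L rep \<phi>"
    by (rule positive_functional_integral[OF U radon_rep])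
  obtain C where C: "compact C" "C \<subseteq> U" "\<And>x. x \<notin> C \<Longrightarrow> \<phi> x = 0"
    by (rule test_compactE[OF \<phi>(1)]) (rule that)
  obtain \<theta> W where \<theta>: "\<theta> \<in> test_functions U" "\<And>x. 0 \<le> \<theta> x" "\<And>x. \<theta> x \<le> 1"
    "open W" "C \<subseteq> W" "\<And>x. x \<in> W \<Longrightarrow> \<theta> x = 1"
    using smooth_urysohn[OF C(1) U C(2)] by metis
  obtain B where B: "B > 0" "\<And>x. \<bar>\<phi> x\<bar> \<le> B" using test_bounded[OF \<phi>(1)] by metis
  \<comment> \<open>Sum of three errors, all multiples of e: the two layer approximations contribute
    \<Lambda> \<theta> and the integral of \<theta>, and the comparison of the layers contributes 3
    \<Lambda> \<theta> plus that integral. What matters is that it does not depend on e.\<close>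
  define D where "D = 4 * \<Lambda> \<theta> + 2 * integral\<^sup>L rep \<theta>"
  have n: "0 \<le> \<Lambda> \<theta>" "0 \<le> integral\<^sup>L rep \<theta>" using pos I.pos \<theta> by auto
  have main: "\<bar>\<Lambda> \<phi> - integral\<^sup>L rep \<phi>\<bar> \<le> e * D" if e: "e > 0" for e
  proof -
    obtain N where N: "B / e < real N" using reals_Archimedean2 by blast
    have \<phi>N: "\<phi> x < real N * e" for x
    proof -
      have "B < real N * e" using N e by (simp add: divide_simps)
      then show ?thesis using B(2)[of x] by linarith
    qed
    define a b where "a k = \<Lambda> (layer \<phi> e k)" and "b k = integral\<^sup>L rep (layer \<phi> e k)" for k
    define V where "V k = {x. real k * e < \<phi> x}" for k
    define l where "l k = enn2real (lam (V k))" for k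
    have Vo: "open (V k)" for k
      unfolding V_def by (intro open_Collect_less continuous_on_const smooth_continuous test_smooth[OF \<phi>(1)])
    have VC: "V k \<subseteq> C" for k
      using C(3) e unfolding V_def by (smt (verit, ccfv_SIG) mem_Collect_eq mult_nonneg_nonneg of_nat_0_le_iff subsetI)
    have vlam: "lam (V k) = ennreal (l k)" for k
    proof -
      have "lam (V k) \<le> out C" using out_mono[of "V k" C] out_open[OF Vo, of k] VC[of k] by auto
      also have "\<dots> < \<infinity>" using lam_finite C by auto
      finally show ?thesis by (simp add: l_def)
    qed
    have vrep: "emeasure rep (V k) = ennreal (l k)" for k
      using emeasure_rep[of "V k"] out_open[OF Vo, of k] vlam Vo by simp
    have lt: "layer \<phi> e k \<in> test_functions U" for k by (rule layer_test[OF \<phi>(1) e])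
    have ln: "0 \<le> layer \<phi> e k x" "layer \<phi> e k x \<le> 1" for k x by (auto simp: layer_def smooth_step_bounds)
    have ab0: "0 \<le> a k" "0 \<le> b k" for k
      using pos I.pos lt ln by (auto simp: a_def b_def)
    have l0: "0 \<le> l k" for k by (simp add: l_def)
    have a1: "l (Suc k) \<le> a k" for k
      using layer_lower[OF \<phi>(1) e, of k] vlam[of "Suc k"] ab0[of k] by (simp add: V_def a_def)
    have a2: "a (Suc k) \<le> l k" for k
      using layer_upper[OF \<phi>(1) e, of k] vlam[of "k"] l0[of k] by (simp add: V_def a_def)
    have b1: "l (Suc k) \<le> b k" for k
    proof -
      have "emeasure rep (V (Suc k)) \<le> ennreal (b k)" unfolding b_def
      proof (rule emeasure_le_integral[OF radon_integrable[OF radon_rep lt] ln(1)])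
        fix x assume "x \<in> V (Suc k)"
        then have "1 \<le> \<phi> x / e - real k" using e by (simp add: V_def field_simps)
        then show "1 \<le> layer \<phi> e k x" by (simp add: layer_def smooth_step_eq_1)
      qed (use Vo in \<open>auto simp: sets_rep\<close>)
      then show ?thesis using vrep ab0[of k] by simp
    qed
    have b2: "b (Suc k) \<le> l k" for k
    proof -
      have "ennreal (b (Suc k)) \<le> emeasure rep (V k)" unfolding b_def
      proof (rule integral_le_emeasure[OF radon_integrable[OF radon_rep lt] ln])
        fix x assume "x \<notin> V k"
        then have "\<phi> x \<le> real (Suc k) * e" using e by (auto simp: V_def algebra_simps)
        then show "layer \<phi> e (Suc k) x = 0" using e
          by (auto simp: layer_def divide_simps intro!: smooth_step_eq_0)
      qed (use Vo in \<open>auto simp: sets_rep\<close>)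
      then show ?thesis using vrep l0[of k] by simp
    qed
    have le\<theta>: "layer \<phi> e 0 x \<le> \<theta> x" for x
    proof (cases "x \<in> C")
      case True
      then show ?thesis using \<theta> ln by (metis subsetD)
    next
      case False
      then show ?thesis using C(3) \<theta>(2) by (simp add: layer_def smooth_step_eq_0)
    qed
    have a00: "a 0 \<le> \<Lambda> \<theta>" "b 0 \<le> integral\<^sup>L rep \<theta>"
      using mono[OF lt \<theta>(1) le\<theta>] I.mono[OF lt \<theta>(1) le\<theta>] by (auto simp: a_def b_def)
    have "lam (V 0) \<le> ennreal (\<Lambda> \<theta>)"
    proof (rule lam_least)
      fix \<psi> assume \<psi>: "\<psi> \<in> test_functions (U \<inter> V 0)" "\<And>x. 0 \<le> \<psi> x" "\<And>x. \<psi> x \<le> 1"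
      have "\<psi> x \<le> \<theta> x" for x
        using test_support[OF \<psi>(1), of x] \<theta>(2)[of x] \<theta>(6)[of x] \<psi>(3)[of x] VC[of 0] \<theta>(5)
        by (cases "\<psi> x = 0") auto
      then show "ennreal (\<Lambda> \<psi>) \<le> ennreal (\<Lambda> \<theta>)"
        using \<psi> \<theta> by (intro ennreal_leI mono) (auto intro: test_mono)
    qed
    then have l00: "l 0 \<le> \<Lambda> \<theta>" using vlam n by simp
    \<comment> \<open>Both \<open>a (Suc k)\<close> and \<open>b (Suc k)\<close> lie between
      \<open>l (Suc (Suc k))\<close> and \<open>l k\<close>. These gaps telescope in steps of two,
      so their sum stays below \<open>l 0 + l 1\<close> however many layers there are.\<close>
    have tel: "(\<Sum>k<N. l k - l (Suc (Suc k))) = l 0 + l 1 - l N - l (Suc N)" for N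
      by (induction N) auto
    have "(\<Sum>k<N. \<bar>a k - b k\<bar>) \<le> (\<Sum>k<Suc N. \<bar>a k - b k\<bar>)" by simp
    also have "\<dots> = \<bar>a 0 - b 0\<bar> + (\<Sum>k<N. \<bar>a (Suc k) - b (Suc k)\<bar>)"
      by (rule sum.lessThan_Suc_shift)
    also have "\<dots> \<le> (\<Lambda> \<theta> + integral\<^sup>L rep \<theta>) + (\<Sum>k<N. l k - l (Suc (Suc k)))"
      using ab0[of 0] a00 a1 a2 b1 b2 by (intro add_mono sum_mono) (auto simp: abs_le_iff diff_mono)
    also have "\<dots> \<le> 3 * \<Lambda> \<theta> + integral\<^sup>L rep \<theta>"
      using tel[of N] l0[of N] l0[of "Suc N"] l00 a1[of 0] a00 by simp
    finally have s: "(\<Sum>k<N. \<bar>a k - b k\<bar>) \<le> 3 * \<Lambda> \<theta> + integral\<^sup>L rep \<theta>" .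
    have \<theta>1: "\<theta> x = 1" if "\<phi> x \<noteq> 0" for x using that C(3) \<theta>(5,6) by blast
    have "\<bar>\<Lambda> \<phi> - e * (\<Sum>k<N. a k)\<bar> \<le> e * \<Lambda> \<theta>"
      unfolding a_def by (rule layer_approx[OF \<phi> \<phi>N e \<theta>(1,2) \<theta>1])
    moreover have "\<bar>integral\<^sup>L rep \<phi> - e * (\<Sum>k<N. b k)\<bar> \<le> e * integral\<^sup>L rep \<theta>"
      unfolding b_def by (rule I.layer_approx[OF \<phi> \<phi>N e \<theta>(1,2) \<theta>1])
    moreover have "\<bar>e * (\<Sum>k<N. a k) - e * (\<Sum>k<N. b k)\<bar> \<le> e * (3 * \<Lambda> \<theta> + integral\<^sup>L rep \<theta>)"
    proof -
      have "e * (\<Sum>k<N. a k) - e * (\<Sum>k<N. b k) = e * (\<Sum>k<N. a k - b k)"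
        by (simp add: sum_subtractf right_diff_distrib)
      also have "\<bar>\<dots>\<bar> \<le> e * (\<Sum>k<N. \<bar>a k - b k\<bar>)"
        using e by (simp add: abs_mult)
      also have "\<dots> \<le> e * (3 * \<Lambda> \<theta> + integral\<^sup>L rep \<theta>)" using e s by simp
      finally show ?thesis .
    qed
    ultimately show ?thesis unfolding D_def by (simp add: algebra_simps abs_le_iff)
  qed
  have "\<bar>\<Lambda> \<phi> - integral\<^sup>L rep \<phi>\<bar> \<le> 0 + e" if "e > 0" for e
  proof -
    have "D \<ge> 0" using n by (simp add: D_def)
    then have "e / (D + 1) * D \<le> e" using that by (simp add: field_simps)
    moreover have "e / (D + 1) > 0" using that \<open>D \<ge> 0\<close> by simp
    ultimately show ?thesis using main[of "e / (D + 1)"] by linarith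
  qed
  then have "\<bar>\<Lambda> \<phi> - integral\<^sup>L rep \<phi>\<bar> \<le> 0" by (rule field_le_epsilon)
  then show ?thesis by simp
qed

theorem representation:
  assumes \<phi>: "\<phi> \<in> test_functions U"
  shows "\<Lambda> \<phi> = integral\<^sup>L rep \<phi>"
proof -
  interpret I: positive_functional U "\<lambda>\<phi>. integral\<^sup>L rep \<phi>"
    by (rule positive_functional_integral[OF U radon_rep])
  obtain C where C: "compact C" "C \<subseteq> U" "\<And>x. x \<notin> C \<Longrightarrow> \<phi> x = 0"
    by (rule test_compactE[OF \<phi>]) (rule that)
  obtain \<theta> W where \<theta>: "\<theta> \<in> test_functions U" "\<And>x. 0 \<le> \<theta> x" "\<And>x. \<theta> x \<le> 1"
    "open W" "C \<subseteq> W" "\<And>x. x \<in> W \<Longrightarrow> \<theta> x = 1"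
    using smooth_urysohn[OF C(1) U C(2)] by metis
  obtain B where B: "B > 0" "\<And>x. \<bar>\<phi> x\<bar> \<le> B" using test_bounded[OF \<phi>] by metis
  have t: "(\<lambda>x. B * \<theta> x) \<in> test_functions U" "\<And>x. 0 \<le> B * \<theta> x"
    using \<theta> B by (auto intro: test_cmult)
  \<comment> \<open>A multiple of the plateau function makes \<phi> nonnegative. The nonnegative
    case also applies to that multiple alone, so it can be subtracted again.\<close>
  have "0 \<le> \<phi> x + B * \<theta> x" for x
  proof (cases "x \<in> C")
    case True
    then show ?thesis using \<theta>(5,6) B(2)[of x] by (auto simp: subset_iff)
  qed (use C(3) t in auto)
  then have "\<Lambda> (\<lambda>x. \<phi> x + B * \<theta> x) = integral\<^sup>L rep (\<lambda>x. \<phi> x + B * \<theta> x)"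
    by (intro rep_nonneg test_add \<phi> t) auto
  then show ?thesis using rep_nonneg[OF t] add[OF \<phi> t(1)] I.add[OF \<phi> t(1)] by simp
qed

end

lemma riesz_representation:
  assumes "positive_functional U \<Lambda>"
  obtains \<mu> where "radon_measure_on U \<mu>" "\<And>\<phi>. \<phi> \<in> test_functions U \<Longrightarrow> \<Lambda> \<phi> = integral\<^sup>L \<mu> \<phi>"
  using positive_functional.representation[OF assms] positive_functional.radon_rep[OF assms] by blast

section \<open>Comparison of Radon measures and identification of Jordan parts\<close>

lemma open_compact_exhaustion:
  fixes U :: "'n::finite space set"
  assumes "open U"
  obtains C where "\<And>n. compact (C n)" "incseq C" "(\<Union>n::nat. C n) = U"
proof -
  obtain \<D> where D: "countable \<D>" "\<And>X. X \<in> \<D> \<Longrightarrow> \<exists>a b. X = cbox a b" "\<Union>\<D> = U"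
    using open_countable_Union_open_cbox[OF assms] by metis
  show thesis
  proof (cases "\<D> = {}")
    case True
    then show thesis using D by (intro that[of "\<lambda>n. {}"]) auto
  next
    case False
    show thesis
    proof (rule that[of "\<lambda>n. \<Union>i\<le>n. from_nat_into \<D> i"])
      show "compact (\<Union>i\<le>n. from_nat_into \<D> i)" for n
        using D(2)[OF from_nat_into[OF False]] by (intro compact_UN) (auto, metis compact_cbox)
      show "incseq (\<lambda>n. \<Union>i\<le>n. from_nat_into \<D> i)"
        by (intro monoI UN_mono) auto
      have "(\<Union>n. \<Union>i\<le>n. from_nat_into \<D> i) = \<Union>(range (from_nat_into \<D>))" by auto
      then show "(\<Union>n. \<Union>i\<le>n. from_nat_into \<D> i) = U"
        using D False by (simp add: range_from_nat_into)
    qed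
  qed
qed

text \<open>Three steps: plateau functions compare a compact set with an open neighbourhood; outer
  regularity of \<nu> shrinks the neighbourhood to the compact set; inner regularity of \<mu> passes
  to Borel sets. As Radon measures on \<open>U\<close> may be infinite, regularity is applied to
  restrictions of finite mass, to \<open>W\<close> for \<nu> and to the members \<open>C n\<close>
  of an exhaustion for \<mu>.\<close>

lemma radon_compare:
  fixes \<mu> \<nu> :: "'n::finite space measure"
  assumes U: "open U" and \<mu>: "radon_measure_on U \<mu>" and \<nu>: "radon_measure_on U \<nu>"
    and le: "\<And>\<phi>. \<phi> \<in> test_functions U \<Longrightarrow> (\<And>x. 0 \<le> \<phi> x) \<Longrightarrow> integral\<^sup>L \<mu> \<phi> \<le> integral\<^sup>L \<nu> \<phi>"
    and A: "A \<in> sets borel"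
  shows "emeasure \<mu> A \<le> emeasure \<nu> A"
proof -
  note sets = radon_sets[OF \<mu>] radon_sets[OF \<nu>]
  have compact_open: "emeasure \<mu> C \<le> emeasure \<nu> V" if CV: "compact C" "open V" "C \<subseteq> V" "V \<subseteq> U" for C V
  proof -
    obtain \<theta> W where \<theta>: "\<theta> \<in> test_functions V" "\<And>x. 0 \<le> \<theta> x" "\<And>x. \<theta> x \<le> 1"
      "C \<subseteq> W" "\<And>x. x \<in> W \<Longrightarrow> \<theta> x = 1"
      using smooth_urysohn[OF CV(1,2,3)] by metis
    have tU: "\<theta> \<in> test_functions U" using \<theta>(1) CV(4) by (rule test_mono)
    have "\<theta> x = 0" if "x \<notin> V" for x
      using that test_support[OF \<theta>(1), of x] by auto
    then have "ennreal (integral\<^sup>L \<nu> \<theta>) \<le> emeasure \<nu> V"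
      using CV by (intro integral_le_emeasure radon_integrable[OF \<nu> tU] \<theta>) (auto simp: sets)
    moreover have "emeasure \<mu> C \<le> ennreal (integral\<^sup>L \<mu> \<theta>)"
      using CV \<theta> by (intro emeasure_le_integral radon_integrable[OF \<mu> tU]) (auto simp: sets borel_compact subset_iff)
    moreover have "ennreal (integral\<^sup>L \<mu> \<theta>) \<le> ennreal (integral\<^sup>L \<nu> \<theta>)"
      using le[OF tU] \<theta> by (intro ennreal_leI) auto
    ultimately show ?thesis by order
  qed
  have compact_le: "emeasure \<mu> C \<le> emeasure \<nu> C" if C: "compact C" "C \<subseteq> U" for C
  proof -
    obtain \<theta> W where \<theta>: "\<theta> \<in> test_functions U" "open W" "C \<subseteq> W" "\<And>x. x \<in> W \<Longrightarrow> \<theta> x = 1"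
      using smooth_urysohn[OF C(1) U C(2)] by metis
    obtain D where D: "compact D" "D \<subseteq> U" "\<And>x. x \<notin> D \<Longrightarrow> \<theta> x = 0"
      by (rule test_compactE[OF \<theta>(1)]) (rule that)
    have WD: "W \<subseteq> D" using D(3) \<theta>(4) by force
    have "emeasure \<nu> W \<le> emeasure \<nu> D" using WD D by (intro emeasure_mono) (auto simp: sets borel_compact)
    then have fin: "emeasure \<nu> W < \<infinity>" using radon_finite[OF \<nu> D(1,2)] by order
    let ?N = "density \<nu> (indicator W)"
    have em: "emeasure ?N X = emeasure \<nu> (W \<inter> X)" if "X \<in> sets borel" for X
      using that \<theta>(2) by (intro emeasure_restricted) (auto simp: sets)
    have "emeasure ?N C = (INF V\<in>{V. C \<subseteq> V \<and> open V}. emeasure ?N V)"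
    proof (rule outer_regular)
      show "emeasure ?N (space ?N) \<noteq> \<infinity>"
        using em[of UNIV] fin sets_eq_imp_space_eq[OF sets(2)] by simp
    qed (use C in \<open>auto simp: sets borel_compact\<close>)
    moreover have "emeasure \<mu> C \<le> emeasure ?N V" if "C \<subseteq> V" "open V" for V
    proof -
      have "W \<subseteq> U" using WD D by auto
      then show ?thesis using compact_open[of C "W \<inter> V"] em[of V] that C \<theta> by auto
    qed
    ultimately have "emeasure \<mu> C \<le> emeasure ?N C" by (auto intro: INF_greatest)
    also have "\<dots> = emeasure \<nu> C" using em[of C] C \<theta> by (simp add: borel_compact Int_absorb1)
    finally show ?thesis .
  qed
  obtain C where C: "\<And>n. compact (C n)" "incseq C" "(\<Union>n::nat. C n) = U"
    using open_compact_exhaustion[OF U] by metis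
  have Cb: "C n \<in> sets borel" for n using C by (simp add: borel_compact)
  have CU: "C n \<subseteq> U" for n using C(3) by blast
  have 1: "emeasure \<mu> (C n \<inter> A) \<le> emeasure \<nu> A" for n
  proof -
    let ?N = "density \<mu> (indicator (C n))"
    have em: "emeasure ?N X = emeasure \<mu> (C n \<inter> X)" if "X \<in> sets borel" for X
      using that Cb by (intro emeasure_restricted) (auto simp: sets)
    have "emeasure ?N A = (SUP X\<in>{X. X \<subseteq> A \<and> compact X}. emeasure ?N X)"
    proof (rule inner_regular)
      show "emeasure ?N (space ?N) \<noteq> \<infinity>"
        using em[of UNIV] radon_finite[OF \<mu> C(1) CU, of n] sets_eq_imp_space_eq[OF sets(1)] by simp
    qed (use A in \<open>auto simp: sets\<close>)
    moreover have "emeasure ?N X \<le> emeasure \<nu> A" if "X \<subseteq> A" "compact X" for X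
    proof -
      have "emeasure ?N X = emeasure \<mu> (C n \<inter> X)" using em that by (simp add: borel_compact)
      also have "\<dots> \<le> emeasure \<nu> (C n \<inter> X)" using C that by (intro compact_le) (auto intro: compact_Int)
      also have "\<dots> \<le> emeasure \<nu> A" using that A by (intro emeasure_mono) (auto simp: sets)
      finally show ?thesis .
    qed
    ultimately have "emeasure ?N A \<le> emeasure \<nu> A" by (auto intro: SUP_least)
    then show ?thesis using em A by simp
  qed
  have 2: "(SUP n. emeasure \<mu> (C n \<inter> A)) = emeasure \<mu> (\<Union>n. C n \<inter> A)"
    using A Cb C(2) by (intro SUP_emeasure_incseq) (auto simp: sets incseq_def)
  have "emeasure \<mu> (U \<inter> A) \<le> emeasure \<nu> A"
  proof -
    have "emeasure \<mu> (U \<inter> A) = emeasure \<mu> (\<Union>n. C n \<inter> A)" using C(3) by (intro arg_cong2[where f = emeasure]) auto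
    also have "\<dots> = (SUP n. emeasure \<mu> (C n \<inter> A))" using 2 by simp
    also have "\<dots> \<le> emeasure \<nu> A" by (rule SUP_least) (rule 1)
    finally show ?thesis .
  qed
  moreover have "emeasure \<mu> A = emeasure \<mu> (U \<inter> A)"
  proof (rule antisym)
    have "emeasure \<mu> A \<le> emeasure \<mu> ((U \<inter> A) \<union> - U)" using A U by (intro emeasure_mono) (auto simp: sets)
    also have "\<dots> \<le> emeasure \<mu> (U \<inter> A) + emeasure \<mu> (- U)"
      using A U by (intro emeasure_subadditive) (auto simp: sets)
    also have "\<dots> = emeasure \<mu> (U \<inter> A)" using \<mu> by (simp add: radon_measure_on_def)
    finally show "emeasure \<mu> A \<le> emeasure \<mu> (U \<inter> A)" .
  qed (use A in \<open>auto simp: sets intro: emeasure_mono\<close>)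
  ultimately show ?thesis by simp
qed

text \<open>\<open>jordan\<close> picks some decomposition, and this is how its parts get
  identified. If u \<le> 0 on nonnegative functions then \<mu> \<le> \<nu>; so \<mu> vanishes where
  \<nu> does, and on the remaining set it vanishes by mutual singularity.\<close>

lemma jordan_of_nonpos:
  assumes U: "open U" and j: "jordan_of U u \<mu> \<nu>"
    and le: "\<And>\<phi>. \<phi> \<in> test_functions U \<Longrightarrow> (\<And>x. 0 \<le> \<phi> x) \<Longrightarrow> u \<phi> \<le> 0"
    and A: "A \<in> sets borel"
  shows "emeasure \<mu> A = 0"
proof -
  obtain B where B: "B \<in> sets borel" "emeasure \<mu> B = 0" "emeasure \<nu> (- B) = 0"
    using j by (auto simp: jordan_of_def)
  have r: "radon_measure_on U \<mu>" "radon_measure_on U \<nu>" using j by (auto simp: jordan_of_def)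
  have "emeasure \<mu> (- B) \<le> emeasure \<nu> (- B)"
    using j le B by (intro radon_compare[OF U r]) (auto simp: jordan_of_def)
  then have "emeasure \<mu> (- B) = 0" using B by simp
  moreover have "emeasure \<mu> A \<le> emeasure \<mu> (B \<union> - B)"
    using B A by (intro emeasure_mono) (auto simp: radon_sets[OF r(1)])
  moreover have "\<dots> \<le> emeasure \<mu> B + emeasure \<mu> (- B)"
    using B by (intro emeasure_subadditive) (auto simp: radon_sets[OF r(1)])
  ultimately show ?thesis using B by simp
qed

lemma jordan_of_swap: "jordan_of U u \<mu> \<nu> \<Longrightarrow> jordan_of U (\<lambda>\<phi>. - u \<phi>) \<nu> \<mu>"
  unfolding jordan_of_def by (metis (no_types, lifting) borel_comp double_complement minus_diff_eq)

section \<open>Sets of finite Hausdorff measure have small potentials\<close>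

definition cost :: "nat \<Rightarrow> 'a::metric_space set \<Rightarrow> real" where
  "cost d A = (if A = {} then 0 else diameter A ^ d)"

lemma hausdorff_cost_eq: "hausdorff_cost d A = ennreal (cost d A)"
  by (simp add: hausdorff_cost_def cost_def)

lemma cost_nonneg: "bounded A \<Longrightarrow> 0 \<le> cost d A"
  by (simp add: cost_def diameter_ge_0)

lemma hausdorff_pre_le:
  assumes "A \<subseteq> (\<Union>i. C i)" "\<And>i. bounded (C i)" "\<And>i. diameter (C i) \<le> \<delta>"
  shows "hausdorff_pre \<delta> d A \<le> (\<Sum>i. hausdorff_cost d (C i))"
  unfolding hausdorff_pre_def by (rule INF_lower) (use assms in auto)

lemma hausdorff_pre_close:
  assumes "hausdorff_pre \<delta> d A < c"
  obtains C :: "nat \<Rightarrow> 'a::metric_space set" where "A \<subseteq> (\<Union>i. C i)" "\<And>i. bounded (C i)"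
    "\<And>i. diameter (C i) \<le> \<delta>" "(\<Sum>i. hausdorff_cost d (C i)) < c"
  using assms unfolding hausdorff_pre_def INF_less_iff by auto

lemma hausdorff_pre_mono: "A \<subseteq> B \<Longrightarrow> hausdorff_pre \<delta> d A \<le> hausdorff_pre \<delta> d B"
  unfolding hausdorff_pre_def by (rule INF_superset_mono) auto

lemma hausdorff_pre_antimono: "\<delta> \<le> \<delta>' \<Longrightarrow> hausdorff_pre \<delta>' d A \<le> hausdorff_pre \<delta> d A"
  unfolding hausdorff_pre_def by (rule INF_superset_mono) (auto intro: order_trans)

lemma hausdorff_pre_le_measure: "0 < \<delta> \<Longrightarrow> hausdorff_pre \<delta> d A \<le> hausdorff_measure d A"
  unfolding hausdorff_measure_def by (rule SUP_upper) simp

lemma hausdorff_measure_least: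
  "(\<And>\<delta>. 0 < \<delta> \<Longrightarrow> hausdorff_pre \<delta> d A \<le> c) \<Longrightarrow> hausdorff_measure d A \<le> c"
  unfolding hausdorff_measure_def by (rule SUP_least) simp

lemma hausdorff_measure_mono: "A \<subseteq> B \<Longrightarrow> hausdorff_measure d A \<le> hausdorff_measure d B"
  by (meson hausdorff_measure_least hausdorff_pre_le_measure hausdorff_pre_mono order_trans)

lemma hausdorff_pre_countable_subadditive:
  "hausdorff_pre \<delta> d (\<Union>i. A i) \<le> (\<Sum>i. hausdorff_pre \<delta> d (A i :: 'a::metric_space set))"
proof (rule ennreal_le_epsilon)
  fix e :: real assume e: "0 < e" "(\<Sum>n. hausdorff_pre \<delta> d (A n)) < top"
  then have "hausdorff_pre \<delta> d (A n) < hausdorff_pre \<delta> d (A n) + e * (1/2)^Suc n" for n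
    by (auto simp add: less_top dest!: ennreal_suminf_lessD)
  then have "\<exists>C. A n \<subseteq> (\<Union>i. C i) \<and> (\<forall>i. bounded (C i)) \<and> (\<forall>i. diameter (C i) \<le> \<delta>) \<and>
      (\<Sum>i. hausdorff_cost d (C i)) < hausdorff_pre \<delta> d (A n) + e * (1/2)^Suc n" for n
    by (metis hausdorff_pre_close)
  then obtain C where C: "\<And>n. A n \<subseteq> (\<Union>i. C n i)" "\<And>n i. bounded (C n i)" "\<And>n i. diameter (C n i) \<le> \<delta>"
      "\<And>n. (\<Sum>i. hausdorff_cost d (C n i)) < hausdorff_pre \<delta> d (A n) + e * (1/2)^Suc n"
    by metis
  define D where "D k = case_prod C (prod_decode k)" for k
  have DC: "C n i = D (prod_encode (n, i))" for n i by (simp add: D_def)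
  have "(\<Union>n. A n) \<subseteq> (\<Union>k. D k)" 
  proof
    fix x assume "x \<in> (\<Union>n. A n)"
    then obtain n i where "x \<in> C n i" using C(1) by blast
    then show "x \<in> (\<Union>k. D k)" unfolding DC by blast
  qed
  then have "hausdorff_pre \<delta> d (\<Union>i. A i) \<le> (\<Sum>k. hausdorff_cost d (D k))"
    using C(2,3) by (intro hausdorff_pre_le) (auto simp: D_def split: prod.splits)
  also have "\<dots> = (\<Sum>k. case_prod (\<lambda>n i. hausdorff_cost d (C n i)) (prod_decode k))"
    by (simp add: D_def prod.case_distrib split_def)
  also have "\<dots> = (\<Sum>n. \<Sum>i. hausdorff_cost d (C n i))"
    using suminf_ennreal_2dimen[of "\<lambda>n. \<Sum>i. hausdorff_cost d (C n i)" "\<lambda>(n,i). hausdorff_cost d (C n i)"]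
    by (simp add: comp_def)
  also have "\<dots> \<le> (\<Sum>n. hausdorff_pre \<delta> d (A n) + e * (1/2) ^ Suc n)"
    using C(4) by (intro suminf_le) (auto intro: less_imp_le)
  also have "... = (\<Sum>n. hausdorff_pre \<delta> d (A n)) + (\<Sum>n. ennreal e * ennreal ((1/2) ^ Suc n))"
    using \<open>0 < e\<close> by (subst suminf_add[symmetric])
      (auto simp del: ennreal_suminf_cmult simp add: ennreal_mult[symmetric])
  also have "\<dots> = (\<Sum>n. hausdorff_pre \<delta> d (A n)) + e"
    unfolding ennreal_suminf_cmult
    by (subst suminf_ennreal_eq[OF zero_le_power power_half_series]) auto
  finally show "hausdorff_pre \<delta> d (\<Union>i. A i) \<le> (\<Sum>n. hausdorff_pre \<delta> d (A n)) + e" .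
qed

lemma hausdorff_measure_countable_subadditive:
  "hausdorff_measure d (\<Union>i. A i) \<le> (\<Sum>i. hausdorff_measure d (A i :: 'a::metric_space set))"
proof (rule hausdorff_measure_least)
  fix \<delta> :: real assume "0 < \<delta>"
  have "hausdorff_pre \<delta> d (\<Union>i. A i) \<le> (\<Sum>i. hausdorff_pre \<delta> d (A i))"
    by (rule hausdorff_pre_countable_subadditive)
  also have "\<dots> \<le> (\<Sum>i. hausdorff_measure d (A i))"
    using \<open>0 < \<delta>\<close> by (intro suminf_le hausdorff_pre_le_measure) auto
  finally show "hausdorff_pre \<delta> d (\<Union>i. A i) \<le> (\<Sum>i. hausdorff_measure d (A i))" .
qed

lemma hausdorff_measure_empty [simp]: "hausdorff_measure d {} = 0"
proof -
  have "hausdorff_measure d ({} :: 'a set) \<le> 0"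
    by (rule hausdorff_measure_least, rule order_trans[OF hausdorff_pre_le[of _ "\<lambda>i. {}"]])
      (auto simp: hausdorff_cost_def)
  then show ?thesis by simp
qed

lemma dyadic_bracket:
  fixes D :: real
  assumes "0 < D" "D \<le> 1 / 2 ^ k"
  obtains j where "k \<le> j" "1 / 2 ^ Suc j < D" "D \<le> 1 / 2 ^ j"
proof -
  obtain n where "(1 / 2) ^ n < D" using real_arch_pow_inv[OF assms(1), of "1/2"] by auto
  then have ex: "\<exists>n. 1 / 2 ^ n < D" by (auto simp: power_one_over)
  define m where "m = (LEAST n. 1 / 2 ^ n < D)"
  have m: "1 / 2 ^ m < D" unfolding m_def by (rule LeastI_ex[OF ex])
  have "k < m"
  proof (rule ccontr)
    assume "\<not> k < m"
    then have "(1::real) / 2 ^ k \<le> 1 / 2 ^ m" by (simp add: divide_simps)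
    with m assms show False by linarith
  qed
  then obtain j where j: "m = Suc j" "k \<le> j" by (cases m) auto
  have "\<not> 1 / 2 ^ j < D" using not_less_Least[of j "\<lambda>n. 1 / 2 ^ n < D"] j(1) m_def by auto
  then show thesis using that[of j] j m by auto
qed

text \<open>The points at which \<open>E\<close> has density at most 2^-(d+1) at all dyadic scales
  from \<open>k\<close> on. The factor 2^-d pays for rounding a diameter up to a dyadic radius, and
  the remaining 1/2 is the loss that makes the set null.\<close>

definition thin :: "nat \<Rightarrow> 'a::metric_space set \<Rightarrow> nat \<Rightarrow> 'a set" where
  "thin d E k = {x \<in> E. \<forall>j\<ge>k. hausdorff_measure d (E \<inter> cball x (1 / 2 ^ j)) \<le> ennreal (1 / 2 ^ Suc d * (1 / 2 ^ j) ^ d)}"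

text \<open>If the density of \<open>E\<close> were at most half of what a cover costs, then an almost optimal
  cover would give \<open>H \<le> H / 2\<close>.\<close>

lemma hausdorff_measure_thin:
  fixes E :: "'a::metric_space set"
  assumes fin: "hausdorff_measure d E < \<infinity>"
  shows "hausdorff_measure d (thin d E k) = 0"
proof -
  let ?N = "thin d E k" and ?H = "hausdorff_measure d"
  have NE: "?N \<subseteq> E" by (auto simp: thin_def)
  have "?H ?N < \<infinity>" using hausdorff_measure_mono[OF NE, of d] fin by order
  then obtain h where h: "0 \<le> h" "?H ?N = ennreal h" by (cases "?H ?N") auto
  have "h \<le> 0 + e" if e: "e > 0" for e
  proof -
    have "hausdorff_pre (1 / 2 ^ k) d ?N < ennreal (h + e)"
      using hausdorff_pre_le_measure[of "1 / 2 ^ k" d ?N] h e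
      by (metis add_0 add_less_cancel_right ennreal_less_iff le_less_trans less_add_same_cancel1 zero_less_divide_1_iff zero_less_numeral zero_less_power)
    then obtain C where C: "?N \<subseteq> (\<Union>i. C i)" "\<And>i. bounded (C i)" "\<And>i. diameter (C i) \<le> 1 / 2 ^ k"
        "(\<Sum>i. hausdorff_cost d (C i)) < ennreal (h + e)"
      by (rule hausdorff_pre_close) blast
    have piece: "?H (?N \<inter> C i) \<le> ennreal (1 / 2) * hausdorff_cost d (C i)" for i
    proof (cases "?N \<inter> C i = {}")
      case False
      then obtain x where x: "x \<in> ?N" "x \<in> C i" by blast
      have sub: "?N \<inter> C i \<subseteq> E \<inter> cball x r" if "diameter (C i) \<le> r" for r
        using NE diameter_bounded_bound[OF C(2) x(2)] that by force
      have le: "?H (?N \<inter> C i) \<le> ennreal (1 / 2 ^ Suc d * (1 / 2 ^ j) ^ d)"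
        if "k \<le> j" "diameter (C i) \<le> 1 / 2 ^ j" for j
        using x(1) that hausdorff_measure_mono[OF sub[OF that(2)], of d]
        by (auto simp: thin_def intro: order_trans)
      have hc: "ennreal (1 / 2) * hausdorff_cost d (C i) = ennreal (1 / 2 * diameter (C i) ^ d)"
        using x(2) C(2)[of i] by (subst ennreal_mult) (auto simp: hausdorff_cost_def diameter_ge_0)
      show ?thesis
      proof (cases "diameter (C i) = 0")
        case D: False
        then have "0 < diameter (C i)" using C(2)[of i] diameter_ge_0 by (metis order_le_less)
        from dyadic_bracket[OF this C(3)] obtain j where
          j: "k \<le> j" "1 / 2 ^ Suc j < diameter (C i)" "diameter (C i) \<le> 1 / 2 ^ j" by metis
        have "(1 / 2 ^ Suc j) ^ d \<le> diameter (C i) ^ d" using j(2) by (intro power_mono) auto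
        moreover have "1 / 2 ^ Suc d * (1 / 2 ^ j) ^ d = 1 / 2 * ((1 / 2 ^ Suc j) ^ d :: real)"
          by (simp add: power_divide power_mult_distrib)
        ultimately have "1 / 2 ^ Suc d * (1 / 2 ^ j) ^ d \<le> 1 / 2 * diameter (C i) ^ d" by simp
        then show ?thesis unfolding hc using le[OF j(1,3)] ennreal_leI order_trans by blast
      next
        \<comment> \<open>Diameter 0 has no dyadic bracket. For d = 0 the cost is 1, and scale
          \<open>k\<close> alone gives the bound 1/2; for d > 0 the cost is 0, and the density
          bounds at ever finer scales force measure 0.\<close>
        case D: True
        show ?thesis
        proof (cases "d = 0")
          case True
          then show ?thesis unfolding hc using le[of k] C(3)[of i] by simp
        next
          case False
          have eps: "?H (?N \<inter> C i) \<le> 0 + ennreal r" if r: "0 < r" for r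
          proof -
            obtain n where n: "(1 / 2 :: real) ^ n < r" using real_arch_pow_inv[OF r, of "1/2"] by auto
            define j where "j = max k n"
            have "1 / 2 ^ Suc d \<le> (1 :: real)" using one_le_power[of "2 :: real" "Suc d"] by simp
            moreover have "(1 / 2 ^ j :: real) ^ d \<le> (1 / 2 ^ j) ^ 1"
              using False by (intro power_decreasing) auto
            ultimately have "1 / 2 ^ Suc d * (1 / 2 ^ j) ^ d \<le> 1 * (1 / 2 ^ j :: real) ^ 1"
              by (intro mult_mono) auto
            also have "\<dots> \<le> (1 / 2) ^ n" by (simp add: j_def power_one_over divide_simps)
            finally have "1 / 2 ^ Suc d * (1 / 2 ^ j) ^ d \<le> r" using n by linarith
            then show ?thesis using le[of j] D by (simp add: j_def) (meson ennreal_leI order_trans)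
          qed
          have "?H (?N \<inter> C i) \<le> 0"
          proof (rule ennreal_le_epsilon)
            fix r :: real assume "0 < r"
            then show "?H (?N \<inter> C i) \<le> 0 + ennreal r" by (rule eps)
          qed
          then show ?thesis by simp
        qed
      qed
    qed simp
    have "?H ?N = ?H (\<Union>i. ?N \<inter> C i)" using C(1) by (intro arg_cong[where f = ?H]) auto
    also have "\<dots> \<le> (\<Sum>i. ?H (?N \<inter> C i))" by (rule hausdorff_measure_countable_subadditive)
    also have "\<dots> \<le> (\<Sum>i. ennreal (1 / 2) * hausdorff_cost d (C i))" by (intro suminf_le piece) auto
    also have "\<dots> = ennreal (1 / 2) * (\<Sum>i. hausdorff_cost d (C i))" by simp
    also have "\<dots> \<le> ennreal (1 / 2) * ennreal (h + e)" using C(4) by (intro mult_left_mono) auto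
    also have "\<dots> = ennreal (1 / 2 * (h + e))" using h(1) e by (intro ennreal_mult[symmetric]) auto
    finally have "h \<le> 1 / 2 * (h + e)" using h e by simp
    then show ?thesis by simp
  qed
  then have "h \<le> 0" by (rule field_le_epsilon)
  with h show ?thesis by simp
qed

subsection \<open>Discrete potentials\<close>

text \<open>A list of triples \<open>(a, y, r)\<close> stands for the sum of the kernels \<open>a * f (dist x y\<^sup>2 + r\<^sup>2)\<close>.\<close>

type_synonym 'a charges = "(real \<times> 'a \<times> real) list"

definition potential :: "(real \<Rightarrow> real) \<Rightarrow> 'a::metric_space charges \<Rightarrow> 'a \<Rightarrow> real" where
  "potential f X x = (\<Sum>(a, y, r)\<leftarrow>X. a * f ((dist x y)\<^sup>2 + r\<^sup>2))"

definition total_charge :: "'a charges \<Rightarrow> real" where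
  "total_charge X = (\<Sum>(a, y, r)\<leftarrow>X. a)"

definition charges_on :: "'a set \<Rightarrow> 'a charges \<Rightarrow> bool" where
  "charges_on K X \<longleftrightarrow> (\<forall>(a, y, r)\<in>set X. 0 \<le> a \<and> y \<in> K \<and> 0 < r \<and> r \<le> 1)"

lemma potential_append [simp]: "potential f (X @ Y) x = potential f X x + potential f Y x"
  by (simp add: potential_def)

lemma total_charge_append [simp]: "total_charge (X @ Y) = total_charge X + total_charge Y"
  by (simp add: total_charge_def)

lemma charges_on_append [simp]: "charges_on K (X @ Y) \<longleftrightarrow> charges_on K X \<and> charges_on K Y"
  unfolding charges_on_def set_append ball_Un ..

text \<open>The model is f(r^2) = r^-s, or log(1/r) when s = 0; stating \<open>growth\<close> for
  one dyadic step treats both cases alike. \<open>L\<close> bounds the arguments that occur for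
  points of \<open>K\<close> and radii up to 1; beyond it a logarithmic kernel may be negative. The
  value 64 is 8^2, the argument at which the dyadic sums start.\<close>

locale kernel =
  fixes f :: "real \<Rightarrow> real" and s :: nat and c L :: real and K :: "'a::metric_space set"
  assumes c: "0 < c" and L: "64 \<le> L"
    and anti: "\<And>t u. 0 < t \<Longrightarrow> t \<le> u \<Longrightarrow> f u \<le> f t"
    and nonneg: "\<And>t. 0 < t \<Longrightarrow> t \<le> L \<Longrightarrow> 0 \<le> f t"
    and growth: "\<And>r. 0 < r \<Longrightarrow> c / r ^ s \<le> f (r\<^sup>2) - f ((2 * r)\<^sup>2)"
    and K: "\<And>x y. x \<in> K \<Longrightarrow> y \<in> K \<Longrightarrow> (dist x y)\<^sup>2 + 1 \<le> L"
begin

lemma lower: "0 < r \<Longrightarrow> 2 * r \<le> 8 \<Longrightarrow> c / r ^ s \<le> f (r\<^sup>2)"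
proof -
  assume r: "0 < r" "2 * r \<le> 8"
  have "(2 * r)\<^sup>2 \<le> 8\<^sup>2" using r by (intro power_mono) auto
  then show ?thesis using growth[OF r(1)] nonneg[of "(2 * r)\<^sup>2"] r L by simp
qed

lemma kernel_nonneg: "x \<in> K \<Longrightarrow> y \<in> K \<Longrightarrow> 0 < r \<Longrightarrow> r \<le> 1 \<Longrightarrow> 0 \<le> f ((dist x y)\<^sup>2 + r\<^sup>2)"
proof (rule nonneg)
  assume "x \<in> K" "y \<in> K" "0 < r" "r \<le> 1"
  then show "0 < (dist x y)\<^sup>2 + r\<^sup>2" "(dist x y)\<^sup>2 + r\<^sup>2 \<le> L"
    using K[of x y] power_le_one[of r 2] by (auto simp: add_nonneg_pos)
qed

lemma potential_nonneg: "charges_on K X \<Longrightarrow> x \<in> K \<Longrightarrow> 0 \<le> potential f X x"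
  unfolding potential_def charges_on_def
  by (intro sum_list_nonneg) (auto intro!: mult_nonneg_nonneg kernel_nonneg)

lemma dyadic_lower: "c * (2 ^ s) ^ j / 4 ^ s \<le> f ((4 / 2 ^ j)\<^sup>2) - f ((8 / 2 ^ j)\<^sup>2)"
  using growth[of "4 / 2 ^ j"] by (simp add: power_divide mult.commute flip: power_mult)

lemma dyadic_sum: "(\<Sum>j\<le>m. c * (2 ^ s) ^ j / 4 ^ s) \<le> f ((4 / 2 ^ m)\<^sup>2)"
proof (induction m)
  case 0
  then show ?case using dyadic_lower[of 0] nonneg[of "8\<^sup>2"] L by simp
next
  case (Suc m)
  then show ?case using dyadic_lower[of "Suc m"] by simp
qed

text \<open>Only the finest scale m in \<open>M\<close> with \<rho> \<le> 3/2^m matters: the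
  argument is at most (9 + 1)/4^m, hence at most (4/2^m)^2, and by \<open>dyadic_sum\<close> the
  value of f there already exceeds the weights of all scales up to m. So a single kernel collects a
  contribution from every scale at which it is close.\<close>

lemma kernel_lower:
  assumes "finite M" "\<And>j. j \<in> M \<Longrightarrow> j \<le> k" "0 \<le> \<rho>" "\<rho>\<^sup>2 + 1 \<le> L"
  shows "(\<Sum>j | j \<in> M \<and> \<rho> \<le> 3 / 2 ^ j. c * (2 ^ s) ^ j / 4 ^ s) \<le> f (\<rho>\<^sup>2 + (1 / 2 ^ k)\<^sup>2)"
proof (cases "{j \<in> M. \<rho> \<le> 3 / 2 ^ j} = {}")
  case True
  have "(1 / 2 ^ k :: real)\<^sup>2 \<le> 1" by (intro power_le_one) auto
  then have "0 \<le> f (\<rho>\<^sup>2 + (1 / 2 ^ k)\<^sup>2)"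
    using assms by (intro nonneg) (auto simp: add_nonneg_pos)
  then show ?thesis unfolding True by simp
next
  case False
  define m where "m = Max {j \<in> M. \<rho> \<le> 3 / 2 ^ j}"
  have m: "m \<in> M" "\<rho> \<le> 3 / 2 ^ m"
    using Max_in[OF _ False] assms(1) by (auto simp: m_def)
  have "(\<Sum>j | j \<in> M \<and> \<rho> \<le> 3 / 2 ^ j. c * (2 ^ s) ^ j / 4 ^ s) \<le> (\<Sum>j\<le>m. c * (2 ^ s) ^ j / 4 ^ s)"
    using assms(1) c by (intro sum_mono2) (auto simp: m_def)
  also have "\<dots> \<le> f ((4 / 2 ^ m)\<^sup>2)" by (rule dyadic_sum)
  also have "\<dots> \<le> f (\<rho>\<^sup>2 + (1 / 2 ^ k)\<^sup>2)"
  proof (rule anti)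
    have "\<rho>\<^sup>2 \<le> (3 / 2 ^ m)\<^sup>2" using m assms by (intro power_mono) auto
    moreover have "(1 / 2 ^ k :: real)\<^sup>2 \<le> (1 / 2 ^ m)\<^sup>2"
      using assms(2)[OF m(1)] by (intro power_mono) (auto simp: divide_simps)
    moreover have "(3 / 2 ^ m)\<^sup>2 + (1 / 2 ^ m)\<^sup>2 \<le> ((4 / 2 ^ m)\<^sup>2 :: real)"
      by (simp add: power_divide divide_simps)
    ultimately show "\<rho>\<^sup>2 + (1 / 2 ^ k)\<^sup>2 \<le> (4 / 2 ^ m)\<^sup>2" by linarith
  qed (simp add: add_nonneg_pos)
  finally show ?thesis .
qed

text \<open>A sequence of charges and not a single one, because a charge is a finite list while a
  countable union calls for infinitely many lists. Asking for the lower bound on a neighbourhood and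
  for all late \<open>k\<close> lets the notion survive a diagonal choice and, at the end, a
  compactness argument.\<close>

definition polar :: "'a set \<Rightarrow> bool" where
  "polar A \<longleftrightarrow> (\<forall>e>0. \<exists>X. (\<forall>k::nat. charges_on K (X k) \<and> total_charge (X k) \<le> e) \<and>
     (\<forall>x\<in>A. \<exists>V. open V \<and> x \<in> V \<and> (\<exists>k0. \<forall>k\<ge>k0. \<forall>z\<in>V \<inter> K. 1 \<le> potential f (X k) z)))"

lemma polar_UN:
  fixes A :: "nat \<Rightarrow> 'a set"
  assumes "\<And>i. polar (A i)"
  shows "polar (\<Union>i. A i)"
  unfolding polar_def
proof (intro allI impI)
  fix e :: real assume e: "0 < e"
  let ?P = "\<lambda>i X. (\<forall>k::nat. charges_on K (X k) \<and> total_charge (X k) \<le> e * (1/2) ^ Suc i) \<and>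
     (\<forall>x\<in>A i. \<exists>V. open V \<and> x \<in> V \<and> (\<exists>k0. \<forall>k\<ge>k0. \<forall>z\<in>V \<inter> K. 1 \<le> potential f (X k) z))"
  have "\<exists>X. ?P i X" for i
  proof -
    have "0 < e * (1/2) ^ Suc i" using e by simp
    with assms[of i] show ?thesis unfolding polar_def by blast
  qed
  then have "\<exists>X. \<forall>i. ?P i (X i)" by (intro choice allI)
  then obtain X :: "nat \<Rightarrow> nat \<Rightarrow> 'a charges" where XP: "\<forall>i. ?P i (X i)" by blast
  have X: "charges_on K (X i k)" "total_charge (X i k) \<le> e * (1/2) ^ Suc i"
    "x \<in> A i \<Longrightarrow> \<exists>V. open V \<and> x \<in> V \<and> (\<exists>k0. \<forall>k\<ge>k0. \<forall>z\<in>V \<inter> K. 1 \<le> potential f (X i k) z)" for i k x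
    using XP by blast+
  define Y where "Y n k = concat (map (\<lambda>i. X i k) [0..<n])" for n k :: nat
  have Ys: "Y (Suc n) k = Y n k @ X n k" for n k by (simp add: Y_def)
  have Y0: "Y 0 k = []" for k by (simp add: Y_def)
  have on: "charges_on K (Y n k)" for n k
    by (induction n) (auto simp: Ys Y0 X(1) charges_on_def[of _ "[]"])
  have "total_charge (Y n k) \<le> e * (1 - (1/2) ^ n)" for n k
  proof (induction n)
    case (Suc n)
    then show ?case using X(2)[of n k] by (simp add: Ys algebra_simps)
  qed (simp add: Y0 total_charge_def)
  moreover have "e * (1 - (1/2) ^ n) \<le> e" for n using e by (simp add: algebra_simps)
  ultimately have tot: "total_charge (Y n k) \<le> e" for n k using order_trans by blast
  have pot: "potential f (X i k) z \<le> potential f (Y n k) z" if "i < n" "z \<in> K" for i n k z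
    using that
  proof (induction n)
    case (Suc n)
    then show ?case
      using potential_nonneg[OF X(1) Suc(3), of n k] potential_nonneg[OF on Suc(3), of n k]
      by (cases "i = n") (auto simp: Ys)
  qed simp
  show "\<exists>X. (\<forall>k::nat. charges_on K (X k) \<and> total_charge (X k) \<le> e) \<and>
     (\<forall>x\<in>\<Union>i. A i. \<exists>V. open V \<and> x \<in> V \<and> (\<exists>k0. \<forall>k\<ge>k0. \<forall>z\<in>V \<inter> K. 1 \<le> potential f (X k) z))"
  \<comment> \<open>Diagonal choice: the \<open>k\<close>-th charge uses the first
    \<open>Suc k\<close> sets, so set \<open>i\<close> takes part as soon as k \<ge> i. Further
    lists do no harm, since potentials are nonnegative on \<open>K\<close>.\<close>
  proof (intro exI[of _ "\<lambda>k. Y (Suc k) k"] conjI allI ballI)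
    fix x assume "x \<in> (\<Union>i. A i)"
    then obtain i where "x \<in> A i" by blast
    from X(3)[OF this] obtain V k0 where V: "open V" "x \<in> V"
      "\<And>k z. k \<ge> k0 \<Longrightarrow> z \<in> V \<inter> K \<Longrightarrow> 1 \<le> potential f (X i k) z" by metis
    have "1 \<le> potential f (Y (Suc k) k) z" if "k \<ge> max k0 i" "z \<in> V \<inter> K" for k z
    proof -
      have "1 \<le> potential f (X i k) z" using V(3) that by auto
      also have "\<dots> \<le> potential f (Y (Suc k) k) z" using that by (intro pot) auto
      finally show ?thesis .
    qed
    with V(1,2) show "\<exists>V. open V \<and> x \<in> V \<and> (\<exists>k0. \<forall>k\<ge>k0. \<forall>z\<in>V \<inter> K. 1 \<le> potential f (Y (Suc k) k) z)"
      by blast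
  qed (use on tot in auto)
qed

lemma polar_subset:
  assumes "polar B" "A \<subseteq> B"
  shows "polar A"
  unfolding polar_def
proof (intro allI impI)
  let ?P = "\<lambda>e A X. (\<forall>k::nat. charges_on K (X k) \<and> total_charge (X k) \<le> e) \<and>
     (\<forall>x\<in>A. \<exists>V. open V \<and> x \<in> V \<and> (\<exists>k0. \<forall>k\<ge>k0. \<forall>z\<in>V \<inter> K. 1 \<le> potential f (X k) z))"
  fix e :: real assume "0 < e"
  from assms(1)[unfolded polar_def, rule_format, OF this]
  obtain X where "?P e B X" by (rule exE) (rule that)
  then have "?P e A X" using assms(2) by (auto simp: subset_iff)
  then show "\<exists>X. ?P e A X" by (intro exI[of _ X])
qed

lemma polar_compact:
  assumes "polar K" "compact K" "0 < e"
  obtains X where "charges_on K X" "total_charge X \<le> e" "\<And>x. x \<in> K \<Longrightarrow> 1 \<le> potential f X x"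
proof -
  obtain X where X: "\<And>k::nat. charges_on K (X k)" "\<And>k. total_charge (X k) \<le> e"
    "\<And>x. x \<in> K \<Longrightarrow> \<exists>V. open V \<and> x \<in> V \<and> (\<exists>k0. \<forall>k\<ge>k0. \<forall>z\<in>V \<inter> K. 1 \<le> potential f (X k) z)"
    using assms(1,3) unfolding polar_def by metis
  obtain V k0 where V: "\<And>x. x \<in> K \<Longrightarrow> open (V x)" "\<And>x. x \<in> K \<Longrightarrow> x \<in> V x"
    "\<And>x k z. x \<in> K \<Longrightarrow> k \<ge> k0 x \<Longrightarrow> z \<in> V x \<inter> K \<Longrightarrow> 1 \<le> potential f (X k) z"
    using X(3) by metis
  have "K \<subseteq> (\<Union>x\<in>K. V x)" using V(2) by blast
  then obtain F where F: "F \<subseteq> K" "finite F" "K \<subseteq> (\<Union>x\<in>F. V x)"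
    using compactE_image[OF assms(2), of K V] V(1) by metis
  obtain k where k: "\<And>x. x \<in> F \<Longrightarrow> k0 x \<le> k"
    using finite_nat_set_iff_bounded_le[of "k0 ` F"] F(2) by auto
  show thesis
  proof (rule that[of "X k"])
    fix z assume z: "z \<in> K"
    then obtain x where "x \<in> F" "z \<in> V x" using F(3) by auto
    then show "1 \<le> potential f (X k) z" using V(3)[of x k z] F(1) k z by auto
  qed (use X in auto)
qed

lemma potential_filter_map:
  "potential f (map g (filter P [0..<n])) z = (\<Sum>i | i < n \<and> P i. case g i of (a, y, r) \<Rightarrow> a * f ((dist z y)\<^sup>2 + r\<^sup>2))"
  unfolding potential_def map_map comp_def
  by (subst sum_list_distinct_conv_sum_set) (auto intro!: sum.cong)

lemma total_charge_filter_map: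
  "total_charge (map g (filter P [0..<n])) = (\<Sum>i | i < n \<and> P i. case g i of (a, y, r) \<Rightarrow> a)"
  unfolding total_charge_def map_map comp_def
  by (subst sum_list_distinct_conv_sum_set) (auto intro!: sum.cong)

lemma cost_sum_le:
  assumes "\<And>i. bounded (C i)" "(\<Sum>i. hausdorff_cost d (C i)) < ennreal m" "finite F"
  shows "(\<Sum>i\<in>F. cost d (C i)) \<le> m"
proof -
  have "ennreal (\<Sum>i\<in>F. cost d (C i)) = (\<Sum>i\<in>F. hausdorff_cost d (C i))"
    using assms(1) by (simp add: hausdorff_cost_eq sum_ennreal cost_nonneg)
  also have "\<dots> \<le> (\<Sum>i. hausdorff_cost d (C i))" using assms(3) by (intro sum_le_suminf) auto
  also have "\<dots> < ennreal m" by fact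
  finally have "(\<Sum>i\<in>F. cost d (C i)) < m"
    using assms(1) by (subst (asm) ennreal_less_iff) (auto intro!: sum_nonneg cost_nonneg)
  then show ?thesis by simp
qed

lemma polar_null:
  assumes "A \<subseteq> K" "hausdorff_measure s A = 0"
  shows "polar A"
  unfolding polar_def
proof (intro allI impI)
  fix e :: real assume e: "0 < e"
  \<comment> \<open>Chosen so that a charge \<kappa> r^s with r \<le> 1 has potential at least 1
    within distance 2 r of its centre, where the argument of the kernel is at most (3 r)^2.\<close>
  define \<kappa> where "\<kappa> = 3 ^ s / c"
  have \<kappa>: "\<kappa> > 0" using c by (simp add: \<kappa>_def)
  \<comment> \<open>Half of the budget pays for the cover, half for enlarging the radii.\<close>
  define e1 where "e1 = e / (2 * \<kappa>)"
  have e1: "e1 > 0" using e \<kappa> by (simp add: e1_def)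
  have "hausdorff_pre (1/2) s A < ennreal e1"
    using hausdorff_pre_le_measure[of "1/2" s A] assms(2) e1 by (simp add: le_less_trans)
  then obtain C where C: "A \<subseteq> (\<Union>i. C i)" "\<And>i. bounded (C i)" "\<And>i. diameter (C i) \<le> 1/2"
      "(\<Sum>i. hausdorff_cost s (C i)) < ennreal e1"
    by (rule hausdorff_pre_close) blast
  \<comment> \<open>The radius slightly exceeds the diameter: it must be positive even for one-point
    sets, and the lower bound has to hold on a ball around each covered point. Continuity of r^s
    keeps the extra cost below e1 / 2^(i+1).\<close>
  have "\<exists>y r. C i \<inter> A \<noteq> {} \<longrightarrow> y \<in> C i \<inter> A \<and> diameter (C i) \<le> r \<and> 0 < r \<and> r \<le> 1 \<and>
      r ^ s \<le> cost s (C i) + e1 * (1/2) ^ Suc i" for i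
  proof (cases "C i \<inter> A = {}")
    case False
    then obtain y where y: "y \<in> C i \<inter> A" by blast
    let ?D = "diameter (C i)"
    have D: "0 \<le> ?D" using C(2) by (rule diameter_ge_0)
    have "((\<lambda>r. r ^ s) \<longlongrightarrow> ?D ^ s) (at_right ?D)" by (intro tendsto_intros)
    moreover have "?D ^ s < cost s (C i) + e1 * (1/2) ^ Suc i"
      using y e1 by (auto simp: cost_def)
    ultimately have "eventually (\<lambda>r. r ^ s < cost s (C i) + e1 * (1/2) ^ Suc i) (at_right ?D)"
      by (rule order_tendstoD)
    moreover have "eventually (\<lambda>r. ?D < r \<and> r < 1) (at_right ?D)"
      using eventually_at_right_real[of ?D 1] C(3)[of i] by (auto elim: eventually_mono)
    ultimately have "eventually (\<lambda>r. r ^ s < cost s (C i) + e1 * (1/2) ^ Suc i \<and> ?D < r \<and> r < 1) (at_right ?D)"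
      by (rule eventually_conj)
    then obtain r where "r ^ s < cost s (C i) + e1 * (1/2) ^ Suc i" "?D < r" "r < 1"
      using eventually_happens'[OF trivial_limit_at_right_real] by blast
    then show ?thesis using y D by (intro exI[of _ y] exI[of _ r]) auto
  qed auto
  then obtain y r where yr: "\<And>i. C i \<inter> A \<noteq> {} \<Longrightarrow> y i \<in> C i \<inter> A \<and> diameter (C i) \<le> r i \<and> 0 < r i \<and> r i \<le> 1 \<and>
      r i ^ s \<le> cost s (C i) + e1 * (1/2) ^ Suc i" by metis
  define X where "X k = map (\<lambda>i. (\<kappa> * r i ^ s, y i, r i)) (filter (\<lambda>i. C i \<inter> A \<noteq> {}) [0..<k])" for k
  have on: "charges_on K (X k)" for k
    using yr \<kappa> assms(1) unfolding charges_on_def X_def by (auto simp: less_imp_le)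
  have "total_charge (X k) \<le> e" for k
  proof -
    have "total_charge (X k) = (\<Sum>i | i < k \<and> C i \<inter> A \<noteq> {}. \<kappa> * r i ^ s)"
      by (simp add: X_def total_charge_filter_map)
    also have "\<dots> \<le> (\<Sum>i | i < k \<and> C i \<inter> A \<noteq> {}. \<kappa> * (cost s (C i) + e1 * (1/2) ^ Suc i))"
      using yr \<kappa> by (intro sum_mono mult_left_mono) (auto simp: less_imp_le)
    also have "\<dots> \<le> (\<Sum>i<k. \<kappa> * (cost s (C i) + e1 * (1/2) ^ Suc i))"
      using \<kappa> e1 C(2) by (intro sum_mono2) (auto intro!: mult_nonneg_nonneg add_nonneg_nonneg cost_nonneg simp: less_imp_le)
    also have "\<dots> = \<kappa> * ((\<Sum>i<k. cost s (C i)) + e1 * (\<Sum>i<k. (1/2) ^ Suc i))"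
      by (simp add: sum_distrib_left sum.distrib distrib_left mult.assoc)
    also have "(\<Sum>i<k. (1/2::real) ^ Suc i) = 1 - (1/2) ^ k"
      by (induction k) auto
    also have "\<kappa> * ((\<Sum>i<k. cost s (C i)) + e1 * (1 - (1/2) ^ k)) \<le> \<kappa> * (e1 + e1 * 1)"
      using \<kappa> e1 cost_sum_le[OF C(2,4), of "{..<k}"] by (intro mult_left_mono add_mono) auto
    also have "\<dots> = e" using \<kappa> by (simp add: e1_def)
    finally show ?thesis .
  qed
  moreover have "\<exists>V. open V \<and> x \<in> V \<and> (\<exists>k0. \<forall>k\<ge>k0. \<forall>z\<in>V \<inter> K. 1 \<le> potential f (X k) z)" if x: "x \<in> A" for x
  proof -
    obtain i where i: "x \<in> C i" using C(1) x by auto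
    then have ne: "C i \<inter> A \<noteq> {}" using x by auto
    note yi = yr[OF ne]
    have "1 \<le> potential f (X k) z" if k: "Suc i \<le> k" and z: "z \<in> ball x (r i) \<inter> K" for k z
    proof -
      have "dist z (y i) \<le> dist x z + dist x (y i)" by (metis dist_commute dist_triangle2 add.commute)
      also have "\<dots> \<le> r i + r i" using z yi diameter_bounded_bound[OF C(2) i, of "y i"] by auto
      finally have "(dist z (y i))\<^sup>2 \<le> (2 * r i)\<^sup>2" by (intro power_mono) auto
      then have le: "(dist z (y i))\<^sup>2 + (r i)\<^sup>2 \<le> (3 * r i)\<^sup>2"
        by (simp add: power_mult_distrib) (smt (verit) zero_le_power2)
      have "1 = \<kappa> * r i ^ s * (c / (3 * r i) ^ s)"
        using yi c by (simp add: \<kappa>_def power_mult_distrib)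
      also have "\<dots> \<le> \<kappa> * r i ^ s * f ((3 * r i)\<^sup>2)"
        using yi \<kappa> by (intro mult_left_mono lower) auto
      also have "\<dots> \<le> \<kappa> * r i ^ s * f ((dist z (y i))\<^sup>2 + (r i)\<^sup>2)"
        using yi \<kappa> le by (intro mult_left_mono anti) (auto simp: add_nonneg_pos)
      also have "\<dots> \<le> potential f (X k) z"
        unfolding X_def potential_filter_map prod.case
      proof (rule member_le_sum)
        show "i \<in> {i. i < k \<and> C i \<inter> A \<noteq> {}}" using k ne by auto
        fix j assume "j \<in> {i. i < k \<and> C i \<inter> A \<noteq> {}} - {i}"
        then have "y j \<in> K \<and> 0 < r j \<and> r j \<le> 1" using yr[of j] assms(1) by auto
        then show "0 \<le> \<kappa> * r j ^ s * f ((dist z (y j))\<^sup>2 + (r j)\<^sup>2)"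
          using z \<kappa> by (intro mult_nonneg_nonneg kernel_nonneg) auto
      qed auto
      finally show ?thesis .
    qed
    then show ?thesis using yi by (intro exI[of _ "ball x (r i)"] conjI exI[of _ "Suc i"]) auto
  qed
  ultimately show "\<exists>X. (\<forall>k::nat. charges_on K (X k) \<and> total_charge (X k) \<le> e) \<and>
     (\<forall>x\<in>A. \<exists>V. open V \<and> x \<in> V \<and> (\<exists>k0. \<forall>k\<ge>k0. \<forall>z\<in>V \<inter> K. 1 \<le> potential f (X k) z))"
    using on by (intro exI[of _ X]) auto
qed

text \<open>At a point where \<open>E\<close> is not thin, the weights of an almost optimal cover at scale \<open>2^-k\<close>
  charge arbitrarily many dyadic balls proportionally to \<open>2^-js\<close>, and the potential adds these
  contributions up.\<close>

lemma polar_thick: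
  assumes "E \<subseteq> K" and fin: "hausdorff_measure s E < \<infinity>"
  shows "polar (E - (\<Union>k. thin s E k))"
  unfolding polar_def
proof (intro allI impI)
  fix e :: real assume e: "0 < e"
  let ?H = "hausdorff_measure s"
  obtain h where h: "0 \<le> h" "?H E = ennreal h" using fin by (cases "?H E") auto
  \<comment> \<open>A number above the measure, so that at each scale some cover costs less than
    \<open>m\<close>.\<close>
  define m where "m = h + 1"
  have m: "0 < m" using h by (simp add: m_def)
  have "\<exists>C. E \<subseteq> (\<Union>i. C i) \<and> (\<forall>i. bounded (C i)) \<and> (\<forall>i. diameter (C i) \<le> 1 / 2 ^ k) \<and>
      (\<Sum>i. hausdorff_cost s (C i)) < ennreal m" for k :: nat
  proof -
    have "hausdorff_pre (1 / 2 ^ k) s E \<le> ennreal h"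
      using hausdorff_pre_le_measure[of "1 / 2 ^ k" s E] h by simp
    also have "\<dots> < ennreal m" using h by (simp add: m_def ennreal_less_iff)
    finally show ?thesis by (metis hausdorff_pre_close)
  qed
  then obtain C where C: "\<And>k::nat. E \<subseteq> (\<Union>i. C k i)" "\<And>k i. bounded (C k i)"
    "\<And>k i. diameter (C k i) \<le> 1 / 2 ^ k" "\<And>k. (\<Sum>i. hausdorff_cost s (C k i)) < ennreal m"
    by metis
  have cn: "0 \<le> cost s (C k i)" for k i using C(2) by (rule cost_nonneg)
  have sm: "summable (\<lambda>i. cost s (C k i))" for k
    using cost_sum_le[OF C(2,4)] cn by (intro summableI_nonneg_bounded[of _ m]) auto
  \<comment> \<open>Charges are finite lists, so each cover is truncated where its tail costs less
    than 2^-k.\<close>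
  have "\<exists>n. (\<Sum>i. cost s (C k (i + n))) < 1 / 2 ^ k" for k
  proof -
    have "\<exists>N. \<forall>n\<ge>N. norm (\<Sum>i. cost s (C k (i + n))) < 1 / 2 ^ k"
      by (rule suminf_exist_split[OF _ sm]) simp
    then obtain N where "norm (\<Sum>i. cost s (C k (i + N))) < 1 / 2 ^ k" by blast
    then show ?thesis by (intro exI[of _ N]) (simp add: abs_less_iff)
  qed
  then obtain n where n: "\<And>k. (\<Sum>i. cost s (C k (i + n k))) < 1 / 2 ^ k" by metis
  \<comment> \<open>To cover \<open>E \<inter> B\<close> only sets meeting it are needed; the others
    among the first \<open>n k\<close> are replaced by the empty set, of cost 0. So up to 2^-k the
    listed sets near \<open>B\<close> carry the premeasure of \<open>E \<inter> B\<close>.\<close>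
  have tail: "hausdorff_pre (1 / 2 ^ k) s (E \<inter> B)
      \<le> ennreal ((\<Sum>i | i < n k \<and> C k i \<inter> B \<inter> E \<noteq> {}. cost s (C k i)) + 1 / 2 ^ k)" for k B
  proof -
    define D where "D i = (if i < n k \<and> C k i \<inter> B \<inter> E = {} then {} else C k i)" for i
    have "E \<inter> B \<subseteq> (\<Union>i. D i)"
    proof
      fix x assume x: "x \<in> E \<inter> B"
      then obtain i where "x \<in> C k i" using C(1)[of k] by auto
      then have "x \<in> D i" using x by (auto simp: D_def)
      then show "x \<in> (\<Union>i. D i)" by blast
    qed
    then have "hausdorff_pre (1 / 2 ^ k) s (E \<inter> B) \<le> (\<Sum>i. hausdorff_cost s (D i))"
      using C(2,3) by (intro hausdorff_pre_le) (auto simp: D_def)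
    also have "\<dots> = ennreal (\<Sum>i. cost s (D i))"
    proof -
      have dn: "0 \<le> cost s (D i)" "cost s (D i) \<le> cost s (C k i)" for i
        using cn by (auto simp: D_def cost_def[of _ "{}"])
      have "summable (\<lambda>i. cost s (D i))"
        by (rule summable_comparison_test_ev[OF _ sm[of k]]) (use dn in auto)
      then show ?thesis unfolding hausdorff_cost_eq using dn by (intro suminf_ennreal2)
    qed
    also have "(\<Sum>i. cost s (D i)) = (\<Sum>i. cost s (D (i + n k))) + (\<Sum>i<n k. cost s (D i))"
    proof (rule suminf_split_initial_segment)
      show "summable (\<lambda>i. cost s (D i))"
        by (rule summable_comparison_test_ev[OF _ sm[of k]]) (use cn in \<open>auto simp: D_def cost_def[of _ "{}"]\<close>)
    qed
    also have "(\<lambda>i. cost s (D (i + n k))) = (\<lambda>i. cost s (C k (i + n k)))" by (auto simp: D_def)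
    also have "(\<Sum>i<n k. cost s (D i)) = (\<Sum>i | i < n k \<and> C k i \<inter> B \<inter> E \<noteq> {}. cost s (C k i))"
      by (rule sum.mono_neutral_cong_right) (auto simp: D_def cost_def[of _ "{}"])
    finally have "hausdorff_pre (1 / 2 ^ k) s (E \<inter> B)
      \<le> ennreal ((\<Sum>i. cost s (C k (i + n k))) + (\<Sum>i | i < n k \<and> C k i \<inter> B \<inter> E \<noteq> {}. cost s (C k i)))" .
    also have "\<dots> \<le> ennreal ((\<Sum>i | i < n k \<and> C k i \<inter> B \<inter> E \<noteq> {}. cost s (C k i)) + 1 / 2 ^ k)"
      using n[of k] by (intro ennreal_leI) simp
    finally show ?thesis .
  qed
  define y where "y k i = (SOME y. y \<in> C k i \<inter> E)" for k i
  have y: "y k i \<in> C k i \<inter> E" if ne: "C k i \<inter> E \<noteq> {}" for k i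
  proof -
    obtain v where "v \<in> C k i \<inter> E" using ne by blast
    then show ?thesis unfolding y_def by (rule someI)
  qed
  \<comment> \<open>The costs of the cover serve as weights, scaled by e / m to a total of at most
    e, all with the common radius 2^-k.\<close>
  define X where "X k = map (\<lambda>i. (e / m * cost s (C k i), y k i, 1 / 2 ^ k :: real)) (filter (\<lambda>i. C k i \<inter> E \<noteq> {}) [0..<n k])" for k
  have em: "0 < e / m" using e m by simp
  have on: "charges_on K (X k)" for k
    using y assms(1) e m cn unfolding charges_on_def X_def
    by (auto intro!: mult_nonneg_nonneg divide_nonneg_pos simp: less_imp_le)
  have "total_charge (X k) \<le> e" for k
  proof -
    have "total_charge (X k) = e / m * (\<Sum>i | i < n k \<and> C k i \<inter> E \<noteq> {}. cost s (C k i))"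
      by (simp add: X_def total_charge_filter_map sum_distrib_left)
    also have "\<dots> \<le> e / m * m" using em cost_sum_le[OF C(2,4)] by (intro mult_left_mono) auto
    finally show ?thesis using m by simp
  qed
  moreover have "\<exists>V. open V \<and> x \<in> V \<and> (\<exists>k0. \<forall>k\<ge>k0. \<forall>z\<in>V \<inter> K. 1 \<le> potential f (X k) z)"
    if x: "x \<in> E - (\<Union>k. thin s E k)" for x
  proof -
    define t where "t = (1 / 2 ^ Suc s :: real)"
    have t: "0 < t" by (simp add: t_def)
    \<comment> \<open>The scales at which \<open>E\<close> is dense around \<open>x\<close>. There
      are infinitely many, since \<open>x\<close> lies in no \<open>thin s E k\<close>.\<close>
    define T where "T = {j. ennreal (t * (1 / 2 ^ j) ^ s) < ?H (E \<inter> cball x (1 / 2 ^ j))}"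
    have "\<exists>j\<ge>k. j \<in> T" for k
      using x by (auto simp: T_def t_def thin_def not_le)
    then have "infinite T" unfolding infinite_nat_iff_unbounded_le by blast
    \<comment> \<open>Gain per scale: the kernel weight c 2^(sj) / 4^s times the cost t 2^(-sj) / 2
      found near \<open>x\<close> does not depend on j. Hence q scales with \<kappa> q \<ge> 1
      suffice, however small e is.\<close>
    define \<kappa> where "\<kappa> = e / m * (c / 4 ^ s) * (t / 2)"
    have "0 < \<kappa>" unfolding \<kappa>_def by (intro mult_pos_pos divide_pos_pos e m c t) auto
    moreover obtain q :: nat where "1 / \<kappa> \<le> real q" using real_arch_simple by blast
    ultimately have "1 \<le> \<kappa> * real q" by (simp add: pos_divide_le_eq mult.commute)
    then have q: "1 \<le> e / m * (c / 4 ^ s) * (t / 2) * real q" by (simp only: \<kappa>_def)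
    obtain M where M: "M \<subseteq> T" "finite M" "card M = q"
      using infinite_arbitrarily_large[OF \<open>infinite T\<close>] by metis
    let ?Q = "\<lambda>j k. t / 2 * (1 / 2 ^ j) ^ s \<le> (\<Sum>i | i < n k \<and> C k i \<inter> cball x (1 / 2 ^ j) \<inter> E \<noteq> {}. cost s (C k i))"
    \<comment> \<open>For fine covers the premeasure of the piece of \<open>E\<close> in the ball
      exceeds t 2^(-js) as well, and the truncation error 2^-k is less than half of that.\<close>
    have "\<exists>k0. j \<le> k0 \<and> (\<forall>k\<ge>k0. ?Q j k)" if "j \<in> M" for j
    proof -
      have "ennreal (t * (1 / 2 ^ j) ^ s) < ?H (E \<inter> cball x (1 / 2 ^ j))" using that M by (auto simp: T_def)
      then obtain \<delta> where \<delta>: "0 < \<delta>" "ennreal (t * (1 / 2 ^ j) ^ s) < hausdorff_pre \<delta> s (E \<inter> cball x (1 / 2 ^ j))"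
        unfolding hausdorff_measure_def less_SUP_iff by auto
      define w where "w = min \<delta> (t / 2 * (1 / 2 ^ j) ^ s)"
      have "0 < w" using \<delta> t by (simp add: w_def)
      then obtain k1 where k1: "(1 / 2 :: real) ^ k1 < w" using real_arch_pow_inv[of w "1/2"] by auto
      show ?thesis
      proof (intro exI[of _ "max j k1"] conjI allI impI)
        fix k assume k: "max j k1 \<le> k"
        have "(1 / 2 ^ k :: real) \<le> (1 / 2) ^ k1" using k by (simp add: power_one_over divide_simps)
        then have k2: "1 / 2 ^ k < w" using k1 by linarith
        have "ennreal (t * (1 / 2 ^ j) ^ s) < hausdorff_pre \<delta> s (E \<inter> cball x (1 / 2 ^ j))" by (rule \<delta>)
        also have "\<dots> \<le> hausdorff_pre (1 / 2 ^ k) s (E \<inter> cball x (1 / 2 ^ j))"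
          using k2 by (intro hausdorff_pre_antimono) (auto simp: w_def)
        also have "\<dots> \<le> ennreal ((\<Sum>i | i < n k \<and> C k i \<inter> cball x (1 / 2 ^ j) \<inter> E \<noteq> {}. cost s (C k i)) + 1 / 2 ^ k)"
          by (rule tail)
        finally have "t * (1 / 2 ^ j) ^ s < (\<Sum>i | i < n k \<and> C k i \<inter> cball x (1 / 2 ^ j) \<inter> E \<noteq> {}. cost s (C k i)) + 1 / 2 ^ k"
          using t by (subst (asm) ennreal_less_iff) auto
        then show "t / 2 * (1 / 2 ^ j) ^ s \<le> (\<Sum>i | i < n k \<and> C k i \<inter> cball x (1 / 2 ^ j) \<inter> E \<noteq> {}. cost s (C k i))"
          using k2 by (simp add: w_def)
      qed simp
    qed
    then have "\<forall>j\<in>M. \<exists>k0. j \<le> k0 \<and> (\<forall>k\<ge>k0. ?Q j k)" by blast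
    from bchoice[OF this] obtain k0 where "\<forall>j\<in>M. j \<le> k0 j \<and> (\<forall>k\<ge>k0 j. ?Q j k)"
      by (rule exE) (rule that)
    then have k0: "j \<le> k0 j" "k0 j \<le> k \<Longrightarrow> ?Q j k" if "j \<in> M" for j k
      using that by auto
    obtain N where N: "\<And>j. j \<in> M \<Longrightarrow> k0 j \<le> N"
      using finite_nat_set_iff_bounded_le[of "k0 ` M"] M(2) by auto
    have "1 \<le> potential f (X k) z" if k: "N \<le> k" and z: "z \<in> ball x (1 / 2 ^ N) \<inter> K" for k z
    proof -
      let ?I = "{i. i < n k \<and> C k i \<inter> E \<noteq> {}}"
      have jk: "j \<le> k" "j \<le> N" if "j \<in> M" for j using k0(1)[OF that] N[OF that] k by auto
      let ?w = "\<lambda>j. c * (2 ^ s) ^ j / 4 ^ s"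
      have w: "?w j * (t / 2 * (1 / 2 ^ j) ^ s) = c / 4 ^ s * (t / 2)" for j
        by (simp add: power_divide power_mult[symmetric] mult.commute)
      have "1 \<le> e / m * (\<Sum>j\<in>M. c / 4 ^ s * (t / 2))"
        using q M(3) by (simp add: mult_ac)
      also have "\<dots> = e / m * (\<Sum>j\<in>M. ?w j * (t / 2 * (1 / 2 ^ j) ^ s))" by (simp only: w)
      also have "\<dots> \<le> e / m * (\<Sum>j\<in>M. ?w j * (\<Sum>i | i < n k \<and> C k i \<inter> cball x (1 / 2 ^ j) \<inter> E \<noteq> {}. cost s (C k i)))"
        using em c k0(2) N k by (intro mult_left_mono sum_mono) (auto intro: order_trans)
      also have "\<dots> \<le> e / m * (\<Sum>j\<in>M. ?w j * (\<Sum>i | i \<in> ?I \<and> dist z (y k i) \<le> 3 / 2 ^ j. cost s (C k i)))"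
      proof (intro mult_left_mono sum_mono sum_mono2)
        fix j assume j: "j \<in> M"
        \<comment> \<open>Origin of the 3: z is within 2^-j of x, x is within 2^-j of a point of the
          cover set, and that set has diameter at most 2^-j.\<close>
        show "{i. i < n k \<and> C k i \<inter> cball x (1 / 2 ^ j) \<inter> E \<noteq> {}} \<subseteq> {i. i \<in> ?I \<and> dist z (y k i) \<le> 3 / 2 ^ j}"
        proof
          fix i assume "i \<in> {i. i < n k \<and> C k i \<inter> cball x (1 / 2 ^ j) \<inter> E \<noteq> {}}"
          then obtain v where v: "i < n k" "v \<in> C k i" "v \<in> E" "dist x v \<le> 1 / 2 ^ j" by auto
          then have I: "i \<in> ?I" by auto
          then have yi: "y k i \<in> C k i" using y[of k i] by auto
          have "dist v (y k i) \<le> 1 / 2 ^ k"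
            using diameter_bounded_bound[OF C(2) v(2) yi] C(3)[of k i] by linarith
          moreover have "(1 / 2 ^ k :: real) \<le> 1 / 2 ^ j" "(1 / 2 ^ N :: real) \<le> 1 / 2 ^ j"
            using jk[OF j] by (auto simp: divide_simps)
          moreover have "dist z x < 1 / 2 ^ N" using z by (simp add: dist_commute)
          moreover have "dist z (y k i) \<le> dist z x + dist x v + dist v (y k i)"
            by (smt (verit) dist_triangle)
          ultimately have "dist z (y k i) \<le> 3 / 2 ^ j" using v(4) by linarith
          then show "i \<in> {i. i \<in> ?I \<and> dist z (y k i) \<le> 3 / 2 ^ j}" using I by auto
        qed
      qed (use em c cn in auto)
      \<comment> \<open>Exchange of summation: each charge collects its contributions at all scales
        in \<open>M\<close>, and \<open>kernel_lower\<close> bounds them by one value of the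
        kernel.\<close>
      also have "\<dots> = e / m * (\<Sum>j\<in>M. \<Sum>i\<in>?I. if dist z (y k i) \<le> 3 / 2 ^ j then ?w j * cost s (C k i) else 0)"
        by (intro arg_cong2[where f = "(*)"] sum.cong refl, unfold sum_distrib_left, rule sum.inter_filter) simp
      also have "\<dots> = e / m * (\<Sum>i\<in>?I. \<Sum>j\<in>M. if dist z (y k i) \<le> 3 / 2 ^ j then ?w j * cost s (C k i) else 0)"
        by (subst sum.swap) simp
      also have "\<dots> = e / m * (\<Sum>i\<in>?I. cost s (C k i) * (\<Sum>j | j \<in> M \<and> dist z (y k i) \<le> 3 / 2 ^ j. ?w j))"
      proof (intro arg_cong2[where f = "(*)"] sum.cong refl)
        fix i
        have "(\<Sum>j\<in>M. if dist z (y k i) \<le> 3 / 2 ^ j then ?w j * cost s (C k i) else 0)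
            = (\<Sum>j | j \<in> M \<and> dist z (y k i) \<le> 3 / 2 ^ j. ?w j * cost s (C k i))"
          by (rule sum.inter_filter[OF M(2), symmetric])
        also have "\<dots> = cost s (C k i) * (\<Sum>j | j \<in> M \<and> dist z (y k i) \<le> 3 / 2 ^ j. ?w j)"
          unfolding sum_distrib_left by (rule sum.cong[OF refl]) (rule mult.commute)
        finally show "(\<Sum>j\<in>M. if dist z (y k i) \<le> 3 / 2 ^ j then ?w j * cost s (C k i) else 0)
            = cost s (C k i) * (\<Sum>j | j \<in> M \<and> dist z (y k i) \<le> 3 / 2 ^ j. ?w j)" .
      qed
      also have "\<dots> \<le> e / m * (\<Sum>i\<in>?I. cost s (C k i) * f ((dist z (y k i))\<^sup>2 + (1 / 2 ^ k)\<^sup>2))"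
      proof (intro mult_left_mono sum_mono kernel_lower M(2) jk)
        fix i assume "i \<in> ?I"
        then show "(dist z (y k i))\<^sup>2 + 1 \<le> L" using y[of k i] assms(1) z by (intro K) auto
      qed (use em cn in auto)
      also have "\<dots> = potential f (X k) z"
        by (simp add: X_def potential_filter_map sum_distrib_left mult.assoc)
      finally show ?thesis .
    qed
    then show ?thesis by (intro exI[of _ "ball x (1 / 2 ^ N)"] conjI exI[of _ N]) auto
  qed
  ultimately show "\<exists>X. (\<forall>k::nat. charges_on K (X k) \<and> total_charge (X k) \<le> e) \<and>
     (\<forall>x\<in>E - (\<Union>k. thin s E k). \<exists>V. open V \<and> x \<in> V \<and> (\<exists>k0. \<forall>k\<ge>k0. \<forall>z\<in>V \<inter> K. 1 \<le> potential f (X k) z))"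
    using on by (intro exI[of _ X]) auto
qed

text \<open>The countably many thin parts are null, so cheap covers exist; at all other points the
  density argument applies.\<close>

lemma polar_finite_measure:
  assumes "E \<subseteq> K" "hausdorff_measure s E < \<infinity>"
  shows "polar E"
proof -
  define A where "A i = (case i of 0 \<Rightarrow> E - (\<Union>k. thin s E k) | Suc k \<Rightarrow> thin s E k)" for i
  have "polar (A i)" for i
  proof (cases i)
    case 0
    then show ?thesis using polar_thick[OF assms] by (simp add: A_def)
  next
    case (Suc k)
    have "thin s E k \<subseteq> K" using assms(1) by (auto simp: thin_def)
    then show ?thesis using Suc polar_null hausdorff_measure_thin[OF assms(2)] by (simp add: A_def)
  qed
  then have "polar (\<Union>i. A i)" by (rule polar_UN)
  moreover have "E \<subseteq> (\<Union>i. A i)"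
  proof
    fix x assume "x \<in> E"
    then have "x \<in> A 0 \<or> (\<exists>k. x \<in> A (Suc k))" by (auto simp: A_def)
    then show "x \<in> (\<Union>i. A i)" by blast
  qed
  ultimately show ?thesis by (rule polar_subset)
qed

theorem small_potential:
  assumes "compact K" "sigma_finite_hausdorff s K" "0 < e"
  obtains X where "charges_on K X" "total_charge X \<le> e" "\<And>x. x \<in> K \<Longrightarrow> 1 \<le> potential f X x"
proof -
  obtain E :: "nat \<Rightarrow> 'a set" where E: "K = (\<Union>i. E i)" "\<And>i. hausdorff_measure s (E i) < \<infinity>"
    using assms(2) unfolding sigma_finite_hausdorff_def by metis
  have "polar (\<Union>i. E i)"
    by (rule polar_UN, rule polar_finite_measure) (use E in auto)
  then have "polar K" using E(1) by simp
  then show thesis using polar_compact[OF _ assms(1,3)] that by metis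
qed

end

section \<open>Signs and exterior multiplication by bidegree (1,1) forms\<close>

definition inversions :: "'n::{finite,linorder} set \<Rightarrow> 'n set \<Rightarrow> nat" where
  "inversions A B = card {(a, b). a \<in> A \<and> b \<in> B \<and> b < a}"

text \<open>For i in I this is the sign in dx_I = \<open>sg I i\<close> dx_i \<and> dx_(I -
  {i}).\<close>

definition sg :: "'n::{finite,linorder} set \<Rightarrow> 'n \<Rightarrow> real" where
  "sg I i = (- 1) ^ card {k \<in> I. k < i}"

lemma inversions_Un_left: "A \<inter> B = {} \<Longrightarrow> inversions (A \<union> B) C = inversions A C + inversions B C"
  unfolding inversions_def
  by (subst card_Un_disjoint[symmetric]) (auto intro!: arg_cong[where f = card])

lemma inversions_Un_right: "B \<inter> C = {} \<Longrightarrow> inversions A (B \<union> C) = inversions A B + inversions A C"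
  unfolding inversions_def
  by (subst card_Un_disjoint[symmetric]) (auto intro!: arg_cong[where f = card])

lemma inversions_single_left: "inversions {i} B = card {b \<in> B. b < i}"
proof -
  have "{(a, b). a \<in> {i} \<and> b \<in> B \<and> b < a} = Pair i ` {b \<in> B. b < i}" by auto
  then show ?thesis unfolding inversions_def by (simp add: card_image inj_on_def)
qed

lemma inversions_single_right: "inversions A {i} = card {a \<in> A. i < a}"
proof -
  have "{(a, b). a \<in> A \<and> b \<in> {i} \<and> b < a} = (\<lambda>a. (a, i)) ` {a \<in> A. i < a}" by auto
  then show ?thesis unfolding inversions_def by (simp add: card_image inj_on_def)
qed

lemma inversions_swap: "i \<notin> A \<Longrightarrow> inversions A {i} + inversions {i} A = card A"
proof -
  assume "i \<notin> A"
  then have "A = {a \<in> A. i < a} \<union> {a \<in> A. a < i}" by (auto) (metis linorder_neqE)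
  then have "card A = card ({a \<in> A. i < a} \<union> {a \<in> A. a < i})" by (rule arg_cong)
  also have "\<dots> = card {a \<in> A. i < a} + card {a \<in> A. a < i}" by (rule card_Un_disjoint) auto
  finally show ?thesis by (simp add: inversions_single_left inversions_single_right)
qed

lemma shuffle_sign_eq: "I \<inter> I' = {} \<Longrightarrow> shuffle_sign I I' = (- 1) ^ inversions I I'"
  by (simp add: shuffle_sign_def inversions_def)

lemma sg_eq: "sg I i = (- 1) ^ inversions {i} I"
  by (simp add: sg_def inversions_single_left)

lemma sg_remove: "sg (I - {i}) i = sg I i"
  unfolding sg_def by (rule arg_cong[where f = "\<lambda>A. (- 1) ^ card A"]) auto

lemma shuffle_sign_single: "shuffle_sign {i} (I - {i}) = sg I i"
  by (subst shuffle_sign_eq) (auto simp: sg_eq[symmetric] sg_remove)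

text \<open>Anticommutation of dx_i and dx_k: removing the smaller index first lowers the count for
  the larger one by one, while removing the larger one first does not affect the smaller.\<close>

lemma sg_exchange:
  assumes "i \<in> I" "k \<in> I" "i \<noteq> k"
  shows "sg I i * sg (I - {i}) k = - (sg I k * sg (I - {k}) i)"
proof -
  have *: "sg I i * sg (I - {i}) k = - (sg I k * sg (I - {k}) i)"
    if "i \<in> I" "i < k" for i k
  proof -
    have "{b \<in> I. b < k} = insert i {b \<in> I - {i}. b < k}" using that by auto
    then have "sg I k = - sg (I - {i}) k" by (simp add: sg_def)
    moreover have "{b \<in> I - {k}. b < i} = {b \<in> I. b < i}" using that by auto
    then have "sg (I - {k}) i = sg I i" by (simp add: sg_def)
    ultimately show ?thesis by simp
  qed
  show ?thesis
  proof (cases "i < k")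
    case False
    then show ?thesis using *[of k i] assms by auto
  qed (use * assms in auto)
qed

text \<open>With G the complement of \<open>insert i I\<close>, every sign is -1 to a sum of
  inversion numbers among {i}, I and G, and the inversions between i and I in the two orders add up
  to \<open>card I\<close>. Both identities move i from the complement into I, which is what
  differentiation by dx_i does to a coefficient.\<close>

lemma sign_insert:
  assumes "i \<notin> I"
  shows "shuffle_sign I (- I) * sg (- I) i = shuffle_sign (insert i I) (- insert i I) * sg (insert i I) i * (- 1) ^ card I"
    and "shuffle_sign I (- I) * sg (- I) i = (- 1) ^ card I * sg UNIV i * shuffle_sign I (- insert i I)"
proof -
  let ?G = "- insert i I"
  have C: "- I = {i} \<union> ?G" "insert i I = {i} \<union> I" using assms by auto
  have 1: "shuffle_sign I (- I) = (- 1) ^ (inversions I {i} + inversions I ?G)"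
  proof -
    have "inversions I (- I) = inversions I {i} + inversions I ?G"
      by (subst C(1), rule inversions_Un_right) auto
    then show ?thesis by (simp add: shuffle_sign_eq)
  qed
  have 2: "sg (- I) i = (- 1) ^ inversions {i} ?G"
    using sg_remove[of "- I" i] by (simp add: sg_eq Compl_insert)
  have 3: "shuffle_sign (insert i I) ?G = (- 1) ^ (inversions {i} ?G + inversions I ?G)"
    using inversions_Un_left[of "{i}" I ?G] assms by (simp add: shuffle_sign_eq)
  have 4: "sg (insert i I) i = (- 1) ^ inversions {i} I"
    using sg_remove[of "insert i I" i] assms by (simp add: sg_eq)
  have 5: "sg UNIV i = (- 1) ^ (inversions {i} I + inversions {i} ?G)"
  proof -
    have "sg UNIV i = sg (I \<union> ?G) i"
      unfolding sg_def by (rule arg_cong[where f = "\<lambda>A. (- 1) ^ card A"]) auto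
    also have "\<dots> = (- 1) ^ (inversions {i} I + inversions {i} ?G)"
      unfolding sg_eq by (subst inversions_Un_right) auto
    finally show ?thesis .
  qed
  have 6: "shuffle_sign I ?G = (- 1) ^ inversions I ?G" by (subst shuffle_sign_eq) auto
  note card = inversions_swap[OF assms, symmetric]
  show "shuffle_sign I (- I) * sg (- I) i = shuffle_sign (insert i I) ?G * sg (insert i I) i * (- 1) ^ card I"
    unfolding 1 2 3 4 card by (simp add: power_add mult_ac)
  show "shuffle_sign I (- I) * sg (- I) i = (- 1) ^ card I * sg UNIV i * shuffle_sign I ?G"
    unfolding 1 2 5 6 card by (simp add: power_add mult_ac)
qed

text \<open>Left multiplication by \<Sum> A_ij dx_i \<and> d\<xi>_j, acting on the coefficients at
  one point. The power of -1 comes from moving d\<xi>_j past dx_(N - {i}).\<close>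

definition wedge2 ::
  "('n \<Rightarrow> 'n \<Rightarrow> real) \<Rightarrow> ('n::{finite,linorder} set \<Rightarrow> 'n set \<Rightarrow> real) \<Rightarrow> 'n set \<Rightarrow> 'n set \<Rightarrow> real" where
  "wedge2 A c N P = (\<Sum>i\<in>N. \<Sum>j\<in>P.
     A i j * ((- 1) ^ (card N - 1) * sg N i * sg P j) * c (N - {i}) (P - {j}))"

definition unit_form :: "'n set \<Rightarrow> 'n set \<Rightarrow> real" where
  "unit_form I L = (if I = {} \<and> L = {} then 1 else 0)"

lemma sum_Pow_singletons:
  fixes N :: "'n::finite set"
  assumes "\<And>I. card I \<noteq> 1 \<Longrightarrow> f I = 0"
  shows "(\<Sum>I\<in>Pow N. f I) = (\<Sum>i\<in>N. f {i})"
proof -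
  have "(\<Sum>I\<in>Pow N. f I) = (\<Sum>I\<in>(\<lambda>i. {i}) ` N. f I)"
  proof (rule sum.mono_neutral_right)
    show "\<forall>I\<in>Pow N - (\<lambda>i. {i}) ` N. f I = 0"
    proof
      fix I assume I: "I \<in> Pow N - (\<lambda>i. {i}) ` N"
      then have "card I \<noteq> 1" by (auto simp: card_1_singleton_iff)
      then show "f I = 0" by (rule assms)
    qed
  qed auto
  also have "\<dots> = (\<Sum>i\<in>N. f {i})" by (subst sum.reindex) auto
  finally show ?thesis .
qed

lemma wedge_eq_wedge2:
  assumes "\<And>I L. card I \<noteq> 1 \<or> card L \<noteq> 1 \<Longrightarrow> \<alpha> I L x = 0"
  shows "wedge \<alpha> \<gamma> N P x = wedge2 (\<lambda>i j. \<alpha> {i} {j} x) (\<lambda>I L. \<gamma> I L x) N P"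
proof -
  have "wedge \<alpha> \<gamma> N P x = (\<Sum>i\<in>N. \<Sum>L\<in>Pow P.
     wedge_sign {i} L (N - {i}) (P - L) * \<alpha> {i} L x * \<gamma> (N - {i}) (P - L) x)"
    unfolding wedge_def by (rule sum_Pow_singletons) (simp add: assms)
  also have "\<dots> = (\<Sum>i\<in>N. \<Sum>j\<in>P.
     wedge_sign {i} {j} (N - {i}) (P - {j}) * \<alpha> {i} {j} x * \<gamma> (N - {i}) (P - {j}) x)"
    by (intro sum.cong refl sum_Pow_singletons) (simp add: assms)
  also have "\<dots> = wedge2 (\<lambda>i j. \<alpha> {i} {j} x) (\<lambda>I L. \<gamma> I L x) N P"
    unfolding wedge2_def by (intro sum.cong refl) (simp add: wedge_sign_def shuffle_sign_single)
  finally show ?thesis .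
qed

section \<open>Powers of beta and products of squares, evaluated at a point\<close>

abbreviation delta :: "'n \<Rightarrow> 'n \<Rightarrow> real" where
  "delta i j \<equiv> (if i = j then 1 else 0)"

abbreviation beta_power :: "nat \<Rightarrow> 'n::{finite,linorder} set \<Rightarrow> 'n set \<Rightarrow> real" where
  "beta_power k \<equiv> (wedge2 delta ^^ k) unit_form"

lemma sum_delta_left: "(\<Sum>e\<in>UNIV. delta e i * f e) = f i" for i :: "'n::finite"
  by (simp add: mult_delta_left)

lemma sum_delta_right: "(\<Sum>e\<in>UNIV. f e * delta e i) = f i" for i :: "'n::finite"
  by (simp add: mult_delta_right)

lemma wedge_power_beta: "wedge_power beta k N P x = beta_power k N P"
proof (induction k arbitrary: N P)
  case 0
  then show ?case by (simp add: fun_form_def unit_form_def)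
next
  case (Suc k)
  have "wedge_power beta (Suc k) N P x = wedge2 (\<lambda>i j. beta {i} {j} x) (\<lambda>I L. wedge_power beta k I L x) N P"
    unfolding wedge_power.simps by (rule wedge_eq_wedge2) (auto simp: beta_eq)
  also have "(\<lambda>i j. beta {i} {j} x) = delta" by (auto simp: beta_eq fun_eq_iff)
  finally show ?case by (simp add: Suc)
qed

lemma wedge_J_self:
  assumes "\<And>I L. L \<noteq> {} \<or> card I \<noteq> 1 \<Longrightarrow> \<alpha> I L x = 0"
  shows "wedge \<alpha> (J \<alpha>) {i} {j} x = \<alpha> {i} {} x * \<alpha> {j} {} x"
    and "card N \<noteq> 1 \<or> card P \<noteq> 1 \<Longrightarrow> wedge \<alpha> (J \<alpha>) N P x = 0"
proof -
  have "wedge \<alpha> (J \<alpha>) {i} {j} x = (\<Sum>k\<in>{i}. \<Sum>L\<in>Pow {j}.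
     wedge_sign {k} L ({i} - {k}) ({j} - L) * \<alpha> {k} L x * J \<alpha> ({i} - {k}) ({j} - L) x)"
    unfolding wedge_def by (rule sum_Pow_singletons) (simp add: assms)
  also have "\<dots> = \<alpha> {i} {} x * \<alpha> {j} {} x"
    by (simp add: Pow_insert assms wedge_sign_def J_def)
  finally show "wedge \<alpha> (J \<alpha>) {i} {j} x = \<alpha> {i} {} x * \<alpha> {j} {} x" .
  assume c: "card N \<noteq> 1 \<or> card P \<noteq> 1"
  have "wedge_sign I L (N - I) (P - L) * \<alpha> I L x * J \<alpha> (N - I) (P - L) x = 0"
    if "I \<subseteq> N" "L \<subseteq> P" for I L
  proof (rule ccontr)
    assume "wedge_sign I L (N - I) (P - L) * \<alpha> I L x * J \<alpha> (N - I) (P - L) x \<noteq> 0"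
    then have "\<alpha> I L x \<noteq> 0" "\<alpha> (P - L) (N - I) x \<noteq> 0" by (auto simp: J_def)
    then have "L = {}" "card I = 1" "N - I = {}" "card (P - L) = 1" using assms by blast+
    with that c show False by (metis Diff_eq_empty_iff Diff_empty subset_antisym)
  qed
  then show "wedge \<alpha> (J \<alpha>) N P x = 0"
    unfolding wedge_def by (intro sum.neutral ballI) auto
qed

abbreviation square :: "('n \<Rightarrow> real) \<Rightarrow> 'n \<Rightarrow> 'n \<Rightarrow> real" where
  "square v i j \<equiv> v i * v j"

lemma wedge_J_eq:
  assumes "\<And>\<alpha> I L. \<alpha> \<in> set \<alpha>s \<Longrightarrow> L \<noteq> {} \<or> card I \<noteq> 1 \<Longrightarrow> \<alpha> I L x = 0"
  shows "wedge_J \<alpha>s N P x = foldr (\<lambda>\<alpha>. wedge2 (square (\<lambda>i. \<alpha> {i} {} x))) \<alpha>s unit_form N P"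
  using assms
proof (induction \<alpha>s arbitrary: N P)
  case Nil
  then show ?case by (simp add: fun_form_def unit_form_def)
next
  case (Cons \<alpha> \<alpha>s)
  have a: "\<And>I L. L \<noteq> {} \<or> card I \<noteq> 1 \<Longrightarrow> \<alpha> I L x = 0" using Cons.prems by simp
  have "wedge_J (\<alpha> # \<alpha>s) N P x
      = wedge2 (\<lambda>i j. wedge \<alpha> (J \<alpha>) {i} {j} x) (\<lambda>I L. wedge_J \<alpha>s I L x) N P"
    unfolding wedge_J.simps by (rule wedge_eq_wedge2) (rule wedge_J_self(2)[where \<alpha> = \<alpha> and x = x, OF a])
  also have "(\<lambda>i j. wedge \<alpha> (J \<alpha>) {i} {j} x) = square (\<lambda>i. \<alpha> {i} {} x)"
    by (intro ext wedge_J_self(1)[where \<alpha> = \<alpha> and x = x, OF a])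
  also have "(\<lambda>I L. wedge_J \<alpha>s I L x) = foldr (\<lambda>\<alpha>. wedge2 (square (\<lambda>i. \<alpha> {i} {} x))) \<alpha>s unit_form"
    using Cons by (intro ext) auto
  finally show ?case by simp
qed

lemma wedge2_add: "wedge2 A (\<lambda>I L. c I L + d I L) N P = wedge2 A c N P + wedge2 A d N P"
  by (simp add: wedge2_def distrib_left sum.distrib)

lemma wedge2_cmult: "wedge2 A (\<lambda>I L. r * c I L) N P = r * wedge2 A c N P"
  by (simp add: wedge2_def sum_distrib_left mult_ac)

lemma wedge2_sum: "wedge2 A (\<lambda>I L. \<Sum>e\<in>E. c e I L) N P = (\<Sum>e\<in>E. wedge2 A (c e) N P)"
proof (induction E rule: infinite_finite_induct)
  case (insert e E)
  then show ?case by (simp add: wedge2_add)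
qed (simp_all add: wedge2_def)

lemma wedge2_tensor_add: "wedge2 (\<lambda>i j. A i j + B i j) c N P = wedge2 A c N P + wedge2 B c N P"
  by (simp add: wedge2_def distrib_right sum.distrib)

lemma wedge2_tensor_cmult: "wedge2 (\<lambda>i j. r * A i j) c N P = r * wedge2 A c N P"
  by (simp add: wedge2_def sum_distrib_left mult_ac)

lemma wedge2_tensor_diff: "wedge2 (\<lambda>i j. A i j - B i j) c N P = wedge2 A c N P - wedge2 B c N P"
  by (simp add: wedge2_def left_diff_distrib sum_subtractf)

lemma wedge2_tensor_sum: "wedge2 (\<lambda>i j. \<Sum>e\<in>E. A e i j) c N P = (\<Sum>e\<in>E. wedge2 (A e) c N P)"
proof (induction E rule: infinite_finite_induct)
  case (insert e E)
  then show ?case by (simp add: wedge2_tensor_add)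
qed (simp_all add: wedge2_def)

text \<open>The sign of taking out i and then k, extended by 0 where this makes no sense. Double
  products become sums over all indices, in which exchanging i and k is merely a change of
  sign.\<close>

definition sg2 :: "'n::{finite,linorder} set \<Rightarrow> 'n \<Rightarrow> 'n \<Rightarrow> real" where
  "sg2 N i k = (if i \<in> N \<and> k \<in> N \<and> i \<noteq> k then sg N i * sg (N - {i}) k else 0)"

lemma sg2_swap: "sg2 N i k = - sg2 N k i"
  using sg_exchange[of i N k] by (auto simp: sg2_def)

lemma wedge2_wedge2:
  fixes N P :: "'n::{finite,linorder} set"
  shows "wedge2 A (wedge2 B c) N P = (\<Sum>i\<in>UNIV. \<Sum>j\<in>UNIV. \<Sum>k\<in>UNIV. \<Sum>l\<in>UNIV.
    A i j * B k l * ((- 1) ^ (card N - 1) * (- 1) ^ (card N - 2) * sg2 N i k * sg2 P j l) * c (N - {i, k}) (P - {j, l}))"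
    (is "_ = (\<Sum>i\<in>UNIV. \<Sum>j\<in>UNIV. \<Sum>k\<in>UNIV. \<Sum>l\<in>UNIV. ?t i j k l)")
proof -
  have "wedge2 A (wedge2 B c) N P = (\<Sum>i\<in>N. \<Sum>j\<in>P. \<Sum>k\<in>N - {i}. \<Sum>l\<in>P - {j}. ?t i j k l)"
    unfolding wedge2_def[of A] unfolding wedge2_def[of B] sum_distrib_left
    by (intro sum.cong refl) (auto simp: sg2_def insert_commute Diff_insert2[symmetric] Diff_insert[symmetric] numeral_2_eq_2)
  also have "\<dots> = (\<Sum>i\<in>N. \<Sum>j\<in>P. \<Sum>k\<in>UNIV. \<Sum>l\<in>UNIV. ?t i j k l)"
    by (intro sum.cong refl sum.mono_neutral_cong_left) (auto simp: sg2_def intro!: sum.neutral)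
  also have "\<dots> = (\<Sum>i\<in>UNIV. \<Sum>j\<in>UNIV. \<Sum>k\<in>UNIV. \<Sum>l\<in>UNIV. ?t i j k l)"
    by (intro sum.mono_neutral_cong_left) (auto simp: sg2_def intro!: sum.neutral)
  finally show ?thesis .
qed

lemma sum4_swap:
  "(\<Sum>i\<in>A. \<Sum>j\<in>B. \<Sum>k\<in>C. \<Sum>l\<in>D. F i j k l) = (\<Sum>k\<in>C. \<Sum>l\<in>D. \<Sum>i\<in>A. \<Sum>j\<in>B. F i j k l)"
proof -
  have "(\<Sum>i\<in>A. \<Sum>j\<in>B. \<Sum>k\<in>C. \<Sum>l\<in>D. F i j k l) = (\<Sum>i\<in>A. \<Sum>k\<in>C. \<Sum>j\<in>B. \<Sum>l\<in>D. F i j k l)"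
    by (intro sum.cong refl sum.swap)
  also have "\<dots> = (\<Sum>k\<in>C. \<Sum>i\<in>A. \<Sum>j\<in>B. \<Sum>l\<in>D. F i j k l)" by (rule sum.swap)
  also have "\<dots> = (\<Sum>k\<in>C. \<Sum>i\<in>A. \<Sum>l\<in>D. \<Sum>j\<in>B. F i j k l)"
    by (intro sum.cong refl sum.swap)
  also have "\<dots> = (\<Sum>k\<in>C. \<Sum>l\<in>D. \<Sum>i\<in>A. \<Sum>j\<in>B. F i j k l)"
    by (intro sum.cong refl sum.swap)
  finally show ?thesis .
qed

text \<open>Exchanging the factors swaps i with k and j with l; each swap gives a sign, and the two
  signs cancel.\<close>

lemma wedge2_commute:
  fixes c :: "'n::{finite,linorder} set \<Rightarrow> 'n set \<Rightarrow> real"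
  shows "wedge2 A (wedge2 B c) = wedge2 B (wedge2 A c)"
proof (intro ext)
  fix N P :: "'n set"
  let ?t = "\<lambda>A B i j k l. A i j * B k l * ((- 1) ^ (card N - 1) * (- 1) ^ (card N - 2) * sg2 N i k * sg2 P j l) * c (N - {i, k}) (P - {j, l})"
  have t: "?t A B i j k l = ?t B A k l i j" for i j k l
    using sg2_swap[of N i k] sg2_swap[of P j l] by (simp add: insert_commute)
  have "(\<Sum>i\<in>UNIV. \<Sum>j\<in>UNIV. \<Sum>k\<in>UNIV. \<Sum>l\<in>UNIV. ?t A B i j k l)
      = (\<Sum>k\<in>UNIV. \<Sum>l\<in>UNIV. \<Sum>i\<in>UNIV. \<Sum>j\<in>UNIV. ?t A B i j k l)"
    by (rule sum4_swap)
  also have "\<dots> = (\<Sum>k\<in>UNIV. \<Sum>l\<in>UNIV. \<Sum>i\<in>UNIV. \<Sum>j\<in>UNIV. ?t B A k l i j)"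
    by (intro sum.cong refl t)
  finally show "wedge2 A (wedge2 B c) N P = wedge2 B (wedge2 A c) N P"
    unfolding wedge2_wedge2 .
qed

text \<open>Swapping only i and k preserves the product v_i v_j v_k v_l and changes the sign, so the
  sum equals its own negative.\<close>

lemma wedge2_square_square: "wedge2 (square v) (wedge2 (square v) c) N P = 0"
proof -
  let ?t = "\<lambda>i j k l. v i * v j * (v k * v l) * ((- 1) ^ (card N - 1) * (- 1) ^ (card N - 2) * sg2 N i k * sg2 P j l) * c (N - {i, k}) (P - {j, l})"
  let ?S = "\<Sum>i\<in>UNIV. \<Sum>j\<in>UNIV. \<Sum>k\<in>UNIV. \<Sum>l\<in>UNIV. ?t i j k l"
  have t: "?t i j k l = - ?t k j i l" for i j k l
    using sg2_swap[of N i k] by (simp add: insert_commute)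
  have "?S = (\<Sum>j\<in>UNIV. \<Sum>i\<in>UNIV. \<Sum>k\<in>UNIV. \<Sum>l\<in>UNIV. ?t i j k l)" by (rule sum.swap)
  also have "\<dots> = (\<Sum>j\<in>UNIV. \<Sum>k\<in>UNIV. \<Sum>i\<in>UNIV. \<Sum>l\<in>UNIV. ?t i j k l)"
    by (intro sum.cong refl sum.swap)
  also have "\<dots> = (\<Sum>j\<in>UNIV. \<Sum>k\<in>UNIV. \<Sum>i\<in>UNIV. \<Sum>l\<in>UNIV. - ?t k j i l)"
    by (intro sum.cong refl t)
  also have "\<dots> = - (\<Sum>j\<in>UNIV. \<Sum>k\<in>UNIV. \<Sum>i\<in>UNIV. \<Sum>l\<in>UNIV. ?t k j i l)"
    by (simp only: sum_negf)
  also have "(\<Sum>j\<in>UNIV. \<Sum>k\<in>UNIV. \<Sum>i\<in>UNIV. \<Sum>l\<in>UNIV. ?t k j i l) = ?S" by (rule sum.swap)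
  finally show ?thesis unfolding wedge2_wedge2 by simp
qed

text \<open>The binomial formula for \<open>(t \<beta> - v \<and> J v)\<^sup>k\<close>, in which only two terms survive.\<close>

lemma wedge2_binomial:
  "((wedge2 (\<lambda>i j. t * delta i j - v i * v j)) ^^ Suc k) u N P
    = t ^ Suc k * (wedge2 delta ^^ Suc k) u N P
      - real (Suc k) * t ^ k * wedge2 (square v) ((wedge2 delta ^^ k) u) N P"
proof -
  let ?\<Theta> = "wedge2 (\<lambda>i j. t * delta i j - v i * v j)" and ?B = "wedge2 delta" and ?A = "wedge2 (square v)"
  have \<Theta>: "?\<Theta> c N P = t * ?B c N P - ?A c N P" for c N P
    by (simp only: wedge2_tensor_diff wedge2_tensor_cmult)
  have lin: "wedge2 D (\<lambda>I L. r * c I L - q * d I L) N P = r * wedge2 D c N P - q * wedge2 D d N P" for D r q c d N P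
    using wedge2_add[of D "\<lambda>I L. r * c I L" "\<lambda>I L. - q * d I L" N P]
      wedge2_cmult[of D r c N P] wedge2_cmult[of D "- q" d N P] by simp
  show ?thesis
  proof (induction k arbitrary: N P)
    case 0
    then show ?case by (simp add: \<Theta>)
  next
    case (Suc k)
    have eq: "(?\<Theta> ^^ Suc k) u = (\<lambda>I L. t ^ Suc k * (?B ^^ Suc k) u I L - (real (Suc k) * t ^ k) * ?A ((?B ^^ k) u) I L)"
      by (intro ext) (rule Suc)
    have com: "?B (?A ((?B ^^ k) u)) N P = ?A ((?B ^^ Suc k) u) N P"
      by (subst wedge2_commute) simp
    have "(?\<Theta> ^^ Suc (Suc k)) u N P = ?\<Theta> ((?\<Theta> ^^ Suc k) u) N P" by simp
    also have "\<dots> = t * (t ^ Suc k * ?B ((?B ^^ Suc k) u) N P - real (Suc k) * t ^ k * ?B (?A ((?B ^^ k) u)) N P)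
        - (t ^ Suc k * ?A ((?B ^^ Suc k) u) N P - real (Suc k) * t ^ k * ?A (?A ((?B ^^ k) u)) N P)"
      unfolding eq \<Theta> lin ..
    also have "\<dots> = t ^ Suc (Suc k) * (?B ^^ Suc (Suc k)) u N P - real (Suc (Suc k)) * t ^ Suc k * ?A ((?B ^^ Suc k) u) N P"
      unfolding com wedge2_square_square by (simp add: algebra_simps)
    finally show ?case .
  qed
qed

text \<open>Multilinear expansion: a power of a sum of squares is a sum of products of squares, one
  for each list of summands. Such products are the building blocks of strongly positive
  forms.\<close>

lemma wedge2_power_lists:
  fixes v :: "'e::finite \<Rightarrow> 'n::{finite,linorder} \<Rightarrow> real"
  assumes "\<And>i j. A i j = (\<Sum>e\<in>UNIV. v e i * v e j)"
  shows "(wedge2 A ^^ k) u N P = (\<Sum>es | length es = k. foldr (\<lambda>e. wedge2 (square (v e))) es u N P)"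
proof (induction k arbitrary: N P)
  case 0
  have "{es :: 'e list. length es = 0} = {[]}" by auto
  then show ?case by simp
next
  case (Suc k)
  have "{es :: 'e list. length es = Suc k} = (\<lambda>(e, es). e # es) ` (UNIV \<times> {es. length es = k})"
    by (auto simp: length_Suc_conv image_iff)
  then have "(\<Sum>es | length es = Suc k. foldr (\<lambda>e. wedge2 (square (v e))) es u N P)
      = (\<Sum>(e, es)\<in>UNIV \<times> {es. length es = k}. foldr (\<lambda>e. wedge2 (square (v e))) (e # es) u N P)"
    by (simp add: sum.reindex inj_on_def split_def)
  also have "\<dots> = (\<Sum>e\<in>UNIV. \<Sum>es | length es = k. wedge2 (square (v e)) (foldr (\<lambda>e. wedge2 (square (v e))) es u) N P)"
    by (simp add: sum.cartesian_product)
  also have "\<dots> = (\<Sum>e\<in>UNIV. wedge2 (square (v e)) (\<lambda>I L. \<Sum>es | length es = k. foldr (\<lambda>e. wedge2 (square (v e))) es u I L) N P)"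
    by (simp only: wedge2_sum)
  also have "\<dots> = (\<Sum>e\<in>UNIV. wedge2 (square (v e)) ((wedge2 A ^^ k) u) N P)"
    by (simp only: Suc[symmetric])
  also have "\<dots> = wedge2 A ((wedge2 A ^^ k) u) N P"
    by (subst wedge2_tensor_sum[symmetric]) (simp add: assms[abs_def])
  finally show ?case by simp
qed

lemma wedge2_nonzero:
  assumes "wedge2 A c N P \<noteq> 0"
  obtains i j where "i \<in> N" "j \<in> P" "A i j \<noteq> 0" "c (N - {i}) (P - {j}) \<noteq> 0"
proof -
  have "\<exists>i\<in>N. \<exists>j\<in>P. A i j \<noteq> 0 \<and> c (N - {i}) (P - {j}) \<noteq> 0"
  proof (rule ccontr)
    assume "\<not> (\<exists>i\<in>N. \<exists>j\<in>P. A i j \<noteq> 0 \<and> c (N - {i}) (P - {j}) \<noteq> 0)"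
    then have "wedge2 A c N P = 0"
      unfolding wedge2_def by (intro sum.neutral ballI) auto
    with assms show False by simp
  qed
  then show thesis using that by blast
qed

text \<open>Each factor \<beta> adds the same index to both sets. This is what fixes the
  cardinalities in the sign computations later on.\<close>

lemma wedge2_diagonal:
  fixes N P :: "'n::{finite,linorder} set"
  assumes "beta_power k N P \<noteq> 0"
  shows "N = P" "card N = k"
proof -
  have "N = P \<and> card N = k" using assms
  proof (induction k arbitrary: N P)
    case 0
    then show ?case by (simp add: unit_form_def split: if_splits)
  next
    case (Suc k)
    then have "wedge2 delta (beta_power k) N P \<noteq> 0" by simp
    then obtain i j where ij: "i \<in> N" "j \<in> P" "delta i j \<noteq> 0" "beta_power k (N - {i}) (P - {j}) \<noteq> 0"
      by (rule wedge2_nonzero)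
    then have "i = j" by (auto split: if_splits)
    with Suc.IH[OF ij(4)] ij(1,2) show ?case
      by (metis One_nat_def Suc_diff_1 card_Diff_singleton card_gt_0_iff empty_iff finite insert_Diff)
  qed
  then show "N = P" "card N = k" by auto
qed

lemma foldr_wedge2_card:
  assumes "foldr (\<lambda>e. wedge2 (A e)) es unit_form N P \<noteq> 0"
  shows "card N = length es \<and> card P = length es"
  using assms
proof (induction es arbitrary: N P)
  case Nil
  then show ?case by (simp add: unit_form_def split: if_splits)
next
  case (Cons e es)
  then have "wedge2 (A e) (foldr (\<lambda>e. wedge2 (A e)) es unit_form) N P \<noteq> 0" by simp
  then obtain i j where ij: "i \<in> N" "j \<in> P" "foldr (\<lambda>e. wedge2 (A e)) es unit_form (N - {i}) (P - {j}) \<noteq> 0"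
    by (rule wedge2_nonzero)
  with Cons.IH[OF ij(3)] show ?case
    by (metis One_nat_def Suc_diff_1 card_Diff_singleton card_gt_0_iff empty_iff finite length_Cons)
qed

lemma foldr_wedge2_smooth:
  assumes "\<And>e i j. e \<in> set es \<Longrightarrow> smooth (A e i j)"
  shows "smooth (\<lambda>x. foldr (\<lambda>e. wedge2 (\<lambda>i j. A e i j x)) es unit_form N P)"
  using assms
proof (induction es arbitrary: N P)
  case (Cons e es)
  show ?case
    unfolding foldr.simps comp_def wedge2_def[of "\<lambda>i j. A e i j _" for x]
    by (intro smooth_sum smooth_mult smooth_const Cons) auto
qed simp

section \<open>Positivity\<close>

definition covector :: "('n \<Rightarrow> 'n space \<Rightarrow> real) \<Rightarrow> 'n::{finite,linorder} superform" where
  "covector w I L x = (\<Sum>i\<in>UNIV. if I = {i} \<and> L = {} then w i x else 0)"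

lemma covector_single [simp]: "covector w {i} {} x = w i x"
  by (simp add: covector_def)

lemma covector_zero: "L \<noteq> {} \<or> card I \<noteq> 1 \<Longrightarrow> covector w I L x = 0"
  unfolding covector_def by (rule sum.neutral) auto

lemma covector_bidegree: "(\<And>i. smooth (w i)) \<Longrightarrow> bidegree_form U 1 0 (covector w)"
proof -
  assume w: "\<And>i. smooth (w i)"
  have "smooth (covector w I L)" for I L
  proof -
    have eq: "covector w I L = (\<lambda>x. \<Sum>i\<in>UNIV. if I = {i} \<and> L = {} then w i x else 0)"
      by (auto simp: covector_def)
    have "smooth (\<lambda>x. if I = {i} \<and> L = {} then w i x else 0)" for i
    proof (cases "I = {i} \<and> L = {}")
      case True
      show ?thesis unfolding if_P[OF True] by (rule w)
    next
      case False
      show ?thesis unfolding if_not_P[OF False] by (rule smooth_const)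
    qed
    then show ?thesis unfolding eq by (rule smooth_sum)
  qed
  then have "smooth_on U (covector w I L)" for I L by (rule smooth_on_subset)
  moreover have "covector w I L x = 0" if "(card I, card L) \<noteq> (1, 0)" for I L x
  proof (rule covector_zero)
    show "L \<noteq> {} \<or> card I \<noteq> 1" using that by auto
  qed
  ultimately show ?thesis unfolding bidegree_form_def by blast
qed

text \<open>The interface to weak positivity. Products of squares are indexed by lists over an
  arbitrary type, so that different kinds of covectors can be mixed; a bijection with an initial
  segment of the naturals recovers the numbered sum of \<open>strongly_positive\<close>, and every
  weight is the same function \<open>c\<close>.\<close>

lemma pairing_lists_nonneg:
  fixes w :: "'e \<Rightarrow> 'n::{finite,linorder} \<Rightarrow> 'n space \<Rightarrow> real"
  assumes T: "weakly_positive U p T"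
    and c: "c \<in> test_functions U" "\<And>x. 0 \<le> c x"
    and w: "\<And>e i. smooth (w e i)"
    and W: "finite W" "\<And>es. es \<in> W \<Longrightarrow> length es = p"
    and \<gamma>: "\<And>I L x. \<gamma> I L x = c x * (\<Sum>es\<in>W. foldr (\<lambda>e. wedge2 (square (\<lambda>i. w e i x))) es unit_form I L)"
  shows "0 \<le> pairing T \<gamma>"
proof -
  have sm: "smooth (\<lambda>x. \<Sum>es\<in>W. foldr (\<lambda>e. wedge2 (square (\<lambda>i. w e i x))) es unit_form I L)" for I L
    by (intro smooth_sum foldr_wedge2_smooth[where A = "\<lambda>e i j x. w e i x * w e j x"] smooth_mult w)
  have \<gamma>': "\<gamma> I L = (\<lambda>x. c x * (\<Sum>es\<in>W. foldr (\<lambda>e. wedge2 (square (\<lambda>i. w e i x))) es unit_form I L))" for I L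
    using \<gamma> by blast
  have test: "\<gamma> I L \<in> test_functions U" for I L
    unfolding \<gamma>' by (rule test_mult(2)[OF c(1) sm])
  have deg: "\<gamma> I L x = 0" if "(card I, card L) \<noteq> (p, p)" for I L x
  proof -
    have "foldr (\<lambda>e. wedge2 (square (\<lambda>i. w e i x))) es unit_form I L = 0" if "es \<in> W" for es
      using foldr_wedge2_card[of "\<lambda>e. square (\<lambda>i. w e i x)" es I L] W(2)[OF that] \<open>(card I, card L) \<noteq> (p, p)\<close> by auto
    then show ?thesis unfolding \<gamma> by simp
  qed
  have bi: "bidegree_form U p p \<gamma>"
    unfolding bidegree_form_def
    by (intro conjI allI impI ballI smooth_on_subset[OF test_smooth[OF test]] deg)
  obtain g where g: "bij_betw g {..<card W} W"
    using ex_bij_betw_nat_finite[OF W(1)] by (auto simp: atLeast0LessThan)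
  define \<alpha> where "\<alpha> s i = covector (w (g s ! i))" for s i
  have "strongly_positive U p \<gamma>"
    unfolding strongly_positive_def
  proof (intro conjI bi exI[of _ "card W"] exI[of _ "\<lambda>_. c"] exI[of _ \<alpha>] allI impI ballI)
    show "smooth_on U c" by (rule smooth_on_subset[OF test_smooth[OF c(1)]])
    show "0 \<le> c x" for x by (rule c(2))
    show "bidegree_form U 1 0 (\<alpha> s i)" for s i unfolding \<alpha>_def by (intro covector_bidegree w)
    fix I L x
    have "wedge_J (map (\<alpha> s) [0..<p]) I L x = foldr (\<lambda>e. wedge2 (square (\<lambda>i. w e i x))) (g s) unit_form I L"
      if "s < card W" for s
    proof -
      have len: "length (g s) = p" using g that W(2) by (auto simp: bij_betw_def)
      have m: "map (\<alpha> s) [0..<p] = map (\<lambda>e. covector (w e)) (g s)"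
        using len by (auto simp: \<alpha>_def intro!: nth_equalityI)
      show ?thesis
        unfolding m
      proof (subst wedge_J_eq)
        fix \<alpha> :: "'n superform" and I L :: "'n set"
        assume "\<alpha> \<in> set (map (\<lambda>e. covector (w e)) (g s))" "L \<noteq> {} \<or> card I \<noteq> 1"
        then show "\<alpha> I L x = 0" using covector_zero[OF \<open>L \<noteq> {} \<or> card I \<noteq> 1\<close>] by auto
      qed (simp add: foldr_map comp_def)
    qed
    then have "(\<Sum>s<card W. c x * wedge_J (map (\<alpha> s) [0..<p]) I L x)
        = (\<Sum>s<card W. c x * foldr (\<lambda>e. wedge2 (square (\<lambda>i. w e i x))) (g s) unit_form I L)"
      by simp
    also have "\<dots> = (\<Sum>es\<in>W. c x * foldr (\<lambda>e. wedge2 (square (\<lambda>i. w e i x))) es unit_form I L)"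
      by (rule sum.reindex_bij_betw[OF g])
    finally show "\<gamma> I L x = (\<Sum>s<card W. c x * wedge_J (map (\<alpha> s) [0..<p]) I L x)"
      by (simp add: \<gamma> sum_distrib_left)
  qed
  then show ?thesis
    using T test bi by (auto simp: weakly_positive_def test_form_def)
qed

definition tensor_form :: "nat \<Rightarrow> ('n \<Rightarrow> 'n \<Rightarrow> 'n space \<Rightarrow> real) \<Rightarrow> 'n::{finite,linorder} superform" where
  "tensor_form q A N P x = wedge2 (\<lambda>i j. A i j x) (beta_power q) N P"

lemma pairing_square_nonneg:
  fixes a :: "'n::{finite,linorder} \<Rightarrow> 'n space \<Rightarrow> real"
  assumes T: "weakly_positive U (Suc q) T"
    and c: "c \<in> test_functions U" "\<And>x. 0 \<le> c x" and a: "\<And>i. smooth (a i)"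
  shows "0 \<le> pairing T (tensor_form q (\<lambda>i j x. c x * (a i x * a j x)))"
\<comment> \<open>\<open>None\<close> stands for the covector a and \<open>Some b\<close> for dx_b.
  The lists begin with \<open>None\<close> and continue with q basis covectors, which yields a
  \<and> J a \<and> \<beta>^q.\<close>
proof (rule pairing_lists_nonneg[OF T c, where W = "(#) None ` map Some ` {es. length es = q}"
      and w = "\<lambda>e i x. case e of None \<Rightarrow> a i x | Some b \<Rightarrow> delta b i"])
  show "smooth (\<lambda>x. case e of None \<Rightarrow> a i x | Some b \<Rightarrow> delta b i)" for e i
    using a by (cases e) auto
  show "finite ((#) None ` map Some ` {es :: 'n list. length es = q})"
    using finite_lists_length_eq[of "UNIV :: 'n set" q] by auto
  fix I L x
  have D: "delta i j = (\<Sum>e\<in>UNIV. delta e i * delta e j)" for i j :: 'n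
    by (rule sum_delta_left[symmetric])
  have inj: "inj_on ((#) None) (map Some ` {es :: 'n list. length es = q})" "inj_on (map Some) {es :: 'n list. length es = q}"
    by (auto simp: inj_on_def inj_map_eq_map)
  have f: "foldr (\<lambda>e. wedge2 (square (\<lambda>i. case e of None \<Rightarrow> a i x | Some b \<Rightarrow> delta b i))) (map Some es) u
      = foldr (\<lambda>b. wedge2 (square (delta b))) es u" for es :: "'n list" and u
    by (simp add: foldr_map comp_def)
  have "tensor_form q (\<lambda>i j x. c x * (a i x * a j x)) I L x = c x * wedge2 (square (\<lambda>i. a i x)) (beta_power q) I L"
    by (simp add: tensor_form_def wedge2_tensor_cmult)
  also have "beta_power q = (\<lambda>(I :: 'n set) L. \<Sum>es | length es = q. foldr (\<lambda>b. wedge2 (square (delta b))) es unit_form I L)"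
    by (intro ext, rule wedge2_power_lists) (rule D)
  also have "wedge2 (square (\<lambda>i. a i x)) (\<lambda>I L. \<Sum>es | length es = q. foldr (\<lambda>b. wedge2 (square (delta b))) es unit_form I L) I L
      = (\<Sum>es | length es = q. wedge2 (square (\<lambda>i. a i x)) (foldr (\<lambda>b. wedge2 (square (delta b))) es unit_form) I L)"
    by (rule wedge2_sum)
  also have "\<dots> = (\<Sum>es\<in>(#) None ` map Some ` {es. length es = q}. foldr (\<lambda>e. wedge2 (square (\<lambda>i. case e of None \<Rightarrow> a i x | Some b \<Rightarrow> delta b i))) es unit_form I L)"
    by (simp add: sum.reindex[OF inj(1)] sum.reindex[OF inj(2)] f)
  finally show "tensor_form q (\<lambda>i j x. c x * (a i x * a j x)) I L x = c x *
       (\<Sum>es\<in>(#) None ` map Some ` {es. length es = q}.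
           foldr (\<lambda>e. wedge2 (square (\<lambda>i. case e of None \<Rightarrow> a i x | Some b \<Rightarrow> delta b i))) es unit_form I L)" .
qed auto

text \<open>With \<open>z = x - y\<close>, \<open>t = |z|\<^sup>2 + r\<^sup>2\<close> and \<open>\<zeta> = \<Sum> z\<^sub>i dx\<^sub>i\<close>, Lagrange's identity shows that
  \<open>t \<beta> - \<zeta> \<and> J \<zeta>\<close> is a sum of squares, and
  \<open>(t \<beta> - \<zeta> \<and> J \<zeta>)\<^sup>p = t\<^bsup>p-1\<^esup> (t \<beta> - p \<zeta> \<and> J \<zeta>) \<and> \<beta>\<^bsup>p-1\<^esup>\<close>.\<close>

lemma pairing_kernel_nonneg:
  fixes y :: "'n::{finite,linorder} space"
  assumes T: "weakly_positive U (Suc q) T"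
    and c: "c \<in> test_functions U" "\<And>x. 0 \<le> c x" and r: "0 < r"
  defines "t \<equiv> \<lambda>x. (norm (x - y))\<^sup>2 + r\<^sup>2"
  shows "0 \<le> pairing T (tensor_form q (\<lambda>i j x. c x * (t x * delta i j - real (Suc q) * ((x $ i - y $ i) * (x $ j - y $ j)))))"
proof -
  have t: "t x > 0" for x using r by (simp add: t_def add_nonneg_pos)
  have ts: "smooth t" unfolding t_def by (intro smooth_add smooth_norm_sq smooth_const)
  \<comment> \<open>The binomial formula produces a factor t^q, which is divided out in
    advance.\<close>
  define c0 where "c0 x = c x / t x ^ q" for x
  have c0: "c0 \<in> test_functions U" "0 \<le> c0 x" for x
  proof -
    have "smooth (\<lambda>x. 1 / t x ^ q)" by (intro smooth_divide smooth_power ts) (auto simp: t)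
    from test_mult(2)[OF c(1) this] show "c0 \<in> test_functions U" by (simp add: c0_def[abs_def])
    show "0 \<le> c0 x" using c(2) t by (simp add: c0_def less_imp_le)
  qed
  \<comment> \<open>The squares of Lagrange's identity: r dx_b for each b, and (z_k dx_l - z_l dx_k)
    / sqrt 2 for each ordered pair, where the root compensates for counting every pair
    twice.\<close>
  define w where "w e i x = (case e of Inl b \<Rightarrow> r * delta b i
    | Inr kl \<Rightarrow> ((x $ fst kl - y $ fst kl) * delta (snd kl) i - (x $ snd kl - y $ snd kl) * delta (fst kl) i) / sqrt 2)"
    for e :: "'n + 'n \<times> 'n" and i and x :: "'n space"
  have ws: "smooth (w e i)" for e i
  proof (cases e)
    case (Inr kl)
    have "smooth (\<lambda>x. ((x $ fst kl - y $ fst kl) * delta (snd kl) i - (x $ snd kl - y $ snd kl) * delta (fst kl) i) / sqrt 2)"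
      by (intro smooth_divide smooth_diff smooth_mult smooth_nth smooth_const) simp
    then show ?thesis by (simp add: w_def[abs_def] Inr)
  qed (simp add: w_def[abs_def])
  have sq: "t x * delta i j - (x $ i - y $ i) * (x $ j - y $ j) = (\<Sum>e\<in>UNIV. w e i x * w e j x)" for i j x
  proof -
    let ?z = "\<lambda>k. x $ k - y $ k"
    have tx: "t x = (\<Sum>k\<in>UNIV. ?z k * ?z k) + r * r"
      using norm_sq_sum[of x y] by (simp add: t_def power2_eq_square)
    have "(\<Sum>e\<in>UNIV. w e i x * w e j x) = (\<Sum>b\<in>UNIV. r * delta b i * (r * delta b j))
       + (\<Sum>kl\<in>UNIV. (?z (fst kl) * delta (snd kl) i - ?z (snd kl) * delta (fst kl) i) * (?z (fst kl) * delta (snd kl) j - ?z (snd kl) * delta (fst kl) j) / 2)"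
      by (simp add: UNIV_Plus_UNIV[symmetric] sum.Plus w_def del: UNIV_Plus_UNIV)
    also have "(\<Sum>b\<in>UNIV. r * delta b i * (r * delta b j)) = r\<^sup>2 * delta i j"
      using sum_delta_left[of i "\<lambda>b. r * r * delta b j"] by (simp add: power2_eq_square mult_ac)
    also have "(\<Sum>kl\<in>UNIV. (?z (fst kl) * delta (snd kl) i - ?z (snd kl) * delta (fst kl) i) * (?z (fst kl) * delta (snd kl) j - ?z (snd kl) * delta (fst kl) j) / 2)
       = (\<Sum>k\<in>UNIV. \<Sum>l\<in>UNIV. (?z k * delta l i - ?z l * delta k i) * (?z k * delta l j - ?z l * delta k j) / 2)"
      by (simp add: sum.cartesian_product UNIV_Times_UNIV split_def)
    also have "\<dots> = (\<Sum>k\<in>UNIV. \<Sum>l\<in>UNIV. (?z k * ?z k * (delta l i * delta l j)) / 2 - (?z k * delta k j) * (?z l * delta l i) / 2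
         - (?z k * delta k i) * (?z l * delta l j) / 2 + (delta k i * delta k j) * (?z l * ?z l) / 2)"
      by (intro sum.cong refl) (simp add: field_simps)
    also have "\<dots> = (\<Sum>k\<in>UNIV. ?z k * ?z k) * (\<Sum>l\<in>UNIV. delta l i * delta l j) / 2 - (\<Sum>k\<in>UNIV. ?z k * delta k j) * (\<Sum>l\<in>UNIV. ?z l * delta l i) / 2
         - (\<Sum>k\<in>UNIV. ?z k * delta k i) * (\<Sum>l\<in>UNIV. ?z l * delta l j) / 2 + (\<Sum>k\<in>UNIV. delta k i * delta k j) * (\<Sum>l\<in>UNIV. ?z l * ?z l) / 2"
      by (simp only: sum.distrib sum_subtractf sum_product sum_divide_distrib)
    finally show ?thesis
      unfolding sum_delta_left sum_delta_right using tx
      by (simp add: power2_eq_square algebra_simps)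
  qed
  show ?thesis
  proof (rule pairing_lists_nonneg[OF T c0 ws, where W = "{es. length es = Suc q}"])
    show "finite {es :: ('n + 'n \<times> 'n) list. length es = Suc q}"
      using finite_lists_length_eq[of "UNIV :: ('n + 'n \<times> 'n) set" "Suc q"] by simp
    fix I L x
    let ?v = "\<lambda>i. x $ i - y $ i"
    have lists: "(wedge2 (\<lambda>i j. t x * delta i j - ?v i * ?v j) ^^ Suc q) unit_form I L
        = (\<Sum>es | length es = Suc q. foldr (\<lambda>e. wedge2 (square (\<lambda>i. w e i x))) es unit_form I L)"
      by (rule wedge2_power_lists) (rule sq)
    have "tensor_form q (\<lambda>i j x. c x * (t x * delta i j - real (Suc q) * ((x $ i - y $ i) * (x $ j - y $ j)))) I L x
        = c x * (t x * beta_power (Suc q) I L - real (Suc q) * wedge2 (square ?v) (beta_power q) I L)"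
      by (simp only: tensor_form_def wedge2_tensor_diff wedge2_tensor_cmult funpow.simps comp_def)
    also have "\<dots> = c0 x * (t x ^ Suc q * beta_power (Suc q) I L - real (Suc q) * t x ^ q * wedge2 (square ?v) (beta_power q) I L)"
      using t[of x] by (simp add: c0_def field_simps)
    also have "\<dots> = c0 x * (wedge2 (\<lambda>i j. t x * delta i j - ?v i * ?v j) ^^ Suc q) unit_form I L"
      by (simp only: wedge2_binomial)
    finally show "tensor_form q (\<lambda>i j x. c x * (t x * delta i j - real (Suc q) * ((x $ i - y $ i) * (x $ j - y $ j)))) I L x
       = c0 x * (\<Sum>es | length es = Suc q. foldr (\<lambda>e. wedge2 (square (\<lambda>i. w e i x))) es unit_form I L)"
      by (simp only: lists)
  qed auto
qed

section \<open>The top degree coefficient of \<open>dd\<^sup># T \<and> \<beta>\<^sup>q\<close>\<close>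

definition linear_on :: "'n::finite space set \<Rightarrow> 'n functional \<Rightarrow> bool" where
  "linear_on U u \<longleftrightarrow> (\<forall>\<phi>\<in>test_functions U. \<forall>\<psi>\<in>test_functions U. \<forall>a b.
     u (\<lambda>x. a * \<phi> x + b * \<psi> x) = a * u \<phi> + b * u \<psi>)"

lemma linear_onD:
  assumes "linear_on U u" "\<phi> \<in> test_functions U" "\<psi> \<in> test_functions U"
  shows "u (\<lambda>x. a * \<phi> x + b * \<psi> x) = a * u \<phi> + b * u \<psi>"
  using assms unfolding linear_on_def by blast

lemma linear_on_cmult: "linear_on U u \<Longrightarrow> \<phi> \<in> test_functions U \<Longrightarrow> u (\<lambda>x. a * \<phi> x) = a * u \<phi>"
  using linear_onD[of U u \<phi> \<phi> a 0] by simp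

lemma linear_on_zero: "linear_on U u \<Longrightarrow> u (\<lambda>x. 0) = 0"
  using linear_on_cmult[of U u "\<lambda>x. 0" 0] by simp

lemma linear_on_add:
  "linear_on U u \<Longrightarrow> \<phi> \<in> test_functions U \<Longrightarrow> \<psi> \<in> test_functions U \<Longrightarrow> u (\<lambda>x. \<phi> x + \<psi> x) = u \<phi> + u \<psi>"
  using linear_onD[of U u \<phi> \<psi> 1 1] by simp

lemma linear_on_sum:
  assumes "linear_on U u" "\<And>m. m \<in> S \<Longrightarrow> f m \<in> test_functions U"
  shows "u (\<lambda>x. \<Sum>m\<in>S. f m x) = (\<Sum>m\<in>S. u (f m))"
  using assms(2)
proof (induction S rule: infinite_finite_induct)
  case (insert m S)
  then show ?case
    using linear_on_add[OF assms(1), of "f m" "\<lambda>x. \<Sum>m\<in>S. f m x"] by (simp add: test_sum)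
qed (simp_all add: linear_on_zero[OF assms(1)])

lemma linear_on_sum_cmult:
  assumes "linear_on U u" "\<And>m. m \<in> S \<Longrightarrow> f m \<in> test_functions U"
  shows "u (\<lambda>x. \<Sum>m\<in>S. r m * f m x) = (\<Sum>m\<in>S. r m * u (f m))"
  using assms by (subst linear_on_sum[OF assms(1)]) (auto simp: linear_on_cmult test_cmult)

lemma linear_on_combination:
  assumes "\<And>m. m \<in> S \<Longrightarrow> linear_on U (u m)"
  shows "linear_on U (\<lambda>\<phi>. \<Sum>m\<in>S. r m * u m \<phi>)"
  unfolding linear_on_def
proof (intro ballI allI)
  fix \<phi> \<psi> a b assume t: "\<phi> \<in> test_functions U" "\<psi> \<in> test_functions U"
  have "(\<Sum>m\<in>S. r m * u m (\<lambda>x. a * \<phi> x + b * \<psi> x)) = (\<Sum>m\<in>S. a * (r m * u m \<phi>) + b * (r m * u m \<psi>))"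
  proof (rule sum.cong[OF refl])
    fix m assume "m \<in> S"
    then show "r m * u m (\<lambda>x. a * \<phi> x + b * \<psi> x) = a * (r m * u m \<phi>) + b * (r m * u m \<psi>)"
      using linear_onD[OF assms t, of m a b] by (simp add: algebra_simps)
  qed
  also have "\<dots> = a * (\<Sum>m\<in>S. r m * u m \<phi>) + b * (\<Sum>m\<in>S. r m * u m \<psi>)"
    by (simp add: sum.distrib sum_distrib_left)
  finally show "(\<Sum>m\<in>S. r m * u m (\<lambda>x. a * \<phi> x + b * \<psi> x)) = a * (\<Sum>m\<in>S. r m * u m \<phi>) + b * (\<Sum>m\<in>S. r m * u m \<psi>)" .
qed

lemma distribution_linear: "distribution U u \<Longrightarrow> linear_on U u"
  unfolding distribution_def linear_on_def by blast

text \<open>The weight of T_IL in top degree: the sign of completing dx_I \<and> d\<xi>_L by the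
  complementary form, times the coefficient of that form in dx_i \<and> d\<xi>_j \<and>
  \<beta>^q.\<close>

definition rho_coeff :: "nat \<Rightarrow> 'n::{finite,linorder} \<Rightarrow> 'n \<Rightarrow> 'n set \<Rightarrow> 'n set \<Rightarrow> real" where
  "rho_coeff q i j I L = (if i \<notin> I \<and> j \<notin> L then wedge_sign I L (- I) (- L) *
     ((- 1) ^ (card (- I) - 1) * sg (- I) i * sg (- L) j * beta_power q (- I - {i}) (- L - {j})) else 0)"

text \<open>The functionals with \<open>\<Sum> rho q T i j (A i j) = \<integral> T \<and> (\<Sum> A\<^sub>i\<^sub>j dx\<^sub>i \<and> d\<xi>\<^sub>j) \<and> \<beta>\<^sup>q\<close>.\<close>

definition rho :: "nat \<Rightarrow> 'n::{finite,linorder} current \<Rightarrow> 'n \<Rightarrow> 'n \<Rightarrow> 'n functional" where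
  "rho q T i j \<phi> = (\<Sum>(I, L)\<in>UNIV. volume_sign TYPE('n) * rho_coeff q i j I L * T I L \<phi>)"

lemma volume_sign_square: "volume_sign TYPE('n::{finite,linorder}) * volume_sign TYPE('n) = 1"
  by (simp add: volume_sign_def flip: power_mult_distrib)

lemma sum_pair_UNIV: "(\<Sum>(I, L)\<in>UNIV. f I L) = (\<Sum>I\<in>UNIV. \<Sum>L\<in>UNIV. f I L)"
  by (simp add: sum.cartesian_product UNIV_Times_UNIV)

lemma sum_filter_UNIV: "(\<Sum>i\<in>A. f i) = (\<Sum>i\<in>UNIV. if i \<in> A then f i else 0)" for A :: "'a::finite set"
  by (simp add: sum.If_cases)

lemma sum4_filter:
  fixes F :: "'a::finite \<Rightarrow> 'b::finite \<Rightarrow> 'c::finite \<Rightarrow> 'd::finite \<Rightarrow> real"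
  shows "(\<Sum>I\<in>UNIV. \<Sum>L\<in>UNIV. \<Sum>i\<in>A I. \<Sum>j\<in>B L. F I L i j)
    = (\<Sum>i\<in>UNIV. \<Sum>j\<in>UNIV. \<Sum>I\<in>UNIV. \<Sum>L\<in>UNIV. if i \<in> A I \<and> j \<in> B L then F I L i j else 0)"
proof -
  have "(\<Sum>I\<in>UNIV. \<Sum>L\<in>UNIV. \<Sum>i\<in>A I. \<Sum>j\<in>B L. F I L i j)
      = (\<Sum>I\<in>UNIV. \<Sum>L\<in>UNIV. \<Sum>i\<in>UNIV. \<Sum>j\<in>UNIV. if i \<in> A I \<and> j \<in> B L then F I L i j else 0)"
  proof (rule sum.cong[OF refl], rule sum.cong[OF refl])
    fix I L
    have "(\<Sum>i\<in>A I. \<Sum>j\<in>B L. F I L i j) = (\<Sum>i\<in>UNIV. if i \<in> A I then (\<Sum>j\<in>UNIV. if j \<in> B L then F I L i j else 0) else 0)"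
      by (subst sum_filter_UNIV, subst sum_filter_UNIV) (rule refl)
    also have "\<dots> = (\<Sum>i\<in>UNIV. \<Sum>j\<in>UNIV. if i \<in> A I \<and> j \<in> B L then F I L i j else 0)"
      by (intro sum.cong refl) auto
    finally show "(\<Sum>i\<in>A I. \<Sum>j\<in>B L. F I L i j) = (\<Sum>i\<in>UNIV. \<Sum>j\<in>UNIV. if i \<in> A I \<and> j \<in> B L then F I L i j else 0)" .
  qed
  also have "\<dots> = (\<Sum>i\<in>UNIV. \<Sum>j\<in>UNIV. \<Sum>I\<in>UNIV. \<Sum>L\<in>UNIV. if i \<in> A I \<and> j \<in> B L then F I L i j else 0)"
    by (rule sum4_swap)
  finally show ?thesis .
qed

lemma pairing_tensor_form:
  fixes T :: "'n::{finite,linorder} current"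
  assumes T: "\<And>I L. linear_on U (T I L)" and A: "\<And>i j. A i j \<in> test_functions U"
  shows "pairing T (tensor_form q A) = (\<Sum>i\<in>UNIV. \<Sum>j\<in>UNIV. rho q T i j (A i j))"
proof -
  let ?k = "\<lambda>I L i j. (- 1) ^ (card (- I) - 1) * sg (- I) i * sg (- L) j * beta_power q (- I - {i}) (- L - {j})"
  have TA: "T I L (\<lambda>x. tensor_form q A (- I) (- L) x * 1) = (\<Sum>i\<in>- I. \<Sum>j\<in>- L. ?k I L i j * T I L (A i j))" for I L
  proof -
    have "(\<lambda>x. tensor_form q A (- I) (- L) x * 1) = (\<lambda>x. \<Sum>i\<in>- I. \<Sum>j\<in>- L. ?k I L i j * A i j x)"
      unfolding tensor_form_def wedge2_def by (simp add: mult_ac)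
    then have "T I L (\<lambda>x. tensor_form q A (- I) (- L) x * 1) = T I L (\<lambda>x. \<Sum>i\<in>- I. \<Sum>j\<in>- L. ?k I L i j * A i j x)"
      by (rule arg_cong)
    also have "\<dots> = (\<Sum>i\<in>- I. T I L (\<lambda>x. \<Sum>j\<in>- L. ?k I L i j * A i j x))"
      by (intro linear_on_sum[OF T] test_sum test_cmult A)
    also have "\<dots> = (\<Sum>i\<in>- I. \<Sum>j\<in>- L. ?k I L i j * T I L (A i j))"
      by (intro sum.cong refl linear_on_sum_cmult[OF T] A)
    finally show ?thesis .
  qed
  have "pairing T (tensor_form q A) = volume_sign TYPE('n) *
      (\<Sum>I\<in>UNIV. \<Sum>L\<in>UNIV. wedge_sign I L (- I) (- L) * T I L (\<lambda>x. tensor_form q A (- I) (- L) x * 1))"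
    by (simp add: pairing_def wedge_current_def Compl_eq_Diff_UNIV)
  also have "\<dots> = volume_sign TYPE('n) * (\<Sum>I\<in>UNIV. \<Sum>L\<in>UNIV. \<Sum>i\<in>- I. \<Sum>j\<in>- L.
      wedge_sign I L (- I) (- L) * ?k I L i j * T I L (A i j))"
    unfolding TA by (simp only: sum_distrib_left mult.assoc)
  also have "\<dots> = volume_sign TYPE('n) * (\<Sum>i\<in>UNIV. \<Sum>j\<in>UNIV. \<Sum>I\<in>UNIV. \<Sum>L\<in>UNIV.
      if i \<in> - I \<and> j \<in> - L then wedge_sign I L (- I) (- L) * ?k I L i j * T I L (A i j) else 0)"
    by (subst sum4_filter) (rule refl)
  also have "\<dots> = volume_sign TYPE('n) * (\<Sum>i\<in>UNIV. \<Sum>j\<in>UNIV. \<Sum>I\<in>UNIV. \<Sum>L\<in>UNIV. rho_coeff q i j I L * T I L (A i j))"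
    by (intro arg_cong2[where f = "(*)"] refl sum.cong) (auto simp: rho_coeff_def)
  also have "\<dots> = (\<Sum>i\<in>UNIV. \<Sum>j\<in>UNIV. rho q T i j (A i j))"
    by (simp add: rho_def sum_pair_UNIV sum_distrib_left mult.assoc)
  finally show ?thesis .
qed

section \<open>Second derivatives of a current and multiplication by powers of beta\<close>

lemma ddsharp_current:
  "d_current (dsharp_current T) I L \<phi> = (\<Sum>i\<in>I. \<Sum>j\<in>L.
     sg I i * sg L j * (- 1) ^ (card I - 1) * T (I - {i}) (L - {j}) (partial j (partial i \<phi>)))"
proof -
  have "d_current (dsharp_current T) I L \<phi> = (\<Sum>i\<in>I. sg I i * (\<Sum>j\<in>L. (- 1) ^ card (I - {i}) * sg L j *
      T (I - {i}) (L - {j}) (partial j (partial i \<phi>))))"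
    unfolding d_current_def dsharp_current_def distr_partial_def
    by (intro sum.cong refl)
      (simp add: wedge_sign_def shuffle_sign_single sum_negf sum_distrib_left)
  then show ?thesis by (simp add: sum_distrib_left mult_ac)
qed

text \<open>Multiplication by the constant form \<beta>^q commutes with the two derivatives. The
  first identity differentiates before multiplying, the second multiplies before differentiating,
  and both give the sign of T \<and> dx_i \<and> d\<xi>_j \<and> \<beta>^q. Unless all sides vanish,
  \<open>insert i I = insert j L\<close>, so I and L have equal size and the parities match.\<close>

lemma sign_coeff:
  fixes I L :: "'n::{finite,linorder} set"
  assumes "i \<notin> I" "j \<notin> L"
  shows "wedge_sign (insert i I) (insert j L) (- insert i I) (- insert j L) * beta_power q (- insert i I) (- insert j L) *
      (sg (insert i I) i * sg (insert j L) j * (- 1) ^ (card (insert i I) - 1)) = rho_coeff q i j I L" (is ?A)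
    and "sg UNIV i * sg UNIV j * (- 1) ^ (CARD('n) - 1) *
      (wedge_sign I L (- insert i I) (- insert j L) * beta_power q (- insert i I) (- insert j L)) = rho_coeff q i j I L" (is ?B)
proof -
  have C: "- I - {i} = - insert i I" "- L - {j} = - insert j L" by auto
  have "?A \<and> ?B"
  proof (cases "beta_power q (- insert i I) (- insert j L) = 0")
    case True
    then show ?thesis by (simp add: rho_coeff_def C)
  next
    case False
    from wedge2_diagonal[OF this] have eq: "insert i I = insert j L" and q: "card (- insert i I) = q" by auto
    have cI: "card (insert i I) = Suc (card I)" "card (insert j L) = Suc (card L)" using assms by auto
    with eq have IL: "card L = card I" by simp
    have q': "card (- insert j L) = q" using q eq by simp
    have "- I = insert i (- insert i I)" "- L = insert j (- insert j L)" using assms by auto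
    then have cC: "card (- I) = Suc q" "card (- L) = Suc q"
      using q q' by (metis ComplD card_insert_disjoint finite insertI1)+
    have n: "CARD('n) - 1 = card I + q"
    proof -
      have "CARD('n) = card (insert i I) + card (- insert i I)"
        by (subst card_Un_disjoint[symmetric]) auto
      then show ?thesis using cI q by simp
    qed
    let ?e = "(- 1 :: real) ^ card I" and ?f = "(- 1 :: real) ^ (card I * q)" and ?g = "(- 1 :: real) ^ q"
    have ee: "?e * ?e = 1" by (simp flip: power_mult_distrib)
    have sI: "shuffle_sign I (- I) * sg (- I) i = shuffle_sign (insert i I) (- insert i I) * sg (insert i I) i * ?e"
      "shuffle_sign I (- I) * sg (- I) i = ?e * sg UNIV i * shuffle_sign I (- insert i I)"
      by (rule sign_insert[OF assms(1)])+
    have sL: "shuffle_sign L (- L) * sg (- L) j = shuffle_sign (insert j L) (- insert j L) * sg (insert j L) j * ?e"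
      "shuffle_sign L (- L) * sg (- L) j = ?e * sg UNIV j * shuffle_sign L (- insert j L)"
      using sign_insert[OF assms(2)] by (simp_all only: IL)
    let ?b = "beta_power q (- insert i I) (- insert j L)"
    have r: "rho_coeff q i j I L = (?f * ?e * ?g) * ((shuffle_sign I (- I) * sg (- I) i) * (shuffle_sign L (- L) * sg (- L) j)) * ?b"
      using assms by (simp add: rho_coeff_def C wedge_sign_def cC IL power_add mult_ac)
    have A: ?A
      unfolding r sI(1) sL(1) wedge_sign_def cI q q' IL
      using ee by (simp add: power_add mult_ac)
    have B: ?B
      unfolding r sI(2) sL(2) wedge_sign_def n q q' IL
      using ee by (simp add: power_add mult_ac)
    from A B show ?thesis by blast
  qed
  then show ?A ?B by auto
qed

lemma partial_partial_cmult:
  assumes "smooth \<phi>"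
  shows "partial j (partial i (\<lambda>x. c * \<phi> x)) = (\<lambda>x. c * partial j (partial i \<phi>) x)"
proof -
  have "partial i (\<lambda>x. c * \<phi> x) = (\<lambda>x. c * partial i \<phi> x)"
    by (rule partial_cmult) (rule smooth_differentiable[OF assms])
  then show ?thesis
    using partial_cmult[of "partial i \<phi>" j c] smooth_differentiable[OF smooth_partial[OF assms]] by simp
qed

lemma ddsharp_current_cmult:
  assumes T: "\<And>I L. linear_on U (T I L)" and \<phi>: "\<phi> \<in> test_functions U"
  shows "d_current (dsharp_current T) I L (\<lambda>x. c * \<phi> x) = c * d_current (dsharp_current T) I L \<phi>"
proof -
  have "T I' L' (partial j (partial i (\<lambda>x. c * \<phi> x))) = c * T I' L' (partial j (partial i \<phi>))" for I' L' i j
    unfolding partial_partial_cmult[OF test_smooth[OF \<phi>]]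
    by (intro linear_on_cmult[OF T] test_partial \<phi>)
  then show ?thesis unfolding ddsharp_current by (simp add: sum_distrib_left mult_ac)
qed

lemma sum_insert_reindex:
  fixes F :: "'n::finite set \<Rightarrow> real"
  shows "(\<Sum>I\<in>UNIV. if i \<in> I then F I else 0) = (\<Sum>I\<in>UNIV. if i \<notin> I then F (insert i I) else 0)"
proof -
  have "(\<Sum>I | i \<in> I. F I) = (\<Sum>I | i \<notin> I. F (insert i I))"
    by (rule sum.reindex_bij_witness[where j = "\<lambda>I. I - {i}" and i = "insert i"]) (auto simp: insert_absorb)
  then show ?thesis by (simp add: sum.If_cases)
qed

text \<open>Here superforms disappear from the problem: what remains of T is the matrix
  \<open>rho\<close>, paired with the Hessian of the test function.\<close>

theorem ddsharp_wedge_beta_top: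
  fixes T :: "'n::{finite,linorder} current"
  assumes T: "\<And>I L. linear_on U (T I L)" and \<phi>: "\<phi> \<in> test_functions U"
  shows "volume_sign TYPE('n) * wedge_current (d_current (dsharp_current T)) (wedge_power beta q) UNIV UNIV \<phi>
     = (\<Sum>i\<in>UNIV. \<Sum>j\<in>UNIV. rho q T i j (partial j (partial i \<phi>)))"
proof -
  let ?b = "\<lambda>I L. wedge_sign I L (- I) (- L) * beta_power q (- I) (- L)"
  let ?s = "\<lambda>I L i j. sg I i * sg L j * (- 1) ^ (card I - 1)"
  let ?d = "\<lambda>i j. partial j (partial i \<phi>)"
  have "wedge_current (d_current (dsharp_current T)) (wedge_power beta q) UNIV UNIV \<phi>
      = (\<Sum>I\<in>UNIV. \<Sum>L\<in>UNIV. wedge_sign I L (- I) (- L) * d_current (dsharp_current T) I L (\<lambda>x. beta_power q (- I) (- L) * \<phi> x))"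
    by (simp add: wedge_current_def Compl_eq_Diff_UNIV wedge_power_beta)
  also have "\<dots> = (\<Sum>I\<in>UNIV. \<Sum>L\<in>UNIV. \<Sum>i\<in>I. \<Sum>j\<in>L. ?b I L * ?s I L i j * T (I - {i}) (L - {j}) (?d i j))"
    unfolding ddsharp_current_cmult[where T = T, OF T \<phi>] unfolding ddsharp_current
    by (simp add: sum_distrib_left mult_ac)
  also have "\<dots> = (\<Sum>i\<in>UNIV. \<Sum>j\<in>UNIV. \<Sum>I\<in>UNIV. \<Sum>L\<in>UNIV. if i \<in> I \<and> j \<in> L then ?b I L * ?s I L i j * T (I - {i}) (L - {j}) (?d i j) else 0)"
    by (rule sum4_filter)
  also have "\<dots> = (\<Sum>i\<in>UNIV. \<Sum>j\<in>UNIV. \<Sum>I\<in>UNIV. \<Sum>L\<in>UNIV. rho_coeff q i j I L * T I L (?d i j))"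
  proof (rule sum.cong[OF refl], rule sum.cong[OF refl])
    fix i j :: 'n
    let ?F = "\<lambda>I L. ?b I L * ?s I L i j * T (I - {i}) (L - {j}) (?d i j)"
    have "(\<Sum>I\<in>UNIV. \<Sum>L\<in>UNIV. if i \<in> I \<and> j \<in> L then ?F I L else 0)
        = (\<Sum>I\<in>UNIV. if i \<in> I then (\<Sum>L\<in>UNIV. if j \<in> L then ?F I L else 0) else 0)"
      by (intro sum.cong refl) auto
    \<comment> \<open>Differentiation adds i to I and j to L; re-indexing by the sets before
      differentiation exposes the coefficient of T_IL.\<close>
    also have "\<dots> = (\<Sum>I\<in>UNIV. if i \<notin> I then (\<Sum>L\<in>UNIV. if j \<notin> L then ?F (insert i I) (insert j L) else 0) else 0)"
      by (subst sum_insert_reindex, subst sum_insert_reindex) (rule refl)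
    also have "\<dots> = (\<Sum>I\<in>UNIV. \<Sum>L\<in>UNIV. rho_coeff q i j I L * T I L (?d i j))"
    proof (rule sum.cong[OF refl])
      fix I
      show "(if i \<notin> I then (\<Sum>L\<in>UNIV. if j \<notin> L then ?F (insert i I) (insert j L) else 0) else 0)
          = (\<Sum>L\<in>UNIV. rho_coeff q i j I L * T I L (?d i j))"
      proof (cases "i \<in> I")
        case True
        then show ?thesis by (simp add: rho_coeff_def)
      next
        case False
        have "(\<Sum>L\<in>UNIV. if j \<notin> L then ?F (insert i I) (insert j L) else 0) = (\<Sum>L\<in>UNIV. rho_coeff q i j I L * T I L (?d i j))"
        proof (rule sum.cong[OF refl])
          fix L
          show "(if j \<notin> L then ?F (insert i I) (insert j L) else 0) = rho_coeff q i j I L * T I L (?d i j)"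
          proof (cases "j \<in> L")
            case True
            then show ?thesis by (simp add: rho_coeff_def)
          next
            case L: False
            have "insert i I - {i} = I" "insert j L - {j} = L" using False L by auto
            then show ?thesis using L by (simp only: sign_coeff(1)[OF False L] if_True not_False_eq_True)
          qed
        qed
        then show ?thesis using False by (simp only: if_True not_False_eq_True)
      qed
    qed
    finally show "(\<Sum>I\<in>UNIV. \<Sum>L\<in>UNIV. if i \<in> I \<and> j \<in> L then ?F I L else 0)
        = (\<Sum>I\<in>UNIV. \<Sum>L\<in>UNIV. rho_coeff q i j I L * T I L (?d i j))" .
  qed
  finally show ?thesis by (simp add: rho_def sum_pair_UNIV sum_distrib_left mult.assoc)
qed

text \<open>Concavity concerns the second derivative of T \<and> \<beta>^q, the extension problem
  the product of the second derivative of T with \<beta>^q. This and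
  \<open>ddsharp_wedge_beta_top\<close> reduce both to one expression.\<close>

lemma ddsharp_of_wedge_beta:
  fixes T :: "'n::{finite,linorder} current"
  assumes T: "\<And>I L. linear_on U (T I L)" and \<phi>: "\<phi> \<in> test_functions U"
  shows "volume_sign TYPE('n) * d_current (dsharp_current (wedge_current T (wedge_power beta q))) UNIV UNIV \<phi>
     = (\<Sum>i\<in>UNIV. \<Sum>j\<in>UNIV. rho q T i j (partial j (partial i \<phi>)))"
proof -
  let ?d = "\<lambda>i j. partial j (partial i \<phi>)"
  let ?s = "\<lambda>i j. sg UNIV i * sg UNIV j * (- 1) ^ (CARD('n) - 1)"
  have w: "?s i j * wedge_current T (wedge_power beta q) (UNIV - {i}) (UNIV - {j}) (?d i j)
      = (\<Sum>I\<in>UNIV. \<Sum>L\<in>UNIV. rho_coeff q i j I L * T I L (?d i j))" for i j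
  proof -
    have c: "UNIV - {i} - I = - insert i I" for i :: 'n and I by auto
    have P: "Pow (UNIV - {i}) = {I. i \<notin> I}" for i :: 'n by auto
    have "?s i j * wedge_current T (wedge_power beta q) (UNIV - {i}) (UNIV - {j}) (?d i j)
        = (\<Sum>I | i \<notin> I. \<Sum>L | j \<notin> L. ?s i j * (wedge_sign I L (- insert i I) (- insert j L)
            * T I L (\<lambda>x. beta_power q (- insert i I) (- insert j L) * ?d i j x)))"
      by (simp add: wedge_current_def wedge_power_beta c P sum_distrib_left)
    also have "\<dots> = (\<Sum>I | i \<notin> I. \<Sum>L | j \<notin> L. rho_coeff q i j I L * T I L (?d i j))"
    proof (intro sum.cong refl)
      fix I L :: "'n set" assume "I \<in> {I. i \<notin> I}" "L \<in> {L. j \<notin> L}"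
      then have IL: "i \<notin> I" "j \<notin> L" by auto
      have "T I L (\<lambda>x. beta_power q (- insert i I) (- insert j L) * ?d i j x) = beta_power q (- insert i I) (- insert j L) * T I L (?d i j)"
        by (intro linear_on_cmult[OF T] test_partial \<phi>)
      then show "?s i j * (wedge_sign I L (- insert i I) (- insert j L)
            * T I L (\<lambda>x. beta_power q (- insert i I) (- insert j L) * ?d i j x)) = rho_coeff q i j I L * T I L (?d i j)"
        unfolding sign_coeff(2)[OF IL, symmetric] by (simp only: mult.assoc)
    qed
    also have "\<dots> = (\<Sum>I\<in>UNIV. \<Sum>L\<in>UNIV. rho_coeff q i j I L * T I L (?d i j))"
    proof -
      have "(\<Sum>I | i \<notin> I. \<Sum>L | j \<notin> L. rho_coeff q i j I L * T I L (?d i j))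
          = (\<Sum>I | i \<notin> I. \<Sum>L\<in>UNIV. rho_coeff q i j I L * T I L (?d i j))"
        by (intro sum.cong refl sum.mono_neutral_left) (auto simp: rho_coeff_def)
      also have "\<dots> = (\<Sum>I\<in>UNIV. \<Sum>L\<in>UNIV. rho_coeff q i j I L * T I L (?d i j))"
        by (intro sum.mono_neutral_left) (auto simp: rho_coeff_def)
      finally show ?thesis .
    qed
    finally show ?thesis .
  qed
  have "d_current (dsharp_current (wedge_current T (wedge_power beta q))) UNIV UNIV \<phi>
      = (\<Sum>i\<in>UNIV. \<Sum>j\<in>UNIV. \<Sum>I\<in>UNIV. \<Sum>L\<in>UNIV. rho_coeff q i j I L * T I L (?d i j))"
    unfolding ddsharp_current by (intro sum.cong refl w)
  then show ?thesis by (simp add: rho_def sum_pair_UNIV sum_distrib_left mult.assoc)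
qed

text \<open>The degrees add up to n = (n - q - 1) + 1 + q. So only the coefficient at
  \<open>(UNIV, UNIV)\<close> survives, and a statement about currents becomes one about a single
  functional.\<close>

lemma ddsharp_wedge_beta_degree:
  fixes T :: "'n::{finite,linorder} current"
  assumes T: "\<And>I L. linear_on U (T I L)"
    and deg: "\<And>I L \<phi>. (card I, card L) \<noteq> (CARD('n) - Suc q, CARD('n) - Suc q) \<Longrightarrow> \<phi> \<in> test_functions U \<Longrightarrow> T I L \<phi> = 0"
    and q: "Suc q \<le> CARD('n)"
    and NP: "(N, P) \<noteq> (UNIV, UNIV)" and \<phi>: "\<phi> \<in> test_functions U"
  shows "wedge_current (d_current (dsharp_current T)) (wedge_power beta q) N P \<phi> = 0"
proof -
  have "wedge_sign I L (N - I) (P - L) * d_current (dsharp_current T) I L (\<lambda>x. wedge_power beta q (N - I) (P - L) x * \<phi> x) = 0"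
    if IL: "I \<subseteq> N" "L \<subseteq> P" for I L
  proof (cases "beta_power q (N - I) (P - L) = 0")
    case True
    then show ?thesis
      using ddsharp_current_cmult[where T = T and I = I and L = L and c = 0, OF T \<phi>] by (simp add: wedge_power_beta)
  next
    case False
    from wedge2_diagonal[OF False] have e: "card (N - I) = q" "card (P - L) = q" by auto
    then have cN: "card N = card I + q" "card P = card L + q"
      using IL by (metis card_Diff_subset card_mono finite le_add_diff_inverse)+
    have "T (I - {i}) (L - {j}) (partial j (partial i \<phi>)) = 0" if "i \<in> I" "j \<in> L" for i j
    proof (rule deg)
      show "(card (I - {i}), card (L - {j})) \<noteq> (CARD('n) - Suc q, CARD('n) - Suc q)"
      proof
        assume "(card (I - {i}), card (L - {j})) = (CARD('n) - Suc q, CARD('n) - Suc q)"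
        then have "card (I - {i}) = CARD('n) - Suc q" "card (L - {j}) = CARD('n) - Suc q" by auto
        moreover have "card I = Suc (card (I - {i}))" "card L = Suc (card (L - {j}))"
          using card.remove[OF finite that(1)] card.remove[OF finite that(2)] by simp_all
        ultimately have "card N = CARD('n)" "card P = CARD('n)" using cN q by simp_all
        then have "N = UNIV" "P = UNIV" by (simp_all add: card_eq_UNIV_imp_eq_UNIV)
        with NP show False by simp
      qed
    qed (intro test_partial \<phi>)
    then have "d_current (dsharp_current T) I L \<phi> = 0" unfolding ddsharp_current by simp
    then show ?thesis using ddsharp_current_cmult[where T = T and I = I and L = L, OF T \<phi>] by (simp add: wedge_power_beta)
  qed
  then show ?thesis unfolding wedge_current_def by (intro sum.neutral ballI) auto
qed

section \<open>Positivity and concavity in terms of the matrix rho\<close>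

lemma weakly_positive_linear: "weakly_positive U p T \<Longrightarrow> linear_on U (T I L)"
  unfolding weakly_positive_def bidimension_current_def bidegree_current_def
  by (blast intro: distribution_linear)

lemma rho_square_nonneg:
  assumes T: "weakly_positive U (Suc q) T"
    and c: "c \<in> test_functions U" "\<And>x. 0 \<le> c x" and a: "\<And>i. smooth (a i)"
  shows "0 \<le> (\<Sum>i\<in>UNIV. \<Sum>j\<in>UNIV. rho q T i j (\<lambda>x. c x * (a i x * a j x)))"
proof -
  have "pairing T (tensor_form q (\<lambda>i j x. c x * (a i x * a j x)))
      = (\<Sum>i\<in>UNIV. \<Sum>j\<in>UNIV. rho q T i j (\<lambda>x. c x * (a i x * a j x)))"
    by (intro pairing_tensor_form[where U = U] weakly_positive_linear[OF T] test_mult(2)[OF c(1)] smooth_mult a)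
  then show ?thesis using pairing_square_nonneg[where a = a, OF assms] by simp
qed

lemma rho_kernel_nonneg:
  assumes T: "weakly_positive U (Suc q) T"
    and c: "c \<in> test_functions U" "\<And>x. 0 \<le> c x" and r: "0 < r"
  shows "0 \<le> (\<Sum>i\<in>UNIV. \<Sum>j\<in>UNIV. rho q T i j (\<lambda>x. c x * (((norm (x - y))\<^sup>2 + r\<^sup>2) * delta i j
      - real (Suc q) * ((x $ i - y $ i) * (x $ j - y $ j)))))"
proof -
  let ?A = "\<lambda>i j x. c x * (((norm (x - y))\<^sup>2 + r\<^sup>2) * delta i j - real (Suc q) * ((x $ i - y $ i) * (x $ j - y $ j)))"
  have "pairing T (tensor_form q ?A) = (\<Sum>i\<in>UNIV. \<Sum>j\<in>UNIV. rho q T i j (?A i j))"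
    by (intro pairing_tensor_form[where U = U] weakly_positive_linear[OF T] test_mult(2)[OF c(1)] smooth_mult
        smooth_diff smooth_add smooth_norm_sq smooth_nth smooth_const)
  then show ?thesis using pairing_kernel_nonneg[OF assms, of y] by simp
qed

lemma weakly_positive_zero_nonneg:
  fixes T :: "'n::{finite,linorder} current"
  assumes T: "weakly_positive U 0 T" and c: "c \<in> test_functions U" "\<And>x. 0 \<le> c x"
  shows "0 \<le> volume_sign TYPE('n) * T UNIV UNIV c"
proof -
  have "0 \<le> pairing T (fun_form c)"
    \<comment> \<open>In bidegree (0,0) the only product of squares is the empty one.\<close>
    by (rule pairing_lists_nonneg[OF T c, where W = "{[]}" and w = "\<lambda>(e::'n) i x. 0"])
      (auto simp: fun_form_def unit_form_def)
  also have "pairing T (fun_form c) = volume_sign TYPE('n) * T UNIV UNIV c"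
  proof -
    have "wedge_sign I L (UNIV - I) (UNIV - L) * T I L (\<lambda>x. fun_form c (UNIV - I) (UNIV - L) x * 1)
        = (if I = UNIV \<and> L = UNIV then T UNIV UNIV c else 0)" for I L
    proof (cases "I = UNIV \<and> L = UNIV")
      case True
      then show ?thesis by (simp add: fun_form_def wedge_sign_def)
    next
      case False
      then have nf: "\<not> (UNIV - I = {} \<and> UNIV - L = {})" by auto
      have "(\<lambda>x. fun_form c (UNIV - I) (UNIV - L) x * 1) = (\<lambda>x. 0)"
        by (simp only: fun_form_def if_not_P[OF nf] mult_1_right)
      then show ?thesis
        unfolding if_not_P[OF False] using linear_on_zero[OF weakly_positive_linear[OF T]] by simp
    qed
    then have "wedge_current T (fun_form c) UNIV UNIV (\<lambda>x. 1)
        = (\<Sum>(I :: 'n set)\<in>UNIV. \<Sum>(L :: 'n set)\<in>UNIV. if I = UNIV \<and> L = UNIV then T UNIV UNIV c else 0)"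
      unfolding wedge_current_def by simp
    also have "\<dots> = (\<Sum>(I :: 'n set)\<in>UNIV. if I = UNIV then (\<Sum>(L :: 'n set)\<in>UNIV. if L = UNIV then T UNIV UNIV c else 0) else 0)"
      by (intro sum.cong refl) auto
    also have "\<dots> = T UNIV UNIV c" by simp
    finally show ?thesis by (simp add: pairing_def)
  qed
  finally show ?thesis .
qed

lemma concave_rho_nonpos:
  fixes T :: "'n::{finite,linorder} current"
  assumes T: "\<And>I L. linear_on U (T I L)"
    and con: "concave_current U 1 (wedge_current T (wedge_power beta q))"
    and c: "c \<in> test_functions U" "\<And>x. 0 \<le> c x"
  shows "(\<Sum>i\<in>UNIV. \<Sum>j\<in>UNIV. rho q T i j (partial j (partial i c))) \<le> 0"
proof -
  let ?R = "wedge_current T (wedge_power beta q)"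
  have "weakly_positive U 0 (d_current (dsharp_current (neg_current ?R)))"
    using con by (simp add: concave_current_def convex_current_def)
  from weakly_positive_zero_nonneg[OF this c]
  have "0 \<le> volume_sign TYPE('n) * d_current (dsharp_current (neg_current ?R)) UNIV UNIV c" .
  also have "d_current (dsharp_current (neg_current ?R)) UNIV UNIV c = - d_current (dsharp_current ?R) UNIV UNIV c"
    unfolding ddsharp_current by (simp add: neg_current_def sum_negf)
  finally show ?thesis using ddsharp_of_wedge_beta[where T = T and q = q, OF T c(1)] by simp
qed

section \<open>Superharmonic kernels\<close>

text \<open>The derivatives of the function with \<open>f' t = - t\<^bsup>-p/2\<^esup>\<close>; \<open>L\<close> only normalises \<open>f\<close> for \<open>p = 2\<close>.\<close>

definition kern :: "nat \<Rightarrow> real \<Rightarrow> nat \<Rightarrow> real \<Rightarrow> real" where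
  "kern p L m t = (case m of
      0 \<Rightarrow> if p = 2 then ln L - ln t else 2 / (real p - 2) * t powr (1 - real p / 2)
    | Suc k \<Rightarrow> - ((\<Prod>i<k. - (real p / 2) - real i) * t powr (- (real p / 2) - real k)))"

lemma kern_deriv:
  assumes "2 \<le> p" "0 < t"
  shows "(kern p L m has_real_derivative kern p L (Suc m) t) (at t)"
proof (cases m)
  case 0
  show ?thesis
  proof (cases "p = 2")
    case True
    have "((\<lambda>t. ln L - ln t) has_real_derivative 0 - 1 / t) (at t)"
      by (intro DERIV_diff DERIV_const DERIV_ln_divide assms)
    moreover have "kern p L 0 = (\<lambda>t. ln L - ln t)" using True by (auto simp: kern_def)
    moreover have "kern p L (Suc 0) t = 0 - 1 / t"
      using True assms by (simp add: kern_def powr_minus_divide)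
    ultimately show ?thesis using 0 by simp
  next
    case False
    have "((\<lambda>t. 2 / (real p - 2) * t powr (1 - real p / 2)) has_real_derivative
        2 / (real p - 2) * ((1 - real p / 2) * t powr (1 - real p / 2 - 1))) (at t)"
      by (intro DERIV_cmult has_real_derivative_powr assms)
    moreover have "kern p L 0 = (\<lambda>t. 2 / (real p - 2) * t powr (1 - real p / 2))"
      using False by (auto simp: kern_def)
    moreover have "2 / (real p - 2) * (1 - real p / 2) = - 1"
      using False assms(1) by (simp add: field_simps)
    then have "kern p L (Suc 0) t = 2 / (real p - 2) * ((1 - real p / 2) * t powr (1 - real p / 2 - 1))"
      by (simp add: kern_def mult.assoc[symmetric])
    ultimately show ?thesis using 0 by simp
  qed
next
  case (Suc k)
  have eq: "kern p L (Suc k) = (\<lambda>t. - ((\<Prod>i<k. - (real p / 2) - real i) * t powr (- (real p / 2) - real k)))" for k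
    by (auto simp: kern_def)
  show ?thesis unfolding Suc eq by (rule DERIV_minus[OF powr_chain[OF assms(2)]])
qed

lemma kern_1: "kern p L (Suc 0) t = - (t powr (- (real p / 2)))"
  by (simp add: kern_def)

lemma kern_2: "kern p L (Suc (Suc 0)) t = real p / 2 * t powr (- (real p / 2) - 1)"
  by (simp add: kern_def)

lemma kern_antimono:
  assumes "2 \<le> p" "0 < t" "t \<le> u"
  shows "kern p L 0 u \<le> kern p L 0 t"
proof (rule DERIV_nonpos_imp_nonincreasing[OF assms(3)])
  fix x assume "t \<le> x" "x \<le> u"
  then have "0 < x" using assms by simp
  then show "\<exists>y. (kern p L 0 has_real_derivative y) (at x) \<and> y \<le> 0"
    using kern_deriv[OF assms(1), of x L 0] by (intro exI[of _ "kern p L (Suc 0) x"]) (simp add: kern_1)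
qed

lemma kern_nonneg: "2 \<le> p \<Longrightarrow> 0 < t \<Longrightarrow> t \<le> L \<Longrightarrow> 0 \<le> kern p L 0 t"
  by (auto simp: kern_def)

text \<open>Mean value theorem on the interval from r^2 to 4 r^2, of length 3 r^2, in which -f' is
  at least (2 r)^-p. The product is 3/2^p times r^(2-p), and this exponent is what singles out
  Hausdorff dimension p - 2.\<close>

lemma kern_growth:
  assumes p: "2 \<le> p" and r: "0 < r"
  shows "3 / 2 ^ p / r ^ (p - 2) \<le> kern p L 0 (r\<^sup>2) - kern p L 0 ((2 * r)\<^sup>2)"
proof -
  have lt: "r\<^sup>2 < (2 * r)\<^sup>2" using r by (intro power_strict_mono) auto
  have "\<exists>z. r\<^sup>2 < z \<and> z < (2 * r)\<^sup>2 \<and> kern p L 0 ((2 * r)\<^sup>2) - kern p L 0 (r\<^sup>2) = ((2 * r)\<^sup>2 - r\<^sup>2) * kern p L (Suc 0) z"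
  proof (rule MVT2[OF lt])
    fix x assume "r\<^sup>2 \<le> x" "x \<le> (2 * r)\<^sup>2"
    then have "0 < x" using r by (smt (verit) zero_less_power)
    then show "(kern p L 0 has_real_derivative kern p L (Suc 0) x) (at x)" by (rule kern_deriv[OF p])
  qed
  then obtain z where z: "r\<^sup>2 < z" "z < (2 * r)\<^sup>2"
    "kern p L 0 ((2 * r)\<^sup>2) - kern p L 0 (r\<^sup>2) = ((2 * r)\<^sup>2 - r\<^sup>2) * kern p L (Suc 0) z" by auto
  have z0: "0 < z" using z(1) r by (smt (verit) zero_less_power)
  have "((2 * r)\<^sup>2) powr (- (real p / 2)) \<le> z powr (- (real p / 2))"
    using z z0 by (intro powr_mono2') auto
  moreover have "((2 * r)\<^sup>2) powr (- (real p / 2)) = 1 / (2 * r) ^ p"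
  proof -
    have "((2 * r)\<^sup>2) powr (- (real p / 2)) = ((2 * r) powr 2) powr (- (real p / 2))"
      using r by simp
    also have "\<dots> = (2 * r) powr (- real p)" unfolding powr_powr by simp
    also have "\<dots> = 1 / (2 * r) ^ p" using r by (simp add: powr_minus_divide powr_realpow)
    finally show ?thesis .
  qed
  ultimately have "3 * r\<^sup>2 * (1 / (2 * r) ^ p) \<le> 3 * r\<^sup>2 * z powr (- (real p / 2))"
    by (intro mult_left_mono) auto
  also have "\<dots> = kern p L 0 (r\<^sup>2) - kern p L 0 ((2 * r)\<^sup>2)"
    using z(3) by (simp add: kern_1 power_mult_distrib)
  finally have *: "3 * r\<^sup>2 * (1 / (2 * r) ^ p) \<le> kern p L 0 (r\<^sup>2) - kern p L 0 ((2 * r)\<^sup>2)" .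
  have "p - 2 + 2 = p" using p by simp
  then have "r ^ p = r ^ (p - 2 + 2)" by (simp only:)
  then have "r ^ p = r ^ (p - 2) * r\<^sup>2" by (simp only: power_add)
  then have "3 * r\<^sup>2 * (1 / (2 * r) ^ p) = 3 / 2 ^ p / r ^ (p - 2)"
    using r by (simp add: power_mult_distrib)
  with * show ?thesis by simp
qed

lemma kern_kernel:
  fixes K :: "'a::metric_space set"
  assumes "2 \<le> p" "64 \<le> L" "\<And>x y. x \<in> K \<Longrightarrow> y \<in> K \<Longrightarrow> (dist x y)\<^sup>2 + 1 \<le> L"
  shows "kernel (kern p L 0) (p - 2) (3 / 2 ^ p) L K"
  by standard (use assms kern_antimono kern_nonneg kern_growth in auto)

lemma smooth_kern: "2 \<le> p \<Longrightarrow> 0 < r \<Longrightarrow> smooth (\<lambda>x. kern p L m ((norm (x - y))\<^sup>2 + r\<^sup>2))"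
  by (rule smooth_compose[where D = "{0<..}" and F = "kern p L" and g = "\<lambda>x. (norm (x - y))\<^sup>2 + r\<^sup>2"])
    (auto intro!: kern_deriv smooth_add smooth_norm_sq simp: add_nonneg_pos)

lemma partial_norm_sq_shift: "partial i (\<lambda>x::'n::finite space. (norm (x - y))\<^sup>2 + c) = (\<lambda>x. 2 * (x $ i - y $ i))"
proof
  fix x :: "'n space"
  have "((\<lambda>x::'n space. (norm (x - y))\<^sup>2 + c) has_derivative (\<lambda>h. 2 * ((x - y) \<bullet> h))) (at x)"
    unfolding power2_norm_eq_inner
    by (auto intro!: derivative_eq_intros simp: inner_commute)
  from partial_eqI[OF this] show "partial i (\<lambda>x. (norm (x - y))\<^sup>2 + c) x = 2 * (x $ i - y $ i)"
    by (simp add: inner_axis)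
qed

lemma partial_kern:
  assumes "2 \<le> p" "0 < r"
  shows "partial i (\<lambda>x. kern p L m ((norm (x - y))\<^sup>2 + r\<^sup>2))
    = (\<lambda>x. kern p L (Suc m) ((norm (x - y))\<^sup>2 + r\<^sup>2) * (2 * (x $ i - y $ i)))"
proof
  fix x
  have "0 < (norm (x - y))\<^sup>2 + r\<^sup>2" using assms by (simp add: add_nonneg_pos)
  from kern_deriv[OF assms(1) this, of L m]
  have "partial i (\<lambda>x. kern p L m ((norm (x - y))\<^sup>2 + r\<^sup>2)) x
      = kern p L (Suc m) ((norm (x - y))\<^sup>2 + r\<^sup>2) * partial i (\<lambda>x. (norm (x - y))\<^sup>2 + r\<^sup>2) x"
    by (rule partial_compose) (intro smooth_differentiable smooth_add smooth_norm_sq smooth_const)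
  then show "partial i (\<lambda>x. kern p L m ((norm (x - y))\<^sup>2 + r\<^sup>2)) x
      = kern p L (Suc m) ((norm (x - y))\<^sup>2 + r\<^sup>2) * (2 * (x $ i - y $ i))"
    by (simp only: partial_norm_sq_shift)
qed

lemma smooth_sum_list: "(\<And>z. z \<in> set X \<Longrightarrow> smooth (F z)) \<Longrightarrow> smooth (\<lambda>x. \<Sum>z\<leftarrow>X. F z x)"
  by (induction X) (auto intro: smooth_add)

lemma partial_sum_list:
  "(\<And>z. z \<in> set X \<Longrightarrow> smooth (F z)) \<Longrightarrow> partial i (\<lambda>x. \<Sum>z\<leftarrow>X. F z x) = (\<lambda>x. \<Sum>z\<leftarrow>X. partial i (F z) x)"
proof (induction X)
  case (Cons z X)
  then have "partial i (\<lambda>x. F z x + (\<Sum>z\<leftarrow>X. F z x)) = (\<lambda>x. partial i (F z) x + partial i (\<lambda>x. \<Sum>z\<leftarrow>X. F z x) x)"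
    by (intro partial_add smooth_differentiable smooth_sum_list) auto
  with Cons show ?case by simp
qed simp

definition charge :: "nat \<Rightarrow> real \<Rightarrow> real \<times> 'n::finite space \<times> real \<Rightarrow> 'n space \<Rightarrow> real" where
  "charge p L z x = fst z * kern p L 0 ((norm (x - fst (snd z)))\<^sup>2 + (snd (snd z))\<^sup>2)"

lemma potential_charge: "potential (kern p L 0) X = (\<lambda>x. \<Sum>z\<leftarrow>X. charge p L z x)"
  by (auto simp: potential_def charge_def dist_norm split_def)

lemma charges_onD:
  "charges_on K X \<Longrightarrow> z \<in> set X \<Longrightarrow> 0 \<le> fst z \<and> fst (snd z) \<in> K \<and> 0 < snd (snd z) \<and> snd (snd z) \<le> 1"
  unfolding charges_on_def by (auto simp: split_def)

lemma smooth_charge: "2 \<le> p \<Longrightarrow> 0 < snd (snd z) \<Longrightarrow> smooth (charge p L z)"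
  unfolding charge_def[abs_def] by (intro smooth_mult smooth_const smooth_kern)

lemma partial_charge:
  assumes "2 \<le> p" "0 < snd (snd z)"
  shows "partial i (charge p L z) = (\<lambda>x. fst z * (kern p L (Suc 0) ((norm (x - fst (snd z)))\<^sup>2 + (snd (snd z))\<^sup>2)
    * (2 * (x $ i - fst (snd z) $ i))))"
  unfolding charge_def[abs_def]
  by (subst partial_cmult) (auto simp: partial_kern[OF assms] intro!: smooth_differentiable smooth_kern assms)

text \<open>The Hessian 2 f'(t) \<delta>_ij + 4 f''(t) z_i z_j, with f' = -t^(-p/2) and f'' = (p/2)
  t^(-p/2-1). The choice of f makes it, for a nonnegative charge, a nonpositive multiple of t
  \<delta>_ij - p z_i z_j, the tensor whose pairing with R is nonnegative.\<close>

lemma partial2_charge: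
  assumes "2 \<le> p" "0 < snd (snd z)"
  defines "y \<equiv> fst (snd z)" and "r \<equiv> snd (snd z)"
  shows "partial j (partial i (charge p L z)) x =
    - (2 * fst z * ((norm (x - y))\<^sup>2 + r\<^sup>2) powr (- (real p / 2) - 1) *
      (((norm (x - y))\<^sup>2 + r\<^sup>2) * delta i j - real p * ((x $ i - y $ i) * (x $ j - y $ j))))"
proof -
  let ?t = "(norm (x - y))\<^sup>2 + r\<^sup>2"
  have r: "0 < r" using assms by simp
  have t: "0 < ?t" using r by (simp add: add_nonneg_pos)
  have lin: "partial j (\<lambda>x::'a space. 2 * (x $ i - y $ i)) = (\<lambda>x. 2 * delta i j)"
  proof -
    have "partial j (\<lambda>x::'a space. 2 * (x $ i - y $ i)) = (\<lambda>x. 2 * partial j (\<lambda>x. x $ i + - (y $ i)) x)"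
      by (subst partial_cmult[symmetric]) (auto intro!: smooth_differentiable smooth_diff smooth_nth)
    also have "partial j (\<lambda>x::'a space. x $ i + - (y $ i)) = (\<lambda>x. partial j (\<lambda>x. x $ i) x + partial j (\<lambda>x. - (y $ i)) x)"
      by (rule partial_add) (auto intro!: smooth_differentiable smooth_nth)
    finally show ?thesis by (auto simp: partial_nth)
  qed
  have "partial j (partial i (charge p L z)) x = fst z * partial j (\<lambda>x. kern p L (Suc 0) ((norm (x - y))\<^sup>2 + r\<^sup>2) * (2 * (x $ i - y $ i))) x"
    unfolding partial_charge[OF assms(1,2)] y_def[symmetric] r_def[symmetric]
    by (subst partial_cmult) (auto intro!: smooth_differentiable smooth_mult smooth_kern smooth_diff smooth_nth assms(1) r)
  also have "partial j (\<lambda>x. kern p L (Suc 0) ((norm (x - y))\<^sup>2 + r\<^sup>2) * (2 * (x $ i - y $ i))) x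
      = partial j (\<lambda>x. kern p L (Suc 0) ((norm (x - y))\<^sup>2 + r\<^sup>2)) x * (2 * (x $ i - y $ i))
        + kern p L (Suc 0) ?t * partial j (\<lambda>x. 2 * (x $ i - y $ i)) x"
    by (subst partial_mult) (auto intro!: smooth_differentiable smooth_mult smooth_kern smooth_diff smooth_nth assms(1) r)
  also have "\<dots> = kern p L (Suc (Suc 0)) ?t * (2 * (x $ j - y $ j)) * (2 * (x $ i - y $ i)) + kern p L (Suc 0) ?t * (2 * delta i j)"
    unfolding partial_kern[OF assms(1) r] lin ..
  also have "kern p L (Suc 0) ?t = - (?t * ?t powr (- (real p / 2) - 1))"
    using t by (simp add: kern_1 powr_mult_base)
  finally show ?thesis unfolding kern_2 by (simp add: algebra_simps)
qed

section \<open>Cutoff functions\<close>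

abbreviation X2 :: "real poly" where "X2 \<equiv> [:0, 0, 1:]"
abbreviation X4 :: "real poly" where "X4 \<equiv> [:0, 0, 0, 0, 1:]"

lemma flat_deriv_one: "flat_deriv 1 = X2"
  by (simp add: flat_deriv_def)

text \<open>With psi = \<open>flat 1\<close>, psi' = \<open>flat X2\<close> and psi'' =
  \<open>flat (flat_deriv X2)\<close>, all three are multiples of e = \<open>flat X4\<close>, namely
  u^4 e, u^2 e and (1 - 2 u) e. Consequently psi'^2 = psi e, the balance needed for completing a
  square.\<close>

lemma flat_relations:
  "flat X2 u = u\<^sup>2 * flat X4 u" "flat 1 u = u ^ 4 * flat X4 u"
  "flat (flat_deriv X2) u = (1 - 2 * u) * flat X4 u"
  by (auto simp: flat_def flat_deriv_def pderiv_pCons field_simps power2_eq_square power4_eq_xxxx)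

lemma flat_X_nonneg: "0 \<le> flat X2 u" "0 \<le> flat X4 u"
  by (auto simp: flat_def)

lemma flat_le_one: "flat 1 u \<le> 1"
  by (auto simp: flat_def)

lemma flat_isCont: "isCont (flat P) u"
  using flat_has_derivative DERIV_isCont by blast

lemma flat_bounded: obtains B where "0 < B" "\<And>u. u \<le> 1 \<Longrightarrow> \<bar>flat P u\<bar> \<le> B"
proof -
  have "compact (flat P ` {0..1})"
    by (intro compact_continuous_image continuous_at_imp_continuous_on) (auto simp: flat_isCont)
  then obtain B where B: "0 < B" "\<forall>v\<in>flat P ` {0..1}. norm v \<le> B"
    using bounded_pos compact_imp_bounded by blast
  have "\<bar>flat P u\<bar> \<le> B" if "u \<le> 1" for u
  proof (cases "0 \<le> u")
    case True
    with that B(2) show ?thesis by auto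
  next
    case False
    with B(1) show ?thesis by (simp add: flat_nonpos)
  qed
  with B(1) that show thesis by blast
qed

lemma partial_flat:
  assumes "smooth h"
  shows "partial i (\<lambda>x. flat P (1/4 - h x)) = (\<lambda>x. - flat (flat_deriv P) (1/4 - h x) * partial i h x)"
proof
  fix x
  have "partial i (\<lambda>x. flat P (1/4 - h x)) x = flat (flat_deriv P) (1/4 - h x) * partial i (\<lambda>x. 1/4 - h x) x"
    by (rule partial_compose[OF flat_has_derivative]) (intro smooth_differentiable smooth_diff smooth_const assms)
  also have "partial i (\<lambda>x. 1/4 - h x) x = - partial i h x"
    using partial_add[of "\<lambda>x. 1/4" "\<lambda>x. - 1 * h x" i] partial_cmult[of h i "- 1"] smooth_differentiable[OF assms]
      smooth_differentiable[OF smooth_minus[OF assms]] by simp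
  finally show "partial i (\<lambda>x. flat P (1/4 - h x)) x = - flat (flat_deriv P) (1/4 - h x) * partial i h x" by simp
qed

lemma partial2_mult:
  assumes "smooth f" "smooth g"
  shows "partial j (partial i (\<lambda>x. f x * g x)) x = partial j (partial i f) x * g x + partial i f x * partial j g x
    + partial j f x * partial i g x + f x * partial j (partial i g) x"
proof -
  note d = smooth_differentiable[OF assms(1)] smooth_differentiable[OF assms(2)]
    smooth_differentiable[OF smooth_partial[OF assms(1)]] smooth_differentiable[OF smooth_partial[OF assms(2)]]
  have "partial j (partial i (\<lambda>x. f x * g x)) = partial j (\<lambda>x. partial i f x * g x + f x * partial i g x)"
    by (simp add: partial_mult d)
  also have "\<dots> = (\<lambda>x. partial j (\<lambda>x. partial i f x * g x) x + partial j (\<lambda>x. f x * partial i g x) x)"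
    by (rule partial_add) (auto intro!: smooth_differentiable smooth_mult smooth_partial assms)
  finally show ?thesis by (simp add: partial_mult d)
qed

text \<open>On \<open>K\<close> the argument 1/4 - h is at most -3/4, so the cutoff vanishes near
  \<open>K\<close>; the support stays in the closed set h \<le> 1/4, which avoids
  \<open>K\<close>.\<close>

lemma cutoff_test:
  assumes "\<phi> \<in> test_functions U" "smooth h" "\<And>x. x \<in> K \<Longrightarrow> 1 \<le> h x"
  shows "(\<lambda>x. flat P (1/4 - h x) * \<phi> x) \<in> test_functions (U - K)"
proof -
  obtain C where C: "compact C" "C \<subseteq> U" "\<And>x. x \<notin> C \<Longrightarrow> \<phi> x = 0"
    by (rule test_compactE[OF assms(1)]) (rule that)
  have "closed {x. h x \<le> 1/4}"
    by (intro closed_Collect_le smooth_continuous assms continuous_on_const)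
  then have cp: "compact (C \<inter> {x. h x \<le> 1/4})" using C by (intro compact_Int_closed)
  have sm: "smooth (\<lambda>x. flat P (1/4 - h x) * \<phi> x)"
    by (intro smooth_mult smooth_flat smooth_diff smooth_const assms test_smooth[OF assms(1)])
  show ?thesis
  proof (rule test_functionsI[OF sm cp])
    show "C \<inter> {x. h x \<le> 1/4} \<subseteq> U - K" using C(2) assms(3) by fastforce
    fix x assume "x \<notin> C \<inter> {x. h x \<le> 1/4}"
    then have "x \<notin> C \<or> 1/4 < h x" by auto
    then show "flat P (1/4 - h x) * \<phi> x = 0" using C(3) by (auto simp: flat_nonpos)
  qed
qed

text \<open>Origin of the 1/4: with u = 1/4 - h the factor of psi'' is 1 - 2 u = 1/2 + 2 h. The half
  absorbs the cross terms weighted by z into a square, which costs -8 u^4 e z^2 times the gradients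
  of \<eta>; the part 2 h has its own sign. The cross terms weighted by 1 - z are kept
  apart.\<close>

lemma cutoff_algebra:
  fixes u e hi hj ni nj n z H hij :: real
  shows "((1 - 2 * u) * e * hj * hi - u\<^sup>2 * e * hij) * (n * n) + - (u\<^sup>2 * e) * hi * (2 * n * nj)
      + - (u\<^sup>2 * e) * hj * (2 * n * ni) + u ^ 4 * e * H
    = u ^ 4 * e * H + 1/2 * e * ((n * hi - 4 * u\<^sup>2 * (z * ni)) * (n * hj - 4 * u\<^sup>2 * (z * nj)))
      + (- 8) * (u ^ 4 * e * (z * z * (ni * nj))) + e * (2 * (1/4 - u) * (n * n)) * (hi * hj)
      + (- 2) * (u\<^sup>2 * e * (hi * ((1 - z) * n * nj) + hj * ((1 - z) * n * ni))) + u\<^sup>2 * e * (n * n) * (- hij)"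
  by (simp add: field_simps power2_eq_square power4_eq_xxxx)

text \<open>Completing the square: the cross terms \<open>\<nabla>h \<otimes> \<nabla>\<eta>\<close> near \<open>K\<close> are absorbed by half of the
  convexity of the flat function, at the price of a term without derivatives of \<open>h\<close>.\<close>

lemma partial2_cutoff:
  fixes h \<eta> \<zeta> \<theta> :: "'n::finite space \<Rightarrow> real"
  assumes h: "smooth h" and \<eta>: "smooth \<eta>"
    and \<theta>: "\<eta> x \<noteq> 0 \<or> partial i \<eta> x \<noteq> 0 \<Longrightarrow> \<theta> x = 1"
  defines "u \<equiv> 1/4 - h x"
  shows "partial j (partial i (\<lambda>x. flat 1 (1/4 - h x) * (\<eta> x * \<eta> x))) x =
      flat 1 u * partial j (partial i (\<lambda>x. \<eta> x * \<eta> x)) x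
    + (1/2 * (flat X4 u * \<theta> x)) * ((\<eta> x * partial i h x - 4 * u\<^sup>2 * (\<zeta> x * partial i \<eta> x)) * (\<eta> x * partial j h x - 4 * u\<^sup>2 * (\<zeta> x * partial j \<eta> x)))
    + (- 8) * (flat 1 u * (\<zeta> x * \<zeta> x * (partial i \<eta> x * partial j \<eta> x)))
    + (flat X4 u * (2 * h x * (\<eta> x * \<eta> x))) * (partial i h x * partial j h x)
    + (- 2) * (flat X2 u * (partial i h x * ((1 - \<zeta> x) * \<eta> x * partial j \<eta> x) + partial j h x * ((1 - \<zeta> x) * \<eta> x * partial i \<eta> x)))
    + flat X2 u * (\<eta> x * \<eta> x) * (- partial j (partial i h) x)"
proof -
  let ?g = "\<lambda>x. flat 1 (1/4 - h x)"
  have sg: "smooth ?g" by (intro smooth_flat smooth_diff smooth_const h)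
  have s\<eta>: "smooth (\<lambda>x. \<eta> x * \<eta> x)" by (intro smooth_mult \<eta>)
  have g1: "partial i ?g = (\<lambda>x. - flat X2 (1/4 - h x) * partial i h x)" for i
    using partial_flat[OF h, of i 1] by (simp add: flat_deriv_one)
  have g2: "partial j (partial i ?g) x = flat (flat_deriv X2) u * partial j h x * partial i h x - flat X2 u * partial j (partial i h) x"
  proof -
    have "partial j (partial i ?g) x = partial j (\<lambda>x. - 1 * flat X2 (1/4 - h x)) x * partial i h x + - 1 * flat X2 u * partial j (partial i h) x"
    proof -
      have "partial i ?g = (\<lambda>x. (- 1 * flat X2 (1/4 - h x)) * partial i h x)" unfolding g1 by simp
      moreover have "partial j (\<lambda>x. (- 1 * flat X2 (1/4 - h x)) * partial i h x)
          = (\<lambda>x. partial j (\<lambda>x. - 1 * flat X2 (1/4 - h x)) x * partial i h x + (- 1 * flat X2 (1/4 - h x)) * partial j (partial i h) x)"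
        by (rule partial_mult) (intro smooth_differentiable smooth_partial smooth_mult smooth_const smooth_flat smooth_diff h)+
      ultimately show ?thesis by (simp add: u_def)
    qed
    also have "partial j (\<lambda>x. - 1 * flat X2 (1/4 - h x)) x = - 1 * (- flat (flat_deriv X2) u * partial j h x)"
      unfolding u_def by (subst partial_cmult) (auto simp: partial_flat[OF h] intro!: smooth_differentiable smooth_flat smooth_diff h)
    finally show ?thesis by simp
  qed
  have e1: "partial i (\<lambda>x. \<eta> x * \<eta> x) x = 2 * \<eta> x * partial i \<eta> x" for i
    by (subst partial_mult) (auto intro!: smooth_differentiable \<eta>)
  have "partial j (partial i (\<lambda>x. ?g x * (\<eta> x * \<eta> x))) x =
      (flat (flat_deriv X2) u * partial j h x * partial i h x - flat X2 u * partial j (partial i h) x) * (\<eta> x * \<eta> x)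
      + (- flat X2 u * partial i h x) * (2 * \<eta> x * partial j \<eta> x) + (- flat X2 u * partial j h x) * (2 * \<eta> x * partial i \<eta> x)
      + flat 1 u * partial j (partial i (\<lambda>x. \<eta> x * \<eta> x)) x"
    by (simp only: partial2_mult[OF sg s\<eta>] g2 e1) (simp only: g1 u_def)
  moreover have hu: "h x = 1/4 - u" by (simp add: u_def)
  moreover have "(1/2 * (flat X4 u * \<theta> x)) * ((\<eta> x * partial i h x - 4 * u\<^sup>2 * (\<zeta> x * partial i \<eta> x)) * (\<eta> x * partial j h x - 4 * u\<^sup>2 * (\<zeta> x * partial j \<eta> x)))
      = (1/2 * flat X4 u) * ((\<eta> x * partial i h x - 4 * u\<^sup>2 * (\<zeta> x * partial i \<eta> x)) * (\<eta> x * partial j h x - 4 * u\<^sup>2 * (\<zeta> x * partial j \<eta> x)))"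
    using \<theta> by (cases "\<eta> x = 0 \<and> partial i \<eta> x = 0") auto
  ultimately show ?thesis
    by (simp only: flat_relations hu cutoff_algebra[where z = "\<zeta> x"])
qed

section \<open>The main estimate\<close>

lemma test_compact_partialE:
  assumes "\<phi> \<in> test_functions U"
  obtains C where "compact C" "C \<subseteq> U" "\<And>x. x \<notin> C \<Longrightarrow> \<phi> x = 0" "\<And>i x. x \<notin> C \<Longrightarrow> partial i \<phi> x = 0"
proof -
  have "compact (closure {x. \<phi> x \<noteq> 0})" "closure {x. \<phi> x \<noteq> 0} \<subseteq> U"
    using assms by (auto simp: test_functions_def)
  moreover have "\<phi> x = 0" "partial i \<phi> x = 0" if "x \<notin> closure {x. \<phi> x \<noteq> 0}" for i x
    using test_functionsE[OF assms, of i] that by blast+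
  ultimately show thesis using that by blast
qed

text \<open>Convergence is required only off \<open>K\<close>: this is where the absence of mass on
  \<open>K\<close> enters.\<close>

lemma radon_dct:
  fixes f :: "nat \<Rightarrow> 'n::finite space \<Rightarrow> real"
  assumes \<mu>: "radon_measure_on U \<mu>" and K: "emeasure \<mu> K = 0" "compact K"
    and C: "compact C" "C \<subseteq> U"
    and f: "\<And>k. f k \<in> borel_measurable borel" "g \<in> borel_measurable borel"
    and b: "\<And>k x. \<bar>f k x\<bar> \<le> b" "\<And>k x. x \<notin> C \<Longrightarrow> f k x = 0"
    and lim: "\<And>x. x \<notin> K \<Longrightarrow> (\<lambda>k. f k x) \<longlonglongrightarrow> g x"
  shows "(\<lambda>k. integral\<^sup>L \<mu> (f k)) \<longlonglongrightarrow> integral\<^sup>L \<mu> g"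
proof (rule integral_dominated_convergence[where w = "\<lambda>x. b * indicator C x"])
  note s = radon_sets[OF \<mu>]
  show "f k \<in> borel_measurable \<mu>" "g \<in> borel_measurable \<mu>" for k
    using f s measurable_cong_sets by blast+
  have "K \<in> null_sets \<mu>" using K s by (auto simp: null_sets_def borel_compact)
  then show "AE x in \<mu>. (\<lambda>k. f k x) \<longlonglongrightarrow> g x"
    using lim by (intro AE_I'[of K]) auto
  show "AE x in \<mu>. norm (f k x) \<le> b * indicator C x" for k
    using b by (intro AE_I2) (auto simp: indicator_def)
  show "integrable \<mu> (\<lambda>x. b * indicator C x)"
    using radon_finite[OF \<mu> C] C(1) by (intro integrable_mult_right) (simp add: s borel_compact)
qed

text \<open>Currents are left behind. \<rho> is the matrix R of signed measures, written as
  combinations of Radon measures on \<Omega> without mass on \<open>K\<close>. It acts on all of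
  \<Omega>, whereas the two positivity properties are known only for weights supported off
  \<open>K\<close>.\<close>

locale extension =
  fixes \<Omega> K :: "'n::finite space set" and p :: nat and \<rho> :: "'n \<Rightarrow> 'n \<Rightarrow> 'n functional"
    and w :: "'n \<Rightarrow> 'n \<Rightarrow> 'm::finite \<Rightarrow> real" and \<tau> :: "'m \<Rightarrow> 'n space measure"
  assumes \<Omega>: "open \<Omega>" and K: "compact K" and p: "2 \<le> p"
    and haus: "sigma_finite_hausdorff (p - 2) K"
    and \<tau>: "\<And>m. radon_measure_on \<Omega> (\<tau> m)" and \<tau>K: "\<And>m. emeasure (\<tau> m) K = 0"
    and \<rho>: "\<And>i j \<phi>. \<phi> \<in> test_functions \<Omega> \<Longrightarrow> \<rho> i j \<phi> = (\<Sum>m\<in>UNIV. w i j m * integral\<^sup>L (\<tau> m) \<phi>)"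
    and square: "\<And>c a. c \<in> test_functions (\<Omega> - K) \<Longrightarrow> (\<And>x. 0 \<le> c x) \<Longrightarrow> (\<And>i. smooth (a i)) \<Longrightarrow>
      0 \<le> (\<Sum>i\<in>UNIV. \<Sum>j\<in>UNIV. \<rho> i j (\<lambda>x. c x * (a i x * a j x)))"
    and superharmonic: "\<And>c y r. c \<in> test_functions (\<Omega> - K) \<Longrightarrow> (\<And>x. 0 \<le> c x) \<Longrightarrow> 0 < r \<Longrightarrow>
      0 \<le> (\<Sum>i\<in>UNIV. \<Sum>j\<in>UNIV. \<rho> i j (\<lambda>x. c x * (((norm (x - y))\<^sup>2 + r\<^sup>2) * delta i j
        - real p * ((x $ i - y $ i) * (x $ j - y $ j)))))"
begin

definition R :: "('n \<Rightarrow> 'n \<Rightarrow> 'n space \<Rightarrow> real) \<Rightarrow> real" where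
  "R A = (\<Sum>i\<in>UNIV. \<Sum>j\<in>UNIV. \<rho> i j (A i j))"

definition D :: "('n space \<Rightarrow> real) \<Rightarrow> real" where
  "D \<phi> = R (\<lambda>i j. partial j (partial i \<phi>))"

lemma \<rho>_linear: "linear_on \<Omega> (\<rho> i j)"
proof -
  have "linear_on \<Omega> (\<lambda>\<phi>. \<Sum>m\<in>UNIV. w i j m * integral\<^sup>L (\<tau> m) \<phi>)"
    using radon_integrable[OF \<tau>] by (intro linear_on_combination) (auto simp: linear_on_def)
  then show ?thesis
    unfolding linear_on_def by (auto simp: \<rho> test_add test_cmult)
qed

lemma R_add:
  assumes "\<And>i j. A i j \<in> test_functions \<Omega>" "\<And>i j. B i j \<in> test_functions \<Omega>"
  shows "R (\<lambda>i j x. A i j x + B i j x) = R A + R B"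
  unfolding R_def using linear_on_add[OF \<rho>_linear assms] by (simp add: sum.distrib)

lemma R_cmult:
  assumes "\<And>i j. A i j \<in> test_functions \<Omega>"
  shows "R (\<lambda>i j x. c * A i j x) = c * R A"
  unfolding R_def using linear_on_cmult[OF \<rho>_linear assms] by (simp add: sum_distrib_left)

lemma R_zero: "R (\<lambda>i j x. 0) = 0"
  unfolding R_def using linear_on_zero[OF \<rho>_linear] by simp

lemma test_sum_list: "(\<And>z. z \<in> set X \<Longrightarrow> F z \<in> test_functions U) \<Longrightarrow> (\<lambda>x. \<Sum>z\<leftarrow>X. F z x) \<in> test_functions U"
  by (induction X) (auto intro: test_add)

lemma R_sum_list:
  assumes "\<And>z i j. z \<in> set X \<Longrightarrow> F z i j \<in> test_functions \<Omega>"
  shows "R (\<lambda>i j x. \<Sum>z\<leftarrow>X. F z i j x) = (\<Sum>z\<leftarrow>X. R (F z))"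
  using assms
proof (induction X)
  case (Cons z X)
  have "R (\<lambda>i j x. F z i j x + (\<Sum>z\<leftarrow>X. F z i j x)) = R (F z) + R (\<lambda>i j x. \<Sum>z\<leftarrow>X. F z i j x)"
    using Cons.prems by (intro R_add test_sum_list) auto
  with Cons show ?case by simp
qed (simp add: R_zero)

lemma R_tendsto:
  assumes A: "\<And>k i j. A k i j \<in> test_functions \<Omega>" and B: "\<And>i j. B i j \<in> test_functions \<Omega>"
    and C: "compact C" "C \<subseteq> \<Omega>" "\<And>k i j x. x \<notin> C \<Longrightarrow> A k i j x = 0"
    and b: "\<And>k i j x. \<bar>A k i j x\<bar> \<le> b i j"
    and lim: "\<And>i j x. x \<notin> K \<Longrightarrow> (\<lambda>k. A k i j x) \<longlonglongrightarrow> B i j x"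
  shows "(\<lambda>k. R (A k)) \<longlonglongrightarrow> R B"
  unfolding R_def
proof (intro tendsto_sum)
  fix i j
  have meas: "\<phi> \<in> borel_measurable borel" if "\<phi> \<in> test_functions \<Omega>" for \<phi>
    using test_measurable[OF refl test_smooth[OF that]] .
  have "(\<lambda>k. integral\<^sup>L (\<tau> m) (A k i j)) \<longlonglongrightarrow> integral\<^sup>L (\<tau> m) (B i j)" for m
    by (rule radon_dct[OF \<tau> \<tau>K K C(1,2) meas[OF A] meas[OF B] b C(3) lim])
  then have "(\<lambda>k. \<Sum>m\<in>UNIV. w i j m * integral\<^sup>L (\<tau> m) (A k i j)) \<longlonglongrightarrow> (\<Sum>m\<in>UNIV. w i j m * integral\<^sup>L (\<tau> m) (B i j))"
    by (intro tendsto_sum tendsto_mult tendsto_const)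
  then show "(\<lambda>k. \<rho> i j (A k i j)) \<longlonglongrightarrow> \<rho> i j (B i j)" by (simp add: \<rho> A B)
qed

text \<open>Three of the six terms of \<open>partial2_cutoff\<close> are nonnegative and are
  dropped: the completed square, the term with 2 h (as h \<ge> 0 where \<eta> is nonzero), and the
  term with second derivatives of h, by superharmonicity of each charge.\<close>

lemma cutoff_estimate:
  assumes \<eta>: "\<eta> \<in> test_functions \<Omega>" and \<zeta>: "smooth \<zeta>"
    and X: "charges_on K X" "\<And>x. x \<in> K \<Longrightarrow> 1 \<le> potential (kern p L 0) X x"
    and nn: "\<And>x. \<eta> x \<noteq> 0 \<Longrightarrow> 0 \<le> potential (kern p L 0) X x"
  defines "h \<equiv> potential (kern p L 0) X"
  shows "R (\<lambda>i j x. flat 1 (1/4 - h x) * partial j (partial i (\<lambda>x. \<eta> x * \<eta> x)) x)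
      - 8 * R (\<lambda>i j x. flat 1 (1/4 - h x) * (\<zeta> x * \<zeta> x * (partial i \<eta> x * partial j \<eta> x)))
      - 2 * R (\<lambda>i j x. flat X2 (1/4 - h x) * (partial i h x * ((1 - \<zeta> x) * \<eta> x * partial j \<eta> x) + partial j h x * ((1 - \<zeta> x) * \<eta> x * partial i \<eta> x)))
    \<le> D (\<lambda>x. flat 1 (1/4 - h x) * (\<eta> x * \<eta> x))"
proof -
  have \<eta>s: "smooth \<eta>" by (rule test_smooth[OF \<eta>])
  have rX: "0 < snd (snd z)" "0 \<le> fst z" if "z \<in> set X" for z using charges_onD[OF X(1) that] by auto
  have ch: "smooth (charge p L z)" if "z \<in> set X" for z using rX[OF that] by (intro smooth_charge p)
  have hs: "smooth h" unfolding h_def potential_charge by (intro smooth_sum_list ch)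
  have h1: "1 \<le> h x" if "x \<in> K" for x using X(2) that by (simp add: h_def)
  have h2: "partial j (partial i h) x = (\<Sum>z\<leftarrow>X. partial j (partial i (charge p L z)) x)" for i j x
  proof -
    have e: "partial i h = (\<lambda>x. \<Sum>z\<leftarrow>X. partial i (charge p L z) x)"
      unfolding h_def potential_charge by (intro partial_sum_list ch)
    have "partial j (partial i h) = (\<lambda>x. \<Sum>z\<leftarrow>X. partial j (partial i (charge p L z)) x)"
      unfolding e by (intro partial_sum_list smooth_partial ch)
    then show ?thesis by simp
  qed
  define u where "u x = 1/4 - h x" for x
  have us: "smooth u" unfolding u_def by (intro smooth_diff smooth_const hs)
  obtain C where C: "compact C" "C \<subseteq> \<Omega>" "\<And>x. x \<notin> C \<Longrightarrow> \<eta> x = 0" "\<And>i x. x \<notin> C \<Longrightarrow> partial i \<eta> x = 0"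
    by (rule test_compact_partialE[OF \<eta>]) (rule that)
  obtain \<theta> W where \<theta>: "\<theta> \<in> test_functions \<Omega>" "\<And>x. 0 \<le> \<theta> x" "C \<subseteq> W" "\<And>x. x \<in> W \<Longrightarrow> \<theta> x = 1"
    using smooth_urysohn[OF C(1) \<Omega> C(2)] by metis
  have \<theta>1: "\<theta> x = 1" if "\<eta> x \<noteq> 0 \<or> partial i \<eta> x \<noteq> 0" for i x
    using that C(3,4) \<theta>(3,4) by blast
  have cut: "(\<lambda>x. flat P (u x) * \<phi> x) \<in> test_functions (\<Omega> - K)" if "\<phi> \<in> test_functions \<Omega>" for P \<phi>
    unfolding u_def by (rule cutoff_test[OF that hs h1])
  have cut': "(\<lambda>x. flat P (u x) * \<phi> x) \<in> test_functions \<Omega>" if "\<phi> \<in> test_functions \<Omega>" for P \<phi>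
    using cut[OF that] by (rule test_mono) auto
  define a where "a i x = \<eta> x * partial i h x - 4 * (u x)\<^sup>2 * (\<zeta> x * partial i \<eta> x)" for i x
  have as: "smooth (a i)" for i
    unfolding a_def by (intro smooth_diff smooth_mult smooth_power smooth_const smooth_partial hs \<eta>s us \<zeta>)
  \<comment> \<open>The positivity properties ask for weights that are test functions off
    \<open>K\<close>. The square comes without compactly supported weight, hence the factor
    \<theta>, which is 1 wherever \<eta> or its gradient is nonzero.\<close>
  define c1 where "c1 x = 1/2 * (flat X4 (u x) * \<theta> x)" for x
  define c2 where "c2 x = flat X4 (u x) * (2 * h x * (\<eta> x * \<eta> x))" for x
  define c3 where "c3 z x = flat X2 (u x) * (2 * fst z * ((norm (x - fst (snd z)))\<^sup>2 + (snd (snd z))\<^sup>2) powr (- (real p / 2) - 1) * (\<eta> x * \<eta> x))" for z x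
  define k where "k z i j x = ((norm (x - fst (snd z)))\<^sup>2 + (snd (snd z))\<^sup>2) * delta i j
        - real p * ((x $ i - fst (snd z) $ i) * (x $ j - fst (snd z) $ j))" for z :: "real \<times> 'n space \<times> real" and i j x
  have \<eta>\<eta>: "(\<lambda>x. \<eta> x * \<eta> x) \<in> test_functions \<Omega>" by (rule test_mult(2)[OF \<eta> \<eta>s])
  have c1: "c1 \<in> test_functions (\<Omega> - K)" "0 \<le> c1 x" for x
  proof -
    show "c1 \<in> test_functions (\<Omega> - K)" unfolding c1_def by (rule test_cmult[OF cut[OF \<theta>(1)]])
    show "0 \<le> c1 x" unfolding c1_def using \<theta>(2) flat_X_nonneg by simp
  qed
  have c2: "c2 \<in> test_functions (\<Omega> - K)" "0 \<le> c2 x" for x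
  proof -
    show "c2 \<in> test_functions (\<Omega> - K)"
      unfolding c2_def by (intro cut test_mult(1)[OF \<eta>\<eta>] smooth_mult smooth_const hs)
    show "0 \<le> c2 x" unfolding c2_def using nn[of x] flat_X_nonneg by (cases "\<eta> x = 0") (auto simp: h_def)
  qed
  have c3: "c3 z \<in> test_functions (\<Omega> - K)" "0 \<le> c3 z x" if "z \<in> set X" for z x
  proof -
    show "c3 z \<in> test_functions (\<Omega> - K)"
      unfolding c3_def using rX[OF that]
      by (intro cut test_mult(1)[OF \<eta>\<eta>] smooth_mult smooth_const smooth_powr smooth_add smooth_norm_sq)
        (auto simp: add_nonneg_pos)
    show "0 \<le> c3 z x" unfolding c3_def using rX[OF that] flat_X_nonneg by auto
  qed
  have ks: "smooth (k z i j)" for z i j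
    unfolding k_def by (intro smooth_diff smooth_mult smooth_add smooth_norm_sq smooth_const smooth_nth)
  let ?A1 = "\<lambda>i j x. flat 1 (u x) * partial j (partial i (\<lambda>x. \<eta> x * \<eta> x)) x"
  let ?A2 = "\<lambda>i j x. c1 x * (a i x * a j x)"
  let ?A3 = "\<lambda>i j x. flat 1 (u x) * (\<zeta> x * \<zeta> x * (partial i \<eta> x * partial j \<eta> x))"
  let ?A4 = "\<lambda>i j x. c2 x * (partial i h x * partial j h x)"
  let ?A5 = "\<lambda>i j x. flat X2 (u x) * (partial i h x * ((1 - \<zeta> x) * \<eta> x * partial j \<eta> x) + partial j h x * ((1 - \<zeta> x) * \<eta> x * partial i \<eta> x))"
  let ?A6 = "\<lambda>i j x. \<Sum>z\<leftarrow>X. c3 z x * k z i j x"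
  have id: "partial j (partial i (\<lambda>x. flat 1 (1/4 - h x) * (\<eta> x * \<eta> x)))
      = (\<lambda>x. ?A1 i j x + (?A2 i j x + (- 8 * ?A3 i j x + (?A4 i j x + (- 2 * ?A5 i j x + ?A6 i j x)))))" for i j
  proof
    fix x
    have "flat X2 (u x) * (\<eta> x * \<eta> x) * (- partial j (partial i h) x) = ?A6 i j x"
    proof -
      have "flat X2 (u x) * (\<eta> x * \<eta> x) * (- partial j (partial i h) x)
          = (\<Sum>z\<leftarrow>X. flat X2 (u x) * (\<eta> x * \<eta> x) * (- partial j (partial i (charge p L z)) x))"
      proof -
        have "c * (- (\<Sum>z\<leftarrow>Y. F z)) = (\<Sum>z\<leftarrow>Y. c * (- F z))" for c :: real and F and Y :: "(real \<times> 'n space \<times> real) list"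
          by (induction Y) (auto simp: algebra_simps)
        then show ?thesis unfolding h2 .
      qed
      also have "\<dots> = ?A6 i j x"
      proof (rule arg_cong[where f = sum_list], rule map_cong[OF refl])
        fix z assume "z \<in> set X"
        then show "flat X2 (u x) * (\<eta> x * \<eta> x) * (- partial j (partial i (charge p L z)) x) = c3 z x * k z i j x"
          using rX by (simp add: partial2_charge p c3_def k_def)
      qed
      finally show ?thesis .
    qed
    then show "partial j (partial i (\<lambda>x. flat 1 (1/4 - h x) * (\<eta> x * \<eta> x))) x
      = ?A1 i j x + (?A2 i j x + (- 8 * ?A3 i j x + (?A4 i j x + (- 2 * ?A5 i j x + ?A6 i j x))))"
      using partial2_cutoff[OF hs \<eta>s, of x i \<theta> j \<zeta>] \<theta>1[of x i]
      unfolding c1_def c2_def a_def u_def by (simp add: add.assoc)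
  qed
  have t\<Omega>: "\<phi> \<in> test_functions (\<Omega> - K) \<Longrightarrow> \<phi> \<in> test_functions \<Omega>" for \<phi> by (erule test_mono) auto
  have p\<eta>: "partial i \<eta> \<in> test_functions \<Omega>" for i by (rule test_partial[OF \<eta>])
  have T1: "?A1 i j \<in> test_functions \<Omega>" for i j by (intro cut' test_partial \<eta>\<eta>)
  have T2: "?A2 i j \<in> test_functions \<Omega>" for i j by (intro test_mult(2)[OF t\<Omega>[OF c1(1)]] smooth_mult as)
  have T3: "?A3 i j \<in> test_functions \<Omega>" for i j
    by (intro cut' test_mult(1)[OF test_mult(2)[OF p\<eta>]] smooth_mult \<zeta> smooth_partial \<eta>s)
  have T4: "?A4 i j \<in> test_functions \<Omega>" for i j by (intro test_mult(2)[OF t\<Omega>[OF c2(1)]] smooth_mult smooth_partial hs)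
  have T5: "?A5 i j \<in> test_functions \<Omega>" for i j
    by (intro cut' test_add test_mult(1)[OF test_mult(1)[OF p\<eta>]] smooth_mult smooth_diff smooth_const \<zeta> smooth_partial \<eta>s hs)
  have T6: "(\<lambda>x. c3 z x * k z i j x) \<in> test_functions \<Omega>" if "z \<in> set X" for z i j
    by (intro test_mult(2)[OF t\<Omega>[OF c3(1)[OF that]]] ks)
  have T6': "?A6 i j \<in> test_functions \<Omega>" for i j by (intro test_sum_list T6)
  have "D (\<lambda>x. flat 1 (1/4 - h x) * (\<eta> x * \<eta> x))
      = R (\<lambda>i j x. ?A1 i j x + (?A2 i j x + (- 8 * ?A3 i j x + (?A4 i j x + (- 2 * ?A5 i j x + ?A6 i j x)))))"
    unfolding D_def id ..
  also have "\<dots> = R ?A1 + (R ?A2 + (R (\<lambda>i j x. - 8 * ?A3 i j x) + (R ?A4 + (R (\<lambda>i j x. - 2 * ?A5 i j x) + R ?A6))))"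
    by (subst R_add | intro T1 T2 T3 T4 T5 T6' test_add test_cmult refl)+
  also have "\<dots> = R ?A1 + (R ?A2 + (- 8 * R ?A3 + (R ?A4 + (- 2 * R ?A5 + (\<Sum>z\<leftarrow>X. R (\<lambda>i j x. c3 z x * k z i j x))))))"
    by (simp only: R_cmult[OF T3] R_cmult[OF T5] R_sum_list[OF T6])
  finally have "D (\<lambda>x. flat 1 (1/4 - h x) * (\<eta> x * \<eta> x))
      = R ?A1 + (R ?A2 + (- 8 * R ?A3 + (R ?A4 + (- 2 * R ?A5 + (\<Sum>z\<leftarrow>X. R (\<lambda>i j x. c3 z x * k z i j x))))))" .
  moreover have "0 \<le> R ?A2" unfolding R_def by (rule square[OF c1 as])
  moreover have "0 \<le> R ?A4" unfolding R_def by (rule square[OF c2 smooth_partial[OF hs]])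
  moreover have "0 \<le> (\<Sum>z\<leftarrow>X. R (\<lambda>i j x. c3 z x * k z i j x))"
  proof (rule sum_list_nonneg)
    fix v assume "v \<in> set (map (\<lambda>z. R (\<lambda>i j x. c3 z x * k z i j x)) X)"
    then obtain z where z: "z \<in> set X" "v = R (\<lambda>i j x. c3 z x * k z i j x)" by auto
    show "0 \<le> v" unfolding z(2) R_def k_def by (rule superharmonic[OF c3[OF z(1)] rX(1)[OF z(1)]])
  qed
  ultimately show ?thesis unfolding u_def by linarith
qed

end

section \<open>Bounds for potentials away from the charges\<close>

lemma total_charge_Cons: "total_charge (z # X) = fst z + total_charge X"
  by (simp add: total_charge_def split_def)

lemma sum_list_charge_bound:
  "(\<And>z. z \<in> set X \<Longrightarrow> 0 \<le> fst z \<and> \<bar>F z\<bar> \<le> B) \<Longrightarrow> \<bar>\<Sum>z\<leftarrow>X. fst z * F z\<bar> \<le> total_charge X * (B::real)"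
proof (induction X)
  case Nil
  then show ?case by (simp add: total_charge_def)
next
  case (Cons z X)
  have "\<bar>fst z * F z\<bar> \<le> fst z * B"
    using Cons.prems[of z] by (simp add: abs_mult mult_left_mono)
  moreover have "\<bar>\<Sum>z\<leftarrow>X. fst z * F z\<bar> \<le> total_charge X * B" using Cons by simp
  ultimately show ?case by (simp add: total_charge_Cons algebra_simps)
qed

text \<open>At distance \<delta> from \<open>K\<close> the kernel and its gradient are bounded, so
  the potential and its gradient are small with the total charge. The factor 2 L bounds 2 |x_i -
  y_i|, because a distance s satisfies s \<le> s^2 + 1 \<le> L.\<close>

lemma potential_bound:
  assumes p: "2 \<le> p" and X: "charges_on K X"
    and d: "\<And>y. y \<in> K \<Longrightarrow> \<delta> \<le> dist x y" "0 < \<delta>" "\<And>y. y \<in> K \<Longrightarrow> (dist x y)\<^sup>2 + 1 \<le> L"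
  shows "\<bar>potential (kern p L 0) X x\<bar> \<le> total_charge X * kern p L 0 (\<delta>\<^sup>2)"
    and "\<bar>partial i (potential (kern p L 0) X) x\<bar> \<le> total_charge X * ((\<delta>\<^sup>2) powr (- (real p / 2)) * (2 * L))"
proof -
  let ?t = "\<lambda>z. (norm (x - fst (snd z)))\<^sup>2 + (snd (snd z))\<^sup>2"
  have t: "0 \<le> fst z" "\<delta>\<^sup>2 \<le> ?t z" "0 < ?t z" "?t z \<le> L" "norm (x - fst (snd z)) \<le> L" if "z \<in> set X" for z
  proof -
    have z: "0 \<le> fst z" "fst (snd z) \<in> K" "0 < snd (snd z)" "snd (snd z) \<le> 1" using charges_onD[OF X that] by auto
    have n: "\<delta> \<le> norm (x - fst (snd z))" "(norm (x - fst (snd z)))\<^sup>2 + 1 \<le> L"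
      using d(1,3)[OF z(2)] by (auto simp: dist_norm)
    have "\<delta>\<^sup>2 \<le> (norm (x - fst (snd z)))\<^sup>2" using n(1) d(2) by (intro power_mono) auto
    then show "\<delta>\<^sup>2 \<le> ?t z" by (simp add: add_increasing2)
    show "0 < ?t z" using z(3) by (simp add: add_nonneg_pos)
    have "(snd (snd z))\<^sup>2 \<le> 1" using z by (intro power_le_one) auto
    then show "?t z \<le> L" using n(2) by linarith
    have "2 * norm (x - fst (snd z)) \<le> (norm (x - fst (snd z)))\<^sup>2 + 1"
      using zero_le_power2[of "norm (x - fst (snd z)) - 1"] by (simp add: power2_diff)
    then show "norm (x - fst (snd z)) \<le> L" using n(2) norm_ge_zero[of "x - fst (snd z)"] by linarith
    show "0 \<le> fst z" by (rule z)
  qed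
  have \<delta>2: "0 < \<delta>\<^sup>2" using d(2) by simp
  have "\<bar>\<Sum>z\<leftarrow>X. fst z * kern p L 0 (?t z)\<bar> \<le> total_charge X * kern p L 0 (\<delta>\<^sup>2)"
  proof (rule sum_list_charge_bound)
    fix z assume "z \<in> set X"
    note tz = t[OF this]
    show "0 \<le> fst z \<and> \<bar>kern p L 0 (?t z)\<bar> \<le> kern p L 0 (\<delta>\<^sup>2)"
      using kern_nonneg[OF p tz(3,4)] kern_antimono[OF p \<delta>2 tz(2), of L] tz(1) by simp
  qed
  then show "\<bar>potential (kern p L 0) X x\<bar> \<le> total_charge X * kern p L 0 (\<delta>\<^sup>2)"
    by (simp add: potential_charge charge_def)
  have r: "0 < snd (snd z)" if "z \<in> set X" for z using charges_onD[OF X that] by simp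
  have "partial i (potential (kern p L 0) X) x = (\<Sum>z\<leftarrow>X. partial i (charge p L z) x)"
    unfolding potential_charge by (subst partial_sum_list) (auto intro: smooth_charge p r)
  also have "\<dots> = (\<Sum>z\<leftarrow>X. fst z * (kern p L (Suc 0) (?t z) * (2 * (x $ i - fst (snd z) $ i))))"
    by (intro arg_cong[where f = sum_list] map_cong refl) (simp add: partial_charge[OF p r])
  also have "\<bar>\<dots>\<bar> \<le> total_charge X * ((\<delta>\<^sup>2) powr (- (real p / 2)) * (2 * L))"
  proof (rule sum_list_charge_bound)
    fix z assume "z \<in> set X"
    note tz = t[OF this]
    have "?t z powr (- (real p / 2)) \<le> (\<delta>\<^sup>2) powr (- (real p / 2))"
      using \<delta>2 tz(2) by (intro powr_mono2') auto
    moreover have "\<bar>x $ i - fst (snd z) $ i\<bar> \<le> L"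
      using component_le_norm_cart[of "x - fst (snd z)" i] tz(5) by simp
    ultimately have "?t z powr (- (real p / 2)) * (2 * \<bar>x $ i - fst (snd z) $ i\<bar>) \<le> (\<delta>\<^sup>2) powr (- (real p / 2)) * (2 * L)"
      by (intro mult_mono) auto
    then show "0 \<le> fst z \<and> \<bar>kern p L (Suc 0) (?t z) * (2 * (x $ i - fst (snd z) $ i))\<bar> \<le> (\<delta>\<^sup>2) powr (- (real p / 2)) * (2 * L)"
    proof -
      have "\<bar>kern p L (Suc 0) (?t z) * (2 * a)\<bar> = ?t z powr (- (real p / 2)) * (2 * \<bar>a\<bar>)" for a
        by (simp add: kern_1 abs_mult)
      then show ?thesis using tz(1) \<open>_ \<le> (\<delta>\<^sup>2) powr (- (real p / 2)) * (2 * L)\<close> by (simp only:)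
    qed
  qed
  finally show "\<bar>partial i (potential (kern p L 0) X) x\<bar> \<le> total_charge X * ((\<delta>\<^sup>2) powr (- (real p / 2)) * (2 * L))" .
qed

context extension
begin

text \<open>The weights \<zeta> that confine the completed square to a neighbourhood of
  \<open>K\<close>. They are plateau functions for the neighbourhoods of radius 1/(m+1), and a point
  off \<open>K\<close> leaves these eventually.\<close>

lemma shrinking_cutoffs:
  obtains \<zeta> :: "nat \<Rightarrow> 'n space \<Rightarrow> real" and W where "\<And>m. smooth (\<zeta> m)" "\<And>m x. \<bar>\<zeta> m x\<bar> \<le> 1"
    "\<And>m. open (W m)" "\<And>m. K \<subseteq> W m" "\<And>m x. x \<in> W m \<Longrightarrow> \<zeta> m x = 1"
    "\<And>x. x \<notin> K \<Longrightarrow> (\<lambda>m. \<zeta> m x) \<longlonglongrightarrow> 0"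
proof -
  define V where "V m = (\<Union>y\<in>K. ball y (inverse (real (Suc m))))" for m
  have V: "open (V m)" "K \<subseteq> V m" for m by (auto simp: V_def)
  have "\<forall>m. \<exists>z. (\<exists>W. z \<in> test_functions (V m) \<and> (\<forall>x. 0 \<le> z x \<and> z x \<le> 1) \<and> open W \<and> K \<subseteq> W \<and> (\<forall>x\<in>W. z x = 1))"
  proof
    fix m
    show "\<exists>z W. z \<in> test_functions (V m) \<and> (\<forall>x. 0 \<le> z x \<and> z x \<le> 1) \<and> open W \<and> K \<subseteq> W \<and> (\<forall>x\<in>W. z x = 1)"
      by (rule smooth_urysohn[OF K V]) blast
  qed
  then obtain z where "\<forall>m. \<exists>W. z m \<in> test_functions (V m) \<and> (\<forall>x. 0 \<le> z m x \<and> z m x \<le> 1) \<and> open W \<and> K \<subseteq> W \<and> (\<forall>x\<in>W. z m x = 1)"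
    by (rule choice[THEN exE]) (rule that)
  then obtain W where zW: "\<forall>m. z m \<in> test_functions (V m) \<and> (\<forall>x. 0 \<le> z m x \<and> z m x \<le> 1) \<and> open (W m) \<and> K \<subseteq> W m \<and> (\<forall>x\<in>W m. z m x = 1)"
    by (rule choice[THEN exE]) (rule that)
  show thesis
  proof (rule that[of z W])
    fix x assume x: "x \<notin> K"
    obtain \<delta> where \<delta>: "0 < \<delta>" "\<And>y. y \<in> K \<Longrightarrow> \<delta> \<le> dist x y"
      using separate_point_closed[OF compact_imp_closed[OF K] x] by blast
    have "eventually (\<lambda>m. inverse (real (Suc m)) < \<delta>) sequentially"
      using order_tendstoD(2)[OF LIMSEQ_inverse_real_of_nat \<delta>(1)] .
    then have "eventually (\<lambda>m. z m x = 0) sequentially"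
    proof eventually_elim
      case (elim m)
      have "x \<notin> V m"
      proof
        assume "x \<in> V m"
        then obtain y where "y \<in> K" "dist y x < inverse (real (Suc m))" by (auto simp: V_def)
        with elim \<delta>(2)[of y] show False by (simp add: dist_commute)
      qed
      then show ?case using test_support[of "z m" "V m" x] zW by blast
    qed
    then show "(\<lambda>m. z m x) \<longlonglongrightarrow> 0" by (rule tendsto_eventually)
  next
    fix m show "smooth (z m)" using zW test_smooth by blast
    show "\<bar>z m x\<bar> \<le> 1" for x using zW by (simp add: abs_le_iff)
  qed (use zW in auto)
qed

text \<open>g_k = psi(1/4 - h_k), for potentials h_k of total charge at most 1/(k+1). The error in
  the estimate of D has two sources with different remedies: near \<open>K\<close> the mass of R on
  shrinking neighbourhoods, away from \<open>K\<close> the decay of grad h_k.\<close>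

lemma approximation:
  assumes \<eta>: "\<eta> \<in> test_functions \<Omega>"
  obtains g :: "nat \<Rightarrow> 'n space \<Rightarrow> real" where
    "\<And>k. (\<lambda>x. g k x * (\<eta> x * \<eta> x)) \<in> test_functions (\<Omega> - K)"
    "\<And>k x. 0 \<le> g k x" "\<And>k x. g k x \<le> 1"
    "\<And>x. x \<notin> K \<Longrightarrow> (\<lambda>k. g k x * (\<eta> x * \<eta> x)) \<longlonglongrightarrow> flat 1 (1/4) * (\<eta> x * \<eta> x)"
    "\<And>e. 0 < e \<Longrightarrow> eventually (\<lambda>k. flat 1 (1/4) * D (\<lambda>x. \<eta> x * \<eta> x) - e \<le> D (\<lambda>x. g k x * (\<eta> x * \<eta> x))) sequentially"
proof -
  have \<eta>s: "smooth \<eta>" by (rule test_smooth[OF \<eta>])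
  have p\<eta>: "partial i \<eta> \<in> test_functions \<Omega>" for i by (rule test_partial[OF \<eta>])
  have \<eta>\<eta>: "(\<lambda>x. \<eta> x * \<eta> x) \<in> test_functions \<Omega>" by (rule test_mult(2)[OF \<eta> \<eta>s])
  obtain C where C: "compact C" "C \<subseteq> \<Omega>" "\<And>x. x \<notin> C \<Longrightarrow> \<eta> x = 0" "\<And>i x. x \<notin> C \<Longrightarrow> partial i \<eta> x = 0"
    by (rule test_compact_partialE[OF \<eta>]) (rule that)
  have "bounded (C \<union> K)" using C(1) K by (simp add: compact_imp_bounded)
  then obtain d where d: "\<And>x y. x \<in> C \<union> K \<Longrightarrow> y \<in> C \<union> K \<Longrightarrow> dist x y \<le> d"
    unfolding bounded_two_points by blast
  \<comment> \<open>Large enough for \<open>K\<close> and for the support of \<eta>, so that the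
    potentials are nonnegative there too and not only on \<open>K\<close>.\<close>
  define L where "L = 64 + (d\<^sup>2 + 1)"
  have L64: "64 \<le> L" by (simp add: L_def)
  have dL: "(dist x y)\<^sup>2 + 1 \<le> L" if "x \<in> C \<union> K" "y \<in> K" for x y
    using power_mono[OF d[of x y], of 2] that by (simp add: L_def)
  interpret kk: kernel "kern p L 0" "p - 2" "3 / 2 ^ p" L K
    by (rule kern_kernel[OF p L64]) (use dL in auto)
  define \<epsilon> where "\<epsilon> k = inverse (real (Suc k))" for k
  have \<epsilon>: "0 < \<epsilon> k" "\<epsilon> k \<le> 1" for k by (auto simp: \<epsilon>_def divide_simps)
  have \<epsilon>0: "\<epsilon> \<longlonglongrightarrow> 0" unfolding \<epsilon>_def[abs_def] by (rule LIMSEQ_inverse_real_of_nat)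
  have "\<forall>k. \<exists>X. charges_on K X \<and> total_charge X \<le> \<epsilon> k \<and> (\<forall>x\<in>K. 1 \<le> potential (kern p L 0) X x)"
  proof
    fix k show "\<exists>X. charges_on K X \<and> total_charge X \<le> \<epsilon> k \<and> (\<forall>x\<in>K. 1 \<le> potential (kern p L 0) X x)"
      by (rule kk.small_potential[OF K haus \<epsilon>(1)[of k]]) blast
  qed
  then obtain X where X': "\<forall>k. charges_on K (X k) \<and> total_charge (X k) \<le> \<epsilon> k \<and> (\<forall>x\<in>K. 1 \<le> potential (kern p L 0) (X k) x)"
    by (rule choice[THEN exE]) (rule that)
  then have X: "charges_on K (X k)" "total_charge (X k) \<le> \<epsilon> k" "x \<in> K \<Longrightarrow> 1 \<le> potential (kern p L 0) (X k) x" for k x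
    by auto
  define h where "h k = potential (kern p L 0) (X k)" for k
  have hs: "smooth (h k)" for k
    unfolding h_def potential_charge
    by (intro smooth_sum_list smooth_charge p) (use charges_onD[OF X(1)] in auto)
  have hnn: "0 \<le> h k x" if "x \<in> C" for k x
    unfolding h_def potential_charge
  proof (rule sum_list_nonneg)
    fix v assume "v \<in> set (map (\<lambda>z. charge p L z x) (X k))"
    then obtain z where z: "z \<in> set (X k)" "v = charge p L z x" by auto
    have zK: "0 \<le> fst z" "fst (snd z) \<in> K" "0 < snd (snd z)" "snd (snd z) \<le> 1" using charges_onD[OF X(1) z(1)] by auto
    have "(snd (snd z))\<^sup>2 \<le> 1" using zK by (intro power_le_one) auto
    then have "(norm (x - fst (snd z)))\<^sup>2 + (snd (snd z))\<^sup>2 \<le> L"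
      using dL[of x "fst (snd z)"] that zK(2) by (simp add: dist_norm)
    then show "0 \<le> v" unfolding z(2) charge_def
      using zK by (intro mult_nonneg_nonneg kern_nonneg[OF p]) (auto simp: add_nonneg_pos)
  qed
  have hlim: "(\<lambda>k. h k x) \<longlonglongrightarrow> 0" if xC: "x \<in> C" and xK: "x \<notin> K" for x
  proof -
    obtain \<delta> where \<delta>: "0 < \<delta>" "\<And>y. y \<in> K \<Longrightarrow> \<delta> \<le> dist x y"
      using separate_point_closed[OF compact_imp_closed[OF K] xK] by blast
    show ?thesis
    proof (rule Lim_null_comparison)
      show "eventually (\<lambda>k. norm (h k x) \<le> \<epsilon> k * \<bar>kern p L 0 (\<delta>\<^sup>2)\<bar>) sequentially"
      proof (rule always_eventually, rule allI)
        fix k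
        have "\<bar>h k x\<bar> \<le> total_charge (X k) * kern p L 0 (\<delta>\<^sup>2)"
          unfolding h_def using xC dL by (intro potential_bound[OF p X(1) \<delta>(2,1)]) auto
        also have "\<dots> \<le> total_charge (X k) * \<bar>kern p L 0 (\<delta>\<^sup>2)\<bar>"
        proof (rule mult_left_mono)
          have "0 \<le> (\<Sum>z\<leftarrow>X k. fst z)" using charges_onD[OF X(1)] by (intro sum_list_nonneg) auto
          then show "0 \<le> total_charge (X k)" by (simp add: total_charge_def split_def)
        qed simp
        also have "\<dots> \<le> \<epsilon> k * \<bar>kern p L 0 (\<delta>\<^sup>2)\<bar>" using X(2) by (intro mult_right_mono) auto
        finally show "norm (h k x) \<le> \<epsilon> k * \<bar>kern p L 0 (\<delta>\<^sup>2)\<bar>" by simp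
      qed
      show "(\<lambda>k. \<epsilon> k * \<bar>kern p L 0 (\<delta>\<^sup>2)\<bar>) \<longlonglongrightarrow> 0" using tendsto_mult_left_zero[OF \<epsilon>0] .
    qed
  qed
  have flim: "(\<lambda>k. flat P (1/4 - h k x) * v) \<longlonglongrightarrow> flat P (1/4) * v" if "x \<notin> K" "x \<notin> C \<Longrightarrow> v = 0" for P x v
  proof (cases "x \<in> C")
    case True
    have "(\<lambda>k. 1/4 - h k x) \<longlonglongrightarrow> 1/4 - 0" by (intro tendsto_diff tendsto_const hlim True that)
    then have "(\<lambda>k. flat P (1/4 - h k x)) \<longlonglongrightarrow> flat P (1/4 - 0)" by (rule isCont_tendsto_compose[OF flat_isCont])
    then show ?thesis by (intro tendsto_mult tendsto_const) simp
  qed (use that in simp)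
  have fs: "smooth (\<lambda>x. flat P (1/4 - h k x))" for P k by (intro smooth_flat smooth_diff smooth_const hs)
  have lim1: "(\<lambda>k. R (\<lambda>i j x. flat P (1/4 - h k x) * \<psi> i j x)) \<longlonglongrightarrow> flat P (1/4) * R \<psi>"
    if \<psi>: "\<And>i j. \<psi> i j \<in> test_functions \<Omega>" "\<And>i j x. x \<notin> C \<Longrightarrow> \<psi> i j x = 0" for P \<psi>
  proof -
    have "\<forall>i. \<exists>bi. \<forall>j. \<forall>x. \<bar>\<psi> i j x\<bar> \<le> bi j"
    proof (intro allI choice)
      fix i j show "\<exists>b. \<forall>x. \<bar>\<psi> i j x\<bar> \<le> b" using test_bounded[OF \<psi>(1), of i j] by metis
    qed
    then obtain b where b: "\<forall>i j x. \<bar>\<psi> i j x\<bar> \<le> b i j" by (rule choice[THEN exE]) (rule that)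
    obtain B where B: "0 < B" "\<And>u. u \<le> 1 \<Longrightarrow> \<bar>flat P u\<bar> \<le> B" by (rule flat_bounded) (rule that)
    have "(\<lambda>k. R (\<lambda>i j x. flat P (1/4 - h k x) * \<psi> i j x)) \<longlonglongrightarrow> R (\<lambda>i j x. flat P (1/4) * \<psi> i j x)"
    proof (rule R_tendsto[where b = "\<lambda>i j. B * b i j", OF _ _ C(1,2)])
      show "(\<lambda>x. flat P (1/4 - h k x) * \<psi> i j x) \<in> test_functions \<Omega>" for k i j by (rule test_mult(1)[OF \<psi>(1) fs])
      show "(\<lambda>x. flat P (1/4) * \<psi> i j x) \<in> test_functions \<Omega>" for i j by (rule test_cmult[OF \<psi>(1)])
      show "flat P (1/4 - h k x) * \<psi> i j x = 0" if "x \<notin> C" for k i j x using \<psi>(2)[OF that] by simp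
      show "\<bar>flat P (1/4 - h k x) * \<psi> i j x\<bar> \<le> B * b i j" for k i j x
      proof (cases "x \<in> C")
        case True
        have "\<bar>flat P (1/4 - h k x)\<bar> \<le> B" using hnn[OF True, of k] by (intro B) simp
        then show ?thesis using b B(1) unfolding abs_mult by (intro mult_mono) auto
      next
        case False
        have "0 \<le> b i j" using b abs_ge_zero order_trans by blast
        then show ?thesis using \<psi>(2)[OF False] B(1) by simp
      qed
      show "(\<lambda>k. flat P (1/4 - h k x) * \<psi> i j x) \<longlonglongrightarrow> flat P (1/4) * \<psi> i j x" if "x \<notin> K" for i j x
        using that \<psi>(2) by (intro flim)
    qed
    then show ?thesis by (simp only: R_cmult[OF \<psi>(1)])
  qed
  define g where "g k x = flat 1 (1/4 - h k x)" for k x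
  let ?H = "\<lambda>i j. partial j (partial i (\<lambda>x. \<eta> x * \<eta> x))"
  let ?E = "\<lambda>\<zeta> i j x. \<zeta> x * \<zeta> x * (partial i \<eta> x * partial j \<eta> x)"
  let ?\<psi> = "\<lambda>\<zeta> j x. (1 - \<zeta> x) * \<eta> x * partial j \<eta> x"
  let ?F = "\<lambda>\<zeta> k i j x. flat X2 (1/4 - h k x) * (partial i (h k) x * ?\<psi> \<zeta> j x + partial j (h k) x * ?\<psi> \<zeta> i x)"
  have E: "?E \<zeta> i j \<in> test_functions \<Omega>" if "smooth \<zeta>" for \<zeta> i j
    by (intro test_mult(1)[OF test_mult(2)[OF p\<eta>]] smooth_mult that smooth_partial \<eta>s)
  have H: "?H i j \<in> test_functions \<Omega>" for i j by (intro test_partial \<eta>\<eta>)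
  have H0: "?H i j x = 0" if "x \<notin> C" for i j x
    using partial2_mult[OF \<eta>s \<eta>s, of j i x] C(3,4)[OF that] by simp
  \<comment> \<open>The factor 1 - \<zeta> removes the neighbourhood \<open>W\<close> of
    \<open>K\<close>, where grad h_k is not controlled; on \<open>C\<close> outside \<open>W\<close>
    each component is at most \<epsilon>_k M.\<close>
  have lim3: "(\<lambda>k. R (?F \<zeta> k)) \<longlonglongrightarrow> 0"
    if \<zeta>: "smooth \<zeta>" "open W" "K \<subseteq> W" "\<And>x. x \<in> W \<Longrightarrow> \<zeta> x = 1" for \<zeta> W
  proof -
    have \<psi>: "?\<psi> \<zeta> j \<in> test_functions \<Omega>" for j
      by (intro test_mult(1)[OF p\<eta>] smooth_mult smooth_diff smooth_const \<zeta>(1) \<eta>s)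
    have \<psi>0: "?\<psi> \<zeta> j x = 0" if "x \<notin> C \<or> x \<in> W" for j x using that C(3) \<zeta>(4) by auto
    have "\<forall>j. \<exists>b. \<forall>x. \<bar>?\<psi> \<zeta> j x\<bar> \<le> b" using test_bounded[OF \<psi>] by metis
    then obtain b where b: "\<forall>j x. \<bar>?\<psi> \<zeta> j x\<bar> \<le> b j" by (rule choice[THEN exE]) (rule that)
    have b0: "0 \<le> b j" for j using b abs_ge_zero order_trans by blast
    obtain B where B: "0 < B" "\<And>u. u \<le> 1 \<Longrightarrow> \<bar>flat X2 u\<bar> \<le> B" by (rule flat_bounded) (rule that)
    have "\<exists>\<delta>>0. \<forall>y\<in>K. \<forall>x\<in>- W. \<delta> \<le> dist y x"
      using \<zeta>(2,3) by (intro separate_compact_closed K) auto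
    then obtain \<delta> where \<delta>: "0 < \<delta>" "\<And>x y. x \<notin> W \<Longrightarrow> y \<in> K \<Longrightarrow> \<delta> \<le> dist x y"
      by (metis ComplI dist_commute)
    define M where "M = (\<delta>\<^sup>2) powr (- (real p / 2)) * (2 * L)"
    have M0: "0 \<le> M" using L64 by (simp add: M_def)
    have grad: "\<bar>partial i (h k) x\<bar> \<le> \<epsilon> k * M" if "x \<in> C" "x \<notin> W" for i k x
    proof -
      have "\<bar>partial i (h k) x\<bar> \<le> total_charge (X k) * M"
        unfolding h_def M_def using that dL \<delta> by (intro potential_bound[OF p X(1)]) auto
      also have "\<dots> \<le> \<epsilon> k * M" using X(2) M0 by (intro mult_right_mono) auto
      finally show ?thesis .
    qed
    have bound: "\<bar>?F \<zeta> k i j x\<bar> \<le> \<epsilon> k * (B * (M * b j + M * b i))" for k i j x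
    proof (cases "x \<in> C \<and> x \<notin> W")
      case True
      have "\<bar>partial i (h k) x * ?\<psi> \<zeta> j x + partial j (h k) x * ?\<psi> \<zeta> i x\<bar>
          \<le> \<bar>partial i (h k) x\<bar> * \<bar>?\<psi> \<zeta> j x\<bar> + \<bar>partial j (h k) x\<bar> * \<bar>?\<psi> \<zeta> i x\<bar>"
        by (metis abs_mult abs_triangle_ineq)
      also have "\<dots> \<le> (\<epsilon> k * M) * b j + (\<epsilon> k * M) * b i"
        using True b b0 M0 \<epsilon>(1)[of k] by (intro add_mono mult_mono grad) (auto simp: less_imp_le)
      finally have "\<bar>partial i (h k) x * ?\<psi> \<zeta> j x + partial j (h k) x * ?\<psi> \<zeta> i x\<bar> \<le> \<epsilon> k * (M * b j + M * b i)"
        by (simp add: algebra_simps)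
      moreover have "\<bar>flat X2 (1/4 - h k x)\<bar> \<le> B" using hnn[of x k] True by (intro B) simp
      ultimately have "\<bar>?F \<zeta> k i j x\<bar> \<le> B * (\<epsilon> k * (M * b j + M * b i))"
        unfolding abs_mult using B(1) by (intro mult_mono) auto
      then show ?thesis by (simp add: mult_ac)
    next
      case False
      then have z: "?\<psi> \<zeta> j x = 0" for j by (intro \<psi>0) blast
      have F0: "?F \<zeta> k i j x = 0" by (simp only: z mult_zero_right add_0_left)
      have "0 \<le> \<epsilon> k * (B * (M * b j + M * b i))"
        using \<epsilon>(1)[of k] B(1) M0 b0 by (intro mult_nonneg_nonneg add_nonneg_nonneg) (auto simp: less_imp_le)
      then show ?thesis unfolding F0 by (simp only: abs_zero)
    qed
    have "(\<lambda>k. R (?F \<zeta> k)) \<longlonglongrightarrow> R (\<lambda>i j x. 0)"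
    proof (rule R_tendsto[where b = "\<lambda>i j. B * (M * b j + M * b i)", OF _ _ C(1,2)])
      show "?F \<zeta> k i j \<in> test_functions \<Omega>" for k i j
        by (intro test_mult(1)[OF _ fs] test_add test_mult(1)[OF \<psi>] smooth_partial hs)
      show "?F \<zeta> k i j x = 0" if "x \<notin> C" for k i j x
      proof -
        have z: "?\<psi> \<zeta> j x = 0" for j using that by (intro \<psi>0) blast
        show ?thesis by (simp only: z mult_zero_right add_0_left)
      qed
      show "\<bar>?F \<zeta> k i j x\<bar> \<le> B * (M * b j + M * b i)" for k i j x
      proof -
        have "\<epsilon> k * (B * (M * b j + M * b i)) \<le> 1 * (B * (M * b j + M * b i))"
          using \<epsilon>(2) B(1) M0 b0 by (intro mult_right_mono mult_nonneg_nonneg add_nonneg_nonneg) (auto simp: less_imp_le)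
        then show ?thesis using bound[where k = k and i = i and j = j and x = x] by linarith
      qed
      show "(\<lambda>k. ?F \<zeta> k i j x) \<longlonglongrightarrow> 0" for i j x
      proof (rule Lim_null_comparison)
        show "eventually (\<lambda>k. norm (?F \<zeta> k i j x) \<le> \<epsilon> k * (B * (M * b j + M * b i))) sequentially"
          using bound by (intro always_eventually allI) (simp only: real_norm_def)
        show "(\<lambda>k. \<epsilon> k * (B * (M * b j + M * b i))) \<longlonglongrightarrow> 0" by (rule tendsto_mult_left_zero[OF \<epsilon>0])
      qed
    qed simp
    then show ?thesis by (simp only: R_zero)
  qed
  obtain \<zeta> W where \<zeta>: "\<And>m. smooth (\<zeta> m)" "\<And>m x. \<bar>\<zeta> m x\<bar> \<le> 1"
    "\<And>m. open (W m)" "\<And>m. K \<subseteq> W m" "\<And>m x. x \<in> W m \<Longrightarrow> \<zeta> m x = 1"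
    "\<And>x. x \<notin> K \<Longrightarrow> (\<lambda>m. \<zeta> m x) \<longlonglongrightarrow> 0"
    by (rule shrinking_cutoffs) (rule that)
  \<comment> \<open>The weights tend to 0 off \<open>K\<close>, and R does not charge
    \<open>K\<close>.\<close>
  have limE: "(\<lambda>m. R (?E (\<zeta> m))) \<longlonglongrightarrow> 0"
  proof -
    have p\<eta>2: "(\<lambda>x. partial i \<eta> x * partial j \<eta> x) \<in> test_functions \<Omega>" for i j
      by (rule test_mult(2)[OF p\<eta> smooth_partial[OF \<eta>s]])
    have "\<forall>i. \<exists>bi. \<forall>j. \<forall>x. \<bar>partial i \<eta> x * partial j \<eta> x\<bar> \<le> bi j"
    proof (intro allI choice)
      fix i j show "\<exists>b. \<forall>x. \<bar>partial i \<eta> x * partial j \<eta> x\<bar> \<le> b" using test_bounded[OF p\<eta>2, of i j] by metis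
    qed
    then obtain b where b: "\<forall>i j x. \<bar>partial i \<eta> x * partial j \<eta> x\<bar> \<le> b i j" by (rule choice[THEN exE]) (rule that)
    have "(\<lambda>m. R (?E (\<zeta> m))) \<longlonglongrightarrow> R (\<lambda>i j x. 0)"
    proof (rule R_tendsto[where b = b, OF _ _ C(1,2)])
      show "?E (\<zeta> m) i j \<in> test_functions \<Omega>" for m i j by (rule E[OF \<zeta>(1)])
      show "?E (\<zeta> m) i j x = 0" if "x \<notin> C" for m i j x using C(4)[OF that] by simp
      show "\<bar>?E (\<zeta> m) i j x\<bar> \<le> b i j" for m i j x
      proof -
        have "\<bar>\<zeta> m x\<bar> * \<bar>\<zeta> m x\<bar> \<le> 1 * 1" using \<zeta>(2)[of m x] by (intro mult_mono) auto
        then have "\<bar>\<zeta> m x * \<zeta> m x\<bar> * \<bar>partial i \<eta> x * partial j \<eta> x\<bar> \<le> 1 * b i j"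
          using b by (intro mult_mono) (auto simp: abs_mult)
        then show ?thesis by (simp add: abs_mult)
      qed
      show "(\<lambda>m. ?E (\<zeta> m) i j x) \<longlonglongrightarrow> 0" if "x \<notin> K" for i j x
        by (intro tendsto_mult_left_zero tendsto_mult_zero \<zeta>(6) that)
    qed simp
    then show ?thesis by (simp only: R_zero)
  qed
  show thesis
  proof (rule that[of g])
    show "(\<lambda>x. g k x * (\<eta> x * \<eta> x)) \<in> test_functions (\<Omega> - K)" for k
      unfolding g_def by (rule cutoff_test[OF \<eta>\<eta> hs]) (use X(3) in \<open>auto simp: h_def\<close>)
    show "0 \<le> g k x" "g k x \<le> 1" for k x by (auto simp: g_def flat_nonneg flat_le_one)
    show "(\<lambda>k. g k x * (\<eta> x * \<eta> x)) \<longlonglongrightarrow> flat 1 (1/4) * (\<eta> x * \<eta> x)" if "x \<notin> K" for x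
      unfolding g_def using C(3) by (intro flim that) auto
    fix e :: real assume e: "0 < e"
    \<comment> \<open>Order of the limits: the neighbourhood of \<open>K\<close> is fixed first,
      making the remainder less than e; only then does the charge tend to 0.\<close>
    have "(\<lambda>m. 8 * (flat 1 (1/4) * R (?E (\<zeta> m)))) \<longlonglongrightarrow> 8 * (flat 1 (1/4) * 0)"
      by (intro tendsto_mult tendsto_const limE)
    then have "eventually (\<lambda>m. 8 * (flat 1 (1/4) * R (?E (\<zeta> m))) < e) sequentially"
      using e by (intro order_tendstoD(2)) auto
    then obtain m where m: "8 * (flat 1 (1/4) * R (?E (\<zeta> m))) < e"
      using eventually_happens'[OF sequentially_bot] by blast
    have "(\<lambda>k. R (\<lambda>i j x. flat 1 (1/4 - h k x) * ?H i j x)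
        - 8 * R (\<lambda>i j x. flat 1 (1/4 - h k x) * ?E (\<zeta> m) i j x) - 2 * R (?F (\<zeta> m) k))
      \<longlonglongrightarrow> flat 1 (1/4) * R ?H - 8 * (flat 1 (1/4) * R (?E (\<zeta> m))) - 2 * 0"
    proof (intro tendsto_diff tendsto_mult tendsto_const)
      show "(\<lambda>k. R (\<lambda>i j x. flat 1 (1/4 - h k x) * ?H i j x)) \<longlonglongrightarrow> flat 1 (1/4) * R ?H"
        by (rule lim1[OF H H0])
      show "(\<lambda>k. R (\<lambda>i j x. flat 1 (1/4 - h k x) * ?E (\<zeta> m) i j x)) \<longlonglongrightarrow> flat 1 (1/4) * R (?E (\<zeta> m))"
        by (rule lim1[OF E[OF \<zeta>(1)]]) (simp add: C(4))
      show "(\<lambda>k. R (?F (\<zeta> m) k)) \<longlonglongrightarrow> 0" by (rule lim3[OF \<zeta>(1,3,4,5)])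
    qed
    moreover have "flat 1 (1/4) * R ?H - e < flat 1 (1/4) * R ?H - 8 * (flat 1 (1/4) * R (?E (\<zeta> m))) - 2 * 0"
      using m by simp
    ultimately have "eventually (\<lambda>k. flat 1 (1/4) * R ?H - e < R (\<lambda>i j x. flat 1 (1/4 - h k x) * ?H i j x)
        - 8 * R (\<lambda>i j x. flat 1 (1/4 - h k x) * ?E (\<zeta> m) i j x) - 2 * R (?F (\<zeta> m) k)) sequentially"
      by (rule order_tendstoD(1))
    then show "eventually (\<lambda>k. flat 1 (1/4) * D (\<lambda>x. \<eta> x * \<eta> x) - e \<le> D (\<lambda>x. g k x * (\<eta> x * \<eta> x))) sequentially"
    proof eventually_elim
      case (elim k)
      have "R (\<lambda>i j x. flat 1 (1/4 - h k x) * ?H i j x)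
        - 8 * R (\<lambda>i j x. flat 1 (1/4 - h k x) * ?E (\<zeta> m) i j x) - 2 * R (?F (\<zeta> m) k)
          \<le> D (\<lambda>x. flat 1 (1/4 - h k x) * (\<eta> x * \<eta> x))"
        unfolding h_def
      proof (rule cutoff_estimate[OF \<eta> \<zeta>(1) X(1) X(3)])
        show "0 \<le> potential (kern p L 0) (X k) x" if "\<eta> x \<noteq> 0" for x
          using hnn[of x k] C(3)[of x] that by (auto simp: h_def)
      qed
      then show ?case using elim unfolding D_def g_def by linarith
    qed
  qed
qed

section \<open>From the one-sided estimate to a positive measure on K\<close>

lemma flat_quarter_pos: "0 < flat 1 (1/4)"
  by (rule flat_pos) simp

text \<open>Every nonnegative test function is, up to \<open>e\<close> times a fixed one, the square of a test function.\<close>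

lemma nonneg_from_squares:
  assumes lin: "linear_on \<Omega> \<Lambda>" and sq: "\<And>\<eta>. \<eta> \<in> test_functions \<Omega> \<Longrightarrow> 0 \<le> \<Lambda> (\<lambda>x. \<eta> x * \<eta> x)"
    and \<phi>: "\<phi> \<in> test_functions \<Omega>" "\<And>x. 0 \<le> \<phi> x"
  shows "0 \<le> \<Lambda> \<phi>"
proof -
  obtain C where C: "compact C" "C \<subseteq> \<Omega>" "\<And>x. x \<notin> C \<Longrightarrow> \<phi> x = 0"
    by (rule test_compactE[OF \<phi>(1)]) (rule that)
  obtain \<theta> W where \<theta>: "\<theta> \<in> test_functions \<Omega>" "C \<subseteq> W" "\<And>x. x \<in> W \<Longrightarrow> \<theta> x = 1"
    using smooth_urysohn[OF C(1) \<Omega> C(2)] by metis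
  have \<theta>s: "smooth \<theta>" by (rule test_smooth[OF \<theta>(1)])
  have \<theta>\<theta>: "(\<lambda>x. \<theta> x * \<theta> x) \<in> test_functions \<Omega>" by (rule test_mult(2)[OF \<theta>(1) \<theta>s])
  have "- \<Lambda> \<phi> \<le> 0 + e * \<Lambda> (\<lambda>x. \<theta> x * \<theta> x)" if e: "0 < e" for e
  proof -
    \<comment> \<open>The square root of \<phi> alone need not be smooth where \<phi> vanishes;
      \<phi> + e stays positive.\<close>
    define \<eta> where "\<eta> x = \<theta> x * (\<phi> x + e) powr (1/2)" for x
    have \<phi>e: "0 < \<phi> x + e" for x using \<phi>(2)[of x] e by simp
    have \<eta>: "\<eta> \<in> test_functions \<Omega>"
      unfolding \<eta>_def by (intro test_mult(2)[OF \<theta>(1)] smooth_powr smooth_add smooth_const test_smooth[OF \<phi>(1)] \<phi>e)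
    have "\<eta> x * \<eta> x = 1 * \<phi> x + e * (\<theta> x * \<theta> x)" for x
    proof -
      have "(\<phi> x + e) powr (1/2) * (\<phi> x + e) powr (1/2) = \<phi> x + e"
        using \<phi>e[of x] by (simp flip: powr_add)
      then have "\<eta> x * \<eta> x = \<theta> x * \<theta> x * (\<phi> x + e)" unfolding \<eta>_def by (metis mult.assoc mult.left_commute)
      then have eq: "\<eta> x * \<eta> x = \<theta> x * \<theta> x * \<phi> x + \<theta> x * \<theta> x * e" by (simp only: distrib_left)
      have "\<theta> x * \<theta> x * \<phi> x = \<phi> x" using C(3)[of x] \<theta>(2,3) by (cases "x \<in> C") auto
      then show ?thesis unfolding eq by (simp only: mult_1 mult.commute[of e])
    qed
    then have "\<Lambda> (\<lambda>x. \<eta> x * \<eta> x) = \<Lambda> \<phi> + e * \<Lambda> (\<lambda>x. \<theta> x * \<theta> x)"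
      using linear_onD[OF lin \<phi>(1) \<theta>\<theta>, of 1 e] by simp
    then show ?thesis using sq[OF \<eta>] by simp
  qed
  note * = this
  have "- \<Lambda> \<phi> \<le> 0 + e" if e: "0 < e" for e
  proof -
    let ?c = "\<Lambda> (\<lambda>x. \<theta> x * \<theta> x)"
    have c: "0 \<le> ?c" by (rule sq[OF \<theta>(1)])
    have "- \<Lambda> \<phi> \<le> 0 + e / (?c + 1) * ?c" using e c by (intro *) auto
    also have "e / (?c + 1) * ?c \<le> e" using e c by (simp add: field_simps)
    finally show ?thesis by simp
  qed
  then have "- \<Lambda> \<phi> \<le> 0" by (rule field_le_epsilon)
  then show ?thesis by simp
qed

lemma D_linear: "linear_on \<Omega> D"
  unfolding linear_on_def
proof (intro ballI allI)
  fix \<phi> \<psi> a b assume t: "\<phi> \<in> test_functions \<Omega>" "\<psi> \<in> test_functions \<Omega>"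
  note s = test_smooth[OF t(1)] test_smooth[OF t(2)]
  have pp: "partial i (\<lambda>x. a * f x + b * f' x) = (\<lambda>x. a * partial i f x + b * partial i f' x)" if "smooth f" "smooth f'" for f f' i
    using that by (subst partial_add) (auto simp: partial_cmult smooth_differentiable intro!: smooth_differentiable smooth_mult)
  have "D (\<lambda>x. a * \<phi> x + b * \<psi> x) = R (\<lambda>i j x. a * partial j (partial i \<phi>) x + b * partial j (partial i \<psi>) x)"
    unfolding D_def by (simp add: pp s smooth_partial)
  also have "\<dots> = R (\<lambda>i j x. a * partial j (partial i \<phi>) x) + R (\<lambda>i j x. b * partial j (partial i \<psi>) x)"
    by (intro R_add test_cmult test_partial t)
  also have "\<dots> = a * D \<phi> + b * D \<psi>"
    unfolding D_def by (intro arg_cong2[where f = "(+)"] R_cmult test_partial t)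
  finally show "D (\<lambda>x. a * \<phi> x + b * \<psi> x) = a * D \<phi> + b * D \<psi>" .
qed

text \<open>S is the zero extension minus D. Off \<open>K\<close> they agree, so D(g_k \<eta>^2) is
  an integral against \<mu> - \<nu> and converges by dominated convergence;
  \<open>approximation\<close> bounds D(\<eta>^2) by the limit, the factor psi(1/4) appearing on
  both sides. Hence S is nonnegative on squares and then on all nonnegative test functions.\<close>

theorem singular_part:
  assumes \<mu>: "radon_measure_on \<Omega> \<mu>" "emeasure \<mu> K = 0" and \<nu>: "radon_measure_on \<Omega> \<nu>" "emeasure \<nu> K = 0"
    and D: "\<And>\<phi>. \<phi> \<in> test_functions (\<Omega> - K) \<Longrightarrow> D \<phi> = integral\<^sup>L \<mu> \<phi> - integral\<^sup>L \<nu> \<phi>"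
  obtains S where "radon_measure_on \<Omega> S" "emeasure S (- K) = 0"
    "\<And>\<phi>. \<phi> \<in> test_functions \<Omega> \<Longrightarrow> integral\<^sup>L \<mu> \<phi> - integral\<^sup>L \<nu> \<phi> = D \<phi> + integral\<^sup>L S \<phi>"
proof -
  define \<Lambda> where "\<Lambda> \<phi> = integral\<^sup>L \<mu> \<phi> - integral\<^sup>L \<nu> \<phi> - D \<phi>" for \<phi>
  have lin: "linear_on \<Omega> \<Lambda>"
    unfolding linear_on_def \<Lambda>_def
    using radon_integrable[OF \<mu>(1)] radon_integrable[OF \<nu>(1)] linear_onD[OF D_linear]
    by (auto simp: algebra_simps)
  have sq: "0 \<le> \<Lambda> (\<lambda>x. \<eta> x * \<eta> x)" if \<eta>: "\<eta> \<in> test_functions \<Omega>" for \<eta>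
  proof -
    have \<eta>s: "smooth \<eta>" by (rule test_smooth[OF \<eta>])
    have \<eta>\<eta>: "(\<lambda>x. \<eta> x * \<eta> x) \<in> test_functions \<Omega>" by (rule test_mult(2)[OF \<eta> \<eta>s])
    obtain g where g: "\<And>k. (\<lambda>x. g k x * (\<eta> x * \<eta> x)) \<in> test_functions (\<Omega> - K)"
      "\<And>k x. 0 \<le> g k x" "\<And>k x. g k x \<le> 1"
      "\<And>x. x \<notin> K \<Longrightarrow> (\<lambda>k. g k x * (\<eta> x * \<eta> x)) \<longlonglongrightarrow> flat 1 (1/4) * (\<eta> x * \<eta> x)"
      "\<And>e. 0 < e \<Longrightarrow> eventually (\<lambda>k. flat 1 (1/4) * D (\<lambda>x. \<eta> x * \<eta> x) - e \<le> D (\<lambda>x. g k x * (\<eta> x * \<eta> x))) sequentially"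
      by (rule approximation[OF \<eta>]) (rule that)
    obtain C where C: "compact C" "C \<subseteq> \<Omega>" "\<And>x. x \<notin> C \<Longrightarrow> \<eta> x = 0"
      by (rule test_compactE[OF \<eta>]) (rule that)
    obtain b where b: "0 < b" "\<And>x. \<bar>\<eta> x * \<eta> x\<bar> \<le> b" by (rule test_bounded[OF \<eta>\<eta>]) (rule that)
    have gb: "\<bar>g k x * (\<eta> x * \<eta> x)\<bar> \<le> b" for k x
    proof -
      have "\<bar>g k x\<bar> * \<bar>\<eta> x * \<eta> x\<bar> \<le> 1 * b" using g(2,3) b by (intro mult_mono) auto
      then show ?thesis by (simp add: abs_mult)
    qed
    have lim: "(\<lambda>k. integral\<^sup>L \<xi> (\<lambda>x. g k x * (\<eta> x * \<eta> x))) \<longlonglongrightarrow> integral\<^sup>L \<xi> (\<lambda>x. flat 1 (1/4) * (\<eta> x * \<eta> x))"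
      if "radon_measure_on \<Omega> \<xi>" "emeasure \<xi> K = 0" for \<xi>
    proof (rule radon_dct[OF that K C(1,2) _ _ gb _ g(4)])
      show "(\<lambda>x. g k x * (\<eta> x * \<eta> x)) \<in> borel_measurable borel" for k
        by (rule test_measurable[OF refl test_smooth[OF g(1)]])
      show "(\<lambda>x. flat 1 (1/4) * (\<eta> x * \<eta> x)) \<in> borel_measurable borel"
        by (rule test_measurable[OF refl test_smooth[OF test_cmult[OF \<eta>\<eta>]]])
    qed (simp add: C(3))
    have lim': "(\<lambda>k. D (\<lambda>x. g k x * (\<eta> x * \<eta> x))) \<longlonglongrightarrow> flat 1 (1/4) * integral\<^sup>L \<mu> (\<lambda>x. \<eta> x * \<eta> x) - flat 1 (1/4) * integral\<^sup>L \<nu> (\<lambda>x. \<eta> x * \<eta> x)"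
      using tendsto_diff[OF lim[OF \<mu>] lim[OF \<nu>]] by (simp add: D[OF g(1)])
    have "flat 1 (1/4) * D (\<lambda>x. \<eta> x * \<eta> x) \<le> (flat 1 (1/4) * integral\<^sup>L \<mu> (\<lambda>x. \<eta> x * \<eta> x) - flat 1 (1/4) * integral\<^sup>L \<nu> (\<lambda>x. \<eta> x * \<eta> x)) + e"
      if "0 < e" for e
      using tendsto_lowerbound[OF lim' g(5)[OF that]] by simp
    then have "flat 1 (1/4) * D (\<lambda>x. \<eta> x * \<eta> x) \<le> flat 1 (1/4) * integral\<^sup>L \<mu> (\<lambda>x. \<eta> x * \<eta> x) - flat 1 (1/4) * integral\<^sup>L \<nu> (\<lambda>x. \<eta> x * \<eta> x)"
      by (rule field_le_epsilon)
    then have "flat 1 (1/4) * D (\<lambda>x. \<eta> x * \<eta> x) \<le> flat 1 (1/4) * (integral\<^sup>L \<mu> (\<lambda>x. \<eta> x * \<eta> x) - integral\<^sup>L \<nu> (\<lambda>x. \<eta> x * \<eta> x))"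
      by (simp add: right_diff_distrib)
    then show ?thesis using flat_quarter_pos unfolding \<Lambda>_def by simp
  qed
  have "positive_functional \<Omega> \<Lambda>"
    using lin nonneg_from_squares[OF lin sq] \<Omega> unfolding linear_on_def by unfold_locales auto
  then obtain S where S: "radon_measure_on \<Omega> S" "\<And>\<phi>. \<phi> \<in> test_functions \<Omega> \<Longrightarrow> \<Lambda> \<phi> = integral\<^sup>L S \<phi>"
    by (rule riesz_representation) (rule that)
  note sS = radon_sets[OF S(1)]
  have o: "open (\<Omega> - K)" using \<Omega> K by (auto intro: open_Diff compact_imp_closed)
  \<comment> \<open>The functional vanishes on test functions supported off \<open>K\<close>, in
    particular on plateau functions for the sets of a compact exhaustion.\<close>
  have "emeasure S (\<Omega> - K) = 0"
  proof -
    obtain C where C: "\<And>n. compact (C n)" "(\<Union>n::nat. C n) = \<Omega> - K"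
      using open_compact_exhaustion[OF o] by metis
    have "C n \<in> null_sets S" for n
    proof -
      have Cn: "C n \<subseteq> \<Omega> - K" using C(2) by blast
      obtain \<theta> W where \<theta>: "\<theta> \<in> test_functions (\<Omega> - K)" "\<And>x. 0 \<le> \<theta> x" "C n \<subseteq> W" "\<And>x. x \<in> W \<Longrightarrow> \<theta> x = 1"
        using smooth_urysohn[OF C(1) o Cn] by metis
      have \<theta>\<Omega>: "\<theta> \<in> test_functions \<Omega>" using \<theta>(1) by (rule test_mono) auto
      have "emeasure S (C n) \<le> ennreal (integral\<^sup>L S \<theta>)"
        using \<theta> C(1) by (intro emeasure_le_integral radon_integrable[OF S(1) \<theta>\<Omega>]) (auto simp: sS borel_compact subset_iff)
      also have "integral\<^sup>L S \<theta> = 0" using S(2)[OF \<theta>\<Omega>] D[OF \<theta>(1)] by (simp add: \<Lambda>_def)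
      finally show ?thesis using C(1) by (simp add: null_sets_def sS borel_compact)
    qed
    then have "(\<Union>n. C n) \<in> null_sets S" by (rule null_sets_UN)
    then show ?thesis using C(2) by auto
  qed
  have nK: "emeasure S (- K) = 0"
  proof -
    have "emeasure S (- K) \<le> emeasure S ((\<Omega> - K) \<union> - \<Omega>)"
      using o \<Omega> by (intro emeasure_mono) (auto simp: sS)
    also have "\<dots> \<le> emeasure S (\<Omega> - K) + emeasure S (- \<Omega>)"
      using o \<Omega> by (intro emeasure_subadditive) (auto simp: sS)
    also have "\<dots> = 0" using S(1) \<open>emeasure S (\<Omega> - K) = 0\<close> by (simp add: radon_measure_on_def)
    finally show ?thesis by simp
  qed
  show thesis
  proof (rule that[OF S(1) nK])
    fix \<phi> assume "\<phi> \<in> test_functions \<Omega>"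
    from S(2)[OF this] show "integral\<^sup>L \<mu> \<phi> - integral\<^sup>L \<nu> \<phi> = D \<phi> + integral\<^sup>L S \<phi>"
      by (simp add: \<Lambda>_def)
  qed
qed

text \<open>Fatou's lemma and not dominated convergence, since finiteness is the claim. The
  integrals of g_k \<eta>^2 against \<nu> equal -D(g_k \<eta>^2), eventually at most 1 - psi(1/4)
  D(\<eta>^2), while the integrands tend to psi(1/4) on \<open>W - K\<close>.\<close>

theorem concave_finite_mass:
  assumes \<nu>: "radon_measure_on (\<Omega> - K) \<nu>"
    and D: "\<And>\<phi>. \<phi> \<in> test_functions (\<Omega> - K) \<Longrightarrow> D \<phi> = - integral\<^sup>L \<nu> \<phi>"
    and x: "x \<in> \<Omega>"
  obtains V where "open V" "x \<in> V" "V \<subseteq> \<Omega>" "emeasure \<nu> (V - K) < \<infinity>"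
proof -
  have "compact {x}" "{x} \<subseteq> \<Omega>" using x by auto
  then obtain \<eta> W where \<eta>: "\<eta> \<in> test_functions \<Omega>" "open W" "{x} \<subseteq> W" "\<And>x. x \<in> W \<Longrightarrow> \<eta> x = 1"
    using smooth_urysohn[OF _ \<Omega>] by metis
  obtain g where g: "\<And>k. (\<lambda>x. g k x * (\<eta> x * \<eta> x)) \<in> test_functions (\<Omega> - K)"
    "\<And>k x. 0 \<le> g k x" "\<And>k x. g k x \<le> 1"
    "\<And>x. x \<notin> K \<Longrightarrow> (\<lambda>k. g k x * (\<eta> x * \<eta> x)) \<longlonglongrightarrow> flat 1 (1/4) * (\<eta> x * \<eta> x)"
    "\<And>e. 0 < e \<Longrightarrow> eventually (\<lambda>k. flat 1 (1/4) * D (\<lambda>x. \<eta> x * \<eta> x) - e \<le> D (\<lambda>x. g k x * (\<eta> x * \<eta> x))) sequentially"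
    by (rule approximation[OF \<eta>(1)]) (rule that)
  note s = radon_sets[OF \<nu>]
  have o: "open (\<Omega> - K)" using \<Omega> K by (auto intro: open_Diff compact_imp_closed)
  let ?c = "1 - flat 1 (1/4) * D (\<lambda>x. \<eta> x * \<eta> x)"
  have "emeasure \<nu> (W - K) * ennreal (flat 1 (1/4)) = (\<integral>\<^sup>+ x. ennreal (flat 1 (1/4)) * indicator (W - K) x \<partial>\<nu>)"
    using \<eta>(2) K by (subst nn_integral_cmult_indicator) (auto simp: s mult.commute borel_open borel_compact)
  also have "\<dots> \<le> (\<integral>\<^sup>+ x. liminf (\<lambda>k. ennreal (g k x * (\<eta> x * \<eta> x))) \<partial>\<nu>)"
  proof (rule nn_integral_mono)
    fix x
    show "ennreal (flat 1 (1/4)) * indicator (W - K) x \<le> liminf (\<lambda>k. ennreal (g k x * (\<eta> x * \<eta> x)))"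
    proof (cases "x \<in> W - K")
      case True
      then have "(\<lambda>k. ennreal (g k x * (\<eta> x * \<eta> x))) \<longlonglongrightarrow> ennreal (flat 1 (1/4))"
        using g(4)[of x] \<eta>(4)[of x] by (intro tendsto_ennrealI) auto
      from lim_imp_Liminf[OF sequentially_bot this] True show ?thesis by simp
    qed simp
  qed
  also have "\<dots> \<le> liminf (\<lambda>k. \<integral>\<^sup>+ x. ennreal (g k x * (\<eta> x * \<eta> x)) \<partial>\<nu>)"
    by (rule nn_integral_liminf) (use test_measurable[OF s test_smooth[OF g(1)]] in auto)
  also have "\<dots> \<le> ennreal ?c"
  proof (rule Liminf_le)
    show "eventually (\<lambda>k. (\<integral>\<^sup>+ x. ennreal (g k x * (\<eta> x * \<eta> x)) \<partial>\<nu>) \<le> ennreal ?c) sequentially"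
      using g(5)[of 1, simplified]
    proof eventually_elim
      case (elim k)
      have "(\<integral>\<^sup>+ x. ennreal (g k x * (\<eta> x * \<eta> x)) \<partial>\<nu>) = ennreal (integral\<^sup>L \<nu> (\<lambda>x. g k x * (\<eta> x * \<eta> x)))"
        using radon_integrable[OF \<nu> g(1)] g(2) by (intro nn_integral_eq_integral) auto
      also have "\<dots> \<le> ennreal ?c" using elim D[OF g(1)] by (intro ennreal_leI) simp
      finally show ?case .
    qed
  qed simp
  finally have "emeasure \<nu> (W - K) * ennreal (flat 1 (1/4)) < \<infinity>"
    using ennreal_less_top le_less_trans infinity_ennreal_def by metis
  then have fin: "emeasure \<nu> (W - K) < \<infinity>"
    using flat_quarter_pos by (auto simp: ennreal_mult_less_top)
  have "emeasure \<nu> (W \<inter> \<Omega> - K) \<le> emeasure \<nu> (W - K)"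
    using \<eta>(2) K by (intro emeasure_mono) (auto simp: s borel_compact)
  then have "emeasure \<nu> (W \<inter> \<Omega> - K) < \<infinity>" using fin by order
  then show thesis using \<eta>(2,3) \<Omega> x by (intro that[of "W \<inter> \<Omega>"]) auto
qed

end

section \<open>Extension by zero\<close>

lemma jordan_of_jordan: "order_zero U u \<Longrightarrow> jordan_of U u (fst (jordan U u)) (snd (jordan U u))"
  unfolding jordan_def
  by (rule someI_ex[where P = "\<lambda>m. jordan_of U u (fst m) (snd m)"]) (auto simp: order_zero_def)

lemma jordan_ofD:
  assumes "jordan_of U u \<mu> \<nu>"
  shows "radon_measure_on U \<mu>" "radon_measure_on U \<nu>"
    "\<phi> \<in> test_functions U \<Longrightarrow> u \<phi> = integral\<^sup>L \<mu> \<phi> - integral\<^sup>L \<nu> \<phi>"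
  using assms by (auto simp: jordan_of_def)

text \<open>A compact subset of \<Omega> is covered by \<open>K\<close>, of measure 0, by finitely
  many sets V - K of finite measure, and by a compact remainder inside \<Omega> - K.\<close>

lemma radon_measure_extend:
  fixes \<Omega> K :: "'n::finite space set"
  assumes \<Omega>: "open \<Omega>" and K: "compact K" and \<mu>: "radon_measure_on (\<Omega> - K) \<mu>"
    and fin: "\<And>x. x \<in> \<Omega> \<inter> K \<Longrightarrow> \<exists>V. open V \<and> x \<in> V \<and> V \<subseteq> \<Omega> \<and> emeasure \<mu> (V - K) < \<infinity>"
  shows "radon_measure_on \<Omega> \<mu>" "emeasure \<mu> K = 0"
proof -
  note s = radon_sets[OF \<mu>]
  have Kb: "K \<in> sets borel" using K by (rule borel_compact)
  have null: "emeasure \<mu> (- (\<Omega> - K)) = 0" using \<mu> by (simp add: radon_measure_on_def)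
  have null': "- (\<Omega> - K) \<in> sets \<mu>" using \<Omega> Kb by (auto simp: s)
  have "emeasure \<mu> K \<le> emeasure \<mu> (- (\<Omega> - K))" by (intro emeasure_mono null') auto
  then show K0: "emeasure \<mu> K = 0" using null by simp
  have "emeasure \<mu> (- \<Omega>) \<le> emeasure \<mu> (- (\<Omega> - K))" by (intro emeasure_mono null') auto
  then have O0: "emeasure \<mu> (- \<Omega>) = 0" using null by simp
  have "emeasure \<mu> C < \<infinity>" if C: "compact C" "C \<subseteq> \<Omega>" for C
  proof -
    have "\<forall>x\<in>\<Omega> \<inter> K. \<exists>V. open V \<and> x \<in> V \<and> V \<subseteq> \<Omega> \<and> emeasure \<mu> (V - K) < \<infinity>" using fin by blast
    then obtain V where V: "\<forall>x\<in>\<Omega> \<inter> K. open (V x) \<and> x \<in> V x \<and> V x \<subseteq> \<Omega> \<and> emeasure \<mu> (V x - K) < \<infinity>"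
      by (rule bchoice[THEN exE]) (rule that)
    have "compact (C \<inter> K)" using C K by (intro compact_Int)
    moreover have "C \<inter> K \<subseteq> (\<Union>x\<in>C \<inter> K. V x)" using V C by blast
    ultimately obtain F where F: "F \<subseteq> C \<inter> K" "finite F" "C \<inter> K \<subseteq> (\<Union>x\<in>F. V x)"
      using compactE_image[of "C \<inter> K" "C \<inter> K" V] V C by (metis IntD1 IntD2 IntI subsetD)
    have VF: "open (V x)" "emeasure \<mu> (V x - K) < \<infinity>" if "x \<in> F" for x
      using V F(1) C that by auto
    define C' where "C' = C - (\<Union>x\<in>F. V x)"
    have C': "compact C'" "C' \<subseteq> \<Omega> - K"
      using C F VF unfolding C'_def by (auto intro!: compact_diff)
    have sV: "V x - K \<in> sets \<mu>" if "x \<in> F" for x using VF[OF that] Kb by (auto simp: s)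
    have sC': "C' \<in> sets \<mu>" using C' by (simp add: s borel_compact)
    have sU: "(\<Union>x\<in>F. V x - K) \<in> sets \<mu>" by (intro sets.finite_UN F(2) sV)
    have "emeasure \<mu> C \<le> emeasure \<mu> ((C' \<union> (\<Union>x\<in>F. V x - K)) \<union> K)"
      using sC' sU Kb by (intro emeasure_mono) (auto simp: C'_def s)
    also have "\<dots> \<le> emeasure \<mu> (C' \<union> (\<Union>x\<in>F. V x - K)) + emeasure \<mu> K"
      using sC' sU Kb by (intro emeasure_subadditive) (auto simp: s)
    also have "\<dots> \<le> emeasure \<mu> C' + emeasure \<mu> (\<Union>x\<in>F. V x - K)"
      unfolding K0 using emeasure_subadditive[OF sC' sU] by simp
    also have "\<dots> \<le> emeasure \<mu> C' + (\<Sum>x\<in>F. emeasure \<mu> (V x - K))"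
      using emeasure_subadditive_finite[OF F(2), of "\<lambda>x. V x - K" \<mu>] sV by (intro add_left_mono) auto
    also have "\<dots> < \<infinity>"
      using radon_finite[OF \<mu> C'] VF(2) F(2) by (auto simp: less_top)
    finally show ?thesis .
  qed
  then show "radon_measure_on \<Omega> \<mu>" using s O0 by (simp add: radon_measure_on_def)
qed

lemma locally_finite_mass_nearD:
  assumes "locally_finite_mass_near \<Omega> K T" "x \<in> \<Omega> \<inter> K"
  shows "\<exists>V. open V \<and> x \<in> V \<and> V \<subseteq> \<Omega> \<and> emeasure (fst (jordan (\<Omega> - K) (T I L))) (V - K) < \<infinity>"
    and "\<exists>V. open V \<and> x \<in> V \<and> V \<subseteq> \<Omega> \<and> emeasure (snd (jordan (\<Omega> - K) (T I L))) (V - K) < \<infinity>"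
proof -
  obtain V where V: "open V" "x \<in> V" "V \<subseteq> \<Omega>" "mass (\<Omega> - K) T (V - K) < \<infinity>"
    using assms unfolding locally_finite_mass_near_def by blast
  have "total_variation (\<Omega> - K) (T I L) (V - K) \<le> (\<Sum>L\<in>UNIV. total_variation (\<Omega> - K) (T I L) (V - K))"
    by (rule member_le_sum) auto
  also have "\<dots> \<le> mass (\<Omega> - K) T (V - K)"
    unfolding mass_def by (rule member_le_sum[where f = "\<lambda>I. \<Sum>L\<in>UNIV. total_variation (\<Omega> - K) (T I L) (V - K)"]) auto
  finally have "total_variation (\<Omega> - K) (T I L) (V - K) < \<infinity>" using V(4) by order
  then have "emeasure (fst (jordan (\<Omega> - K) (T I L))) (V - K) < \<infinity>" "emeasure (snd (jordan (\<Omega> - K) (T I L))) (V - K) < \<infinity>"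
    by (auto simp: total_variation_def)
  with V(1-3) show "\<exists>V. open V \<and> x \<in> V \<and> V \<subseteq> \<Omega> \<and> emeasure (fst (jordan (\<Omega> - K) (T I L))) (V - K) < \<infinity>"
    "\<exists>V. open V \<and> x \<in> V \<and> V \<subseteq> \<Omega> \<and> emeasure (snd (jordan (\<Omega> - K) (T I L))) (V - K) < \<infinity>" by blast+
qed

lemma radon_null: "radon_measure_on U (null_measure borel)"
  by (simp add: radon_measure_on_def)

lemma jordan_of_null:
  assumes "radon_measure_on U \<nu>" "\<And>\<phi>. \<phi> \<in> test_functions U \<Longrightarrow> u \<phi> = - integral\<^sup>L \<nu> \<phi>"
  shows "jordan_of U u (null_measure borel) \<nu>"
  unfolding jordan_of_def
proof (intro conjI ballI radon_null assms(1) bexI[of _ UNIV])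
  fix \<phi> assume "\<phi> \<in> test_functions U"
  then show "u \<phi> = integral\<^sup>L (null_measure borel) \<phi> - integral\<^sup>L \<nu> \<phi>"
    by (simp add: assms(2) integral_null_measure)
qed auto

lemma order_zero_null: "(\<And>\<phi>. \<phi> \<in> test_functions U \<Longrightarrow> u \<phi> = 0) \<Longrightarrow> order_zero U u"
  unfolding order_zero_def
  by (intro exI, rule jordan_of_null[OF radon_null]) (simp add: integral_null_measure)

lemma integral_zero_measure:
  assumes "\<And>A. A \<in> sets \<mu> \<Longrightarrow> emeasure \<mu> A = 0"
  shows "integral\<^sup>L \<mu> f = (0::real)"
proof -
  have "AE x in \<mu>. f x = 0" by (rule AE_I'[of "space \<mu>"]) (auto simp: null_sets_def assms)
  then show ?thesis by (rule integral_eq_zero_AE)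
qed

lemma jordan_zero:
  assumes "open U" "jordan_of U u \<mu> \<nu>" "\<And>\<phi>. \<phi> \<in> test_functions U \<Longrightarrow> u \<phi> = 0" "A \<in> sets borel"
  shows "emeasure \<mu> A = 0" "emeasure \<nu> A = 0"
  using jordan_of_nonpos[OF assms(1,2) _ assms(4)] jordan_of_nonpos[OF assms(1) jordan_of_swap[OF assms(2)] _ assms(4)]
  by (auto simp: assms(3))

text \<open>Both chosen Jordan parts are the zero measure, so the extension creates nothing across
  \<open>K\<close>. This disposes of every coefficient that vanishes for reasons of degree.\<close>

lemma zero_extension_zero:
  assumes "open U" "order_zero U u" "\<And>\<phi>. \<phi> \<in> test_functions U \<Longrightarrow> u \<phi> = 0"
  shows "zero_extension U u \<phi> = 0"
proof -
  note j = jordan_of_jordan[OF assms(2)]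
  have "emeasure (fst (jordan U u)) A = 0" if "A \<in> sets (fst (jordan U u))" for A
    using jordan_zero(1)[OF assms(1) j assms(3)] that radon_sets[OF jordan_ofD(1)[OF j]] by simp
  moreover have "emeasure (snd (jordan U u)) A = 0" if "A \<in> sets (snd (jordan U u))" for A
    using jordan_zero(2)[OF assms(1) j assms(3)] that radon_sets[OF jordan_ofD(2)[OF j]] by simp
  ultimately show ?thesis
    unfolding zero_extension_def by (simp add: integral_zero_measure)
qed

lemma zero_extension_eq:
  "order_zero U u \<Longrightarrow> \<phi> \<in> test_functions U \<Longrightarrow> zero_extension U u \<phi> = u \<phi>"
  using jordan_ofD(3)[OF jordan_of_jordan, of U u \<phi>] by (simp add: zero_extension_def)

text \<open>The first conjunct belongs to the claim because extension by 0 makes sense only for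
  locally finite mass near \<open>K\<close>; under the concavity alternative this has to be
  proved.\<close>

theorem theorem8:
  fixes \<Omega> K :: "'n::{finite,linorder} space set"
    and p :: nat
    and T :: "'n current"
  assumes "open \<Omega>"
    and "compact K"
    and "2 \<le> p" and "p \<le> CARD('n)"
    and "sigma_finite_hausdorff (p - 2) K"
    and "weakly_positive (\<Omega> - K) p T"
    and "locally_finite_mass_near \<Omega> K T"
    and "locally_finite_mass_near \<Omega> K
           (wedge_current (d_current (dsharp_current T)) (wedge_power beta (p - 1)))
         \<or> concave_current (\<Omega> - K) 1 (wedge_current T (wedge_power beta (p - 1)))"
  shows "locally_finite_mass_near \<Omega> K
           (wedge_current (d_current (dsharp_current T)) (wedge_power beta (p - 1))) \<and>
         (\<exists>S :: 'n space measure. radon_measure_on \<Omega> S \<and> emeasure S (- K) = 0 \<and>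
           current_eq_on \<Omega>
             (zero_extension_current (\<Omega> - K)
               (wedge_current (d_current (dsharp_current T)) (wedge_power beta (p - 1))))
             (add_current
               (wedge_current (d_current (dsharp_current (zero_extension_current (\<Omega> - K) T)))
                 (wedge_power beta (p - 1)))
               (measure_current S)))"
proof -
  define q where "q = p - 1"
  have q: "Suc q = p" "p - 1 = q" using assms(3) by (auto simp: q_def)
  define U where "U = \<Omega> - K"
  have U: "open U" unfolding U_def using assms(1,2) by (intro open_Diff compact_imp_closed)
  have U\<Omega>: "\<phi> \<in> test_functions U \<Longrightarrow> \<phi> \<in> test_functions \<Omega>" for \<phi>
    by (erule test_mono) (auto simp: U_def)
  \<comment> \<open>Coefficients refer to the form with all dx_i in front, integrals and positivity
    to the volume form; the two differ by this sign.\<close>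
  define vol where "vol = volume_sign TYPE('n)"
  have vol2: "vol * vol = 1" unfolding vol_def by (rule volume_sign_square)
  then have vol: "vol = 1 \<or> vol = - 1" by (simp add: square_eq_1_iff)
  define Z where "Z = zero_extension_current U T"
  define W where "W T = wedge_current (d_current (dsharp_current T)) (wedge_power beta q)" for T :: "'n current"
  define u where "u = W T UNIV UNIV"
  have wp: "weakly_positive U (Suc q) T" using assms(6) by (simp add: U_def q)
  have T: "linear_on U (T I L)" for I L by (rule weakly_positive_linear[OF wp])
  have oz: "order_zero U (T I L)" for I L
    using assms(7) unfolding locally_finite_mass_near_def U_def by blast
  note jT = jordan_of_jordan[OF oz]
  have ZT: "Z I L \<phi> = T I L \<phi>" if "\<phi> \<in> test_functions U" for I L \<phi>
    using that by (simp add: Z_def zero_extension_current_def zero_extension_eq[OF oz])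
  \<comment> \<open>The index consists of a coefficient (I, L) and a Boolean selecting the positive
    or the negative part of its Jordan decomposition; \<open>w\<close> restores the sign.\<close>
  define \<tau> where "\<tau> m = (if snd m then fst (jordan U (T (fst (fst m)) (snd (fst m)))) else snd (jordan U (T (fst (fst m)) (snd (fst m)))))"
    for m :: "('n set \<times> 'n set) \<times> bool"
  define w where "w i j m = vol * rho_coeff q i j (fst (fst m)) (snd (fst m)) * (if snd m then 1 else - 1)"
    for i j :: 'n and m :: "('n set \<times> 'n set) \<times> bool"
  have \<tau>: "radon_measure_on \<Omega> (\<tau> m)" "emeasure (\<tau> m) K = 0" for m
  proof -
    have "radon_measure_on (\<Omega> - K) (\<tau> m)"
      using jordan_ofD(1,2)[OF jT] by (auto simp: \<tau>_def U_def)
    moreover have "\<exists>V. open V \<and> x \<in> V \<and> V \<subseteq> \<Omega> \<and> emeasure (\<tau> m) (V - K) < \<infinity>" if "x \<in> \<Omega> \<inter> K" for x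
      using locally_finite_mass_nearD[OF assms(7) that] by (simp add: \<tau>_def U_def)
    ultimately show "radon_measure_on \<Omega> (\<tau> m)" "emeasure (\<tau> m) K = 0"
      using radon_measure_extend[OF assms(1,2)] by blast+
  qed
  have Z_eq: "Z I L \<phi> = integral\<^sup>L (\<tau> ((I, L), True)) \<phi> - integral\<^sup>L (\<tau> ((I, L), False)) \<phi>" for I L \<phi>
    by (simp add: Z_def zero_extension_current_def zero_extension_def \<tau>_def)
  have Z: "linear_on \<Omega> (Z I L)" for I L
    unfolding linear_on_def Z_eq using radon_integrable[OF \<tau>(1)] by (auto simp: algebra_simps)
  have \<rho>: "rho q Z i j \<phi> = (\<Sum>m\<in>UNIV. w i j m * integral\<^sup>L (\<tau> m) \<phi>)" for i j \<phi>
  proof -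
    have "(\<Sum>m\<in>UNIV. w i j m * integral\<^sup>L (\<tau> m) \<phi>) = (\<Sum>IL\<in>UNIV. \<Sum>b\<in>UNIV. w i j (IL, b) * integral\<^sup>L (\<tau> (IL, b)) \<phi>)"
      by (simp add: sum.cartesian_product UNIV_Times_UNIV)
    also have "\<dots> = (\<Sum>IL\<in>UNIV. vol * rho_coeff q i j (fst IL) (snd IL) * Z (fst IL) (snd IL) \<phi>)"
      by (intro sum.cong refl) (simp add: UNIV_bool Z_eq w_def algebra_simps)
    finally show ?thesis by (simp add: rho_def vol_def split_def)
  qed
  \<comment> \<open>T and its zero extension agree off \<open>K\<close>, so the positivity of T
    passes to the matrix of the extension.\<close>
  have \<rho>T: "rho q T i j \<phi> = rho q Z i j \<phi>" if "\<phi> \<in> test_functions U" for i j \<phi>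
    using ZT[OF that] by (simp add: rho_def)
  interpret extension \<Omega> K p "rho q Z" w \<tau>
  proof
    fix c and a :: "'n \<Rightarrow> 'n space \<Rightarrow> real"
    assume c: "c \<in> test_functions (\<Omega> - K)" "\<And>x. 0 \<le> c x" and a: "\<And>i. smooth (a i)"
    then have cU: "c \<in> test_functions U" by (simp add: U_def)
    have t: "(\<lambda>x. c x * (a i x * a j x)) \<in> test_functions U" for i j
      by (intro test_mult(2)[OF cU] smooth_mult a)
    show "0 \<le> (\<Sum>i\<in>UNIV. \<Sum>j\<in>UNIV. rho q Z i j (\<lambda>x. c x * (a i x * a j x)))"
      using rho_square_nonneg[where a = a, OF wp cU c(2) a] by (simp add: \<rho>T[OF t])
  next
    fix c and y :: "'n space" and r :: real
    assume c: "c \<in> test_functions (\<Omega> - K)" "\<And>x. 0 \<le> c x" and r: "0 < r"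
    then have cU: "c \<in> test_functions U" by (simp add: U_def)
    let ?A = "\<lambda>i j x. c x * (((norm (x - y))\<^sup>2 + r\<^sup>2) * delta i j - real p * ((x $ i - y $ i) * (x $ j - y $ j)))"
    have t: "?A i j \<in> test_functions U" for i j
      by (intro test_mult(2)[OF cU] smooth_mult smooth_diff smooth_add smooth_norm_sq smooth_nth smooth_const)
    show "0 \<le> (\<Sum>i\<in>UNIV. \<Sum>j\<in>UNIV. rho q Z i j (?A i j))"
      using rho_kernel_nonneg[OF wp cU c(2) r, of y] unfolding q(1) \<rho>T[OF t] .
  qed (use assms \<tau> \<rho> in auto)
  have D_eq: "D \<phi> = (\<Sum>i\<in>UNIV. \<Sum>j\<in>UNIV. rho q Z i j (partial j (partial i \<phi>)))" for \<phi>
    by (simp add: D_def R_def)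
  have u: "vol * u \<phi> = D \<phi>" if "\<phi> \<in> test_functions U" for \<phi>
    unfolding vol_def u_def W_def D_eq
    using ddsharp_wedge_beta_top[where T = T and q = q, OF T that] \<rho>T[OF test_partial[OF test_partial[OF that]]] by simp
  have WZ: "vol * W Z UNIV UNIV \<phi> = D \<phi>" if "\<phi> \<in> test_functions \<Omega>" for \<phi>
    unfolding vol_def W_def D_eq by (rule ddsharp_wedge_beta_top[where T = Z, OF Z that])
  have degT: "T I L \<phi> = 0" if "(card I, card L) \<noteq> (CARD('n) - Suc q, CARD('n) - Suc q)" "\<phi> \<in> test_functions U" for I L \<phi>
    using wp that unfolding weakly_positive_def bidimension_current_def bidegree_current_def by blast
  have degZ: "Z I L \<phi> = 0" if "(card I, card L) \<noteq> (CARD('n) - Suc q, CARD('n) - Suc q)" for I L \<phi>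
    unfolding Z_def zero_extension_current_def
    by (rule zero_extension_zero[OF U oz degT[OF that]])
  have q_le: "Suc q \<le> CARD('n)" using assms(4) q by simp
  have offT: "W T N P \<phi> = 0" if "(N, P) \<noteq> (UNIV, UNIV)" "\<phi> \<in> test_functions U" for N P \<phi>
    unfolding W_def by (rule ddsharp_wedge_beta_degree[where T = T, OF T degT q_le that])
  have offZ: "W Z N P \<phi> = 0" if "(N, P) \<noteq> (UNIV, UNIV)" "\<phi> \<in> test_functions \<Omega>" for N P \<phi>
    unfolding W_def by (rule ddsharp_wedge_beta_degree[where T = Z, OF Z degZ q_le that])
  have ozW: "order_zero U (W T N P)" if "(N, P) \<noteq> (UNIV, UNIV)" for N P
    by (rule order_zero_null[OF offT[OF that]])
  have mass: "locally_finite_mass_near \<Omega> K (W T)"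
  proof (cases "locally_finite_mass_near \<Omega> K (wedge_current (d_current (dsharp_current T)) (wedge_power beta (p - 1)))")
    case True
    then show ?thesis unfolding W_def q(2) .
  next
    case False
    then have con: "concave_current U 1 (wedge_current T (wedge_power beta q))"
      using assms(8) unfolding U_def q(2) by blast
    have Dle: "D \<phi> \<le> 0" if "\<phi> \<in> test_functions U" "\<And>x. 0 \<le> \<phi> x" for \<phi>
      using concave_rho_nonpos[where T = T, OF T con that] \<rho>T[OF test_partial[OF test_partial[OF that(1)]]]
      by (simp add: D_eq)
    have "positive_functional U (\<lambda>\<phi>. - D \<phi>)"
    proof
      show "open U" by (rule U)
      fix \<phi> \<psi> :: "'n space \<Rightarrow> real" and a b assume "\<phi> \<in> test_functions U" "\<psi> \<in> test_functions U"
      then show "- D (\<lambda>x. a * \<phi> x + b * \<psi> x) = a * - D \<phi> + b * - D \<psi>"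
        using linear_onD[OF D_linear] U\<Omega> by (simp add: algebra_simps)
    qed (use Dle in auto)
    then obtain \<nu> where \<nu>: "radon_measure_on U \<nu>" "\<And>\<phi>. \<phi> \<in> test_functions U \<Longrightarrow> - D \<phi> = integral\<^sup>L \<nu> \<phi>"
      by (rule riesz_representation) (rule that)
    \<comment> \<open>Off \<open>K\<close> the coefficient u is \<open>vol\<close> times D, and here
      -D is a positive measure. Depending on the sign, it is the negative or the positive part of u,
      and the other part vanishes.\<close>
    have "\<exists>\<mu>. jordan_of U u (fst (jordan U u)) (snd (jordan U u)) \<and> radon_measure_on U \<mu> \<and>
        (\<forall>\<phi>\<in>test_functions U. D \<phi> = - integral\<^sup>L \<mu> \<phi>) \<and>
        (\<forall>A\<in>sets borel. total_variation U u A = emeasure \<mu> A)"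
      using vol
    proof
      assume v: "vol = 1"
      have "jordan_of U u (null_measure borel) \<nu>"
        using \<nu> u v by (intro jordan_of_null) force+
      then have j: "jordan_of U u (fst (jordan U u)) (snd (jordan U u))"
        by (intro jordan_of_jordan) (auto simp: order_zero_def)
      have n: "emeasure (fst (jordan U u)) A = 0" if "A \<in> sets borel" for A
        using u v Dle by (intro jordan_of_nonpos[OF U j _ that]) (metis mult_1)
      have "integral\<^sup>L (fst (jordan U u)) \<phi> = 0" for \<phi> :: "'n space \<Rightarrow> real"
        using n radon_sets[OF jordan_ofD(1)[OF j]] by (intro integral_zero_measure) simp
      then have "D \<phi> = - integral\<^sup>L (snd (jordan U u)) \<phi>" if "\<phi> \<in> test_functions U" for \<phi>
        using jordan_ofD(3)[OF j that] u[OF that] v by simp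
      then show ?thesis
        using j jordan_ofD(2)[OF j] n by (intro exI[of _ "snd (jordan U u)"]) (auto simp: total_variation_def)
    next
      assume v: "vol = - 1"
      have "jordan_of U (\<lambda>\<phi>. - u \<phi>) (null_measure borel) \<nu>"
        using \<nu> u v by (intro jordan_of_null) force+
      from jordan_of_swap[OF this] have "jordan_of U u \<nu> (null_measure borel)" by simp
      then have j: "jordan_of U u (fst (jordan U u)) (snd (jordan U u))"
        by (intro jordan_of_jordan) (auto simp: order_zero_def)
      have n: "emeasure (snd (jordan U u)) A = 0" if "A \<in> sets borel" for A
        using u v Dle by (intro jordan_of_nonpos[OF U jordan_of_swap[OF j] _ that]) (metis mult_minus1)
      have "integral\<^sup>L (snd (jordan U u)) \<phi> = 0" for \<phi> :: "'n space \<Rightarrow> real"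
        using n radon_sets[OF jordan_ofD(2)[OF j]] by (intro integral_zero_measure) simp
      then have "D \<phi> = - integral\<^sup>L (fst (jordan U u)) \<phi>" if "\<phi> \<in> test_functions U" for \<phi>
        using jordan_ofD(3)[OF j that] u[OF that] v by simp
      then show ?thesis
        using j jordan_ofD(1)[OF j] n by (intro exI[of _ "fst (jordan U u)"]) (auto simp: total_variation_def)
    qed
    then obtain \<mu> where j: "jordan_of U u (fst (jordan U u)) (snd (jordan U u))" and \<mu>: "radon_measure_on U \<mu>"
      "\<And>\<phi>. \<phi> \<in> test_functions U \<Longrightarrow> D \<phi> = - integral\<^sup>L \<mu> \<phi>"
      "\<And>A. A \<in> sets borel \<Longrightarrow> total_variation U u A = emeasure \<mu> A" by blast
    show ?thesis
      unfolding locally_finite_mass_near_def U_def[symmetric]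
    proof (intro conjI allI ballI)
      fix I L show "order_zero U (W T I L)"
      proof (cases "(I, L) = (UNIV, UNIV)")
        case True
        then show ?thesis using j by (auto simp: u_def order_zero_def)
      qed (rule ozW)
    next
      fix x assume "x \<in> \<Omega> \<inter> K"
      then obtain V where V: "open V" "x \<in> V" "V \<subseteq> \<Omega>" "emeasure \<mu> (V - K) < \<infinity>"
        using concave_finite_mass[of \<mu> x] \<mu>(1,2) unfolding U_def by auto
      have b: "V - K \<in> sets borel" using V(1) assms(2) by (auto simp: borel_compact)
      have "total_variation U (W T I L) (V - K) < \<infinity>" for I L
      proof (cases "(I, L) = (UNIV, UNIV)")
        case True
        then show ?thesis using \<mu>(3)[OF b] V(4) by (simp add: u_def)
      next
        case False
        show ?thesis
          using jordan_zero[OF U jordan_of_jordan[OF ozW[OF False]] offT[OF False] b]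
          by (simp add: total_variation_def)
      qed
      then have "mass U (W T) (V - K) < \<infinity>" unfolding mass_def by (simp add: less_top)
      with V(1-3) show "\<exists>V. open V \<and> x \<in> V \<and> V \<subseteq> \<Omega> \<and> mass U (W T) (V - K) < \<infinity>" by blast
    qed
  qed
  have ozu: "order_zero U u"
    using mass unfolding locally_finite_mass_near_def U_def u_def by blast
  note j = jordan_of_jordan[OF ozu]
  let ?\<mu> = "fst (jordan U u)" and ?\<nu> = "snd (jordan U u)"
  have \<mu>: "radon_measure_on \<Omega> ?\<mu>" "emeasure ?\<mu> K = 0"
    using radon_measure_extend[OF assms(1,2) jordan_ofD(1)[OF j, unfolded U_def]]
      locally_finite_mass_nearD(1)[OF mass] unfolding u_def U_def by blast+
  have \<nu>: "radon_measure_on \<Omega> ?\<nu>" "emeasure ?\<nu> K = 0"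
    using radon_measure_extend[OF assms(1,2) jordan_ofD(2)[OF j, unfolded U_def]]
      locally_finite_mass_nearD(2)[OF mass] unfolding u_def U_def by blast+
  \<comment> \<open>The sign decides which Jordan part of u plays the role of \<mu> in
    \<open>singular_part\<close>.\<close>
  obtain S where S: "radon_measure_on \<Omega> S" "emeasure S (- K) = 0"
    "\<And>\<phi>. \<phi> \<in> test_functions \<Omega> \<Longrightarrow> vol * (integral\<^sup>L ?\<mu> \<phi> - integral\<^sup>L ?\<nu> \<phi>) = D \<phi> + integral\<^sup>L S \<phi>"
    using vol
  proof
    assume v: "vol = 1"
    show thesis
    proof (rule singular_part[OF \<mu> \<nu>])
      show "D \<phi> = integral\<^sup>L ?\<mu> \<phi> - integral\<^sup>L ?\<nu> \<phi>" if "\<phi> \<in> test_functions (\<Omega> - K)" for \<phi>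
        using u[of \<phi>] jordan_ofD(3)[OF j, of \<phi>] that v by (simp add: U_def)
    qed (rule that, use v in auto)
  next
    assume v: "vol = - 1"
    show thesis
    proof (rule singular_part[OF \<nu> \<mu>])
      show "D \<phi> = integral\<^sup>L ?\<nu> \<phi> - integral\<^sup>L ?\<mu> \<phi>" if "\<phi> \<in> test_functions (\<Omega> - K)" for \<phi>
        using u[of \<phi>] jordan_ofD(3)[OF j, of \<phi>] that v by (simp add: U_def)
    qed (rule that, use v in auto)
  qed
  have "current_eq_on \<Omega> (zero_extension_current U (W T)) (add_current (W Z) (measure_current S))"
    unfolding current_eq_on_def
  proof (intro allI ballI)
    fix I L \<phi> assume \<phi>: "\<phi> \<in> test_functions \<Omega>"
    show "zero_extension_current U (W T) I L \<phi> = add_current (W Z) (measure_current S) I L \<phi>"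
    proof (cases "(I, L) = (UNIV, UNIV)")
      case True
      then have IL: "I = UNIV" "L = UNIV" by auto
      have "integral\<^sup>L ?\<mu> \<phi> - integral\<^sup>L ?\<nu> \<phi> = vol * (vol * (integral\<^sup>L ?\<mu> \<phi> - integral\<^sup>L ?\<nu> \<phi>))"
        by (simp add: mult.assoc[symmetric] vol2)
      also have "\<dots> = vol * (vol * W Z UNIV UNIV \<phi> + integral\<^sup>L S \<phi>)" by (simp only: S(3)[OF \<phi>] WZ[OF \<phi>])
      also have "\<dots> = W Z UNIV UNIV \<phi> + vol * integral\<^sup>L S \<phi>"
        by (simp add: distrib_left mult.assoc[symmetric] vol2)
      finally show ?thesis
        unfolding IL by (simp add: zero_extension_current_def zero_extension_def add_current_def measure_current_def u_def vol_def)
    next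
      case False
      then have "\<not> (I = UNIV \<and> L = UNIV)" by simp
      then have "measure_current S I L \<phi> = 0" unfolding measure_current_def by (simp only: if_False)
      then show ?thesis
        using zero_extension_zero[OF U ozW[OF False] offT[OF False]] offZ[OF False \<phi>]
        by (simp add: zero_extension_current_def add_current_def)
    qed
  qed
  with mass S(1,2) show ?thesis
    unfolding W_def Z_def U_def q(2) by blast
qed

end
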